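(* Let $G$ be a locally compact abelian group with dual group $\Gamma$ (written additively), and let $\omega=(\omega_1,\omega_2,\dots)\in\Gamma^\infty$ be a sequence in $\Gamma$. If $-\omega_i\notin\overline{\{\omega_\mu\mid\mu\in\mathcal{W}_n\}}$ for every $i\in\{1,2,\dots\}$ and every $n\in\mathbb{N}$, then the crossed product $\mathcal{O}_\infty\rtimes_{\alpha^\omega}G$ is AF-embeddable.
   Context: $\mathcal{O}_\infty$ is the Cuntz algebra generated universally by infinitely many isometries $S_1,S_2,\dots$ satisfying $S_i^*S_j=\delta_{i,j}$. $\mathcal{W}_n$ is the set of all finite words $\mu=(i_1,\dots,i_k)$, $k\ge 0$, with letters in $\{1,\dots,n\}$ (including the empty word $\emptyset$); for such $\mu$, $\omega_\mu=\sum_{j=1}^k\omega_{i_j}\in\Gamma$ (so $\omega_\emptyset=0$). Denote the pairing of $t\in G$ and $\gamma\in\Gamma$ by $\langle t\,|\,\gamma\rangle\in\mathbb{T}$. The action $\alpha^\omega$ of $G$ on $\mathcal{O}_\infty$ is determined by $\alpha^\omega_t(S_i)=\langle t\,|\,\omega_i\rangle S_i$ for $t\in G$, $i=1,2,\dots$. $\mathcal{O}_\infty\rtimes_{\alpha^\omega}G$ is the crossed product (full and reduced coincide since $G$ is amenable). Closures are taken in $\Gamma$. A $C^*$-algebra is AF if every finite subset can be approximated arbitrarily well in norm by elements of a finite-dimensional $C^*$-subalgebra (for separable algebras: an inductive limit of a sequence of finite-dimensional $C^*$-algebras); it is AF-embeddable if it is isomorphic to a $C^*$-subalgebra of an AF-algebra.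 *)

theory Defs
  imports "HOL-Analysis.Analysis" "HOL-Algebra.Module" "HOL-Decision_Procs.Algebra_Aux"
begin

section \<open>The dual group\<close>

typedef (overloaded) ('g::topological_ab_group_add) dual =
  "{f :: 'g \<Rightarrow> complex. continuous_on UNIV f \<and> (\<forall>t. cmod (f t) = 1) \<and>
      (\<forall>s t. f (s + t) = f s * f t)}"
  morphisms dual_apply Abs_dual
  by (rule exI[of _ "\<lambda>_. 1"]) auto

setup_lifting type_definition_dual

definition pairing :: "'g::topological_ab_group_add \<Rightarrow> 'g dual \<Rightarrow> complex"
  where "pairing t \<gamma> = dual_apply \<gamma> t"

instantiation dual :: (topological_ab_group_add) ab_group_add
begin

lift_definition zero_dual :: "'a dual" is "\<lambda>_. 1"
  by auto

lift_definition plus_dual :: "'a dual \<Rightarrow> 'a dual \<Rightarrow> 'a dual" is "\<lambda>f g t. f t * g t"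
  by (auto intro!: continuous_intros simp: norm_mult)

lift_definition uminus_dual :: "'a dual \<Rightarrow> 'a dual" is "\<lambda>f t. inverse (f t)"
  by (auto intro!: continuous_intros simp: norm_inverse) (metis norm_zero zero_neq_one)

definition minus_dual :: "'a dual \<Rightarrow> 'a dual \<Rightarrow> 'a dual"
  where "minus_dual \<gamma> \<delta> = \<gamma> + - \<delta>"

instance
proof
  fix a b c :: "'a dual"
  show "a + b + c = a + (b + c)" by transfer (simp add: mult.assoc)
  show "a + b = b + a" by transfer (simp add: mult.commute)
  show "0 + a = a" by transfer simp
  show "a - b = a + - b" by (simp add: minus_dual_def)
  show "- a + a = 0"
  proof transfer
    fix f :: "'a \<Rightarrow> complex"
    assume "continuous_on UNIV f \<and> (\<forall>t. cmod (f t) = 1) \<and> (\<forall>s t. f (s + t) = f s * f t)"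
    then have "f t \<noteq> 0" for t by (metis norm_zero zero_neq_one)
    then show "(\<lambda>t. inverse (f t) * f t) = (\<lambda>_. 1)" by auto
  qed
qed

end

text \<open>The compact-open topology.\<close>

instantiation dual :: (topological_ab_group_add) topological_space
begin

definition open_dual :: "'a dual set \<Rightarrow> bool"
  where "open_dual = generate_topology
    {{\<gamma>. \<forall>t\<in>K. pairing t \<gamma> \<in> U} | K U. compact K \<and> open U}"

instance
  by standard (auto simp: open_dual_def intro: generate_topology.intros)

end

text \<open>Haar measures are Radon measures in the sense appropriate to groups that need not be
  \<open>\<sigma>\<close>-compact: outer regular on Borel sets, inner regular on open sets.\<close>

definition haar_measure :: "'g::{topological_ab_group_add, t2_space} measure \<Rightarrow> bool"
  where "haar_measure \<mu> \<longleftrightarrow>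
    sets \<mu> = sets borel \<and>
    emeasure \<mu> UNIV \<noteq> 0 \<and>
    (\<forall>t. \<forall>E\<in>sets borel. emeasure \<mu> ((+) t ` E) = emeasure \<mu> E) \<and>
    (\<forall>K. compact K \<longrightarrow> emeasure \<mu> K < \<infinity>) \<and>
    (\<forall>E\<in>sets borel. emeasure \<mu> E = (INF U\<in>{U. open U \<and> E \<subseteq> U}. emeasure \<mu> U)) \<and>
    (\<forall>U. open U \<longrightarrow> emeasure \<mu> U = (SUP K\<in>{K. compact K \<and> K \<subseteq> U}. emeasure \<mu> K))"


section \<open>C*-algebras\<close>

text \<open>The field \<open>one\<close>, inherited from rings, is meaningful only for unital algebras; it is
  ignored by all notions below whose names do not say \<open>unital\<close>.\<close>

record 'a normed_star_alg = "(complex, 'a) module" +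
  star :: "'a \<Rightarrow> 'a"
  nrm :: "'a \<Rightarrow> real"

locale cstar_algebra = module "cring_class_ops :: complex ring" A
  for A :: "'a normed_star_alg" (structure) +
  assumes mult_closed: "\<lbrakk>x \<in> carrier A; y \<in> carrier A\<rbrakk> \<Longrightarrow> x \<otimes> y \<in> carrier A"
    and mult_assoc: "\<lbrakk>x \<in> carrier A; y \<in> carrier A; z \<in> carrier A\<rbrakk> \<Longrightarrow>
      (x \<otimes> y) \<otimes> z = x \<otimes> (y \<otimes> z)"
    and mult_l_distr: "\<lbrakk>x \<in> carrier A; y \<in> carrier A; z \<in> carrier A\<rbrakk> \<Longrightarrow>
      (x \<oplus> y) \<otimes> z = x \<otimes> z \<oplus> y \<otimes> z"
    and mult_r_distr: "\<lbrakk>x \<in> carrier A; y \<in> carrier A; z \<in> carrier A\<rbrakk> \<Longrightarrow>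
      z \<otimes> (x \<oplus> y) = z \<otimes> x \<oplus> z \<otimes> y"
    and smult_mult_left: "\<lbrakk>x \<in> carrier A; y \<in> carrier A\<rbrakk> \<Longrightarrow> (c \<odot> x) \<otimes> y = c \<odot> (x \<otimes> y)"
    and smult_mult_right: "\<lbrakk>x \<in> carrier A; y \<in> carrier A\<rbrakk> \<Longrightarrow> x \<otimes> (c \<odot> y) = c \<odot> (x \<otimes> y)"
    and star_closed: "x \<in> carrier A \<Longrightarrow> star A x \<in> carrier A"
    and star_star: "x \<in> carrier A \<Longrightarrow> star A (star A x) = x"
    and star_add: "\<lbrakk>x \<in> carrier A; y \<in> carrier A\<rbrakk> \<Longrightarrow> star A (x \<oplus> y) = star A x \<oplus> star A y"
    and star_smult: "x \<in> carrier A \<Longrightarrow> star A (c \<odot> x) = cnj c \<odot> star A x"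
    and star_mult: "\<lbrakk>x \<in> carrier A; y \<in> carrier A\<rbrakk> \<Longrightarrow> star A (x \<otimes> y) = star A y \<otimes> star A x"
    and nrm_nonneg: "x \<in> carrier A \<Longrightarrow> 0 \<le> nrm A x"
    and nrm_eq_0: "x \<in> carrier A \<Longrightarrow> nrm A x = 0 \<longleftrightarrow> x = \<zero>"
    and nrm_triangle: "\<lbrakk>x \<in> carrier A; y \<in> carrier A\<rbrakk> \<Longrightarrow> nrm A (x \<oplus> y) \<le> nrm A x + nrm A y"
    and nrm_smult: "x \<in> carrier A \<Longrightarrow> nrm A (c \<odot> x) = cmod c * nrm A x"
    and nrm_mult: "\<lbrakk>x \<in> carrier A; y \<in> carrier A\<rbrakk> \<Longrightarrow> nrm A (x \<otimes> y) \<le> nrm A x * nrm A y"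
    and nrm_cstar: "x \<in> carrier A \<Longrightarrow> nrm A (star A x \<otimes> x) = (nrm A x)\<^sup>2"
    and nrm_complete:
      "\<lbrakk>\<And>n. X n \<in> carrier A; \<And>e. 0 < e \<Longrightarrow> \<exists>N. \<forall>m\<ge>N. \<forall>n\<ge>N. nrm A (X m \<ominus> X n) < e\<rbrakk> \<Longrightarrow>
        \<exists>x\<in>carrier A. (\<lambda>n::nat. nrm A (X n \<ominus> x)) \<longlonglongrightarrow> 0"

locale unital_cstar_algebra = cstar_algebra +
  assumes one_closed: "\<one> \<in> carrier A"
    and one_mult: "x \<in> carrier A \<Longrightarrow> \<one> \<otimes> x = x"
    and mult_one: "x \<in> carrier A \<Longrightarrow> x \<otimes> \<one> = x"

text \<open>With the inherited norm, being a C*-algebra includes being norm closed in \<open>A\<close>.\<close>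

definition cstar_subalgebra :: "'a set \<Rightarrow> 'a normed_star_alg \<Rightarrow> bool"
  where "cstar_subalgebra C A \<longleftrightarrow> C \<subseteq> carrier A \<and> cstar_algebra (A\<lparr>carrier := C\<rparr>)"

definition star_hom :: "'a normed_star_alg \<Rightarrow> 'b normed_star_alg \<Rightarrow> ('a \<Rightarrow> 'b) \<Rightarrow> bool"
  where "star_hom A B \<phi> \<longleftrightarrow>
    \<phi> \<in> carrier A \<rightarrow> carrier B \<and>
    (\<forall>x\<in>carrier A. \<forall>y\<in>carrier A. \<phi> (x \<oplus>\<^bsub>A\<^esub> y) = \<phi> x \<oplus>\<^bsub>B\<^esub> \<phi> y) \<and>
    (\<forall>c. \<forall>x\<in>carrier A. \<phi> (c \<odot>\<^bsub>A\<^esub> x) = c \<odot>\<^bsub>B\<^esub> \<phi> x) \<and>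
    (\<forall>x\<in>carrier A. \<forall>y\<in>carrier A. \<phi> (x \<otimes>\<^bsub>A\<^esub> y) = \<phi> x \<otimes>\<^bsub>B\<^esub> \<phi> y) \<and>
    (\<forall>x\<in>carrier A. \<phi> (star A x) = star B (\<phi> x))"

definition star_iso :: "'a normed_star_alg \<Rightarrow> 'b normed_star_alg \<Rightarrow> ('a \<Rightarrow> 'b) \<Rightarrow> bool"
  where "star_iso A B \<phi> \<longleftrightarrow> star_hom A B \<phi> \<and> bij_betw \<phi> (carrier A) (carrier B)"

definition nrm_continuous :: "'a normed_star_alg \<Rightarrow> ('g::topological_space \<Rightarrow> 'a) \<Rightarrow> bool"
  where "nrm_continuous A f \<longleftrightarrow> (\<forall>t. ((\<lambda>s. nrm A (f s \<ominus>\<^bsub>A\<^esub> f t)) \<longlongrightarrow> 0) (at t))"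


section \<open>AF-algebras\<close>

definition finite_dim_subalgebra :: "'a set \<Rightarrow> 'a normed_star_alg \<Rightarrow> bool"
  where "finite_dim_subalgebra C A \<longleftrightarrow> cstar_subalgebra C A \<and>
    (\<exists>X. finite X \<and> X \<subseteq> C \<and> (\<forall>x\<in>C. \<exists>c. x = (\<Oplus>\<^bsub>A\<^esub>b\<in>X. c b \<odot>\<^bsub>A\<^esub> b)))"

definition AF_algebra :: "'a normed_star_alg \<Rightarrow> bool"
  where "AF_algebra A \<longleftrightarrow> cstar_algebra A \<and>
    (\<forall>F e. finite F \<and> F \<subseteq> carrier A \<and> 0 < e \<longrightarrow>
      (\<exists>C. finite_dim_subalgebra C A \<and> (\<forall>x\<in>F. \<exists>y\<in>C. nrm A (x \<ominus>\<^bsub>A\<^esub> y) < e)))"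

text \<open>HOL cannot quantify over all types, so the ambient AF-algebra \<open>D\<close> is sought among those whose
  underlying set is contained in the type \<open>'a\<close> of \<open>A\<close>. This is no restriction: if \<open>A \<noteq> 0\<close> embeds
  into some AF-algebra \<open>D'\<close> and \<open>\<kappa>\<close> is the larger of \<open>\<aleph>\<^sub>0\<close> and the density character of \<open>A\<close>, then
  adjoining, \<open>\<omega>\<close> times, approximating finite-dimensional subalgebras for the finite subsets of a
  dense set gives an AF-subalgebra of \<open>D'\<close> that contains \<open>A\<close> and has density character at most
  \<open>\<kappa>\<close>. Its cardinality is at most that of \<open>A\<close>, since a nonzero Banach space of density
  character \<open>\<kappa>\<close> (or of finite dimension, for \<open>\<kappa> = \<aleph>\<^sub>0\<close>) has \<open>\<kappa>\<close> to the power \<open>\<aleph>\<^sub>0\<close> elements.\<close>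

definition AF_embeddable :: "'a normed_star_alg \<Rightarrow> bool"
  where "AF_embeddable A \<longleftrightarrow>
    (\<exists>(D :: 'a normed_star_alg) C \<phi>. AF_algebra D \<and> cstar_subalgebra C D \<and>
      star_iso A (D\<lparr>carrier := C\<rparr>) \<phi>)"


section \<open>The Cuntz algebra on infinitely many generators\<close>

text \<open>The generators are indexed from 0.\<close>

definition cuntz_isometries :: "'a normed_star_alg \<Rightarrow> (nat \<Rightarrow> 'a) \<Rightarrow> bool"
  where "cuntz_isometries A S \<longleftrightarrow> unital_cstar_algebra A \<and> range S \<subseteq> carrier A \<and>
    (\<forall>i j. star A (S i) \<otimes>\<^bsub>A\<^esub> S j = (if i = j then \<one>\<^bsub>A\<^esub> else \<zero>\<^bsub>A\<^esub>))"

text \<open>Universality is tested only against algebras \<open>B\<close> with underlying set in the same type. This is no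
  restriction: only the separable subalgebra of \<open>B\<close> generated by \<open>T\<close> matters, it has at most
  continuum many elements, and \<open>A \<noteq> 0\<close> has at least that many. (Without \<open>\<one> \<noteq> \<zero>\<close> the zero algebra
  in a one-element type would qualify.)\<close>

definition cuntz_algebra_infinity :: "'a normed_star_alg \<Rightarrow> (nat \<Rightarrow> 'a) \<Rightarrow> bool"
  where "cuntz_algebra_infinity A S \<longleftrightarrow>
    cuntz_isometries A S \<and> \<one>\<^bsub>A\<^esub> \<noteq> \<zero>\<^bsub>A\<^esub> \<and>
    (\<forall>C. cstar_subalgebra C A \<and> range S \<subseteq> C \<longrightarrow> C = carrier A) \<and>
    (\<forall>(B :: 'a normed_star_alg) T. cuntz_isometries B T \<longrightarrow>
      (\<exists>\<phi>. star_hom A B \<phi> \<and> (\<forall>i. \<phi> (S i) = T i)))"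


section \<open>Crossed products\<close>

definition cstar_action ::
    "'a normed_star_alg \<Rightarrow> ('g::topological_ab_group_add \<Rightarrow> 'a \<Rightarrow> 'a) \<Rightarrow> bool"
  where "cstar_action A \<alpha> \<longleftrightarrow>
    (\<forall>t. star_iso A A (\<alpha> t)) \<and>
    (\<forall>s t. \<forall>x\<in>carrier A. \<alpha> (s + t) x = \<alpha> s (\<alpha> t x)) \<and>
    (\<forall>x\<in>carrier A. nrm_continuous A (\<lambda>t. \<alpha> t x))"

definition bounded_functional :: "'a normed_star_alg \<Rightarrow> ('a \<Rightarrow> complex) \<Rightarrow> bool"
  where "bounded_functional A \<phi> \<longleftrightarrow>
    (\<forall>x\<in>carrier A. \<forall>y\<in>carrier A. \<phi> (x \<oplus>\<^bsub>A\<^esub> y) = \<phi> x + \<phi> y) \<and>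
    (\<forall>c. \<forall>x\<in>carrier A. \<phi> (c \<odot>\<^bsub>A\<^esub> x) = c * \<phi> x) \<and>
    (\<exists>M. \<forall>x\<in>carrier A. cmod (\<phi> x) \<le> M * nrm A x)"

text \<open>The integral of an \<open>A\<close>-valued function, in the weak sense (unique by Hahn-Banach). It is only
  used for continuous functions with compact support, for which it exists. The library's Bochner
  integral needs the values to range over a whole Banach space type.\<close>

definition alg_integral :: "'g measure \<Rightarrow> 'a normed_star_alg \<Rightarrow> ('g \<Rightarrow> 'a) \<Rightarrow> 'a"
  where "alg_integral \<mu> A h =
    (THE x. x \<in> carrier A \<and> (\<forall>\<phi>. bounded_functional A \<phi> \<longrightarrow>
      integrable \<mu> (\<lambda>s. \<phi> (h s)) \<and> (\<integral>s. \<phi> (h s) \<partial>\<mu>) = \<phi> x))"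

text \<open>The *-algebra of compactly supported continuous functions from \<open>G\<close> to \<open>A\<close>, with twisted
  convolution and the \<open>L\<^sup>1\<close>-norm.\<close>

definition convolution_algebra ::
    "'g::{topological_ab_group_add, t2_space} measure \<Rightarrow> 'a normed_star_alg \<Rightarrow>
      ('g \<Rightarrow> 'a \<Rightarrow> 'a) \<Rightarrow> ('g \<Rightarrow> 'a) normed_star_alg"
  where "convolution_algebra \<mu> A \<alpha> =
    \<lparr>carrier = {f. range f \<subseteq> carrier A \<and> nrm_continuous A f \<and>
                   compact (closure {t. f t \<noteq> \<zero>\<^bsub>A\<^esub>})},
     monoid.mult = (\<lambda>f g t. alg_integral \<mu> A (\<lambda>s. f s \<otimes>\<^bsub>A\<^esub> \<alpha> s (g (t - s)))),
     one = undefined,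
     zero = (\<lambda>_. \<zero>\<^bsub>A\<^esub>),
     add = (\<lambda>f g t. f t \<oplus>\<^bsub>A\<^esub> g t),
     smult = (\<lambda>c f t. c \<odot>\<^bsub>A\<^esub> f t),
     star = (\<lambda>f t. \<alpha> t (star A (f (- t)))),
     nrm = (\<lambda>f. \<integral>t. nrm A (f t) \<partial>\<mu>)\<rparr>"

definition cstar_seminorm :: "'a normed_star_alg \<Rightarrow> ('a \<Rightarrow> real) \<Rightarrow> bool"
  where "cstar_seminorm L p \<longleftrightarrow>
    (\<forall>x\<in>carrier L. 0 \<le> p x) \<and>
    (\<forall>x\<in>carrier L. \<forall>y\<in>carrier L. p (x \<oplus>\<^bsub>L\<^esub> y) \<le> p x + p y) \<and>
    (\<forall>c. \<forall>x\<in>carrier L. p (c \<odot>\<^bsub>L\<^esub> x) = cmod c * p x) \<and>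
    (\<forall>x\<in>carrier L. \<forall>y\<in>carrier L. p (x \<otimes>\<^bsub>L\<^esub> y) \<le> p x * p y) \<and>
    (\<forall>x\<in>carrier L. p (star L x \<otimes>\<^bsub>L\<^esub> x) = (p x)\<^sup>2)"

text \<open>The completion of \<open>L\<close> in its greatest C*-seminorm dominated by the given norm, i.e. in the
  supremum of \<open>x \<mapsto> \<parallel>\<rho> x\<parallel>\<close> over the norm-decreasing *-homomorphisms \<open>\<rho>\<close> into C*-algebras.\<close>

definition enveloping_cstar_algebra ::
    "'b normed_star_alg \<Rightarrow> ('a \<Rightarrow> 'b) \<Rightarrow> 'a normed_star_alg \<Rightarrow> bool"
  where "enveloping_cstar_algebra B \<iota> L \<longleftrightarrow>
    cstar_algebra B \<and> star_hom L B \<iota> \<and>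
    (\<forall>b\<in>carrier B. \<forall>e>0. \<exists>x\<in>carrier L. nrm B (b \<ominus>\<^bsub>B\<^esub> \<iota> x) < e) \<and>
    (\<forall>x\<in>carrier L. nrm B (\<iota> x) =
      (SUP p\<in>{p. cstar_seminorm L p \<and> (\<forall>y\<in>carrier L. p y \<le> nrm L y)}. p x))"

text \<open>The full crossed product: the enveloping C*-algebra of \<open>L\<^sup>1(G, A)\<close>, or equally of its dense
  *-subalgebra of compactly supported continuous functions. It is determined up to isomorphism;
  \<open>\<iota>\<close> is the canonical map.\<close>

definition crossed_product ::
    "'b normed_star_alg \<Rightarrow> (('g::{topological_ab_group_add, t2_space} \<Rightarrow> 'a) \<Rightarrow> 'b) \<Rightarrow>
      'g measure \<Rightarrow> 'a normed_star_alg \<Rightarrow> ('g \<Rightarrow> 'a \<Rightarrow> 'a) \<Rightarrow> bool"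
  where "crossed_product B \<iota> \<mu> A \<alpha> \<longleftrightarrow>
    enveloping_cstar_algebra B \<iota> (convolution_algebra \<mu> A \<alpha>)"

end

theory Submission
  imports Defs
begin

text \<open>The crossed product acts on the Fock space \<open>\<ell>\<^sup>2(\<Gamma> \<times> W)\<close>, where \<open>W\<close> is the set of all finite words: \<open>S\<^sub>i\<close> prepends the
letter \<open>i\<close>, and \<open>t\<close> multiplies the basis vector at \<open>(\<gamma>, w)\<close> by \<open>\<langle>t | \<gamma> + \<omega>\<^sub>w\<rangle>\<close>. The image is the closed span of
the monomials \<open>S\<^sub>\<mu> C S\<^sub>\<nu>\<^sup>*\<close>, where \<open>C\<close> is multiplication by a Fourier transform. This representation is isometric:
a single monomial is treated by the Gelfand theory of the convolution algebra of \<open>G\<close>; a sum of monomials is bounded by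
its operator norm up to a constant that grows only linearly when \<open>x\<close> is repeatedly replaced by \<open>x\<^sup>* x\<close>, which forces
the constant down to 1.

By hypothesis the weights \<open>\<omega>\<^sub>w\<close> of the nonempty words in finitely many letters stay away from 0. By pigeonhole, a word
all of whose partial weights, shifted by \<open>\<gamma>\<close>, lie in a fixed totally bounded set has bounded length. Hence finitely many
operators \<open>S\<^sub>\<mu> 1\<^sub>V S\<^sub>\<nu>\<^sup>*\<close> with \<open>V\<close> totally bounded lie in a finite-dimensional C*-algebra. As a Fourier transform is small
outside a totally bounded set, the closed span of all these operators contains the crossed product. A
Loewenheim--Skolem argument finally makes it small enough to be copied into the type of \<open>B\<close>.\<close>

section \<open>C*-algebras\<close>

text \<open>The coefficients of the monomials in the crossed product are functions on \<Gamma> that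
  vanish at infinity, and among these there are too few projections unless \<Gamma> is totally
  disconnected. Taking the basis over the bare set \<Gamma> removes this obstacle: every operator
  that occurs fixes the \<Gamma>-coordinate, so any bounded function of it can be a coefficient, in
  particular the indicator of an arbitrary set, and these indicators supply the projections of the
  AF-algebra. Hence total boundedness is the natural notion of smallness for \<open>V\<close>. The
  norm of the crossed product is a supremum over dominated C*-seminorms. That the Fock
  representation gives one of them bounds it from below; the bound from above is proved for any
  system of elements that multiply like the monomials, and is used twice, for the Cuntz algebra and
  for the crossed product. It rests on the empty word: as the range projections do not add up to 1,
  each monomial has a matrix entry that no other monomial of at least its total length reaches, and
  its coefficient can be read off there.\<close>

definition nlim :: "'a normed_star_alg => (nat => 'a) => 'a => bool"
 where "nlim A X x \<longleftrightarrow> (%n. nrm A (X n\<ominus>\<^bsub>A\<^esub>x)) \<longlonglongrightarrow> 0"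

context cstar_algebra
begin

lemma add_closed [simp, intro]: "[|x:carrier A;y:carrier A|] ==> x\<oplus>y:carrier A"
 by (rule M.a_closed)

lemma scale_closed [simp, intro]: "x:carrier A ==> c\<odot>x:carrier A"
 by (rule smult_closed) (simp_all add: carrier_class)

lemma diff_closed [simp, intro]: "[|x:carrier A;y:carrier A|] ==> x\<ominus>y:carrier A"
 by (rule M.minus_closed)

lemmas alg_closed [simp, intro] = mult_closed star_closed M.zero_closed M.a_inv_closed

lemma add_scale: "x:carrier A ==> (c + d)\<odot>x = c\<odot>x\<oplus>d\<odot>x"
 using smult_l_distr[of c d x] by (simp add: carrier_class plus_class)

lemma scale_add: "[|x:carrier A;y:carrier A|] ==> c\<odot>(x\<oplus>y) = c\<odot>x\<oplus>c\<odot>y"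
 using smult_r_distr[of c x y] by (simp add: carrier_class)

lemma scale_scale: "x:carrier A ==> c\<odot>(d\<odot>x) = (c * d)\<odot>x"
 using smult_assoc1[of c d x] by (simp add: carrier_class times_class)

lemma scale_one [simp]: "x:carrier A ==> 1\<odot>x = x"
 using smult_one[of x] by (simp add: one_class)

lemma zero_scale [simp]: "x:carrier A ==> 0\<odot>x = \<zero>"
 using smult_l_null[of x] by (simp add: zero_class)

lemma scale_zero [simp]: "c\<odot>\<zero> = \<zero>"
 using smult_r_null[of c] by (simp add: carrier_class)

lemma minus_scale: "x:carrier A ==> (- 1)\<odot>x =\<ominus>x"
 by (metis M.minus_equality add.left_inverse add_scale scale_closed scale_one zero_scale)

lemma diff_scale: "[|x:carrier A;y:carrier A|] ==> x\<ominus>y = x\<oplus>(- 1)\<odot>y"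
 by (simp add: M.minus_eq minus_scale)

lemma zero_mult [simp]: "x:carrier A ==> \<zero>\<otimes>x = \<zero>"
 by (metis M.zero_closed zero_scale smult_mult_left mult_closed)

lemma mult_zero [simp]: "x:carrier A ==> x\<otimes>\<zero> = \<zero>"
 by (metis M.zero_closed zero_scale smult_mult_right mult_closed)

lemma diff_mult: "[|x:carrier A;y:carrier A;z:carrier A|] ==> (x\<ominus>y)\<otimes>z = x\<otimes>z\<ominus>y\<otimes>z"
 by (simp add: diff_scale mult_l_distr smult_mult_left)

lemma mult_diff: "[|x:carrier A;y:carrier A;z:carrier A|] ==> z\<otimes>(x\<ominus>y) = z\<otimes>x\<ominus>z\<otimes>y"
 by (simp add: diff_scale mult_r_distr smult_mult_right)

lemma scale_diff: "[|x:carrier A;y:carrier A|] ==> c\<odot>(x\<ominus>y) = c\<odot>x\<ominus>c\<odot>y"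
 by (simp add: diff_scale scale_add scale_scale mult.commute)

lemma star_diff: "[|x:carrier A;y:carrier A|] ==> star A (x\<ominus>y) = star A x\<ominus>star A y"
 by (simp add: diff_scale star_add star_smult)

lemma star_zero [simp]: "star A \<zero> = \<zero>"
 by (metis M.zero_closed zero_scale star_smult complex_cnj_zero star_closed)

lemma diff_self [simp]: "x:carrier A ==> x\<ominus>x = \<zero>"
 by (simp add: M.minus_eq M.r_neg)

lemma diff_zero [simp]: "x:carrier A ==> x\<ominus>\<zero> = x"
 by (simp add: diff_scale)

lemma diff_add_diff: "[|x:carrier A;y:carrier A;z:carrier A|] ==> (x\<ominus>y)\<oplus>(y\<ominus>z) = x\<ominus>z"
 by (simp add: M.minus_eq) (simp add: M.a_assoc M.r_neg1)

lemma add_diff_add: "[|x:carrier A;y:carrier A;x':carrier A;y':carrier A|] ==>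
  (x\<oplus>y)\<ominus>(x'\<oplus>y') = (x\<ominus>x')\<oplus>(y\<ominus>y')"
 by (simp add: diff_scale scale_add) (simp add: M.a_ac)

lemma diff_add_cancel: "[|x:carrier A;y:carrier A|] ==> (x\<ominus>y)\<oplus>y = x"
 by (simp add: M.minus_eq M.a_assoc M.l_neg)

lemma add_diff_cancel: "[|x:carrier A;y:carrier A|] ==> (x\<oplus>y)\<ominus>y = x"
 by (simp add: M.minus_eq M.a_assoc M.r_neg)

lemma diff_eq_zero: "[|x:carrier A;y:carrier A|] ==> x\<ominus>y = \<zero> \<longleftrightarrow> x = y"
 by (metis M.l_zero diff_add_cancel diff_self)

lemma nrm_zero [simp]: "nrm A \<zero> = 0"
 using nrm_eq_0 by blast

lemma nrm_diff_commute: "[|x:carrier A;y:carrier A|] ==> nrm A (x\<ominus>y) = nrm A (y\<ominus>x)"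
proof -
 assume xy: "x:carrier A" "y:carrier A"
 hence "x\<ominus>y = (- 1)\<odot>(y\<ominus>x)"
  by (simp add: diff_scale scale_add scale_scale M.a_comm)
 thus ?thesis using xy by (simp add: nrm_smult)
qed

lemma nrm_diff_triangle: "[|x:carrier A;y:carrier A;z:carrier A|] ==>
  nrm A (x\<ominus>z) <= nrm A (x\<ominus>y) + nrm A (y\<ominus>z)"
 by (metis diff_add_diff diff_closed nrm_triangle)

lemma nrm_le_diff: "[|x:carrier A;y:carrier A|] ==> nrm A x <= nrm A (x\<ominus>y) + nrm A y"
 by (metis diff_add_cancel diff_closed nrm_triangle)

lemma nrm_diff_abs: "[|x:carrier A;y:carrier A|] ==> \<bar>nrm A x - nrm A y\<bar> <= nrm A (x\<ominus>y)"
 using nrm_le_diff[of x y] nrm_le_diff[of y x] nrm_diff_commute[of x y] by linarith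

lemma nrm_star: "x:carrier A ==> nrm A (star A x) = nrm A x"
proof -
 have le: "nrm A x <= nrm A (star A x)" if x: "x:carrier A" for x
 proof (cases "nrm A x = 0")
  case True thus ?thesis using x nrm_nonneg by simp
 next
  case False
  have "nrm A x * nrm A x <= nrm A (star A x) * nrm A x"
   using nrm_mult[OF star_closed[OF x] x] unfolding nrm_cstar[OF x] by (simp add: semiring_normalization_rules(29))
  thus ?thesis using False nrm_nonneg[OF x] by simp
 qed
 assume x: "x:carrier A"
 show ?thesis using le[OF x] le[of "star A x"] x by (simp add: star_star)
qed

lemma nlimI_le: "[|!!n. nrm A (X n\<ominus>x) <= f n;f \<longlonglongrightarrow> 0;range X \<subseteq> carrier A;x:carrier A|] ==> nlim A X x"
 unfolding nlim_def
 by (rule tendsto_sandwich[of "%_. 0" _ _ f]) (auto intro!: always_eventually nrm_nonneg diff_closed)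

lemma nlim_unique:
 assumes "nlim A X x" "nlim A X y" "range X \<subseteq> carrier A" "x:carrier A" "y:carrier A"
 shows "x = y"
proof -
 have "nrm A (x\<ominus>y) <= nrm A (X n\<ominus>x) + nrm A (X n\<ominus>y)" for n
  using nrm_diff_triangle[of x "X n" y] nrm_diff_commute[of x "X n"] assms by (auto simp: image_subset_iff)
 moreover have "(%n. nrm A (X n\<ominus>x) + nrm A (X n\<ominus>y)) \<longlonglongrightarrow> 0"
  using assms tendsto_add[of _ 0 _ _ 0] by (fastforce simp: nlim_def)
 ultimately have "nrm A (x\<ominus>y) <= 0"
  by (intro LIMSEQ_le_const) auto
 hence "x\<ominus>y = \<zero>" using assms nrm_nonneg[of "x\<ominus>y"] nrm_eq_0[of "x\<ominus>y"] by auto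
 thus ?thesis using assms by (simp add: diff_eq_zero)
qed

lemma nlim_const: "x:carrier A ==> nlim A (%_. x) x"
 by (simp add: nlim_def)

lemma nlim_add:
 assumes "nlim A X x" "nlim A Y y" "range X \<subseteq> carrier A" "range Y \<subseteq> carrier A" "x:carrier A" "y:carrier A"
 shows "nlim A (%n. X n\<oplus>Y n) (x\<oplus>y)"
proof (rule nlimI_le)
 show "nrm A (X n\<oplus>Y n\<ominus>(x\<oplus>y)) <= nrm A (X n\<ominus>x) + nrm A (Y n\<ominus>y)" for n
  using assms by (simp add: add_diff_add image_subset_iff nrm_triangle)
 show "(%n. nrm A (X n\<ominus>x) + nrm A (Y n\<ominus>y)) \<longlonglongrightarrow> 0"
  using assms tendsto_add[of _ 0 _ _ 0] by (fastforce simp: nlim_def)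
qed (use assms in auto)

lemma nlim_scale:
 assumes "nlim A X x" "range X \<subseteq> carrier A" "x:carrier A"
 shows "nlim A (%n. c\<odot>X n) (c\<odot>x)"
proof (rule nlimI_le)
 show "nrm A (c\<odot>X n\<ominus>c\<odot>x) <= cmod c * nrm A (X n\<ominus>x)" for n
  using assms by (simp add: scale_diff[symmetric] image_subset_iff nrm_smult)
 show "(%n. cmod c * nrm A (X n\<ominus>x)) \<longlonglongrightarrow> 0"
  using assms tendsto_mult_right_zero by (fastforce simp: nlim_def)
qed (use assms in auto)

lemma nlim_star:
 assumes "nlim A X x" "range X \<subseteq> carrier A" "x:carrier A"
 shows "nlim A (%n. star A (X n)) (star A x)"
proof (rule nlimI_le)
 show "nrm A (star A (X n)\<ominus>star A x) <= nrm A (X n\<ominus>x)" for n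
  using assms by (simp add: star_diff[symmetric] image_subset_iff nrm_star)
qed (use assms in "auto simp: nlim_def")

lemma nlim_nrm:
 assumes "nlim A X x" "range X \<subseteq> carrier A" "x:carrier A"
 shows "(%n. nrm A (X n)) \<longlonglongrightarrow> nrm A x"
proof (rule LIM_zero_cancel, rule Lim_null_comparison)
 show "\<forall>\<^sub>F n in sequentially. norm (nrm A (X n) - nrm A x) <= nrm A (X n\<ominus>x)"
  using assms by (auto intro!: always_eventually nrm_diff_abs simp: image_subset_iff)
qed (use assms in "simp add: nlim_def")

lemma mult_diff_mult:
 assumes "x:carrier A" "y:carrier A" "x':carrier A" "y':carrier A"
 shows "nrm A (x'\<otimes>y'\<ominus>x\<otimes>y) <= nrm A (x'\<ominus>x) * nrm A y' + nrm A x * nrm A (y'\<ominus>y)"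
proof -
 have "x'\<otimes>y'\<ominus>x\<otimes>y = (x'\<ominus>x)\<otimes>y'\<oplus>x\<otimes>(y'\<ominus>y)"
  using assms by (simp add: diff_mult mult_diff diff_add_diff)
 hence "nrm A (x'\<otimes>y'\<ominus>x\<otimes>y) <= nrm A ((x'\<ominus>x)\<otimes>y') + nrm A (x\<otimes>(y'\<ominus>y))"
  using assms by (simp add: nrm_triangle)
 also have "...<= nrm A (x'\<ominus>x) * nrm A y' + nrm A x * nrm A (y'\<ominus>y)"
  using assms by (intro add_mono nrm_mult) auto
 finally show ?thesis .
qed

lemma nlim_mult:
 assumes "nlim A X x" "nlim A Y y" "range X \<subseteq> carrier A" "range Y \<subseteq> carrier A" "x:carrier A" "y:carrier A"
 shows "nlim A (%n. X n\<otimes>Y n) (x\<otimes>y)"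
proof (rule nlimI_le)
 show "nrm A (X n\<otimes>Y n\<ominus>(x\<otimes>y)) <= nrm A (X n\<ominus>x) * nrm A (Y n) + nrm A x * nrm A (Y n\<ominus>y)" for n
  using assms by (simp add: mult_diff_mult image_subset_iff)
 have "(%n. nrm A (X n\<ominus>x) * nrm A (Y n) + nrm A x * nrm A (Y n\<ominus>y)) \<longlonglongrightarrow> 0 * nrm A y + nrm A x * 0"
  using assms nlim_nrm[of Y y] by (intro tendsto_intros) (auto simp: nlim_def)
 thus "(%n. nrm A (X n\<ominus>x) * nrm A (Y n) + nrm A x * nrm A (Y n\<ominus>y)) \<longlonglongrightarrow> 0" by simp
qed (use assms in auto)

lemma nlim_cauchy:
 assumes "nlim A X x" "range X \<subseteq> carrier A" "x:carrier A" "0 < e"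
 shows "\<exists>N. \<forall>m\<ge>N. \<forall>n\<ge>N. nrm A (X m\<ominus>X n) < e"
proof -
 obtain N where N: "!!n. n >= N ==> nrm A (X n\<ominus>x) < e/2"
  using assms unfolding nlim_def LIMSEQ_def
  by (metis abs_of_nonneg diff_closed diff_zero dist_real_def half_gt_zero image_subset_iff nrm_nonneg UNIV_I cancel_comm_monoid_add_class.diff_zero)
 have "nrm A (X m\<ominus>X n) < e" if "m >= N" "n >= N" for m n
  using N[OF that(1)] N[OF that(2)] nrm_diff_triangle[of "X m" x "X n"] nrm_diff_commute[of x "X n"] assms
  by (auto simp: image_subset_iff)
 thus ?thesis by blast
qed

end

text \<open>Discharges the \<open>module\<close> part of the locale once, with scalars written as
  complex numbers rather than as elements of the ring record \<open>cring_class_ops\<close>.\<close>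

lemma cstar_algebraI':
 fixes A :: "'a normed_star_alg" (structure)
 assumes "abelian_group A"
  and "!!c x. x:carrier A ==> c\<odot>x:carrier A"
  and "!!c d x. x:carrier A ==> (c + d)\<odot>x = c\<odot>x\<oplus>d\<odot>x"
  and "!!c x y. [|x:carrier A;y:carrier A|] ==> c\<odot>(x\<oplus>y) = c\<odot>x\<oplus>c\<odot>y"
  and "!!c d x. x:carrier A ==> (c * d)\<odot>x = c\<odot>(d\<odot>x)"
  and "!!x. x:carrier A ==> 1\<odot>x = x"
  and "cstar_algebra_axioms A"
 shows "cstar_algebra A"
proof -
 interpret abelian_group A by fact
 show ?thesis
  by (intro cstar_algebra.intro moduleI cring_class assms(1,7))
   (simp_all add: assms(2-6) carrier_class plus_class times_class one_class)
qed

text \<open>The additive inverse is a description over the carrier, so it has to be identified again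
  after the carrier shrinks to \<open>C\<close>. Completeness of \<open>C\<close> is completeness of
  \<open>A\<close> together with closedness under limits.\<close>

lemma (in cstar_algebra) subalgebraI:
 assumes sub: "C \<subseteq> carrier A" and zero: "\<zero>:C"
  and add: "!!x y. [|x:C;y:C|] ==> x\<oplus>y:C"
  and scale: "!!c x. x:C ==> c\<odot>x:C"
  and mult: "!!x y. [|x:C;y:C|] ==> x\<otimes>y:C"
  and star: "!!x. x:C ==> star A x:C"
  and closed: "!!X x. [|!!n::nat. X n:C;x:carrier A;nlim A X x|] ==> x:C"
 shows "cstar_subalgebra C A"
proof -
 let ?C = "A\<lparr>carrier := C\<rparr>"
 have inC: "x:C ==> x:carrier A" for x using sub by blast
 have neg: "\<ominus>x:C" if "x:C" for x
  using scale[OF that, of "-1"] minus_scale inC that by simp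
 have grp: "abelian_group ?C"
 proof (rule abelian_groupI)
  fix x assume "x:carrier ?C"
  hence "\<ominus>x:C" "\<ominus>x\<oplus>x = \<zero>" using neg inC by (auto simp: M.l_neg)
  thus "\<exists>y\<in>carrier ?C. y\<oplus>\<^bsub>?C\<^esub>x = \<zero>\<^bsub>?C\<^esub>" by auto
 qed (use zero add inC in "auto simp: M.a_ac")
 have ainv: "\<ominus>\<^bsub>?C\<^esub>x =\<ominus>x" if "x:C" for x
  using abelian_group.minus_equality[OF grp, of "\<ominus>x" x] that neg inC by (simp add: M.l_neg)
 have diff: "x\<ominus>\<^bsub>?C\<^esub>y = x\<ominus>y" if "x:C" "y:C" for x y
  using ainv[OF that(2)] by (simp add: a_minus_def)
 have ax: "cstar_algebra_axioms ?C"
 proof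
  fix X :: "nat => 'a"
  assume X: "!!n. X n:carrier ?C"
   and cau: "!!e. 0 < e ==> \<exists>N. \<forall>m\<ge>N. \<forall>n\<ge>N. nrm ?C (X m\<ominus>\<^bsub>?C\<^esub>X n) < e"
  have "\<exists>x\<in>carrier A. (%n::nat. nrm A (X n\<ominus>x)) \<longlonglongrightarrow> 0"
   using X cau inC diff by (intro nrm_complete) auto
  then obtain x where x: "x:carrier A" "nlim A X x" unfolding nlim_def by blast
  have XC: "X n:C" for n using X by simp
  have "x:C" by (rule closed[OF XC x])
  thus "\<exists>x\<in>carrier ?C. (%n. nrm ?C (X n\<ominus>\<^bsub>?C\<^esub>x)) \<longlonglongrightarrow> 0"
   using x X diff by (intro bexI[of _ x]) (auto simp: nlim_def)
 qed (use inC mult star in "auto simp: mult_assoc mult_l_distr mult_r_distr smult_mult_left smult_mult_right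
    star_star star_add star_smult star_mult nrm_nonneg nrm_eq_0 nrm_triangle nrm_smult nrm_mult nrm_cstar")
 show ?thesis
  unfolding cstar_subalgebra_def
  by (intro conjI sub cstar_algebraI' grp ax)
   (use inC scale in "auto simp: add_scale scale_add scale_scale")
qed

definition nclosure :: "'a normed_star_alg => 'a set => 'a set"
 where "nclosure A C = {x\<in>carrier A. \<exists>X. (\<forall>n::nat. X n:C) \<and> nlim A X x}"

context cstar_algebra
begin

lemma nclosure_iff:
 assumes "C \<subseteq> carrier A"
 shows "x:nclosure A C \<longleftrightarrow> x:carrier A \<and> (\<forall>e>0. \<exists>y\<in>C. nrm A (y\<ominus>x) < e)"
proof
 assume "x:nclosure A C"
 then obtain X where X: "x:carrier A" "!!n. X n:C" "nlim A X x" unfolding nclosure_def by blast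
 have "\<exists>y\<in>C. nrm A (y\<ominus>x) < e" if "e > 0" for e
 proof -
  have "\<forall>\<^sub>F n in sequentially. nrm A (X n\<ominus>x) < e"
   using X(3) that unfolding nlim_def by (rule order_tendstoD)
  then obtain n where "nrm A (X n\<ominus>x) < e" by (auto simp: eventually_sequentially)
  thus ?thesis using X(2) by blast
 qed
 with X show "x:carrier A \<and> (\<forall>e>0. \<exists>y\<in>C. nrm A (y\<ominus>x) < e)" by blast
next
 assume h: "x:carrier A \<and> (\<forall>e>0. \<exists>y\<in>C. nrm A (y\<ominus>x) < e)"
 have "\<forall>n::nat. \<exists>y\<in>C. nrm A (y\<ominus>x) < 1/Suc n" using h by simp
 then obtain X where X: "!!n::nat. X n:C \<and> nrm A (X n\<ominus>x) < 1/Suc n" by metis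
 have "nlim A X x"
 proof (rule nlimI_le[where f = "%n. 1/Suc n"])
  show "(%n. 1/real (Suc n)) \<longlonglongrightarrow> 0" using LIMSEQ_inverse_real_of_nat by (simp add: inverse_eq_divide)
 qed (use X h assms in "auto intro: less_imp_le")
 thus "x:nclosure A C" unfolding nclosure_def using X h by blast
qed

lemma nclosure_subset: "C \<subseteq> carrier A ==> C \<subseteq> nclosure A C"
 by (force simp: nclosure_def intro: exI[of _ "%_. _"] nlim_const)

lemma nclosure_carrier: "x:nclosure A C ==> x:carrier A"
 by (simp add: nclosure_def)

lemma nclosure_limit:
 assumes C: "C \<subseteq> carrier A" and X: "!!n. X n:nclosure A C" and x: "x:carrier A" "nlim A X x"
 shows "x:nclosure A C"
 unfolding nclosure_iff[OF C]
proof (intro conjI x(1) allI impI)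
 fix e :: real assume e: "0 < e"
 have "\<forall>\<^sub>F n in sequentially. nrm A (X n\<ominus>x) < e/2"
  using x(2) e unfolding nlim_def by (intro order_tendstoD) auto
 then obtain n where n: "nrm A (X n\<ominus>x) < e/2" by (auto simp: eventually_sequentially)
 obtain y where y: "y:C" "nrm A (y\<ominus>X n) < e/2"
  using X[of n] half_gt_zero[OF e] unfolding nclosure_iff[OF C] by blast
 have "y:carrier A" "X n:carrier A" using y C nclosure_carrier[OF X] by auto
 hence "nrm A (y\<ominus>x) < e" using nrm_diff_triangle[of y "X n" x] n y x by linarith
 with y(1) show "\<exists>y\<in>C. nrm A (y\<ominus>x) < e" by blast
qed

lemma nclosure_nclosure:
 assumes C: "C \<subseteq> carrier A" and X: "X \<subseteq> nclosure A C" and x: "x:nclosure A X"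
 shows "x:nclosure A C"
proof -
 obtain Y where Y: "!!n::nat. Y n:X" "nlim A Y x" using x unfolding nclosure_def by blast
 show ?thesis by (rule nclosure_limit[OF C subsetD[OF X Y(1)] nclosure_carrier[OF x] Y(2)])
qed

text \<open>One limit argument serves all operations; a unary one is passed as a function that
  ignores its second argument.\<close>

lemma nclosure_map:
 assumes C: "C \<subseteq> carrier A" and xy: "x:nclosure A C" "y:nclosure A C"
  and f: "!!x y. [|x:C;y:C|] ==> f x y:C" "f x y:carrier A"
  and lim: "!!X Y. [|nlim A X x;nlim A Y y;range X \<subseteq> carrier A;range Y \<subseteq> carrier A|] ==> nlim A (%n. f (X n) (Y n)) (f x y)"
 shows "f x y:nclosure A C"
proof -
 obtain X where X: "!!n::nat. X n:C" "nlim A X x" using xy(1) unfolding nclosure_def by blast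
 obtain Y where Y: "!!n::nat. Y n:C" "nlim A Y y" using xy(2) unfolding nclosure_def by blast
 have "range X \<subseteq> carrier A" "range Y \<subseteq> carrier A" using X(1) Y(1) C by auto
 from lim[OF X(2) Y(2) this] show ?thesis
  using X(1) Y(1) f unfolding nclosure_def by (intro CollectI conjI exI[of _ "%n. f (X n) (Y n)"]) simp_all
qed

lemma nclosure_add:
 assumes "C \<subseteq> carrier A" "!!x y. [|x:C;y:C|] ==> x\<oplus>y:C" "x:nclosure A C" "y:nclosure A C"
 shows "x\<oplus>y:nclosure A C"
 by (rule nclosure_map[where f = "%x y. x\<oplus>y", OF assms(1,3,4,2)])
  (simp_all add: nlim_add nclosure_carrier[OF assms(3)] nclosure_carrier[OF assms(4)])

lemma nclosure_scale:
 assumes "C \<subseteq> carrier A" "!!x. x:C ==> c\<odot>x:C" "x:nclosure A C"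
 shows "c\<odot>x:nclosure A C"
 by (rule nclosure_map[where f = "%x y. c\<odot>x", OF assms(1,3,3,2)])
  (simp_all add: nlim_scale nclosure_carrier[OF assms(3)])

lemma nclosure_subalgebra:
 assumes sub: "C \<subseteq> carrier A" and zero: "\<zero>:C"
  and add: "!!x y. [|x:C;y:C|] ==> x\<oplus>y:C"
  and scale: "!!c x. x:C ==> c\<odot>x:C"
  and mult: "!!x y. [|x:C;y:C|] ==> x\<otimes>y:C"
  and star: "!!x. x:C ==> star A x:C"
 shows "cstar_subalgebra (nclosure A C) A"
proof (rule subalgebraI)
 show "nclosure A C \<subseteq> carrier A" by (auto simp: nclosure_def)
 show "\<zero>:nclosure A C" using zero nclosure_subset sub by blast
 fix x assume x: "x:nclosure A C"
 note xc = nclosure_carrier[OF x]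
 show "c\<odot>x:nclosure A C" for c by (rule nclosure_scale[OF sub scale x])
 show "star A x:nclosure A C"
  by (rule nclosure_map[where f = "%x y. star A x", OF sub x x star]) (simp_all add: nlim_star xc)
 fix y assume y: "y:nclosure A C"
 show "x\<oplus>y:nclosure A C" by (rule nclosure_add[OF sub add x y])
 show "x\<otimes>y:nclosure A C"
  by (rule nclosure_map[where f = "%x y. x\<otimes>y", OF sub x y mult]) (simp_all add: nlim_mult xc nclosure_carrier[OF y])
qed (rule nclosure_limit[OF sub])

end

section \<open>Comparison of norms by iterated squaring, and isometric extension\<close>

text \<open>If \<open>b < a\<close>, dividing by a^n at n = 2^k bounds 1 by (C n + D) (b/a)^n, which
  tends to 0.\<close>

lemma le_of_pow_le_linear:
 fixes a b :: real
 assumes ab: "0 <= a" "0 <= b" and le: "!!k::nat. a^(2^k) <= (C * 2^k + D) * b^(2^k)"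
 shows "a <= b"
proof (rule ccontr)
 assume "\<not> a <= b"
 hence ba: "b < a" by simp
 have apos: "0 < a" using ba ab by linarith
 define r where "r = b/a"
 have r: "0 <= r" "r < 1" using ab ba apos by (auto simp: r_def)
 have "1 <= (C * 2^k + D) * r^(2^k)" for k :: nat
  using le[of k] apos by (simp add: r_def power_divide field_simps)
 moreover have "(%k::nat. (C * 2^k + D) * r^(2^k)) \<longlonglongrightarrow> 0"
 proof -
  have "(%n::nat. of_nat n * r^n) \<longlonglongrightarrow> 0"
   using r powser_times_n_limit_0[of r] by simp
  moreover have "(%n::nat. r^n) \<longlonglongrightarrow> 0" using r by (intro LIMSEQ_power_zero) simp
  ultimately have "(%n::nat. C * (of_nat n * r^n) + D * r^n) \<longlonglongrightarrow> C * 0 + D * 0"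
   by (intro tendsto_add tendsto_mult tendsto_const)
  hence "(%n::nat. C * (of_nat n * r^n) + D * r^n) \<longlonglongrightarrow> 0" by simp
  moreover have "filterlim (%k::nat. 2^k) sequentially sequentially"
   by (rule filterlim_subseq) (simp add: strict_mono_def)
  ultimately have "((%n::nat. C * (of_nat n * r^n) + D * r^n) \<circ> (%k. 2^k)) \<longlonglongrightarrow> 0"
   unfolding comp_def by (rule filterlim_compose)
  thus ?thesis by (simp add: comp_def algebra_simps)
 qed
 ultimately have "(1::real) <= 0" by (intro LIMSEQ_le_const) auto
 thus False by simp
qed

text \<open>Iterating \<open>(a, T) \<mapsto> (a\<^sup>*a, T\<^sup>*T)\<close> squares both norms, so that a bound with a constant that grows
 at most linearly in the exponent improves to constant 1.\<close>

lemma squaring_bound: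
 assumes A: "cstar_algebra A" and M: "cstar_algebra M"
  and P: "!!k a T. (a, T):P k ==> a:carrier A \<and> T:carrier M"
  and sq: "!!k a T. (a, T):P k ==> (star A a\<otimes>\<^bsub>A\<^esub>a, star M T\<otimes>\<^bsub>M\<^esub>T):P (Suc k)"
  and bd: "!!k a T. (a, T):P k ==> nrm A a <= (C * 2^k + D) * nrm M T"
  and aT: "(a, T):P 0"
 shows "nrm A a <= nrm M T"
proof -
 interpret A: cstar_algebra A by fact
 interpret M: cstar_algebra M by fact
 have "\<exists>a' T'. (a', T'):P k \<and> nrm A a' = nrm A a^(2^k) \<and> nrm M T' = nrm M T^(2^k)" for k
 proof (induction k)
  case 0 thus ?case using aT by auto
 next
  case (Suc k)
  then obtain a' T' where IH: "(a', T'):P k" "nrm A a' = nrm A a^(2^k)" "nrm M T' = nrm M T^(2^k)" by blast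
  thus ?case using sq[OF IH(1)] P[OF IH(1)]
   by (intro exI[of _ "star A a'\<otimes>\<^bsub>A\<^esub>a'"] exI[of _ "star M T'\<otimes>\<^bsub>M\<^esub>T'"])
    (simp add: A.nrm_cstar M.nrm_cstar power_mult[symmetric] mult.commute)
 qed
 hence "nrm A a^(2^k) <= (C * 2^k + D) * nrm M T^(2^k)" for k :: nat
  using bd by metis
 moreover have "0 <= nrm A a" "0 <= nrm M T" using P[OF aT] A.nrm_nonneg M.nrm_nonneg by blast+
 ultimately show ?thesis using le_of_pow_le_linear by blast
qed

lemma star_homD:
 assumes "star_hom A B phi"
 shows "x:carrier A ==> phi x:carrier B"
  and "[|x:carrier A;y:carrier A|] ==> phi (x\<oplus>\<^bsub>A\<^esub>y) = phi x\<oplus>\<^bsub>B\<^esub>phi y"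
  and "x:carrier A ==> phi (c\<odot>\<^bsub>A\<^esub>x) = c\<odot>\<^bsub>B\<^esub>phi x"
  and "[|x:carrier A;y:carrier A|] ==> phi (x\<otimes>\<^bsub>A\<^esub>y) = phi x\<otimes>\<^bsub>B\<^esub>phi y"
  and "x:carrier A ==> phi (star A x) = star B (phi x)"
 using assms unfolding star_hom_def by auto

lemma (in unital_cstar_algebra) star_one: "star A \<one> = \<one>"
proof -
 have c: "star A \<one>:carrier A" using one_closed by (rule star_closed)
 have "star A (star A \<one>\<otimes>\<one>) = star A \<one>\<otimes>\<one>"
  using star_mult[OF c one_closed] star_star[OF one_closed] by simp
 thus ?thesis using mult_one[OF c] star_star[OF one_closed] by simp
qed

text \<open>The partial sums of the geometric series satisfy s(n+1) = 1 + s(n) h, so their limit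
  satisfies g = 1 + g h. A left inverse is what turns into a lower bound for 1 - h in a
  representation.\<close>

lemma (in unital_cstar_algebra) neumann_inverse:
 assumes h: "h:carrier A" "nrm A h < 1"
 obtains g where "g:carrier A" "g\<otimes>(\<one>\<ominus>h) = \<one>"
proof -
 define f where "f g = \<one>\<oplus>g\<otimes>h" for g
 define s where "s n = (f^^n) \<zero>" for n
 have sS: "s (Suc n) = \<one>\<oplus>s n\<otimes>h" for n by (simp add: s_def f_def)
 have sC: "s n:carrier A" for n
  by (induction n) (simp_all add: sS h one_closed, simp add: s_def)
 \<comment> \<open>The fixed point of r |-> |1| + r |h|, hence a bound that the recursion for
   \<open>s\<close> preserves.\<close>
 define C where "C = nrm A \<one>/(1 - nrm A h)"
 have r0: "0 <= nrm A h" using h nrm_nonneg by simp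
 have C0: "0 <= C" using h one_closed by (simp add: C_def nrm_nonneg)
 have bd: "nrm A (s n) <= C" for n
 proof (induction n)
  case 0 thus ?case using C0 by (simp add: s_def)
 next
  case (Suc n)
  have "nrm A (s (Suc n)) <= nrm A \<one> + nrm A (s n) * nrm A h"
   using nrm_triangle[of \<one> "s n\<otimes>h"] nrm_mult[of "s n" h] h sC one_closed by (simp add: sS)
  also have "...<= nrm A \<one> + C * nrm A h" using Suc r0 by (simp add: mult_right_mono)
  also have "...= C" using h by (simp add: C_def field_simps)
  finally show ?case .
 qed
 have close: "nrm A (s (n + m)\<ominus>s n) <= nrm A h^n * C" for n m
 proof (induction n)
  case 0 show ?case using bd[of m] sC[of m] by (simp add: s_def)
 next
  case (Suc n)
  have "s (Suc n + m)\<ominus>s (Suc n) = (s (n + m)\<ominus>s n)\<otimes>h"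
   using h sC one_closed by (simp add: sS add_diff_add diff_mult M.l_zero)
  hence "nrm A (s (Suc n + m)\<ominus>s (Suc n)) <= nrm A (s (n + m)\<ominus>s n) * nrm A h"
   using nrm_mult[of "s (n + m)\<ominus>s n" h] h sC by simp
  also have "...<= nrm A h^n * C * nrm A h" using Suc r0 by (rule mult_right_mono)
  finally show ?case by (simp add: mult_ac)
 qed
 have lim0: "(%n. nrm A h^n * C) \<longlonglongrightarrow> 0"
  using tendsto_mult_left_zero[OF LIMSEQ_realpow_zero[OF r0 h(2)], of C] .
 have "\<exists>g\<in>carrier A. (%n::nat. nrm A (s n\<ominus>g)) \<longlonglongrightarrow> 0"
 proof (rule nrm_complete)
  fix e :: real assume "0 < e"
  then obtain N where "\<forall>n\<ge>N. norm (nrm A h^n * C - 0) < e" using lim0 unfolding LIMSEQ_iff by blast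
  hence N: "nrm A h^n * C < e" if "n >= N" for n using that by fastforce
  have *: "nrm A (s m\<ominus>s n) < e" if "n <= m" "n >= N" for m n
   using close[of n "m - n"] N[OF that(2)] that(1) by simp
  have "nrm A (s m\<ominus>s n) < e" if "m >= N" "n >= N" for m n
   using *[of m n] *[of n m] that nrm_diff_commute[OF sC sC, of m n] by (cases "n <= m") auto
  thus "\<exists>N. \<forall>m\<ge>N. \<forall>n\<ge>N. nrm A (s m\<ominus>s n) < e" by blast
 qed (rule sC)
 then obtain g where g: "g:carrier A" and lim: "nlim A s g" unfolding nlim_def by blast
 have rs: "range s \<subseteq> carrier A" "range (%n. s n\<otimes>h) \<subseteq> carrier A" using sC h by auto
 have eq: "g = \<one>\<oplus>g\<otimes>h"
 proof (rule nlim_unique)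
  show "nlim A (%n. s (Suc n)) g" using lim unfolding nlim_def by (rule LIMSEQ_Suc)
  show "nlim A (%n. s (Suc n)) (\<one>\<oplus>g\<otimes>h)"
   unfolding sS using h g one_closed
   by (intro nlim_add nlim_mult nlim_const lim rs) auto
 qed (use g h sC one_closed in auto)
 have gh: "g\<otimes>h:carrier A" using g h by simp
 have "g\<otimes>(\<one>\<ominus>h) = (\<one>\<oplus>g\<otimes>h)\<ominus>g\<otimes>h"
  using eq g h one_closed by (simp add: mult_diff mult_one)
 thus ?thesis using that g add_diff_cancel[OF one_closed gh] by simp
qed

text \<open>\<open>E\<close> is the graph of a map that is not yet known to be well defined, since
  one element may be a combination of monomials in several ways. Equality of norms on the linear
  space \<open>E\<close> gives well-definedness, injectivity and continuity at once;
  \<open>R\<close> is the closure of this graph.\<close>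

lemma isometric_extension:
 fixes A :: "'a normed_star_alg" (structure) and M :: "'m normed_star_alg"
 assumes A: "cstar_algebra A" and M: "cstar_algebra M"
  and E: "!!a T. (a, T):E ==> a:carrier A \<and> T:carrier M \<and> nrm A a = nrm M T"
  and add: "!!a T b S. [|(a, T):E;(b, S):E|] ==> (a\<oplus>b, T\<oplus>\<^bsub>M\<^esub>S):E"
  and scale: "!!c a T. (a, T):E ==> (c\<odot>a, c\<odot>\<^bsub>M\<^esub>T):E"
  and mult: "!!a T b S. [|(a, T):E;(b, S):E|] ==> (a\<otimes>b, T\<otimes>\<^bsub>M\<^esub>S):E"
  and star: "!!a T. (a, T):E ==> (star A a, star M T):E"
  and dense: "!!x e. [|x:carrier A;0 < e|] ==> \<exists>(a, T)\<in>E. nrm A (a\<ominus>x) < e"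
 obtains Phi where "star_hom A M Phi" "!!x. x:carrier A ==> nrm M (Phi x) = nrm A x"
  "!!x. x:carrier A ==> Phi x:nclosure M (snd`E)" "!!a T. (a, T):E ==> Phi a = T"
proof -
 interpret A: cstar_algebra A by fact
 interpret M: cstar_algebra M by fact
 define R where "R x T \<longleftrightarrow> x:carrier A \<and> T:carrier M \<and>
  (\<exists>X Y. (\<forall>n::nat. (X n, Y n):E) \<and> nlim A X x \<and> nlim M Y T)" for x T
 have diffE: "(a\<ominus>b, T\<ominus>\<^bsub>M\<^esub>S):E" if "(a, T):E" "(b, S):E" for a b T S
  using add[OF that(1) scale[OF that(2), of "-1"]] E[OF that(1)] E[OF that(2)] by (simp add: A.diff_scale M.diff_scale)
 have rngs: "range X \<subseteq> carrier A" "range Y \<subseteq> carrier M" if "\<forall>n::nat. (X n, Y n):E" for X Y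
  using that E by blast+
 have uniq: "T = S" if RT: "R x T" and RS: "R x S" for x T S
 proof -
  obtain X Y where X: "\<forall>n::nat. (X n, Y n):E" "nlim A X x" "nlim M Y T" using RT R_def by auto
  obtain X' Y' where X': "\<forall>n::nat. (X' n, Y' n):E" "nlim A X' x" "nlim M Y' S" using RS R_def by auto
  have c: "x:carrier A" "T:carrier M" "S:carrier M" using RT RS R_def by auto
  have eq: "nrm M (Y n\<ominus>\<^bsub>M\<^esub>Y' n) = nrm A (X n\<ominus>X' n)" for n
   using E[OF diffE] X(1) X'(1) by metis
  have "nlim A (%n. X n\<oplus>(- 1)\<odot>X' n) (x\<oplus>(- 1)\<odot>x)"
   using X(2) X'(2) rngs(1)[OF X(1)] rngs(1)[OF X'(1)] c by (intro A.nlim_add A.nlim_scale) auto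
  moreover have "nlim M (%n. Y n\<oplus>\<^bsub>M\<^esub>(- 1)\<odot>\<^bsub>M\<^esub>Y' n) (T\<oplus>\<^bsub>M\<^esub>(- 1)\<odot>\<^bsub>M\<^esub>S)"
   using X(3) X'(3) rngs(2)[OF X(1)] rngs(2)[OF X'(1)] c by (intro M.nlim_add M.nlim_scale) auto
  ultimately have "nlim A (%n. X n\<ominus>X' n) \<zero>" "nlim M (%n. Y n\<ominus>\<^bsub>M\<^esub>Y' n) (T\<ominus>\<^bsub>M\<^esub>S)"
   using rngs[OF X(1)] rngs[OF X'(1)] c by (simp_all add: A.diff_scale[symmetric] M.diff_scale[symmetric] image_subset_iff)
  hence "(%n. nrm A (X n\<ominus>X' n)) \<longlonglongrightarrow> 0" "(%n. nrm M (Y n\<ominus>\<^bsub>M\<^esub>Y' n)) \<longlonglongrightarrow> nrm M (T\<ominus>\<^bsub>M\<^esub>S)"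
   using A.nlim_nrm[of _ \<zero>] M.nlim_nrm rngs[OF X(1)] rngs[OF X'(1)] c by (auto simp: image_subset_iff)
  hence "nrm M (T\<ominus>\<^bsub>M\<^esub>S) = 0" unfolding eq by (rule LIMSEQ_unique[rotated])
  thus "T = S" using c M.nrm_eq_0 M.diff_eq_zero by simp
 qed
 have total: "\<exists>T. R x T" if x: "x:carrier A" for x
 proof -
  have "\<exists>p\<in>E. nrm A (fst p\<ominus>x) < 1/Suc n" for n
   using dense[OF x, of "1/Suc n"] by (auto split: prod.splits) force
  then obtain p where p: "!!n. p n:E \<and> nrm A (fst (p n)\<ominus>x) < 1/Suc n" by metis
  define X Y where "X n = fst (p n)" and "Y n = snd (p n)" for n
  have XY: "\<forall>n. (X n, Y n):E" using p by (simp add: X_def Y_def)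
  have lX: "nlim A X x"
  proof (rule A.nlimI_le[where f = "%n. 1/Suc n"])
   show "nrm A (X n\<ominus>x) <= 1/Suc n" for n using p[of n] by (simp add: X_def)
   show "(%n. 1/real (Suc n)) \<longlonglongrightarrow> 0" using LIMSEQ_inverse_real_of_nat by (simp add: inverse_eq_divide)
  qed (use rngs(1)[OF XY] x in auto)
  have "\<exists>T\<in>carrier M. (%n::nat. nrm M (Y n\<ominus>\<^bsub>M\<^esub>T)) \<longlonglongrightarrow> 0"
  proof (rule M.nrm_complete)
   show "Y n:carrier M" for n using rngs(2)[OF XY] by blast
   fix e :: real assume "0 < e"
   from A.nlim_cauchy[OF lX rngs(1)[OF XY] x this]
   show "\<exists>N. \<forall>m\<ge>N. \<forall>n\<ge>N. nrm M (Y m\<ominus>\<^bsub>M\<^esub>Y n) < e"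
    using E[OF diffE] XY by metis
  qed
  then obtain T where "T:carrier M" "nlim M Y T" unfolding nlim_def by blast
  thus ?thesis unfolding R_def using x XY lX by blast
 qed
 define Phi where "Phi x = (THE T. R x T)" for x
 have RP: "R x (Phi x)" if "x:carrier A" for x
  unfolding Phi_def using total[OF that] uniq by (metis theI)
 have Peq: "Phi x = T" if "R x T" for x T using RP uniq that R_def by blast
 show ?thesis
 proof (rule that[of Phi])
  show "star_hom A M Phi"
   unfolding star_hom_def
  proof (intro conjI ballI allI)
   show "Phi:carrier A \<rightarrow> carrier M" using RP R_def by auto
   fix x assume x: "x:carrier A"
   obtain X Y where X: "\<forall>n::nat. (X n, Y n):E" "nlim A X x" "nlim M Y (Phi x)" "Phi x:carrier M" using RP[OF x] R_def by auto
   note rX = rngs[OF X(1)]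
   show "Phi (c\<odot>x) = c\<odot>\<^bsub>M\<^esub>Phi x" for c
    by (rule Peq) (use X x rX scale A.nlim_scale M.nlim_scale in \<open>auto simp: R_def intro!: exI[of _ "%n. c\<odot>X n"] exI[of _ "%n. c\<odot>\<^bsub>M\<^esub>Y n"]\<close>)
   show "Phi (star A x) = star M (Phi x)"
    by (rule Peq) (use X x rX star A.nlim_star M.nlim_star in \<open>auto simp: R_def intro!: exI[of _ "%n. star A (X n)"] exI[of _ "%n. star M (Y n)"]\<close>)
   fix y assume y: "y:carrier A"
   obtain X' Y' where X': "\<forall>n::nat. (X' n, Y' n):E" "nlim A X' y" "nlim M Y' (Phi y)" "Phi y:carrier M" using RP[OF y] R_def by auto
   note rX' = rngs[OF X'(1)]
   show "Phi (x\<oplus>y) = Phi x\<oplus>\<^bsub>M\<^esub>Phi y"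
    by (rule Peq) (use X X' x y rX rX' add A.nlim_add M.nlim_add in
      \<open>auto simp: R_def intro!: exI[of _ "%n. X n\<oplus>X' n"] exI[of _ "%n. Y n\<oplus>\<^bsub>M\<^esub>Y' n"]\<close>)
   show "Phi (x\<otimes>y) = Phi x\<otimes>\<^bsub>M\<^esub>Phi y"
    by (rule Peq) (use X X' x y rX rX' mult A.nlim_mult M.nlim_mult in
      \<open>auto simp: R_def intro!: exI[of _ "%n. X n\<otimes>X' n"] exI[of _ "%n. Y n\<otimes>\<^bsub>M\<^esub>Y' n"]\<close>)
  qed
  fix x assume x: "x:carrier A"
  obtain X Y where X: "\<forall>n::nat. (X n, Y n):E" "nlim A X x" "nlim M Y (Phi x)" "Phi x:carrier M" using RP[OF x] R_def by auto
  have "(%n. nrm M (Y n)) = (%n. nrm A (X n))" using E X(1) by metis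
  thus "nrm M (Phi x) = nrm A x"
   using A.nlim_nrm[OF X(2) rngs(1)[OF X(1)] x] M.nlim_nrm[OF X(3) rngs(2)[OF X(1)] X(4)] LIMSEQ_unique by metis
  have "\<forall>n. Y n:snd`E" using X(1) by (metis image_eqI snd_conv)
  thus "Phi x:nclosure M (snd`E)" unfolding nclosure_def using X by blast
 next
  fix a T assume aT: "(a, T):E"
  have "\<forall>n::nat. (a, T):E" using aT by simp
  hence "R a T" unfolding R_def using E[OF aT]
   by (intro conjI exI[of _ "%_. a"] exI[of _ "%_. T"] A.nlim_const M.nlim_const) simp_all
  thus "Phi a = T" by (rule Peq)
 qed
qed

section \<open>Bounded operators on square-summable families\<close>

text \<open>Complex sequences, made an instance of \<open>real_inner\<close> and
  \<open>banach\<close>, so that bounded operators are the type \<open>blinfun\<close> of real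
  linear maps. Complex multiplication is the separate operation \<open>cscale\<close>, and complex
  linearity is imposed by \<open>clin\<close>.\<close>

typedef 'i ell2 = "{f::'i => complex. (%i. (cmod (f i))\<^sup>2) summable_on UNIV}"
 morphisms coord Abs_ell2
 by (rule exI[of _ "%_. 0"]) simp

setup_lifting type_definition_ell2

lemma coord_summable: "(%i. (cmod (coord x i))\<^sup>2) summable_on UNIV"
 using coord by blast

lemma square_summable_add:
 fixes f g :: "'i => complex"
 assumes "(%i. (cmod (f i))\<^sup>2) summable_on UNIV" "(%i. (cmod (g i))\<^sup>2) summable_on UNIV"
 shows "(%i. (cmod (f i + g i))\<^sup>2) summable_on UNIV"
proof (rule summable_on_comparison_test)
 show "(%i. 2 * (cmod (f i))\<^sup>2 + 2 * (cmod (g i))\<^sup>2) summable_on UNIV"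
  by (intro summable_on_add summable_on_cmult_right assms)
 show "(cmod (f i + g i))\<^sup>2 <= 2 * (cmod (f i))\<^sup>2 + 2 * (cmod (g i))\<^sup>2" for i
 proof -
  have "(cmod (f i + g i))\<^sup>2 <= (cmod (f i) + cmod (g i))\<^sup>2"
   by (intro power_mono norm_triangle_ineq) simp
  also have "...<= 2 * (cmod (f i))\<^sup>2 + 2 * (cmod (g i))\<^sup>2"
   using sum_squares_bound[of "cmod (f i)" "cmod (g i)"] by (simp add: power2_sum)
  finally show ?thesis .
 qed
qed auto

lemma square_summable_mult:
 fixes f :: "'i => complex"
 assumes "(%i. (cmod (f i))\<^sup>2) summable_on UNIV" "!!i. cmod (g i) <= c"
 shows "(%i. (cmod (g i * f i))\<^sup>2) summable_on UNIV"
proof (rule summable_on_comparison_test)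
 show "(%i. c\<^sup>2 * (cmod (f i))\<^sup>2) summable_on UNIV"
  by (intro summable_on_cmult_right assms)
 show "(cmod (g i * f i))\<^sup>2 <= c\<^sup>2 * (cmod (f i))\<^sup>2" for i
  unfolding norm_mult power_mult_distrib by (intro mult_right_mono power_mono assms) auto
qed auto

lemma inner_summable:
 fixes f g :: "'i => complex"
 assumes "(%i. (cmod (f i))\<^sup>2) summable_on UNIV" "(%i. (cmod (g i))\<^sup>2) summable_on UNIV"
 shows "(%i. inner (f i) (g i)) summable_on UNIV"
proof (rule abs_summable_summable, rule summable_on_comparison_test)
 show "(%i. (cmod (f i))\<^sup>2 + (cmod (g i))\<^sup>2) summable_on UNIV"
  by (intro summable_on_add assms)
 show "norm (inner (f i) (g i)) <= (cmod (f i))\<^sup>2 + (cmod (g i))\<^sup>2" for i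
 proof -
  have "norm (inner (f i) (g i)) <= cmod (f i) * cmod (g i)" using Cauchy_Schwarz_ineq2 by simp
  moreover have "2 * (cmod (f i) * cmod (g i)) <= (cmod (f i))\<^sup>2 + (cmod (g i))\<^sup>2"
   using sum_squares_bound[of "cmod (f i)" "cmod (g i)"] by simp
  moreover have "0 <= cmod (f i) * cmod (g i)" by simp
  ultimately show ?thesis by linarith
 qed
qed auto

instantiation ell2 :: (type) real_vector
begin

lift_definition zero_ell2 :: "'a ell2" is "%_. 0" by simp
lift_definition plus_ell2 :: "'a ell2 => 'a ell2 => 'a ell2" is "%f g i. f i + g i"
 by (rule square_summable_add)
lift_definition uminus_ell2 :: "'a ell2 => 'a ell2" is "%f i. - f i" by simp
definition minus_ell2 :: "'a ell2 => 'a ell2 => 'a ell2" where "minus_ell2 x y = x + - y"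
lift_definition scaleR_ell2 :: "real => 'a ell2 => 'a ell2" is "%r f i. complex_of_real r * f i"
 by (rule square_summable_mult) auto

instance
proof
 fix x y z :: "'a ell2" and r s :: real
 show "x + y + z = x + (y + z)" by transfer (simp add: add.assoc)
 show "x + y = y + x" by transfer (simp add: add.commute)
 show "0 + x = x" by transfer simp
 show "- x + x = 0" by transfer simp
 show "x - y = x + - y" by (simp add: minus_ell2_def)
 show "r *\<^sub>R (x + y) = r *\<^sub>R x + r *\<^sub>R y" by transfer (simp add: distrib_left)
 show "(r + s) *\<^sub>R x = r *\<^sub>R x + s *\<^sub>R x" by transfer (simp add: distrib_right)
 show "r *\<^sub>R s *\<^sub>R x = (r * s) *\<^sub>R x" by transfer (simp add: mult.assoc)
 show "1 *\<^sub>R x = x" by transfer simp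
qed

end

instantiation ell2 :: (type) real_inner
begin

lift_definition inner_ell2 :: "'a ell2 => 'a ell2 => real" is "%f g. \<Sum>\<^sub>\<infinity>i. inner (f i) (g i)" .
definition norm_ell2 :: "'a ell2 => real" where "norm_ell2 x = sqrt (inner x x)"
definition dist_ell2 :: "'a ell2 => 'a ell2 => real" where "dist_ell2 x y = norm (x - y)"
definition sgn_ell2 :: "'a ell2 => 'a ell2" where "sgn_ell2 x = x /\<^sub>R norm x"
definition uniformity_ell2 :: "('a ell2\<times>'a ell2) filter"
 where "uniformity_ell2 = (INF e\<in>{0 <..}. principal {(x, y). dist x y < e})"
definition open_ell2 :: "'a ell2 set => bool"
 where "open_ell2 U \<longleftrightarrow> (\<forall>x\<in>U. eventually (%(x', y). x' = x --> y:U) uniformity)"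

instance
proof
 fix x y z :: "'a ell2" and r s :: real
 show "sgn x = x /\<^sub>R norm x" by (simp add: sgn_ell2_def)
 show "dist x y = norm (x - y)" by (simp add: dist_ell2_def)
 show "uniformity = (INF e\<in>{0 <..}. principal {(x, y::'a ell2). dist x y < e})" by (simp add: uniformity_ell2_def)
 show "open U \<longleftrightarrow> (\<forall>x\<in>U. eventually (%(x', y). x' = x --> y:U) uniformity)" for U :: "'a ell2 set"
  by (simp add: open_ell2_def)
 show "inner x y = inner y x" by transfer (simp add: inner_commute)
 show "inner (x + y) z = inner x z + inner y z"
  by transfer (simp add: inner_add_left infsum_add inner_summable)
 show "inner (r *\<^sub>R x) y = r * inner x y"
 proof transfer
  fix r :: real and f g :: "'a => complex"
  have "(%i. inner (complex_of_real r * f i) (g i)) = (%i. r * inner (f i) (g i))"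
   by (auto simp: inner_complex_def algebra_simps)
  thus "(\<Sum>\<^sub>\<infinity>i. inner (complex_of_real r * f i) (g i)) = r * (\<Sum>\<^sub>\<infinity>i. inner (f i) (g i))"
   by (simp add: infsum_cmult_right')
 qed
 show "0 <= inner x x" by transfer (simp add: infsum_nonneg)
 show "inner x x = 0 \<longleftrightarrow> x = 0"
 proof transfer
  fix f :: "'a => complex"
  assume f: "(%i. (cmod (f i))\<^sup>2) summable_on UNIV"
  have s: "(%i. inner (f i) (f i)) summable_on UNIV" by (rule inner_summable) fact+
  show "(\<Sum>\<^sub>\<infinity>i. inner (f i) (f i)) = 0 \<longleftrightarrow> f = (%_. 0)"
  proof
   assume z: "(\<Sum>\<^sub>\<infinity>i. inner (f i) (f i)) = 0"
   have "inner (f i) (f i) = 0" for i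
    by (rule nonneg_infsum_le_0D[OF _ s]) (use z in auto)
   thus "f = (%_. 0)" by auto
  qed simp
 qed
 show "norm x = sqrt (inner x x)" by (simp add: norm_ell2_def)
qed

end

lemma norm_ell2_sq: "(norm x)\<^sup>2 = (\<Sum>\<^sub>\<infinity>i. (cmod (coord x i))\<^sup>2)"
proof -
 have "(norm x)\<^sup>2 = inner x x" by (simp add: power2_norm_eq_inner)
 also have "...= (\<Sum>\<^sub>\<infinity>i. (cmod (coord x i))\<^sup>2)"
  by transfer (simp add: power2_norm_eq_inner)
 finally show ?thesis .
qed

lemma coord_ext: "(!!i. coord x i = coord y i) ==> x = y"
 by (metis coord_inject ext)

lemma coord_zero [simp]: "coord 0 i = 0" by transfer simp
lemma coord_add [simp]: "coord (x + y) i = coord x i + coord y i" by transfer simp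
lemma coord_minus [simp]: "coord (- x) i = - coord x i" by transfer simp
lemma coord_diff [simp]: "coord (x - y) i = coord x i - coord y i"
 unfolding minus_ell2_def coord_add coord_minus by simp
lemma coord_scaleR [simp]: "coord (r *\<^sub>R x) i = complex_of_real r * coord x i" by transfer simp
lemma coord_sum [simp]: "coord (sum f F) i = (\<Sum>j\<in>F. coord (f j) i)"
 by (induction F rule: infinite_finite_induct) auto

lemma inner_ell2_coord: "inner x y = (\<Sum>\<^sub>\<infinity>i. inner (coord x i) (coord y i))" by transfer simp

lemma sum_coord_le: "finite F ==> (\<Sum>i\<in>F. (cmod (coord x i))\<^sup>2) <= (norm x)\<^sup>2"
 unfolding norm_ell2_sq by (rule finite_sum_le_infsum) (auto simp: coord_summable)

lemma coord_le: "cmod (coord x i) <= norm x"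
 using sum_coord_le[of "{i}" x] by (simp add: power2_le_iff_abs_le)

lemma square_summableI:
 assumes "!!F. finite F ==> (\<Sum>i\<in>F. (cmod (f i))\<^sup>2) <= c"
 shows "(%i. (cmod (f i))\<^sup>2) summable_on UNIV"
 by (rule nonneg_bdd_above_summable_on) (use assms in "auto simp: bdd_above_def")

lemma norm_ell2_le:
 assumes "0 <= c" "!!F. finite F ==> (\<Sum>i\<in>F. (cmod (coord x i))\<^sup>2) <= c\<^sup>2"
 shows "norm x <= c"
proof -
 have "(norm x)\<^sup>2 <= c\<^sup>2" unfolding norm_ell2_sq
  by (rule infsum_le_finite_sums) (use assms coord_summable in auto)
 thus ?thesis using assms(1) by (rule power2_le_imp_le)
qed

instance ell2 :: (type) banach
proof
 fix X :: "nat => 'a ell2" assume X: "Cauchy X"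
 have "Cauchy (%n. coord (X n) i)" for i
 proof (rule CauchyI)
  fix e :: real assume "0 < e"
  with X obtain N where N: "!!m n. m >= N ==> n >= N ==> norm (X m - X n) < e"
   unfolding Cauchy_iff by blast
  have "norm (coord (X m) i - coord (X n) i) < e" if "m >= N" "n >= N" for m n
   using coord_le[of "X m - X n" i] N[OF that] by simp
  thus "\<exists>M. \<forall>m\<ge>M. \<forall>n\<ge>M. norm (coord (X m) i - coord (X n) i) < e" by blast
 qed
 hence "\<forall>i. \<exists>l. (%n. coord (X n) i) \<longlonglongrightarrow> l" using Cauchy_convergent convergent_def by blast
 then obtain L where L: "!!i. (%n. coord (X n) i) \<longlonglongrightarrow> L i" by metis
 have bd: "(\<Sum>i\<in>F. (cmod (coord (X m) i - L i))\<^sup>2) <= e\<^sup>2"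
  if N: "!!m n. m >= N ==> n >= N ==> norm (X m - X n) < e" and m: "m >= N" and F: "finite F" for N m e F
 proof (rule LIMSEQ_le_const2)
  show "(%n. \<Sum>i\<in>F. (cmod (coord (X m) i - coord (X n) i))\<^sup>2) \<longlonglongrightarrow> (\<Sum>i\<in>F. (cmod (coord (X m) i - L i))\<^sup>2)"
   by (intro tendsto_intros L)
  show "\<exists>N. \<forall>n\<ge>N. (\<Sum>i\<in>F. (cmod (coord (X m) i - coord (X n) i))\<^sup>2) <= e\<^sup>2"
  proof (intro exI allI impI)
   fix n assume "n >= N"
   have "(\<Sum>i\<in>F. (cmod (coord (X m) i - coord (X n) i))\<^sup>2) <= (norm (X m - X n))\<^sup>2"
    using sum_coord_le[OF F, of "X m - X n"] by simp
   also have "...<= e\<^sup>2" using N[OF m \<open>n \<ge> N\<close>] by (intro power_mono) auto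
   finally show "(\<Sum>i\<in>F. (cmod (coord (X m) i - coord (X n) i))\<^sup>2) <= e\<^sup>2" .
  qed
 qed
 obtain N1 where N1: "!!m n. m >= N1 ==> n >= N1 ==> norm (X m - X n) < 1"
  using X zero_less_one unfolding Cauchy_iff by metis
 have s1: "(%i. (cmod (coord (X N1) i - L i))\<^sup>2) summable_on UNIV"
  by (rule square_summableI[of _ "1\<^sup>2"]) (rule bd[OF N1 order_refl])
 have "(%i. (cmod (coord (X N1) i + - (coord (X N1) i - L i)))\<^sup>2) summable_on UNIV"
  using s1 by (intro square_summable_add) (auto simp: coord_summable norm_minus_commute)
 hence Ls: "(%i. (cmod (L i))\<^sup>2) summable_on UNIV" by simp
 define l where "l = Abs_ell2 L"
 have cl: "coord l i = L i" for i using Ls by (simp add: l_def Abs_ell2_inverse)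
 have "X \<longlonglongrightarrow> l"
 proof (rule LIMSEQ_I)
  fix e :: real assume e: "0 < e"
  then obtain N where N: "!!m n. m >= N ==> n >= N ==> norm (X m - X n) < e/2"
   using X unfolding Cauchy_iff by (meson half_gt_zero)
  have "norm (X m - l) < e" if m: "m >= N" for m
  proof -
   have "norm (X m - l) <= e/2"
    by (rule norm_ell2_le) (use e bd[OF N m] cl in auto)
   thus ?thesis using e by linarith
  qed
  thus "\<exists>N. \<forall>m\<ge>N. norm (X m - l) < e" by blast
 qed
 thus "convergent X" by (rule convergentI)
qed

lift_definition cscale :: "complex => 'i ell2 => 'i ell2" is "%c f i. c * f i"
 by (rule square_summable_mult) auto

lemma coord_cscale [simp]: "coord (cscale c x) i = c * coord x i" by transfer simp

lemma norm_cscale: "norm (cscale c x) = cmod c * norm x"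
proof -
 have "(norm (cscale c x))\<^sup>2 = (cmod c * norm x)\<^sup>2"
  by (simp add: norm_ell2_sq norm_mult power_mult_distrib infsum_cmult_right')
 thus ?thesis by (simp add: power2_eq_iff_nonneg)
qed

lemma inner_cscale: "inner (cscale c x) y = inner x (cscale (cnj c) y)"
 unfolding inner_ell2_coord
 by (rule infsum_cong) (simp add: inner_complex_def algebra_simps)

lift_definition ket :: "'i => 'i ell2" is "%i j. if i = j then 1 else 0"
proof (rule square_summableI)
 fix i :: 'i and F :: "'i set" assume "finite F"
 hence "(\<Sum>j\<in>F. (cmod (if i = j then 1 else 0))\<^sup>2) = (\<Sum>j\<in>F. if i = j then 1 else 0)"
  by (intro sum.cong) auto
 also have "...<= 1" using \<open>finite F\<close> by simp
 finally show "(\<Sum>j\<in>F. (cmod (if i = j then 1 else 0))\<^sup>2) <= 1" .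
qed

lemma coord_ket: "coord (ket i) j = (if i = j then 1 else 0)" by transfer simp

lemma norm_ket [simp]: "norm (ket i) = 1"
proof (rule antisym)
 show "norm (ket i) <= 1"
 proof (rule norm_ell2_le)
  fix F :: "'a set" assume "finite F"
  hence "(\<Sum>j\<in>F. (cmod (coord (ket i) j))\<^sup>2) = (\<Sum>j\<in>F. if i = j then 1 else 0)"
   by (intro sum.cong) (auto simp: coord_ket)
  also have "...<= 1\<^sup>2" using \<open>finite F\<close> by simp
  finally show "(\<Sum>j\<in>F. (cmod (coord (ket i) j))\<^sup>2) <= 1\<^sup>2" .
 qed simp
 show "1 <= norm (ket i)" using coord_le[of "ket i" i] by (simp add: coord_ket)
qed

lemma inner_ket: "inner (ket i) x = Re (coord x i)"
proof -
 have "inner (ket i) x = (\<Sum>\<^sub>\<infinity>j\<in>{i}. inner (coord (ket i) j) (coord x j))"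
  unfolding inner_ell2_coord by (rule infsum_cong_neutral) (auto simp: coord_ket)
 thus ?thesis by (simp add: coord_ket inner_complex_def)
qed

definition restr :: "'i set => 'i ell2 => 'i ell2"
 where "restr F x = (\<Sum>i\<in>F. cscale (coord x i) (ket i))"

lemma coord_restr: "finite F ==> coord (restr F x) i = (if i:F then coord x i else 0)"
 by (simp add: restr_def coord_ket if_distrib[of "%c. _ * c"] cong: if_cong)

lemma norm_restr_sq: "finite F ==> (norm (restr F x))\<^sup>2 = (\<Sum>i\<in>F. (cmod (coord x i))\<^sup>2)"
proof -
 assume F: "finite F"
 have "(norm (restr F x))\<^sup>2 = (\<Sum>\<^sub>\<infinity>i\<in>F. (cmod (coord x i))\<^sup>2)"
  unfolding norm_ell2_sq by (rule infsum_cong_neutral) (auto simp: coord_restr F)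
 thus ?thesis using F by simp
qed

lemma norm_restr_le: "finite F ==> norm (restr F x) <= norm x"
 using norm_restr_sq[of F x] sum_coord_le[of F x] by (simp add: power2_le_imp_le)

lemma restr_approx:
 assumes "0 < e"
 shows "\<exists>F. finite F \<and> norm (x - restr F x) <= e"
proof -
 obtain F where F: "finite F" "dist (\<Sum>i\<in>F. (cmod (coord x i))\<^sup>2) (\<Sum>\<^sub>\<infinity>i. (cmod (coord x i))\<^sup>2) <= e\<^sup>2"
  using infsum_finite_approximation[OF coord_summable, of "e\<^sup>2" x] assms by auto
 have "norm (x - restr F x) <= e"
 proof (rule norm_ell2_le)
  fix F' :: "'a set" assume F': "finite F'"
  have "(\<Sum>i\<in>F'. (cmod (coord (x - restr F x) i))\<^sup>2) = (\<Sum>i\<in>F' - F. (cmod (coord x i))\<^sup>2)"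
   using F' by (intro sum.mono_neutral_cong_right) (auto simp: coord_restr F)
  also have "...= (\<Sum>i\<in>F'\<union>F. (cmod (coord x i))\<^sup>2) - (\<Sum>i\<in>F. (cmod (coord x i))\<^sup>2)"
   using F' F(1) by (subst sum_diff[symmetric]) (auto intro!: sum.cong)
  also have "...<= (norm x)\<^sup>2 - (\<Sum>i\<in>F. (cmod (coord x i))\<^sup>2)"
   using sum_coord_le[of "F'\<union>F" x] F' F(1) by simp
  also have "...<= e\<^sup>2" using F(2) by (simp add: norm_ell2_sq dist_real_def)
  finally show "(\<Sum>i\<in>F'. (cmod (coord (x - restr F x) i))\<^sup>2) <= e\<^sup>2" .
 qed (use assms in simp)
 with F show ?thesis by blast
qed

text \<open>The truncation of \<open>T (restr F x)\<close> to \<open>F\<close> is tested against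
  itself, so a bound for the form on finitely supported vectors controls its norm; both truncations
  become harmless as \<open>F\<close> grows.\<close>

lemma blinfun_norm_le_restr:
 fixes T :: "'i ell2 \<Rightarrow>\<^sub>L 'i ell2"
 assumes c: "0 <= c"
  and le: "!!F x y. finite F ==> \<bar>inner (T (restr F x)) (restr F y)\<bar> <= c * norm (restr F x) * norm (restr F y)"
 shows "norm T <= c"
proof (rule norm_blinfun_bound[OF c])
 fix x
 have 1: "norm (restr F (T (restr F x))) <= c * norm x" if F: "finite F" for F
 proof -
  define z where "z = T (restr F x)"
  define w where "w = restr F z"
  have "inner z w = (\<Sum>\<^sub>\<infinity>i\<in>F. (cmod (coord z i))\<^sup>2)"
   unfolding inner_ell2_coord w_def
   by (rule infsum_cong_neutral) (auto simp: coord_restr F power2_norm_eq_inner)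
  also have "...= (norm w)\<^sup>2" using F by (simp add: w_def norm_restr_sq)
  finally have "(norm w)\<^sup>2 = inner z w" by simp
  also have "...<= c * norm (restr F x) * norm w" using le[OF F, of x z] by (simp add: z_def w_def)
  also have "...<= (c * norm x) * norm w"
   by (intro mult_right_mono mult_left_mono norm_restr_le F c) auto
  finally have "norm w * norm w <= (c * norm x) * norm w" by (simp add: power2_eq_square)
  thus ?thesis using c by (cases "norm w = 0") (auto simp: w_def[symmetric] z_def[symmetric])
 qed
 show "norm (T x) <= c * norm x"
 proof (rule field_le_epsilon)
  fix e :: real assume e: "0 < e"
  \<comment> \<open>Truncating \<open>T x\<close> costs \<open>d\<close>, truncating
    \<open>x\<close> costs \<open>norm T * d\<close>; together they cost \<open>e\<close>.\<close>
  define d where "d = e/(1 + norm T)"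
  have p: "0 < 1 + norm T" by (simp add: add_pos_nonneg)
  have d: "d > 0" "d * (1 + norm T) = e" using e p by (simp_all add: d_def)
  obtain F1 where F1: "finite F1" "norm (x - restr F1 x) <= d" using restr_approx[OF d(1)] by blast
  obtain F2 where F2: "finite F2" "norm (T x - restr F2 (T x)) <= d" using restr_approx[OF d(1)] by blast
  define F where "F = F1\<union>F2"
  have F: "finite F" using F1 F2 by (simp add: F_def)
  have mono: "norm (y - restr F y) <= norm (y - restr F' y)" if "finite F'" "F' \<subseteq> F" for y F'
  proof (rule norm_ell2_le)
   fix E :: "'i set" assume E: "finite E"
   have "(\<Sum>i\<in>E. (cmod (coord (y - restr F y) i))\<^sup>2) <= (\<Sum>i\<in>E. (cmod (coord (y - restr F' y) i))\<^sup>2)"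
    using that by (intro sum_mono) (auto simp: coord_restr F)
   also have "...<= (norm (y - restr F' y))\<^sup>2" by (rule sum_coord_le[OF E])
   finally show "(\<Sum>i\<in>E. (cmod (coord (y - restr F y) i))\<^sup>2) <= (norm (y - restr F' y))\<^sup>2" .
  qed simp
  have a: "norm (x - restr F x) <= d" using mono[of F1 x] F1 by (auto simp: F_def)
  have b: "norm (T x - restr F (T x)) <= d" using mono[of F2 "T x"] F2 by (auto simp: F_def)
  have rd: "restr F u - restr F v = restr F (u - v)" for u v
   by (rule coord_ext) (simp add: coord_restr F)
  have "norm (restr F (T x) - restr F (T (restr F x))) <= norm (T (x - restr F x))"
   unfolding rd by (simp add: blinfun.diff_right norm_restr_le F)
  also have "...<= norm T * d"
   using norm_blinfun[of T "x - restr F x"] a by (meson mult_left_mono norm_ge_zero order_trans)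
  finally have c1: "norm (restr F (T x) - restr F (T (restr F x))) <= norm T * d" .
  have "norm (T x) <= norm (T x - restr F (T x)) + norm (restr F (T x) - restr F (T (restr F x))) + norm (restr F (T (restr F x)))"
   by (smt (verit) norm_triangle_sub)
  also have "...<= d + norm T * d + c * norm x" using b c1 1[OF F] by simp
  also have "...= c * norm x + e" using d(2) by (simp add: algebra_simps)
  finally show "norm (T x) <= c * norm x + e" .
 qed
qed

section \<open>The C*-algebra of bounded operators\<close>

type_synonym 'i bop = "'i ell2 \<Rightarrow>\<^sub>L 'i ell2"

definition adj :: "'i bop => 'i bop => bool"
 where "adj T S \<longleftrightarrow> (\<forall>x y. inner (T x) y = inner x (S y))"

definition clin :: "'i bop => bool"
 where "clin T \<longleftrightarrow> (\<forall>c x. T (cscale c x) = cscale c (T x))"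

lemma bounded_linear_cscale: "bounded_linear (cscale c)"
 by (rule bounded_linear_intro[of _ "cmod c"])
  (auto intro!: coord_ext simp: algebra_simps norm_cscale)

definition cscaleL :: "complex => 'i bop"
 where "cscaleL c = Blinfun (cscale c)"

lemma cscaleL_apply [simp]: "blinfun_apply (cscaleL c) x = cscale c x"
 by (simp add: cscaleL_def bounded_linear_Blinfun_apply bounded_linear_cscale)

text \<open>The C*-algebra of bounded operators: adjoints are taken with respect to the real inner product,
 which for complex linear operators is the same as for the complex one.\<close>

definition bop :: "'i bop normed_star_alg"
 where "bop = \<lparr>carrier = {T. clin T \<and> (\<exists>S. adj T S)}, monoid.mult = (o\<^sub>L), one = id_blinfun,
  zero = 0, add = (+), smult = (%c T. cscaleL c o\<^sub>L T), star = (%T. THE S. adj T S), nrm = norm\<rparr>"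

lemma bop_simps [simp]:
 "monoid.mult bop = (o\<^sub>L)" "one bop = id_blinfun" "zero bop = 0" "add bop = (+)"
 "smult bop = (%c T. cscaleL c o\<^sub>L T)" "nrm bop = norm"
 by (simp_all add: bop_def)

lemma bop_carrier: "T:carrier bop \<longleftrightarrow> clin T \<and> (\<exists>S. adj T S)"
 by (simp add: bop_def)

lemma adj_unique: "adj T S ==> adj T S' ==> S = S'"
proof (rule blinfun_eqI)
 fix y assume "adj T S" "adj T S'"
 hence "inner x (S y - S' y) = 0" for x by (simp add: adj_def inner_diff_right)
 from this[of "S y - S' y"] show "S y = S' y" by simp
qed

lemma star_bop: "adj T S ==> star bop T = S"
 by (auto simp: bop_def intro: adj_unique)

lemma adj_sym: "adj T S ==> adj S T"
 by (simp add: adj_def inner_commute)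

lemma adj_clin: assumes "adj T S" "clin T" shows "clin S"
 unfolding clin_def
proof (intro allI)
 fix c x
 have "inner z (S (cscale c x) - cscale c (S x)) = 0" for z
 proof -
  have a: "inner (T u) v = inner u (S v)" for u v using assms(1) by (simp add: adj_def)
  have "inner z (S (cscale c x)) = inner (cscale (cnj c) (T z)) x" unfolding inner_cscale a[symmetric] by simp
  also have "...= inner (T (cscale (cnj c) z)) x" using assms(2) by (simp add: clin_def)
  also have "...= inner z (cscale c (S x))" unfolding a inner_cscale by simp
  finally show ?thesis by (simp add: inner_diff_right)
 qed
 from this[of "S (cscale c x) - cscale c (S x)"] show "S (cscale c x) = cscale c (S x)" by simp
qed

lemma adj_norm_cstar: assumes "adj T S" shows "norm (S o\<^sub>L T) = (norm T)\<^sup>2"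
proof -
 have le: "norm T' <= norm S'" if a: "adj T' S'" for T' S' :: "'a bop"
 proof (rule norm_blinfun_bound)
  fix x
  have "norm (T' x) * norm (T' x) = inner (T' x) (T' x)" by (metis power2_eq_square power2_norm_eq_inner)
  also have "...= inner x (S' (T' x))" using a by (simp add: adj_def)
  finally have "norm (T' x) * norm (T' x) = inner x (S' (T' x))" .
  also have "inner x (S' (T' x)) <= norm x * norm (S' (T' x))" by (rule norm_cauchy_schwarz)
  also have "...<= norm x * (norm S' * norm (T' x))" by (intro mult_left_mono norm_blinfun) auto
  finally have "norm (T' x) * norm (T' x) <= (norm S' * norm x) * norm (T' x)" by (simp add: algebra_simps)
  thus "norm (T' x) <= norm S' * norm x" by (cases "norm (T' x) = 0") auto
 qed simp
 have eq: "norm S = norm T" using le[OF assms] le[OF adj_sym[OF assms]] by simp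
 have "(norm T)\<^sup>2 <= norm (S o\<^sub>L T)"
 proof -
  have "norm T <= sqrt (norm (S o\<^sub>L T))"
  proof (rule norm_blinfun_bound)
   fix x
   have "(norm (T x))\<^sup>2 = inner x ((S o\<^sub>L T) x)" using assms by (simp add: adj_def power2_norm_eq_inner)
   also have "...<= norm x * (norm (S o\<^sub>L T) * norm x)"
    using norm_cauchy_schwarz[of x "(S o\<^sub>L T) x"] norm_blinfun[of "S o\<^sub>L T" x]
    by (meson mult_left_mono norm_ge_zero order_trans)
   also have "...= (sqrt (norm (S o\<^sub>L T)) * norm x)\<^sup>2" by (simp add: power_mult_distrib power2_eq_square)
   finally show "norm (T x) <= sqrt (norm (S o\<^sub>L T)) * norm x" by (rule power2_le_imp_le) simp
  qed simp
  hence "(norm T)\<^sup>2 <= (sqrt (norm (S o\<^sub>L T)))\<^sup>2" by (intro power_mono) auto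
  thus ?thesis by simp
 qed
 moreover have "norm (S o\<^sub>L T) <= (norm T)\<^sup>2"
  using norm_blinfun_compose[of S T] eq by (simp add: power2_eq_square)
 ultimately show ?thesis by simp
qed

lemma clin_intros:
 "clin 0" "clin T ==> clin S ==> clin (T + S)" "clin T ==> clin S ==> clin (T - S)" "clin T ==> clin S ==> clin (T o\<^sub>L S)"
 "clin (cscaleL c)" "clin id_blinfun" "clin T ==> clin (- T)"
 by (auto simp: clin_def blinfun.add_left blinfun.diff_left blinfun.minus_left algebra_simps intro!: coord_ext)

lemma adj_intros:
 "adj 0 0" "adj T T' ==> adj S S' ==> adj (T + S) (T' + S')" "adj T T' ==> adj S S' ==> adj (T o\<^sub>L S) (S' o\<^sub>L T')"
 "adj T T' ==> adj S S' ==> adj (T - S) (T' - S')"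
 "adj (cscaleL c) (cscaleL (cnj c))" "adj id_blinfun id_blinfun" "adj T T' ==> adj (- T) (- T')"
 by (auto simp: adj_def blinfun.add_left blinfun.diff_left blinfun.minus_left inner_add_left inner_add_right
   inner_diff_left inner_diff_right inner_cscale)

lemma cscaleL_comm: "clin T ==> T o\<^sub>L cscaleL c = cscaleL c o\<^sub>L T"
 by (rule blinfun_eqI) (simp add: clin_def)

lemma norm_cscaleL:
 fixes T :: "'a bop"
 shows "norm (cscaleL c o\<^sub>L T) = cmod c * norm T"
proof (rule antisym)
 have *: "norm (cscaleL c o\<^sub>L T) <= cmod c * norm T" for c and T :: "'a bop"
  by (rule norm_blinfun_bound) (auto simp: norm_cscale mult.assoc intro!: mult_left_mono norm_blinfun)
 show "norm (cscaleL c o\<^sub>L T) <= cmod c * norm T" by (rule *)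
 show "cmod c * norm T <= norm (cscaleL c o\<^sub>L T)"
 proof (cases "c = 0")
  case False
  have "T = cscaleL (1/c) o\<^sub>L (cscaleL c o\<^sub>L T)" using False by (intro blinfun_eqI coord_ext) simp
  hence "norm T <= cmod (1/c) * norm (cscaleL c o\<^sub>L T)" using * by metis
  thus ?thesis using False by (simp add: norm_divide field_simps)
 qed simp
qed

lemma adj_limit:
 assumes X: "X \<longlonglongrightarrow> T" and Y: "Y \<longlonglongrightarrow> S" and a: "!!n. adj (X n) (Y n)"
 shows "adj T S"
 unfolding adj_def
proof (intro allI)
 fix x y
 have "(%n. inner (X n x) y) \<longlonglongrightarrow> inner (T x) y" by (intro tendsto_intros X)
 moreover have "(%n. inner x (Y n y)) \<longlonglongrightarrow> inner x (S y)" by (intro tendsto_intros Y)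
 moreover have "inner (X n x) y = inner x (Y n y)" for n using a[of n] by (simp add: adj_def)
 ultimately show "inner (T x) y = inner x (S y)" by (simp add: LIMSEQ_unique)
qed

lemma clin_limit:
 assumes X: "X \<longlonglongrightarrow> T" and a: "!!n. clin (X n)"
 shows "clin T"
 unfolding clin_def
proof (intro allI)
 fix c x
 have "(%n. X n (cscale c x)) \<longlonglongrightarrow> T (cscale c x)" by (intro tendsto_intros X)
 moreover have "(%n. cscale c (X n x)) \<longlonglongrightarrow> cscale c (T x)"
  by (intro bounded_linear.tendsto[OF bounded_linear_cscale] tendsto_intros X)
 moreover have "X n (cscale c x) = cscale c (X n x)" for n using a[of n] by (simp add: clin_def)
 ultimately show "T (cscale c x) = cscale c (T x)" by (simp add: LIMSEQ_unique)
qed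

lemma abelian_group_bop: "abelian_group bop"
proof (rule abelian_groupI)
 fix T :: "'a bop" assume "T:carrier bop"
 hence "- T:carrier bop" by (auto simp: bop_carrier intro: clin_intros adj_intros)
 thus "\<exists>S\<in>carrier bop. S\<oplus>\<^bsub>bop\<^esub>T = \<zero>\<^bsub>bop\<^esub>" by (intro bexI[of _ "- T"]) auto
qed (auto simp: bop_carrier add.assoc add.commute intro: clin_intros adj_intros)

lemma a_minus_bop: "S:carrier bop ==> T\<ominus>\<^bsub>bop\<^esub>S = T - S"
proof -
 assume S: "S:carrier bop"
 hence "\<ominus>\<^bsub>bop\<^esub>S = - S"
  by (intro abelian_group.minus_equality[OF abelian_group_bop])
   (auto simp: bop_carrier intro: clin_intros adj_intros)
 thus ?thesis by (simp add: a_minus_def)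
qed

text \<open>The variable \<open>M\<close> makes the index-free notation available. For completeness,
  the adjoints of a Cauchy sequence are again Cauchy (\<open>nYX\<close>), so that the limit has an
  adjoint.\<close>

lemma cstar_algebra_bop':
 fixes M :: "'i bop normed_star_alg" (structure)
 assumes [simp]: "M = bop"
 shows "cstar_algebra M"
proof (rule cstar_algebraI')
 show "abelian_group M" by (simp add: abelian_group_bop)
 fix c d and x y :: "'i bop"
 show "x:carrier M ==> c\<odot>x:carrier M"
  by (auto simp: bop_carrier intro: clin_intros adj_intros)
 show "(c + d)\<odot>x = c\<odot>x\<oplus>d\<odot>x"
  by (simp, intro blinfun_eqI coord_ext) (simp add: blinfun.add_left algebra_simps)
 show "c\<odot>(x\<oplus>y) = c\<odot>x\<oplus>c\<odot>y"
  by (simp, intro blinfun_eqI coord_ext) (simp add: blinfun.add_left algebra_simps)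
 show "(c * d)\<odot>x = c\<odot>(d\<odot>x)"
  by (simp, intro blinfun_eqI coord_ext) (simp add: algebra_simps)
 show "1\<odot>x = x"
  by (simp, intro blinfun_eqI coord_ext) simp
next
 show "cstar_algebra_axioms M"
 proof
  fix c and x y z :: "'i bop"
  show "(x\<otimes>y)\<otimes>z = x\<otimes>(y\<otimes>z)" by (simp, intro blinfun_eqI) simp
  show "(x\<oplus>y)\<otimes>z = x\<otimes>z\<oplus>y\<otimes>z"
   by (simp, intro blinfun_eqI) (simp add: blinfun.add_left)
  show "z\<otimes>(x\<oplus>y) = z\<otimes>x\<oplus>z\<otimes>y"
   by (simp, intro blinfun_eqI) (simp add: blinfun.add_left blinfun.add_right)
  show "(c\<odot>x)\<otimes>y = c\<odot>(x\<otimes>y)" by (simp, intro blinfun_eqI) simp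
  show "nrm M (x\<oplus>y) <= nrm M x + nrm M y" by (simp add: norm_triangle_ineq)
  show "nrm M (x\<otimes>y) <= nrm M x * nrm M y" by (simp add: norm_blinfun_compose)
  show "nrm M (c\<odot>x) = cmod c * nrm M x" by (simp add: norm_cscaleL)
  assume x: "x:carrier M"
  then obtain x' where x': "adj x x'" "clin x" by (auto simp: bop_carrier)
  show "x\<otimes>(c\<odot>y) = c\<odot>(x\<otimes>y)"
   using x'(2) by (simp, intro blinfun_eqI) (simp add: clin_def)
  show "star M x:carrier M" using x' adj_sym adj_clin by (auto simp: star_bop bop_carrier)
  show "star M (star M x) = x" using star_bop[OF adj_sym[OF x'(1)]] star_bop[OF x'(1)] by simp
  show "star M (c\<odot>x) = cnj c\<odot>star M x"
   using star_bop[OF adj_intros(3)[OF adj_intros(5) x'(1)], of c] star_bop[OF x'(1)]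
    cscaleL_comm[OF adj_clin[OF x'], of "cnj c"] by simp
  show "nrm M (star M x\<otimes>x) = (nrm M x)\<^sup>2"
   using adj_norm_cstar[OF x'(1)] star_bop[OF x'(1)] by simp
  assume "y:carrier M"
  then obtain y' where y': "adj y y'" "clin y" by (auto simp: bop_carrier)
  show "x\<otimes>y:carrier M" using x' y' by (auto simp: bop_carrier intro: clin_intros adj_intros)
  show "star M (x\<oplus>y) = star M x\<oplus>star M y"
   using star_bop[OF adj_intros(2)[OF x'(1) y'(1)]] star_bop[OF x'(1)] star_bop[OF y'(1)] by simp
  show "star M (x\<otimes>y) = star M y\<otimes>star M x"
   using star_bop[OF adj_intros(3)[OF x'(1) y'(1)]] star_bop[OF x'(1)] star_bop[OF y'(1)] by simp
 next
  fix X :: "nat => 'i bop"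
  assume X: "!!n. X n:carrier M"
   and cau: "!!e. 0 < e ==> \<exists>N. \<forall>m\<ge>N. \<forall>n\<ge>N. nrm M (X m\<ominus>X n) < e"
  from X have "\<forall>n. \<exists>S. adj (X n) S" by (simp add: bop_carrier)
  then obtain Y where Y: "!!n. adj (X n) (Y n)" by metis
  have c: "clin (X n)" for n using X by (simp add: bop_carrier)
  have cX: "Cauchy X"
   unfolding Cauchy_iff using cau X by (simp add: a_minus_bop)
  have nYX: "norm (Y m - Y n) = norm (X m - X n)" for m n
  proof -
   have "adj (X m - X n) (Y m - Y n)" by (intro adj_intros Y)
   from adj_norm_cstar[OF this] adj_norm_cstar[OF adj_sym[OF this]] norm_blinfun_compose[of "Y m - Y n" "X m - X n"]
    norm_blinfun_compose[of "X m - X n" "Y m - Y n"]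
   have "(norm (X m - X n))\<^sup>2 <= norm (Y m - Y n) * norm (X m - X n)"
    "(norm (Y m - Y n))\<^sup>2 <= norm (X m - X n) * norm (Y m - Y n)" by auto
   moreover have "a <= b" if "a\<^sup>2 <= b * a" "0 <= a" "0 <= b" for a b :: real
    using that by (cases "a = 0") (auto simp: power2_eq_square)
   ultimately show ?thesis by (intro antisym) (simp_all add: mult.commute)
  qed
  have cY: "Cauchy Y" using cX unfolding Cauchy_iff nYX .
  obtain T where T: "X \<longlonglongrightarrow> T" using Cauchy_convergent[OF cX] convergent_def by blast
  obtain S where S: "Y \<longlonglongrightarrow> S" using Cauchy_convergent[OF cY] convergent_def by blast
  have Tc: "T:carrier M" using adj_limit[OF T S Y] clin_limit[OF T c] by (auto simp: bop_carrier)
  have "(%n. norm (X n - T)) \<longlonglongrightarrow> 0" using T by (simp add: LIM_zero_iff tendsto_norm_zero)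
  thus "\<exists>x\<in>carrier M. (%n::nat. nrm M (X n\<ominus>x)) \<longlonglongrightarrow> 0"
   using Tc by (intro bexI[of _ T]) (simp_all add: a_minus_bop)
 qed (auto simp: bop_carrier)
qed

lemmas cstar_algebra_bop = cstar_algebra_bop'[OF refl]

text \<open>Weighted partial permutations of the basis: \<open>g\<close> tells from which basis vector a given one is reached.\<close>

definition pinj :: "('i => 'i option) => bool"
 where "pinj g \<longleftrightarrow> (\<forall>i j k. g i = Some k --> g j = Some k --> i = j)"

definition wfun :: "('i => 'i option) => ('i => complex) => 'i ell2 => 'i => complex"
 where "wfun g f x j = (case g j of None => 0 | Some i => f j * coord x i)"

definition wop :: "('i => 'i option) => ('i => complex) => 'i bop"
 where "wop g f = Blinfun (%x. Abs_ell2 (wfun g f x))"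

lemma sum_wfun_le:
 assumes g: "pinj g" and f: "!!j. g j ~= None ==> cmod (f j) <= c" and c: "0 <= c" and F: "finite F"
 shows "(\<Sum>j\<in>F. (cmod (wfun g f x j))\<^sup>2) <= (c * norm x)\<^sup>2"
proof -
 define F' where "F' = {j\<in>F. g j ~= None}"
 have F': "finite F'" using F by (simp add: F'_def)
 have inj: "inj_on (%j. the (g j)) F'" using g by (fastforce simp: inj_on_def pinj_def F'_def)
 have "(\<Sum>j\<in>F. (cmod (wfun g f x j))\<^sup>2) = (\<Sum>j\<in>F'. (cmod (wfun g f x j))\<^sup>2)"
  using F by (intro sum.mono_neutral_right) (auto simp: F'_def wfun_def)
 also have "...<= (\<Sum>j\<in>F'. c\<^sup>2 * (cmod (coord x (the (g j))))\<^sup>2)"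
 proof (rule sum_mono)
  fix j assume "j:F'"
  hence "g j ~= None" by (simp add: F'_def)
  hence "cmod (wfun g f x j) <= c * cmod (coord x (the (g j)))"
   using f[of j] by (auto simp: wfun_def norm_mult intro!: mult_right_mono)
  hence "(cmod (wfun g f x j))\<^sup>2 <= (c * cmod (coord x (the (g j))))\<^sup>2" by (intro power_mono) auto
  thus "(cmod (wfun g f x j))\<^sup>2 <= c\<^sup>2 * (cmod (coord x (the (g j))))\<^sup>2" by (simp add: power_mult_distrib)
 qed
 also have "...= c\<^sup>2 * (\<Sum>i\<in>(%j. the (g j))`F'. (cmod (coord x i))\<^sup>2)"
  by (simp add: sum.reindex[OF inj] sum_distrib_left)
 also have "...<= c\<^sup>2 * (norm x)\<^sup>2" using F' by (intro mult_left_mono sum_coord_le) auto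
 finally show ?thesis by (simp add: power_mult_distrib)
qed

lemma
 assumes g: "pinj g" and f: "!!j. g j ~= None ==> cmod (f j) <= c" and c: "0 <= c"
 shows coord_wop: "coord (wop g f x) j = (case g j of None => 0 | Some i => f j * coord x i)"
  and norm_wop: "norm (wop g f) <= c"
proof -
 have co: "coord (Abs_ell2 (wfun g f x)) j = wfun g f x j" for x j
  by (subst Abs_ell2_inverse) (auto intro!: square_summableI sum_wfun_le[OF assms])
 have nb: "norm (Abs_ell2 (wfun g f x)) <= c * norm x" for x
  using c by (intro norm_ell2_le) (simp_all add: co sum_wfun_le[OF assms])
 have "bounded_linear (%x. Abs_ell2 (wfun g f x))"
 proof (rule bounded_linear_intro)
  show "Abs_ell2 (wfun g f (x + y)) = Abs_ell2 (wfun g f x) + Abs_ell2 (wfun g f y)" for x y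
   by (rule coord_ext) (simp add: co wfun_def distrib_left split: option.split)
  show "Abs_ell2 (wfun g f (r *\<^sub>R x)) = r *\<^sub>R Abs_ell2 (wfun g f x)" for r x
   by (rule coord_ext) (simp add: co wfun_def split: option.split)
  show "norm (Abs_ell2 (wfun g f x)) <= norm x * c" for x using nb[of x] by (simp add: mult.commute)
 qed
 hence ap: "wop g f x = Abs_ell2 (wfun g f x)" for x by (simp add: wop_def bounded_linear_Blinfun_apply)
 show "coord (wop g f x) j = (case g j of None => 0 | Some i => f j * coord x i)"
  by (simp add: ap co wfun_def)
 show "norm (wop g f) <= c" by (rule norm_blinfun_bound[OF c]) (simp add: ap nb)
qed

section \<open>The monomials on Fock space\<close>

definition wt :: "(nat => 'd::ab_group_add) => nat list => 'd"
 where "wt om w = sum_list (map om w)"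

lemma wt_simps [simp]: "wt om [] = 0" "wt om (i#w) = om i + wt om w" "wt om (v@w) = wt om v + wt om w"
 by (simp_all add: wt_def)

text \<open>The operator \<open>S\<^sub>\<mu> C S\<^sub>\<nu>\<^sup>*\<close>, which sends the basis vector at \<open>(ga, nu @ ka)\<close> to \<open>C (ga + wt om ka)\<close> times
 the one at \<open>(ga, mu @ ka)\<close>.\<close>

definition Tsrc :: "nat list => nat list => 'd\<times>nat list => ('d\<times>nat list) option"
 where "Tsrc mu nu p = (if take (length mu) (snd p) = mu then Some (fst p, nu@drop (length mu) (snd p)) else None)"

definition Top :: "(nat => 'd::ab_group_add) => nat list => nat list => ('d => complex) =>
  ('d\<times>nat list) bop"
 where "Top om mu nu C = wop (Tsrc mu nu) (%p. C (fst p + wt om (drop (length mu) (snd p))))"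

lemma pinj_Tsrc: "pinj (Tsrc mu nu)"
proof -
 have "i = j" if "Tsrc mu nu i = Some k" "Tsrc mu nu j = Some k" for i j k :: "'a\<times>nat list"
 proof -
  have t: "take (length mu) (snd i) = mu" "take (length mu) (snd j) = mu"
   using that by (auto simp: Tsrc_def split: if_splits)
  have e: "fst i = fst j" "drop (length mu) (snd i) = drop (length mu) (snd j)"
   using that t by (auto simp: Tsrc_def)
  have "snd i = snd j" using t e(2) by (metis append_take_drop_id)
  thus ?thesis using e(1) by (simp add: prod_eq_iff)
 qed
 thus ?thesis by (auto simp: pinj_def)
qed

definition bfun :: "('d => complex) => bool"
 where "bfun C \<longleftrightarrow> (\<exists>c. \<forall>ga. cmod (C ga) <= c)"

lemma bfunI: "(!!ga. cmod (C ga) <= c) ==> bfun C"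
 by (auto simp: bfun_def)

lemma bfunE: assumes "bfun C" obtains c where "0 <= c" "!!ga. cmod (C ga) <= c"
proof -
 obtain c where "!!ga. cmod (C ga) <= c" using assms by (auto simp: bfun_def)
 moreover have "0 <= c" using calculation[of undefined] norm_ge_zero order_trans by blast
 ultimately show ?thesis using that by blast
qed

lemma bfun_intros:
 "bfun (%_. z)" "bfun C ==> bfun D ==> bfun (%ga. C ga + D ga)" "bfun C ==> bfun D ==> bfun (%ga. C ga * D ga)"
 "bfun C ==> bfun (%ga. cnj (C ga))" "bfun C ==> bfun (%ga. C (h ga))" "bfun (indicator V)"
proof -
 show "bfun (%_. z)" by (rule bfunI[of _ "cmod z"]) simp
 show "bfun (%ga. cnj (C ga))" if "bfun C" using that by (simp add: bfun_def)
 show "bfun (%ga. C (h ga))" if "bfun C" using that by (auto simp: bfun_def)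
 show "bfun (indicator V)" by (rule bfunI[of _ 1]) (simp add: indicator_def)
 assume "bfun C" "bfun D"
 then obtain c d where cd: "0 <= c" "!!ga. cmod (C ga) <= c" "0 <= d" "!!ga. cmod (D ga) <= d"
  by (elim bfunE) blast
 show "bfun (%ga. C ga + D ga)" by (rule bfunI[of _ "c + d"]) (meson cd norm_add_rule_thm)
 show "bfun (%ga. C ga * D ga)" by (rule bfunI[of _ "c * d"]) (simp add: norm_mult mult_mono cd)
qed

lemma coord_Top:
 assumes "bfun C"
 shows "coord (Top om mu nu C x) (ga, v) =
  (if take (length mu) v = mu then C (ga + wt om (drop (length mu) v)) * coord x (ga, nu@drop (length mu) v) else 0)"
proof -
 obtain c where c: "0 <= c" "!!ga. cmod (C ga) <= c" using assms by (elim bfunE) blast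
 show ?thesis unfolding Top_def
  by (subst coord_wop[OF pinj_Tsrc, where c = c]) (auto simp: Tsrc_def c)
qed

lemma coord_Top_append: "bfun C ==> coord (Top om mu nu C x) (ga, mu@ka) = C (ga + wt om ka) * coord x (ga, nu@ka)"
 by (simp add: coord_Top)

lemma coord_Top_out: "bfun C ==> (\<nexists>ka. v = mu@ka) ==> coord (Top om mu nu C x) (ga, v) = 0"
 by (simp add: coord_Top) (metis append_take_drop_id)

lemma Top_ext:
 fixes T S :: "('d\<times>nat list) bop"
 assumes "!!ga ka x. coord (T x) (ga, mu@ka) = coord (S x) (ga, mu@ka)"
  and "!!ga v x. (\<nexists>ka. v = mu@ka) ==> coord (T x) (ga, v) = coord (S x) (ga, v)"
 shows "T = S"
proof (rule blinfun_eqI, rule coord_ext)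
 fix x p
 show "coord (T x) p = coord (S x) p"
  using assms(1)[of x "fst p"] assms(2)[of "snd p" x "fst p"] by (cases "\<exists>ka. snd p = mu@ka") (auto, metis prod.collapse)
qed

lemma norm_Top:
 assumes "0 <= c" "!!ga. cmod (C ga) <= c"
 shows "norm (Top om mu nu C) <= c"
 unfolding Top_def by (rule norm_wop[OF pinj_Tsrc]) (auto simp: assms)

lemma Top_add: "bfun C ==> bfun D ==> Top om mu nu (%ga. C ga + D ga) = Top om mu nu C + Top om mu nu D"
 by (rule Top_ext[where mu = mu]) (simp_all add: blinfun.add_left coord_Top_append coord_Top_out bfun_intros algebra_simps)

lemma Top_zero: "Top om mu nu (%_. 0) = 0"
 by (rule Top_ext[where mu = mu]) (simp_all add: coord_Top_append coord_Top_out bfun_intros)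

lemma Top_scale: "bfun C ==> Top om mu nu (%ga. c * C ga) = cscaleL c o\<^sub>L Top om mu nu C"
 by (rule Top_ext[where mu = mu]) (simp_all add: coord_Top_append coord_Top_out bfun_intros)

lemma clin_Top: "bfun C ==> clin (Top om mu nu C)"
 unfolding clin_def by (intro allI coord_ext) (auto simp: coord_Top)

text \<open>The two sums live on the words with prefix \<open>mu\<close> and on those with prefix
  \<open>nu\<close>; after stripping these prefixes they agree term by term.\<close>

lemma adj_Top:
 assumes C: "bfun C"
 shows "adj (Top om mu nu C) (Top om nu mu (%ga. cnj (C ga)))"
 unfolding adj_def
proof (intro allI)
 fix x y :: "('a\<times>nat list) ell2"
 let ?f = "%al p. (fst p, al@snd p)::'a\<times>nat list"
 have inj: "inj_on (?f al) UNIV" for al by (auto simp: inj_on_def)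
 have out: "coord (Top om mu nu C x) p = 0" if "p\<notin>range (?f mu)" "bfun C" for mu nu C x p
 proof -
  have "\<nexists>ka. snd p = mu@ka"
  proof
   assume "\<exists>ka. snd p = mu@ka"
   then obtain ka where "snd p = mu@ka" by blast
   hence "p = ?f mu (fst p, ka)" by (simp add: prod_eq_iff)
   with that show False by blast
  qed
  thus ?thesis using coord_Top_out[OF that(2), of "snd p" mu om nu x "fst p"] by simp
 qed
 have "inner (Top om mu nu C x) y = (\<Sum>\<^sub>\<infinity>p\<in>range (?f mu). inner (coord (Top om mu nu C x) p) (coord y p))"
  unfolding inner_ell2_coord by (rule infsum_cong_neutral) (auto simp: out C)
 also have "...= (\<Sum>\<^sub>\<infinity>p. inner (coord (Top om mu nu C x) (?f mu p)) (coord y (?f mu p)))"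
  by (subst infsum_reindex[OF inj]) (simp add: o_def)
 also have "...= (\<Sum>\<^sub>\<infinity>p. inner (coord x (?f nu p)) (coord (Top om nu mu (%ga. cnj (C ga)) y) (?f nu p)))"
  by (rule infsum_cong) (simp add: coord_Top_append C bfun_intros inner_complex_def algebra_simps)
 also have "...= (\<Sum>\<^sub>\<infinity>p\<in>range (?f nu). inner (coord x p) (coord (Top om nu mu (%ga. cnj (C ga)) y) p))"
  by (subst infsum_reindex[OF inj]) (simp add: o_def)
 also have "...= inner x (Top om nu mu (%ga. cnj (C ga)) y)"
  unfolding inner_ell2_coord by (rule infsum_cong_neutral) (auto simp: out C bfun_intros)
 finally show "inner (Top om mu nu C x) y = inner x (Top om nu mu (%ga. cnj (C ga)) y)" .
qed

lemma Top_carrier: "bfun C ==> Top om mu nu C:carrier bop"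
 using adj_Top clin_Top unfolding bop_carrier by blast

lemma star_Top: "bfun C ==> star bop (Top om mu nu C) = Top om nu mu (%ga. cnj (C ga))"
 by (rule star_bop[OF adj_Top])

text \<open>Two inner words are comparable in one of two ways, or incomparable, whence three product
  rules. Here a remainder \<open>ka\<close> is left over on the right, and moving the coefficient
  \<open>C\<close> past the corresponding isometry shifts its argument by
  \<open>wt om ka\<close>.\<close>

lemma Top_mult1:
 assumes "bfun C" "bfun D"
 shows "Top om mu nu C o\<^sub>L Top om (nu@ka) nu' D = Top om (mu@ka) nu' (%ga. C (ga + wt om ka) * D ga)"
proof (rule Top_ext[where mu = "mu"])
 note b = bfun_intros(3)[OF bfun_intros(5)[OF assms(1), of "%ga. ga + wt om ka"] assms(2)]
 fix ga eta and x :: "('a\<times>nat list) ell2"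
 show "coord ((Top om mu nu C o\<^sub>L Top om (nu@ka) nu' D) x) (ga, mu@eta) = coord (Top om (mu@ka) nu' (%ga. C (ga + wt om ka) * D ga) x) (ga, mu@eta)"
 proof (cases "\<exists>\<rho>. eta = ka@\<rho>")
  case True
  then obtain \<rho> where l: "eta = ka@\<rho>" by blast
  show ?thesis unfolding l
   using coord_Top_append[OF b, of om "mu@ka" nu' x ga \<rho>] coord_Top_append[OF assms(2), of om "nu@ka" nu' x ga \<rho>]
   by (simp add: coord_Top_append assms) (simp add: ac_simps)
 next
  case False
  thus ?thesis
   using coord_Top_out[OF b, of "mu@eta" "mu@ka" om nu' x ga] coord_Top_out[OF assms(2), of "nu@eta" "nu@ka" om nu' x ga]
   by (simp add: coord_Top_append assms)
 qed
next
 note b = bfun_intros(3)[OF bfun_intros(5)[OF assms(1), of "%ga. ga + wt om ka"] assms(2)]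
 fix ga v and x :: "('a\<times>nat list) ell2" assume v: "\<nexists>eta. v = mu@eta"
 hence "\<nexists>eta. v = (mu@ka)@eta" by auto
 thus "coord ((Top om mu nu C o\<^sub>L Top om (nu@ka) nu' D) x) (ga, v) = coord (Top om (mu@ka) nu' (%ga. C (ga + wt om ka) * D ga) x) (ga, v)"
  using v by (simp add: coord_Top_out assms b)
qed

lemma Top_mult2:
 assumes "bfun C" "bfun D"
 shows "Top om mu (nu@ka) C o\<^sub>L Top om nu nu' D = Top om mu (nu'@ka) (%ga. C ga * D (ga + wt om ka))"
proof (rule Top_ext[where mu = "mu"])
 note b = bfun_intros(3)[OF assms(1) bfun_intros(5)[OF assms(2), of "%ga. ga + wt om ka"]]
 fix ga v eta and x :: "('a\<times>nat list) ell2"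
 show "coord ((Top om mu (nu@ka) C o\<^sub>L Top om nu nu' D) x) (ga, mu@eta) = coord (Top om mu (nu'@ka) (%ga. C ga * D (ga + wt om ka)) x) (ga, mu@eta)"
  using assms by (simp add: coord_Top_append b) (simp add: ac_simps)
 assume "\<nexists>eta. v = mu@eta"
 thus "coord ((Top om mu (nu@ka) C o\<^sub>L Top om nu nu' D) x) (ga, v) = coord (Top om mu (nu'@ka) (%ga. C ga * D (ga + wt om ka)) x) (ga, v)"
  by (simp add: coord_Top_out assms b)
qed

lemma Top_mult0:
 assumes "bfun C" "bfun D" "\<nexists>ka. mu' = nu@ka" "\<nexists>ka. nu = mu'@ka"
 shows "Top om mu nu C o\<^sub>L Top om mu' nu' D = 0"
proof (rule Top_ext[where mu = mu])
 fix ga eta and x :: "('a\<times>nat list) ell2"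
 have "\<nexists>ka. nu@eta = mu'@ka"
  using assms(3,4) by (metis append_eq_append_conv2)
 thus "coord ((Top om mu nu C o\<^sub>L Top om mu' nu' D) x) (ga, mu@eta) = coord (blinfun_apply 0 x) (ga, mu@eta)"
  by (simp add: coord_Top_append coord_Top_out assms)
qed (simp add: coord_Top_out assms)

lemma Top_entry:
 assumes "bfun C"
 shows "coord (Top om mu nu C (ket (ga, w))) (ga', v) =
  (if ga' = ga \<and> (\<exists>ka. v = mu@ka \<and> w = nu@ka) then C (ga + wt om (drop (length mu) v)) else 0)"
proof (cases "\<exists>ka. v = mu@ka")
 case True
 then obtain ka where v: "v = mu@ka" by blast
 show ?thesis unfolding v by (auto simp: coord_Top_append assms coord_ket)
next
 case False
 thus ?thesis using assms by (auto simp: coord_Top_out)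
qed

section \<open>The gauge action and its homogeneous components\<close>

text \<open>Conjugation by this unitary multiplies each generating isometry by
  \<open>cis th\<close>, hence a monomial by \<open>cis\<close> of \<open>th\<close> times the
  difference of the two word lengths.\<close>

definition gauge :: "real => ('d\<times>nat list) bop"
 where "gauge th = wop Some (%p. cis (real (length (snd p)) * th))"

lemma coord_gauge: "coord (gauge th x) (ga, w) = cis (real (length w) * th) * coord x (ga, w)"
 unfolding gauge_def by (subst coord_wop[where c = 1]) (auto simp: pinj_def)

lemma norm_gauge: "norm (gauge th) <= 1"
 unfolding gauge_def by (rule norm_wop) (auto simp: pinj_def)

definition of_degree :: "int => (('d\<times>nat list) bop) => bool"
 where "of_degree k T \<longleftrightarrow> (\<forall>th. gauge th o\<^sub>L T o\<^sub>L gauge (- th) = cscaleL (cis (of_int k * th)) o\<^sub>L T)"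

lemma of_degree_Top:
 assumes "bfun C"
 shows "of_degree (int (length mu) - int (length nu)) (Top om mu nu C)"
 unfolding of_degree_def
proof (intro allI, rule Top_ext[where mu = mu])
 fix th ga ka and x :: "('a\<times>nat list) ell2"
 have "cis (real (length (mu@ka)) * th) * (C (ga + wt om ka) * (cis (real (length (nu@ka)) * - th) * z)) =
  cis (of_int (int (length mu) - int (length nu)) * th) * (C (ga + wt om ka) * z)" for z
 proof -
  have "cis (real (length (mu@ka)) * th) * cis (real (length (nu@ka)) * - th) = cis (of_int (int (length mu) - int (length nu)) * th)"
   by (simp add: cis_mult algebra_simps)
  thus ?thesis by (metis mult.assoc mult.left_commute)
 qed
 thus "coord ((gauge th o\<^sub>L Top om mu nu C o\<^sub>L gauge (- th)) x) (ga, mu@ka) =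
  coord ((cscaleL (cis (of_int (int (length mu) - int (length nu)) * th)) o\<^sub>L Top om mu nu C) x) (ga, mu@ka)"
  by (simp add: coord_gauge coord_Top_append assms)
qed (simp add: coord_gauge coord_Top_out assms)

lemma of_degree_add: "of_degree k T ==> of_degree k S ==> of_degree k (T + S)"
 unfolding of_degree_def
proof (intro allI)
 fix th assume T: "\<forall>th. gauge th o\<^sub>L T o\<^sub>L gauge (- th) = cscaleL (cis (real_of_int k * th)) o\<^sub>L T"
  and S: "\<forall>th. gauge th o\<^sub>L S o\<^sub>L gauge (- th) = cscaleL (cis (real_of_int k * th)) o\<^sub>L S"
 have "gauge th o\<^sub>L (T + S) o\<^sub>L gauge (- th) = (gauge th o\<^sub>L T o\<^sub>L gauge (- th)) + (gauge th o\<^sub>L S o\<^sub>L gauge (- th))"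
  by (rule blinfun_eqI) (simp add: blinfun.add_left blinfun.add_right)
 also have "...= cscaleL (cis (real_of_int k * th)) o\<^sub>L (T + S)"
  unfolding T[rule_format] S[rule_format] by (intro blinfun_eqI coord_ext) (simp add: blinfun.add_left algebra_simps)
 finally show "gauge th o\<^sub>L (T + S) o\<^sub>L gauge (- th) = cscaleL (cis (real_of_int k * th)) o\<^sub>L (T + S)" .
qed

lemma of_degree_zero: "of_degree k 0"
 by (simp add: of_degree_def)

text \<open>A geometric sum over powers of an M-th root of unity; the bound on \<open>l\<close>
  keeps M from dividing it, so the root is not 1.\<close>

lemma roots_sum_zero:
 fixes M :: nat and l :: int
 assumes "0 < M" "l ~= 0" "\<bar>l\<bar> < int M"
 shows "(\<Sum>j<M. cis (of_int l * (2 * pi * real j/real M))) = 0"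
proof -
 define w where "w = cis (2 * pi * of_int l/real M)"
 have pw: "cis (of_int l * (2 * pi * real j/real M)) = w^j" for j
 proof -
  have "w^j = cis (real j * (2 * pi * of_int l/real M))" by (simp only: w_def Complex.DeMoivre)
  also have "real j * (2 * pi * of_int l/real M) = of_int l * (2 * pi * real j/real M)" by simp
  finally show ?thesis by simp
 qed
 have wM: "w^M = 1"
 proof -
  have "w^M = cis (2 * pi * of_int l)" unfolding w_def Complex.DeMoivre using assms(1) by simp
  thus ?thesis by (simp add: cis_multiple_2pi)
 qed
 have w1: "w ~= 1"
 proof
  assume "w = 1"
  hence "cos (2 * pi * of_int l/real M) = 1" by (simp add: w_def complex_eq_iff)
  then obtain n :: int where "2 * pi * of_int l/real M = of_int n * 2 * pi" using cos_one_2pi_int by blast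
  hence "of_int l = of_int n * real M" using assms(1) by (simp add: field_simps)
  hence "real_of_int l = real_of_int (n * int M)" by simp
  hence "l = n * int M" by (simp only: of_int_eq_iff)
  hence "int M dvd l" by simp
  thus False using assms(2,3) dvd_imp_le_int[of l "int M"] by simp
 qed
 show ?thesis unfolding pw using w1 wM by (simp add: geometric_sum)
qed

text \<open>Averaging the rotated operators against a character of the circle projects to one degree
  without increasing the norm. For finitely many degrees the average over finitely many roots of
  unity is already exact.\<close>

lemma norm_degree_component:
 fixes T :: "int => ('d\<times>nat list) bop"
 assumes T: "!!k. k:{-d..d} ==> of_degree k (T k)" and k: "k:{-d..d}"
 shows "norm (T k) <= norm (\<Sum>l\<in>{-d..d}. T l)"
proof -
 \<comment> \<open>Two degrees in \<open>{-d..d}\<close> differ by at most 2d, so 2d + 1 roots of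
   unity tell them apart.\<close>
 define M where "M = nat (2 * d + 1)"
 have M: "0 < M" "int M = 2 * d + 1" using k by (auto simp: M_def)
 define t where "t j = 2 * pi * real j/real M" for j :: nat
 define S where "S = (\<Sum>l\<in>{-d..d}. T l)"
 define Q where "Q j = cscaleL (cis (of_int (- k) * t j)) o\<^sub>L (gauge (t j) o\<^sub>L S o\<^sub>L gauge (- t j))" for j
 have nQ: "norm (Q j) <= norm S" for j
 proof -
  have "norm (Q j) = norm (gauge (t j) o\<^sub>L S o\<^sub>L gauge (- t j))" by (simp add: Q_def norm_cscaleL)
  also have "...<= norm (gauge (t j) o\<^sub>L S) * norm (gauge (- t j)::('d\<times>nat list) bop)" by (rule norm_blinfun_compose)
  also have "...<= (norm (gauge (t j)::('d\<times>nat list) bop) * norm S) * 1" by (intro mult_mono norm_blinfun_compose norm_gauge) auto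
  also have "...<= (1 * norm S) * 1" by (intro mult_right_mono norm_gauge) auto
  finally show ?thesis by simp
 qed
 have Qeq: "Q j = (\<Sum>l\<in>{-d..d}. cscaleL (cis (of_int (l - k) * t j)) o\<^sub>L T l)" for j
 proof -
  have "gauge (t j) o\<^sub>L S o\<^sub>L gauge (- t j) = (\<Sum>l\<in>{-d..d}. gauge (t j) o\<^sub>L T l o\<^sub>L gauge (- t j))"
   unfolding S_def by (intro blinfun_eqI) (simp add: blinfun.sum_left blinfun.sum_right)
  also have "...= (\<Sum>l\<in>{-d..d}. cscaleL (cis (of_int l * t j)) o\<^sub>L T l)"
   using T by (intro sum.cong) (auto simp: of_degree_def)
  finally have "Q j = cscaleL (cis (of_int (- k) * t j)) o\<^sub>L (\<Sum>l\<in>{-d..d}. cscaleL (cis (of_int l * t j)) o\<^sub>L T l)" by (simp add: Q_def)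
  also have "...= (\<Sum>l\<in>{-d..d}. cscaleL (cis (of_int (l - k) * t j)) o\<^sub>L T l)"
  proof (intro blinfun_eqI coord_ext)
   fix x i
   have eq: "cis (of_int (- k) * t j) * (cis (of_int l * t j) * z) = cis (of_int (l - k) * t j) * z" for l z
   proof -
    have "cis (of_int (- k) * t j) * cis (of_int l * t j) = cis (of_int (l - k) * t j)"
     by (simp add: cis_mult algebra_simps)
    thus ?thesis by (metis mult.assoc)
   qed
   have "coord ((cscaleL (cis (of_int (- k) * t j)) o\<^sub>L (\<Sum>l\<in>{-d..d}. cscaleL (cis (of_int l * t j)) o\<^sub>L T l)) x) i =
     (\<Sum>l\<in>{-d..d}. cis (of_int (- k) * t j) * (cis (of_int l * t j) * coord (T l x) i))"
    by (simp add: blinfun.sum_left sum_distrib_left)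
   also have "...= coord ((\<Sum>l\<in>{-d..d}. cscaleL (cis (of_int (l - k) * t j)) o\<^sub>L T l) x) i"
    unfolding eq by (simp add: blinfun.sum_left)
   finally show "coord ((cscaleL (cis (of_int (- k) * t j)) o\<^sub>L (\<Sum>l\<in>{-d..d}. cscaleL (cis (of_int l * t j)) o\<^sub>L T l)) x) i =
    coord ((\<Sum>l\<in>{-d..d}. cscaleL (cis (of_int (l - k) * t j)) o\<^sub>L T l) x) i" .
  qed
  finally show ?thesis .
 qed
 have "(\<Sum>j<M. Q j) = real M *\<^sub>R T k"
 proof (intro blinfun_eqI coord_ext)
  fix x i
  have "coord ((\<Sum>j<M. Q j) x) i = (\<Sum>j<M. \<Sum>l\<in>{-d..d}. cis (of_int (l - k) * t j) * coord (T l x) i)"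
   by (simp add: Qeq blinfun.sum_left)
  also have "...= (\<Sum>l\<in>{-d..d}. (\<Sum>j<M. cis (of_int (l - k) * t j)) * coord (T l x) i)"
   by (subst sum.swap) (simp add: sum_distrib_right)
  also have "...= (\<Sum>l\<in>{-d..d}. if l = k then of_nat M * coord (T k x) i else 0)"
  proof (rule sum.cong)
   fix l assume "l:{-d..d}"
   hence "\<bar>l - k\<bar> < int M" using k M(2) by auto
   thus "(\<Sum>j<M. cis (of_int (l - k) * t j)) * coord (T l x) i = (if l = k then of_nat M * coord (T k x) i else 0)"
    using roots_sum_zero[OF M(1), of "l - k"] by (auto simp: t_def)
  qed simp
  also have "...= of_nat M * coord (T k x) i" using k by simp
  finally show "coord ((\<Sum>j<M. Q j) x) i = coord ((real M *\<^sub>R T k) x) i" by (simp add: blinfun.scaleR_left)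
 qed
 hence "real M * norm (T k) = norm (\<Sum>j<M. Q j)" by simp
 also have "...<= (\<Sum>j<M. norm S)" by (rule sum_norm_le) (rule nQ)
 also have "...= real M * norm S" by simp
 finally show ?thesis using M(1) by (simp add: S_def)
qed

section \<open>Norm estimates for sums in an abstract system of monomials\<close>

lemma star_bop_zero: "star bop 0 = 0"
 by (rule star_bop) (rule adj_intros)

text \<open>The pair \<open>(a, C)\<close> belongs to \<open>Mon mu nu\<close> if \<open>a\<close> plays the role of \<open>S\<^sub>\<mu> C S\<^sub>\<nu>\<^sup>*\<close> in \<open>A\<close>.\<close>

locale monomials = cstar_algebra A for A :: "'a normed_star_alg" (structure) +
 fixes om :: "nat => 'd::ab_group_add"
  and Mon :: "nat list => nat list => ('a\<times>('d => complex)) set"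
 assumes Mon_closed: "(a, C):Mon mu nu ==> a:carrier A \<and> bfun C"
  and Mon_bound: "[|(a, C):Mon mu nu;0 <= c;!!ga. cmod (C ga) <= c|] ==> nrm A a <= c"
  and Mon_zero: "(\<zero>, %_. 0):Mon mu nu"
  and Mon_add: "[|(a, C):Mon mu nu;(b, D):Mon mu nu|] ==> (a\<oplus>b, %ga. C ga + D ga):Mon mu nu"
  and Mon_star: "(a, C):Mon mu nu ==> (star A a, %ga. cnj (C ga)):Mon nu mu"
  and Mon_mult1: "[|(a, C):Mon mu nu;(b, D):Mon (nu@ka) nu'|] ==>
   (a\<otimes>b, %ga. C (ga + wt om ka) * D ga):Mon (mu@ka) nu'"
  and Mon_mult2: "[|(a, C):Mon mu (nu@ka);(b, D):Mon nu nu'|] ==>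
   (a\<otimes>b, %ga. C ga * D (ga + wt om ka)):Mon mu (nu'@ka)"
  and Mon_mult0: "[|(a, C):Mon mu nu;(b, D):Mon mu' nu';\<nexists>ka. mu' = nu@ka;\<nexists>ka. nu = mu'@ka|] ==> a\<otimes>b = \<zero>"
begin

text \<open>Pairs an element of \<open>A\<close> with the operator given by the same sum of
  monomials. It is a relation because the sum is not determined by its value; whether either half
  determines the other is what the norm estimates decide.\<close>

inductive_set Lin :: "(nat list\<times>nat list) set => ('a\<times>(('d\<times>nat list) bop)) set"
 for F where
 zero: "(\<zero>, 0):Lin F"
| step: "[|(x, T):Lin F;(mu, nu):F;(a, C):Mon mu nu|] ==> (a\<oplus>x, Top om mu nu C + T):Lin F"

lemma Lin_closed: "(x, T):Lin F ==> x:carrier A \<and> T:carrier bop"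
proof (induction rule: Lin.induct)
 case zero
 thus ?case using abelian_group.axioms(1)[OF abelian_group_bop] by (auto simp: bop_carrier clin_intros intro: adj_intros)
next
 case (step x T mu nu a C)
 thus ?case using Mon_closed[OF step(3)] Top_carrier[of C om mu nu]
  by (auto simp: bop_carrier intro!: clin_intros intro: adj_intros)
qed

lemma Lin_mono: "F \<subseteq> F' ==> (x, T):Lin F ==> (x, T):Lin F'"
 by (rotate_tac, induction rule: Lin.induct) (auto intro: Lin.intros)

lemma Lin_finite: "(x, T):Lin F ==> \<exists>F'. finite F' \<and> F' \<subseteq> F \<and> (x, T):Lin F'"
proof (induction rule: Lin.induct)
 case zero thus ?case by (intro exI[of _ "{}"]) (auto intro: Lin.intros)
next
 case (step x T mu nu a C)
 then obtain F' where "finite F'" "F' \<subseteq> F" "(x, T):Lin F'" by blast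
 with step show ?case
  by (intro exI[of _ "insert (mu, nu) F'"]) (auto intro!: Lin.step intro: Lin_mono[of F'])
qed

lemma Lin_add: "(x, T):Lin F ==> (y, S):Lin F ==> (x\<oplus>y, T + S):Lin F"
proof (induction rule: Lin.induct)
 case zero thus ?case using Lin_closed[OF zero] by simp
next
 case (step x T mu nu a C)
 have eq: "a\<oplus>x\<oplus>y = a\<oplus>(x\<oplus>y)" "Top om mu nu C + T + S = Top om mu nu C + (T + S)"
  using Mon_closed[OF step(3)] Lin_closed[OF step(1)] Lin_closed[OF step(5)] by (auto simp: M.a_assoc semigroup_add_class.add.assoc)
 show ?case unfolding eq by (rule Lin.step[OF step(4)[OF step(5)] step(2,3)])
qed

lemma Lin_mon: "(a, C):Mon mu nu ==> (mu, nu):F ==> (a, Top om mu nu C):Lin F"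
 using Lin.step[OF Lin.zero, of mu nu F a C] Mon_closed[of a C mu nu] by simp

lemma Lin_split:
 assumes "(x, T):Lin (F\<union>F')"
 shows "\<exists>y S y' S'. (y, S):Lin F \<and> (y', S'):Lin F' \<and> x = y\<oplus>y' \<and> T = S + S'"
 using assms
proof (induction rule: Lin.induct)
 case zero thus ?case by (intro exI[of _ \<zero>] exI[of _ 0]) (auto intro: Lin.intros)
next
 case (step x T mu nu a C)
 then obtain y S y' S' where IH: "(y, S):Lin F" "(y', S'):Lin F'" "x = y\<oplus>y'" "T = S + S'" by blast
 note c = Lin_closed[OF IH(1)] Lin_closed[OF IH(2)] Mon_closed[OF step(3)]
 show ?case
 proof (cases "(mu, nu):F")
  case True
  show ?thesis
   by (intro exI[of _ "a\<oplus>y"] exI[of _ "Top om mu nu C + S"] exI[of _ y'] exI[of _ S'])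
    (use IH c Lin.step[OF IH(1) True step(3)] in "auto simp: M.a_assoc semigroup_add_class.add.assoc")
 next
  case False
  hence F': "(mu, nu):F'" using step by blast
  show ?thesis
   by (intro exI[of _ y] exI[of _ S] exI[of _ "a\<oplus>y'"] exI[of _ "Top om mu nu C + S'"])
    (use IH c Lin.step[OF IH(2) F' step(3)] in "auto simp: M.a_lcomm ab_semigroup_add_class.add.left_commute")
 qed
qed

lemma Lin_single: "(x, T):Lin {(mu, nu)} ==> \<exists>C. (x, C):Mon mu nu \<and> T = Top om mu nu C"
proof (induction rule: Lin.induct)
 case zero thus ?case using Mon_zero Top_zero by metis
next
 case (step x T mu' nu' a C)
 then obtain D where D: "(x, D):Mon mu nu" "T = Top om mu nu D" by blast
 have eq: "mu' = mu" "nu' = nu" using step by auto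
 hence "(a\<oplus>x, %ga. C ga + D ga):Mon mu nu" using Mon_add D(1) step(3) by blast
 moreover have "Top om mu nu (%ga. C ga + D ga) = Top om mu nu C + Top om mu nu D"
  using Top_add Mon_closed[OF step(3)] Mon_closed[OF D(1)] by blast
 ultimately show ?case using D(2) eq by metis
qed

text \<open>If \<open>(mu, nu)\<close> has the least total length, the matrix entries of \<open>T\<close> at \<open>(mu, nu)\<close> are exactly the
 values of the coefficient of that monomial, which can therefore be split off.\<close>

lemma Lin_bound: "finite F ==> \<exists>K\<ge>0. \<forall>x T. (x, T):Lin F --> nrm A x <= K * norm T"
proof (induction "card F" arbitrary: F)
 case 0
 have "nrm A x <= 0 * norm T" if "(x, T):Lin {}" for x T using that by (cases rule: Lin.cases) auto
 with 0 show ?case by (intro exI[of _ 0]) simp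
next
 case (Suc n)
 define len where "len p = length (fst p) + length (snd p)" for p :: "nat list\<times>nat list"
 have "F ~= {}" using Suc by auto
 then obtain p where p: "p:F" "!!q. q:F ==> len p <= len q"
  using ex_min_if_finite[of "len`F"] Suc(3) by (auto simp: not_less)
 obtain mu nu where p_eq: "p = (mu, nu)" by (cases p)
 define F' where "F' = F - {p}"
 have F': "finite F'" "n = card F'" "F = {p}\<union>F'" using Suc p(1) by (auto simp: F'_def)
 from Suc(1)[OF F'(2,1)] obtain K where K: "K >= 0" "!!x T. (x, T):Lin F' ==> nrm A x <= K * norm T" by blast
 have entry0: "coord (T (ket (ga, nu))) (ga, mu) = 0" if "(x, T):Lin F'" for x T ga
  using that
 proof (induction rule: Lin.induct)
  case (step x T mu' nu' a C)
  have "\<not> (\<exists>ka. mu = mu'@ka \<and> nu = nu'@ka)"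
  proof
   assume "\<exists>ka. mu = mu'@ka \<and> nu = nu'@ka"
   then obtain ka where k: "mu = mu'@ka" "nu = nu'@ka" by blast
   have "len (mu, nu) <= len (mu', nu')" using p(2)[of "(mu', nu')"] step(2) by (auto simp: F'_def p_eq)
   hence "ka = []" using k by (simp add: len_def)
   thus False using step(2) k by (simp add: F'_def p_eq)
  qed
  thus ?case using step(4) Mon_closed[OF step(3)] by (auto simp: blinfun.add_left Top_entry)
 qed simp
 \<comment> \<open>The monomial that is split off has norm at most that of \<open>T\<close> on both
   sides; the rest \<open>S'\<close> then has norm at most \<open>2 * norm T\<close>, which the
   induction hypothesis multiplies by \<open>K\<close>.\<close>
 have "nrm A x <= (1 + 2 * K) * norm T" if xT: "(x, T):Lin F" for x T
 proof -
  obtain y S y' S' where s: "(y, S):Lin {(mu, nu)}" "(y', S'):Lin F'" "x = y\<oplus>y'" "T = S + S'"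
   using Lin_split[of x T "{p}" F'] xT F'(3) p_eq by auto
  obtain C where C: "(y, C):Mon mu nu" "S = Top om mu nu C" using Lin_single[OF s(1)] by blast
  have bC: "bfun C" using Mon_closed[OF C(1)] by blast
  have Cle: "cmod (C ga) <= norm T" for ga
  proof -
   have "coord (T (ket (ga, nu))) (ga, mu) = C ga"
    using entry0[OF s(2)] by (simp add: s(4) C(2) blinfun.add_left Top_entry bC)
   hence "cmod (C ga) <= norm (T (ket (ga, nu)))" by (metis coord_le)
   also have "...<= norm T" using norm_blinfun[of T "ket (ga, nu)"] by simp
   finally show ?thesis .
  qed
  have ny: "nrm A y <= norm T" by (rule Mon_bound[OF C(1)]) (auto simp: Cle)
  have nS: "norm S <= norm T" unfolding C(2) by (rule norm_Top) (auto simp: Cle)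
  have "norm S' <= norm T + norm S" using norm_triangle_ineq4[of T S] by (simp add: s(4))
  hence "nrm A y' <= K * (2 * norm T)"
   using K(2)[OF s(2)] nS K(1) by (smt (verit) mult_left_mono)
  moreover have "nrm A x <= nrm A y + nrm A y'"
   unfolding s(3) using Lin_closed[OF s(1)] Lin_closed[OF s(2)] by (intro nrm_triangle) auto
  ultimately show ?thesis using ny by (simp add: algebra_simps)
 qed
 thus ?case using K(1) by (intro exI[of _ "1 + 2 * K"]) auto
qed

lemma Lin_star: "(x, T):Lin F ==> (star A x, star bop T):Lin {(nu, mu). (mu, nu):F}"
proof (induction rule: Lin.induct)
 case zero
 show ?case by (simp add: Lin.zero star_bop_zero)
next
 case (step x T mu nu a C)
 note c = Mon_closed[OF step(3)] Lin_closed[OF step(1)]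
 have "star bop (Top om mu nu C + T) = Top om nu mu (%ga. cnj (C ga)) + star bop T"
  using cstar_algebra.star_add[OF cstar_algebra_bop Top_carrier[of C om mu nu], of T] c by (simp add: star_Top)
 moreover have "star A (a\<oplus>x) = star A a\<oplus>star A x" using c by (simp add: star_add)
 ultimately show ?case using Lin.step[OF step(4) _ Mon_star[OF step(3)]] step(2) by auto
qed

text \<open>Only comparable inner words give a condition on \<open>G\<close>, since all other
  products of monomials vanish.\<close>

definition comp_closed :: "(nat list\<times>nat list) set => (nat list\<times>nat list) set => (nat list\<times>nat list) set => bool"
 where "comp_closed F F' G \<longleftrightarrow> (\<forall>mu nu nu' ka. (mu, nu):F --> (nu@ka, nu'):F' --> (mu@ka, nu'):G) \<and>
  (\<forall>mu nu nu' ka. (mu, nu@ka):F --> (nu, nu'):F' --> (mu, nu'@ka):G)"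

lemma Mon_mult_Lin:
 assumes a: "(a, C):Mon mu nu" and b: "(b, D):Mon mu' nu'" and F: "(mu, nu):F" "(mu', nu'):F'" and G: "comp_closed F F' G"
 shows "(a\<otimes>b, Top om mu nu C o\<^sub>L Top om mu' nu' D):Lin G"
proof -
 have bC: "bfun C" "bfun D" using Mon_closed a b by blast+
 consider ka where "mu' = nu@ka" | ka where "nu = mu'@ka" | "\<nexists>ka. mu' = nu@ka" "\<nexists>ka. nu = mu'@ka" by blast
 thus ?thesis
 proof cases
  case 1
  have "(mu@ka, nu'):G" using G F unfolding comp_closed_def 1 by blast
  thus ?thesis unfolding 1 Top_mult1[OF bC] using Lin_mon[OF Mon_mult1[OF a b[unfolded 1]]] by blast
 next
  case 2
  have "(mu, nu'@ka):G" using G F unfolding comp_closed_def 2 by blast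
  thus ?thesis unfolding 2 Top_mult2[OF bC] using Lin_mon[OF Mon_mult2[OF a[unfolded 2] b]] by blast
 next
  case 3
  show ?thesis using Mon_mult0[OF a b 3] Top_mult0[OF bC 3, of om mu nu'] by (simp add: Lin.zero)
 qed
qed

lemma Lin_mult:
 assumes x: "(x, T):Lin F" and y: "(y, S):Lin F'" and G: "comp_closed F F' G"
 shows "(x\<otimes>y, T o\<^sub>L S):Lin G"
 using x
proof (induction rule: Lin.induct)
 case zero
 have "0 o\<^sub>L S = 0" by (rule blinfun_eqI) simp
 thus ?case using Lin_closed[OF y] by (simp add: Lin.zero)
next
 case (step x T mu nu a C)
 have "(a\<otimes>y, Top om mu nu C o\<^sub>L S):Lin G" using y
 proof (induction rule: Lin.induct)
  case zero
  have "Top om mu nu C o\<^sub>L 0 = 0" by (rule blinfun_eqI) simp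
  thus ?case using Mon_closed[OF step(3)] by (simp add: Lin.zero)
 next
  case s: (step y S mu' nu' b D)
  have "a\<otimes>(b\<oplus>y) = a\<otimes>b\<oplus>a\<otimes>y"
   using Mon_closed[OF step(3)] Mon_closed[OF s(3)] Lin_closed[OF s(1)] by (simp add: mult_r_distr)
  moreover have "Top om mu nu C o\<^sub>L (Top om mu' nu' D + S) = (Top om mu nu C o\<^sub>L Top om mu' nu' D) + (Top om mu nu C o\<^sub>L S)"
   by (rule blinfun_eqI) (simp add: blinfun.add_left blinfun.add_right)
  ultimately show ?case using Lin_add[OF Mon_mult_Lin[OF step(3) s(3) step(2) s(2) G] s(4)] by simp
 qed
 moreover have "(a\<oplus>x)\<otimes>y = a\<otimes>y\<oplus>x\<otimes>y"
  using Mon_closed[OF step(3)] Lin_closed[OF y] Lin_closed[OF step(1)] by (simp add: mult_l_distr)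
 moreover have "(Top om mu nu C + T) o\<^sub>L S = (Top om mu nu C o\<^sub>L S) + (T o\<^sub>L S)"
  by (rule blinfun_eqI) (simp add: blinfun.add_left)
 ultimately show ?case using Lin_add[OF _ step(4)] by simp
qed

lemma Lin_square:
 assumes x: "(x, T):Lin F" and G: "comp_closed {(nu, mu). (mu, nu):F} F G"
 shows "(star A x\<otimes>x, star bop T\<otimes>\<^bsub>bop\<^esub>T):Lin G"
 using Lin_mult[OF Lin_star[OF x] x G] by simp

text \<open>If both words of each monomial have the same length, the words of a product are no
  longer than those of its factors. One finite set \<open>G\<close> therefore contains the words of
  all iterated squares, the constant of \<open>Lin_bound\<close> is the same for all of them, and
  \<open>squaring_bound\<close> applies with C = 0.\<close>

lemma Lin_core:
 assumes xT: "(x, T):Lin {(mu, nu). length mu = length nu}"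
 shows "nrm A x <= norm T"
proof -
 obtain F where F: "finite F" "F \<subseteq> {(mu, nu). length mu = length nu}" "(x, T):Lin F"
  using Lin_finite[OF xT] by blast
 define L where "L = (\<Union>(mu, nu)\<in>F. set mu\<union>set nu)"
 define N where "N = Max (insert 0 ((%(mu, nu). length mu)`F))"
 have L: "finite L" using F(1) by (auto simp: L_def)
 define W where "W = {w. set w \<subseteq> L \<and> length w <= N}"
 have W: "finite W" unfolding W_def by (rule finite_lists_length_le[OF L])
 define G where "G = {(mu, nu). length mu = length nu \<and> mu:W \<and> nu:W}"
 have G: "finite G" by (rule finite_subset[of _ "W\<times>W"]) (auto simp: G_def W)
 have "F \<subseteq> G"
 proof
  fix p assume p: "p:F"
  obtain mu nu where e: "p = (mu, nu)" by (cases p)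
  have l: "length mu = length nu" using p F(2) e by auto
  have "length mu <= N" unfolding N_def using F(1) p e by (intro Max_ge) (auto intro!: image_eqI[of _ _ "(mu, nu)"])
  moreover have "set mu\<union>set nu \<subseteq> L" unfolding L_def using p e by (auto intro!: bexI[of _ "(mu, nu)"])
  ultimately show "p:G" using l by (auto simp: G_def W_def e)
 qed
 hence xG: "(x, T):Lin G" using Lin_mono F(3) by blast
 have cc: "comp_closed {(nu, mu). (mu, nu):G} G G"
  unfolding comp_closed_def G_def W_def by auto
 obtain K where K: "K >= 0" "!!x T. (x, T):Lin G ==> nrm A x <= K * norm T" using Lin_bound[OF G] by blast
 have "nrm A x <= nrm bop T"
  by (rule squaring_bound[OF cstar_algebra_axioms cstar_algebra_bop, where P = "%_. Lin G" and C = 0 and D = K])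
   (use Lin_closed Lin_square[OF _ cc] K(2) xG in auto)
 thus ?thesis by simp
qed

definition deg :: "nat list\<times>nat list => int"
 where "deg p = int (length (fst p)) - int (length (snd p))"

text \<open>The degree cancels in x* x, which reduces the claim to \<open>Lin_core\<close> by the
  C*-identity.\<close>

lemma Lin_homogeneous:
 assumes xT: "(x, T):Lin {p. deg p = k}"
 shows "nrm A x <= norm T"
proof -
 note c = Lin_closed[OF xT]
 have "comp_closed {(nu, mu). (mu, nu):{p. deg p = k}} {p. deg p = k} {(mu, nu). length mu = length nu}"
  unfolding comp_closed_def deg_def by auto
 from Lin_core[OF Lin_square[OF xT this]]
 have "nrm A (star A x\<otimes>x) <= nrm bop (star bop T\<otimes>\<^bsub>bop\<^esub>T)" by simp
 hence "(nrm A x)\<^sup>2 <= (norm T)\<^sup>2"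
  using nrm_cstar c cstar_algebra.nrm_cstar[OF cstar_algebra_bop, of T] by simp
 thus ?thesis by (rule power2_le_imp_le) simp
qed

lemma Lin_of_degree: "(x, T):Lin {p. deg p = k} ==> of_degree k T"
proof (induction rule: Lin.induct)
 case zero thus ?case by (rule of_degree_zero)
next
 case (step x T mu nu a C)
 thus ?case using of_degree_Top[of C mu nu om] Mon_closed[OF step(3)] by (auto simp: deg_def intro!: of_degree_add)
qed

lemma Lin_degrees:
 assumes "finite D" "(x, T):Lin {p. deg p:D}"
 shows "\<exists>X U. (\<forall>k\<in>D. (X k, U k):Lin {p. deg p = k}) \<and> nrm A x <= (\<Sum>k\<in>D. nrm A (X k)) \<and> T = (\<Sum>k\<in>D. U k)"
 using assms
proof (induction D arbitrary: x T rule: finite_induct)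
 case empty
 hence "x = \<zero> \<and> T = 0" by (cases rule: Lin.cases) auto
 thus ?case by auto
next
 case (insert k D)
 have "{p. deg p:insert k D} = {p. deg p = k}\<union>{p. deg p:D}" by auto
 then obtain y S y' S' where s: "(y, S):Lin {p. deg p = k}" "(y', S'):Lin {p. deg p:D}" "x = y\<oplus>y'" "T = S + S'"
  using Lin_split insert.prems by metis
 obtain X U where IH: "\<forall>k\<in>D. (X k, U k):Lin {p. deg p = k}" "nrm A y' <= (\<Sum>k\<in>D. nrm A (X k))" "S' = (\<Sum>k\<in>D. U k)"
  using insert.IH[OF s(2)] by blast
 have t: "nrm A x <= nrm A y + nrm A y'"
  unfolding s(3) using Lin_closed[OF s(1)] Lin_closed[OF s(2)] by (intro nrm_triangle) auto
 have cong: "(\<Sum>l\<in>D. nrm A ((X(k := y)) l)) = (\<Sum>l\<in>D. nrm A (X l))" "(\<Sum>l\<in>D. (U(k := S)) l) = (\<Sum>l\<in>D. U l)"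
  using insert.hyps by (auto intro!: sum.cong)
 show ?case
  by (rule exI[of _ "X(k := y)"], rule exI[of _ "U(k := S)"])
   (use insert.hyps s IH t cong in auto)
qed

text \<open>Iterated squaring leaves every finite set of words, but degrees merely double, so after
  j steps they lie between -d 2^j and d 2^j. Each of the at most 2 d 2^j + 1 homogeneous components
  is bounded by the whole operator, and their number is the linearly growing constant.\<close>

theorem Lin_norm:
 assumes xT: "(x, T):Lin F"
 shows "nrm A x <= norm T"
proof -
 obtain F' where F': "finite F'" "(x, T):Lin F'" using Lin_finite[OF xT] by blast
 define d where "d = Max (insert 0 ((%p. \<bar>deg p\<bar>)`F'))"
 have d: "0 <= d" "!!p. p:F' ==> \<bar>deg p\<bar> <= d" using F'(1) by (auto simp: d_def)
 define G where "G j = {p. deg p:{- (d * 2^j)..d * 2^j}}" for j :: nat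
 have bd: "nrm A y <= (2 * real_of_int d * 2^j + 1) * norm S" if yS: "(y, S):Lin (G j)" for y S j
 proof -
  define e where "e = d * 2^j"
  have e: "0 <= e" using d(1) by (simp add: e_def)
  obtain X U where X: "\<forall>k\<in>{-e..e}. (X k, U k):Lin {p. deg p = k}" "nrm A y <= (\<Sum>k\<in>{-e..e}. nrm A (X k))" "S = (\<Sum>k\<in>{-e..e}. U k)"
   using Lin_degrees[of "{-e..e}"] yS unfolding G_def e_def by (metis finite_atLeastAtMost_int)
  have "nrm A (X k) <= norm S" if k: "k:{-e..e}" for k
  proof -
   have "nrm A (X k) <= norm (U k)" using X(1) k by (blast intro: Lin_homogeneous)
   also have "...<= norm S" unfolding X(3) using X(1) by (intro norm_degree_component k) (blast intro: Lin_of_degree)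
   finally show ?thesis .
  qed
  hence "nrm A y <= (\<Sum>k\<in>{-e..e}. norm S)" using X(2) by (meson order_trans sum_mono)
  also have "...= (2 * real_of_int e + 1) * norm S" using e by simp
  finally show ?thesis by (simp add: e_def mult.assoc)
 qed
 have cc: "comp_closed {(nu, mu). (mu, nu):G j} (G j) (G (Suc j))" for j
  unfolding comp_closed_def G_def deg_def by auto
 have x0: "(x, T):Lin (G 0)" by (rule Lin_mono[OF _ F'(2)]) (use d(2) in "fastforce simp: G_def abs_le_iff")
 have "nrm A x <= nrm bop T"
 proof (rule squaring_bound[OF cstar_algebra_axioms cstar_algebra_bop, where P = "%j. Lin (G j)" and C = "2 * real_of_int d" and D = 1])
  fix k a T assume "(a, T):Lin (G k)"
  thus "a:carrier A \<and> T:carrier bop" "(star A a\<otimes>a, star bop T\<otimes>\<^bsub>bop\<^esub>T):Lin (G (Suc k))"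
   "nrm A a <= (2 * real_of_int d * 2^k + 1) * nrm bop T"
   using Lin_closed Lin_square[OF _ cc] bd by auto
 qed (rule x0)
 thus ?thesis by simp
qed

end

section \<open>Integration on locally compact groups\<close>

lemma compact_sum:
 fixes K L :: "'g::topological_ab_group_add set"
 assumes "compact K" "compact L"
 shows "compact {s + t | s t. s:K \<and> t:L}"
proof -
 have "continuous_on (K\<times>L) (%p. fst p + snd p)"
  by (intro continuous_intros)
 hence "compact ((%p. fst p + snd p)`(K\<times>L))"
  using assms by (intro compact_continuous_image compact_Times)
 moreover have "(%p. fst p + snd p)`(K\<times>L) = {s + t | s t. s:K \<and> t:L}" by force
 ultimately show ?thesis by simp
qed

lemma compact_neg: "compact K ==> compact (uminus`K)" for K :: "'g::topological_ab_group_add set"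
 by (intro compact_continuous_image continuous_intros)

lemma bump_function:
 fixes U :: "'g::t2_space set"
 assumes lc: "locally compact (UNIV::'g set)" and U: "open U" "t:U"
 obtains psi :: "'g => real" where "continuous_on UNIV psi" "!!s. 0 <= psi s" "!!s. psi s <= 1" "psi t = 1" "!!s. s\<notin>U ==> psi s = 0"
proof -
 have "Hausdorff_space (euclidean::'g topology)"
  unfolding Hausdorff_space_def disjnt_def open_openin[symmetric] using hausdorff by blast
 moreover have "locally_compact_space (euclidean::'g topology)"
  unfolding locally_compact_space_def
 proof
  fix x :: 'g
  obtain A B where "open A" "compact B" "x:A" "A \<subseteq> B"
   using lc[unfolded locally_def, rule_format, of UNIV x] by auto
  thus "\<exists>U K. openin euclidean U \<and> compactin euclidean K \<and> x:U \<and> U \<subseteq> K" by auto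
 qed
 ultimately have "completely_regular_space (euclidean::'g topology)"
  using locally_compact_regular_imp_completely_regular_space by blast
 moreover have "closedin euclidean (- U) \<and> t:topspace euclidean - (- U)" using U by (simp add: closed_Compl)
 ultimately obtain f :: "'g => real" where f: "continuous_map euclidean (top_of_set {0..1}) f" "f t = 0" "f`(- U) \<subseteq> {1}"
  unfolding completely_regular_space_def by blast
 have c: "continuous_on UNIV f" "!!s. f s:{0..1}" using f(1) by (auto simp: continuous_map_in_subtopology)
 show ?thesis
  by (rule that[of "%s. 1 - f s"]) (use c f in "auto intro!: continuous_intros")
qed

lemma compact_neighbourhood:
 fixes K :: "'g::topological_space set"
 assumes lc: "locally compact (UNIV::'g set)" and K: "compact K"
 obtains V L where "open V" "K \<subseteq> V" "V \<subseteq> L" "compact L"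
proof -
 have "\<forall>t::'g. \<exists>A B. open A \<and> compact B \<and> t:A \<and> A \<subseteq> B"
 proof
  fix t :: 'g
  obtain A B where "open A" "compact B" "t:A" "A \<subseteq> B"
   using lc[unfolded locally_def, rule_format, of UNIV t] by auto
  thus "\<exists>A B. open A \<and> compact B \<and> t:A \<and> A \<subseteq> B" by blast
 qed
 then obtain A B :: "'g => 'g set" where AB: "!!t. open (A t) \<and> compact (B t) \<and> t:A t \<and> A t \<subseteq> B t" by metis
 obtain J where J: "J \<subseteq> K" "finite J" "K \<subseteq> (\<Union>t\<in>J. A t)"
  by (rule compactE_image[OF K, of K A]) (use AB in auto)
 show ?thesis
 proof (rule that[of "\<Union>t\<in>J. A t" "\<Union>t\<in>J. B t"])
  show "open (\<Union>t\<in>J. A t)" using AB by blast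
  show "K \<subseteq> (\<Union>t\<in>J. A t)" by (fact J(3))
  show "(\<Union>t\<in>J. A t) \<subseteq> (\<Union>t\<in>J. B t)" using AB by blast
  show "compact (\<Union>t\<in>J. B t)" using AB J(2) by (intro compact_UN) blast+
 qed
qed

lemma partition_functions:
 fixes K :: "'g::t2_space set"
 assumes lc: "locally compact (UNIV::'g set)" and K: "compact K"
  and U: "!!t. t:K ==> open (U t) \<and> t:U t"
 obtains J and phi :: "'g => 'g => real" where "finite J" "J \<subseteq> K"
  "!!j. j:J ==> continuous_on UNIV (phi j)" "!!j s. j:J ==> 0 <= phi j s"
  "!!j s. j:J ==> s\<notin>U j ==> phi j s = 0"
  "!!s. (\<Sum>j\<in>J. phi j s) <= 1" "!!s. s:K ==> (\<Sum>j\<in>J. phi j s) = 1"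
proof -
 have "\<forall>t\<in>K. \<exists>psi::'g => real. continuous_on UNIV psi \<and> (\<forall>s. 0 <= psi s) \<and> psi t = 1 \<and> (\<forall>s. s\<notin>U t --> psi s = 0)"
 proof
  fix t assume "t:K"
  from U[OF this] have "open (U t)" "t:U t" by auto
  then obtain psi :: "'g => real" where "continuous_on UNIV psi" "!!s. 0 <= psi s" "psi t = 1" "!!s. s\<notin>U t ==> psi s = 0"
   using bump_function[OF lc, of "U t" t] by metis
  thus "\<exists>psi::'g => real. continuous_on UNIV psi \<and> (\<forall>s. 0 <= psi s) \<and> psi t = 1 \<and> (\<forall>s. s\<notin>U t --> psi s = 0)"
   by (intro exI[of _ psi]) simp
 qed
 then obtain psi :: "'g => 'g => real" where psi: "!!t. t:K ==> continuous_on UNIV (psi t) \<and> (\<forall>s. 0 <= psi t s) \<and> psi t t = 1 \<and> (\<forall>s. s\<notin>U t --> psi t s = 0)"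
  by metis
 have op: "open {s. 1/2 < psi t s}" if "t:K" for t
  using psi[OF that] by (intro open_Collect_less) auto
 obtain J where J: "J \<subseteq> K" "finite J" "K \<subseteq> (\<Union>t\<in>J. {s. 1/2 < psi t s})"
  by (rule compactE_image[OF K, of K "%t. {s. 1/2 < psi t s}"]) (use op psi in auto)
 \<comment> \<open>On \<open>K\<close> some bump function exceeds 1/2, so the factor 2 makes
   \<open>\<sigma>\<close> exceed 1 there; dividing by the maximum with 1 is then exact on
   \<open>K\<close> and safe elsewhere.\<close>
 define \<sigma> where "\<sigma> s = (\<Sum>j\<in>J. 2 * psi j s)" for s
 have \<sigma>0: "0 <= \<sigma> s" for s unfolding \<sigma>_def using J psi by (intro sum_nonneg) auto
 have c\<sigma>: "continuous_on UNIV \<sigma>" unfolding \<sigma>_def using J psi by (intro continuous_intros) auto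
 define phi where "phi j s = 2 * psi j s/max 1 (\<sigma> s)" for j s
 have sum: "(\<Sum>j\<in>J. phi j s) = \<sigma> s/max 1 (\<sigma> s)" for s by (simp add: phi_def \<sigma>_def sum_divide_distrib)
 show ?thesis
 proof (rule that[of J phi])
  show "finite J" "J \<subseteq> K" by fact+
  fix j assume j: "j:J"
  hence p: "continuous_on UNIV (psi j) \<and> (\<forall>s. 0 <= psi j s) \<and> (\<forall>s. s\<notin>U j --> psi j s = 0)" using J psi by blast
  show "continuous_on UNIV (phi j)" unfolding phi_def using p c\<sigma>
   by (intro continuous_intros) (auto simp: max_def)
  show "0 <= phi j s" for s unfolding phi_def using p by simp
  show "s\<notin>U j ==> phi j s = 0" for s unfolding phi_def using p by simp
 next
  fix s
  show "(\<Sum>j\<in>J. phi j s) <= 1" unfolding sum using \<sigma>0[of s] by (simp add: divide_simps)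
  assume "s:K"
  then obtain j where j: "j:J" "1/2 < psi j s" using J(3) by blast
  have "2 * psi j s <= \<sigma> s" unfolding \<sigma>_def using J psi j(1) by (intro member_le_sum) auto
  hence "\<sigma> s > 1" using j(2) by simp
  thus "(\<Sum>j\<in>J. phi j s) = 1" unfolding sum by simp
 qed
qed

text \<open>With the functions of \<open>partition_functions\<close> as weights, this compares a
  value with nearby samples. The weights may add up to less than 1 only where the value itself is 0,
  that is, away from the compact set.\<close>

lemma weighted_sum_close:
 fixes v :: "'j => 'b::real_normed_vector"
 assumes p: "!!j. j:J ==> 0 <= p j" "(\<Sum>j\<in>J. p j) <= 1" "x ~= 0 ==> (\<Sum>j\<in>J. p j) = 1" and e: "0 <= e"
  and v: "!!j. j:J ==> p j ~= 0 ==> norm (x - v j) <= e"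
 shows "norm (x - (\<Sum>j\<in>J. p j *\<^sub>R v j)) <= e"
proof -
 have "x = (\<Sum>j\<in>J. p j *\<^sub>R x)" using p(3) by (cases "x = 0") (simp_all add: scaleR_sum_left[symmetric])
 hence "x - (\<Sum>j\<in>J. p j *\<^sub>R v j) = (\<Sum>j\<in>J. p j *\<^sub>R (x - v j))"
  by (simp add: scaleR_diff_right sum_subtractf)
 also have "norm ...<= (\<Sum>j\<in>J. p j * e)"
 proof (rule sum_norm_le)
  fix j assume "j:J"
  thus "norm (p j *\<^sub>R (x - v j)) <= p j * e" using p(1) v by (cases "p j = 0") (auto intro: mult_left_mono)
 qed
 also have "...<= 1 * e" using p(2) e by (simp only: sum_distrib_right[symmetric] mult_right_mono)
 finally show ?thesis by simp
qed

section \<open>Continuous functions with compact support\<close>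

text \<open>\<open>K\<close> is any compact set outside of which the function vanishes, not its
  support, so that several functions can share one.\<close>

definition cc :: "'g::topological_space set => ('g => complex) => bool"
 where "cc K f \<longleftrightarrow> compact K \<and> continuous_on UNIV f \<and> (\<forall>t. t\<notin>K --> f t = 0)"

lemma cc_mono: "cc K f ==> K \<subseteq> L ==> compact L ==> cc L f"
 by (auto simp: cc_def)

lemma cc_intros:
 "compact K ==> cc K (%_. 0)" "cc K f ==> cc K g ==> cc K (%t. f t + g t)" "cc K f ==> cc K (%t. z * f t)"
 "cc K f ==> continuous_on UNIV h ==> cc K (%t. f t * h t)" "cc K f ==> cc K g ==> cc K (%t. f t - g t)"
 "cc K f ==> cc K (%t. cnj (f t))"
 by (simp_all add: cc_def continuous_on_add continuous_on_mult continuous_on_mult_left continuous_on_diff continuous_on_cnj)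

lemma cc_bounded: assumes "cc K f" obtains B where "0 <= B" "!!t. cmod (f t) <= B"
proof -
 have "continuous_on K f" "compact K" using assms continuous_on_subset[of UNIV f K] by (simp_all add: cc_def)
 hence "compact (f`K)" by (rule compact_continuous_image)
 then obtain B where B: "!!t. t:K ==> cmod (f t) <= B"
  using compact_imp_bounded[of "f`K"] unfolding bounded_iff by blast
 have "cmod (f t) <= max B 0" for t using B[of t] assms by (cases "t:K") (auto simp: cc_def)
 thus ?thesis by (intro that[of "max B 0"]) auto
qed

lemma cc_compose:
 assumes f: "cc K f" and h: "continuous_on UNIV h" "continuous_on UNIV k" and inv: "!!t. k (h t) = t"
 shows "cc (k`K) (%t. f (h t))"
 unfolding cc_def
proof (intro conjI allI impI)
 show "compact (k`K)" using f continuous_on_subset[OF h(2) subset_UNIV] by (intro compact_continuous_image) (simp_all add: cc_def)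
 have "continuous_on UNIV f" using f by (simp add: cc_def)
 from continuous_on_compose2[OF this h(1)] show "continuous_on UNIV (%t. f (h t))" by simp
 fix t assume "t\<notin>k`K"
 hence "h t\<notin>K" using inv[of t] by (metis image_eqI)
 thus "f (h t) = 0" using f by (simp add: cc_def)
qed

lemma cc_translate: "cc K f ==> cc ((%t. t - s)`K) (%t. f (t + s))" for s :: "'g::topological_ab_group_add"
 by (rule cc_compose[where h = "%t. t + s"]) (simp_all add: continuous_intros)

lemma cc_reflect: "cc K f ==> cc (uminus`K) (%t. f (- t))" for f :: "'g::topological_ab_group_add => complex"
 by (rule cc_compose[where h = uminus]) (simp_all add: continuous_intros)

lemma uniform_on_compact:
 fixes F :: "'a::topological_space => 'b::topological_space => complex"
 assumes F: "continuous_on UNIV (%p. F (fst p) (snd p))" and L: "compact L" and e: "0 < e"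
 shows "\<exists>U. open U \<and> s0:U \<and> (\<forall>s\<in>U. \<forall>t\<in>L. cmod (F s t - F s0 t) <= e)"
proof -
 have "continuous_on (UNIV\<times>L) (%p. F (fst p) (snd p))" using F by (rule continuous_on_subset) auto
 then obtain U where "s0:U" "open U" "\<forall>s\<in>U\<inter>UNIV. \<forall>t\<in>L. dist (F s t) (F s0 t) <= e"
  by (rule continuous_on_prod_compactE[OF _ L UNIV_I[of s0] e]) (simp only: fst_conv snd_conv)
 thus ?thesis by (auto simp: dist_norm)
qed

lemma uniform_in_parameter:
 fixes F :: "'a::topological_space => 'b::topological_space => complex"
 assumes F: "continuous_on UNIV (%p. F (fst p) (snd p))" and L: "compact L" and e: "0 < e"
  and supp: "!!s t. t\<notin>L ==> F s t = 0"
 obtains U where "open U" "s0:U" "!!s t. s:U ==> cmod (F s t - F s0 t) <= e"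
proof -
 obtain U where U: "open U" "s0:U" "\<forall>s\<in>U. \<forall>t\<in>L. cmod (F s t - F s0 t) <= e"
  using uniform_on_compact[OF F L e, of s0] by blast
 have "cmod (F s t - F s0 t) <= e" if "s:U" for s t
  using U(3) that supp[of t] e by (cases "t:L") auto
 with U that show ?thesis by blast
qed

text \<open>\<open>L\<close> is \<open>K\<close> enlarged by a compact neighbourhood of 0: all small
  translates vanish outside this one set, and a uniform estimate becomes an L^1-estimate with the
  factor \<open>measure mu L\<close>.\<close>

lemma cc_uniformly_continuous:
 fixes f :: "'g::{topological_ab_group_add, t2_space} => complex"
 assumes lc: "locally compact (UNIV::'g set)" and f: "cc K f" 
 shows "\<exists>L. compact L \<and> K \<subseteq> L \<and> (\<forall>e>0. \<exists>U. open U \<and> 0:U \<and> (\<forall>s\<in>U. (\<forall>t. cmod (f (t - s) - f t) <= e) \<and> (\<forall>t. t\<notin>L --> f (t - s) = 0)))"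
proof -
 obtain V C :: "'g set" where V: "open V" "{0} \<subseteq> V" "V \<subseteq> C" "compact C"
  using compact_neighbourhood[OF lc compact_sing[of 0]] by metis
 define L where "L = {s + t | s t. s:K \<and> t:C}"
 have L: "compact L" unfolding L_def using f V by (intro compact_sum) (auto simp: cc_def)
 have KL: "K \<subseteq> L" unfolding L_def using V by force
 have out: "f (t - s) = 0" if "s:V" "t\<notin>L" for s t
 proof (rule ccontr)
  assume "f (t - s) ~= 0"
  hence "t - s:K" using f by (auto simp: cc_def)
  hence "t:L" unfolding L_def using that V by (intro CollectI exI[of _ "t - s"] exI[of _ s]) auto
  thus False using that by simp
 qed
 have "\<exists>U. open U \<and> 0:U \<and> (\<forall>s\<in>U. (\<forall>t. cmod (f (t - s) - f t) <= e) \<and> (\<forall>t. t\<notin>L --> f (t - s) = 0))" if e: "e > 0" for e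
 proof -
  have "continuous_on UNIV f" using f by (simp add: cc_def)
  hence "continuous_on UNIV (%p. f (snd p - fst p))"
   by (rule continuous_on_compose2[of UNIV f UNIV "%p. snd p - fst p"]) (auto intro!: continuous_intros)
  from uniform_on_compact[of "%s t. f (t - s)", OF this L e, of 0]
  obtain U where U: "open U" "0:U" "\<forall>s\<in>U. \<forall>t\<in>L. cmod (f (t - s) - f t) <= e" by auto
  have "cmod (f (t - s) - f t) <= e" if "s:U\<inter>V" for s t
  proof (cases "t:L")
   case True thus ?thesis using U(3) that by auto
  next
   case False
   hence "f (t - s) = 0" "f t = 0" using out that KL f by (auto simp: cc_def)
   thus ?thesis using e by simp
  qed
  thus ?thesis using U V out by (intro exI[of _ "U\<inter>V"]) auto
 qed
 thus ?thesis using L KL by blast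
qed

section \<open>Integration against a Haar measure\<close>

locale haar =
 fixes mu :: "'g::{topological_ab_group_add, t2_space} measure"
 assumes lc: "locally compact (UNIV::'g set)" and haar: "haar_measure mu"
begin

lemma sets_haar [simp, measurable_cong]: "sets mu = sets borel"
 using haar by (simp add: haar_measure_def)

lemma space_haar [simp]: "space mu = UNIV"
 using sets_eq_imp_space_eq[OF sets_haar] by simp

lemma compact_sets: "compact K ==> K:sets mu"
 by (simp add: compact_imp_closed)

lemma compact_finite: "compact K ==> emeasure mu K < \<infinity>"
 using haar[unfolded haar_measure_def, THEN conjunct2, THEN conjunct2, THEN conjunct2, THEN conjunct1] by simp

lemma emeasure_translate: "E:sets borel ==> emeasure mu ((+) t`E) = emeasure mu E"
 using haar[unfolded haar_measure_def, THEN conjunct2, THEN conjunct2, THEN conjunct1] by simp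

lemma borel_measurable_continuous: "continuous_on UNIV f ==> f:borel_measurable mu"
 unfolding measurable_cong_sets[OF sets_haar refl] by (rule borel_measurable_continuous_onI)

lemma integrable_supp:
 fixes f :: "'g => 'b::{banach, second_countable_topology}"
 assumes "continuous_on UNIV f" "compact K" "!!t. t\<notin>K ==> f t = 0"
 shows "integrable mu f"
proof -
 have "compact (f`K)"
  using assms(2) continuous_on_subset[OF assms(1) subset_UNIV] by (intro compact_continuous_image)
 then obtain B where B: "!!t. t:K ==> norm (f t) <= B"
  using compact_imp_bounded[of "f`K"] unfolding bounded_iff by blast
 show ?thesis
 proof (rule integrableI_bounded_set[where A = K and B = B])
  show "f:borel_measurable mu" by (rule borel_measurable_continuous[OF assms(1)])
  show "AE t in mu. t:K --> norm (f t) <= B" "AE t in mu. t\<notin>K --> f t = 0"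
   using B assms(3) by simp_all
  show "K:sets mu" by (rule compact_sets[OF assms(2)])
  show "emeasure mu K < \<infinity>" by (rule compact_finite[OF assms(2)])
 qed
qed

lemma integrable_cc: "cc K f ==> integrable mu f"
 by (rule integrable_supp[of f K]) (auto simp: cc_def)

lemma integral_norm_le:
 fixes f :: "'g => 'b::{banach, second_countable_topology}"
 assumes "compact K" "!!t. norm (f t) <= B" "!!t. t\<notin>K ==> f t = 0"
 shows "(\<integral>t. norm (f t) \<partial>mu) <= B * measure mu K"
proof -
 have i: "integrable mu (%t. B * indicator K t)"
  using compact_finite[OF assms(1)] compact_sets[OF assms(1)]
  by (intro integrable_mult_right integrable_real_indicator) auto
 have "(\<integral>t. norm (f t) \<partial>mu) <= (\<integral>t. B * indicator K t \<partial>mu)"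
  using i assms order_trans[OF norm_ge_zero assms(2)] by (intro integral_mono') (auto simp: indicator_def)
 also have "...= B * measure mu K" by simp
 finally show ?thesis .
qed

lemma integral_bound:
 fixes f :: "'g => 'b::{banach, second_countable_topology}"
 assumes "compact K" "!!t. norm (f t) <= B" "!!t. t\<notin>K ==> f t = 0"
 shows "norm (\<integral>t. f t \<partial>mu) <= B * measure mu K"
 using integral_norm_le[of K f B, OF assms] integral_norm_bound[of mu f] by linarith

lemma integral_translate:
 fixes f :: "'g => 'b::{banach, second_countable_topology}"
 assumes "continuous_on UNIV f"
 shows "(\<integral>t. f (t + s) \<partial>mu) = (\<integral>t. f t \<partial>mu)"
proof -
 have m: "(%t. t + s):measurable mu mu"
  unfolding measurable_cong_sets[OF sets_haar sets_haar]
  by (intro borel_measurable_continuous_onI continuous_intros)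
 have "distr mu mu (%t. t + s) = mu"
 proof (rule measure_eqI)
  fix E assume "E:sets (distr mu mu (%t. t + s))"
  hence E: "E:sets borel" by simp
  have "(%t. t + s) -` E = (+) (- s)`E"
  proof (intro equalityI subsetI)
   fix t assume "t:(%t. t + s) -` E" thus "t:(+) (- s)`E" by (intro image_eqI[of _ _ "t + s"]) auto
  qed auto
  hence "emeasure (distr mu mu (%t. t + s)) E = emeasure mu ((+) (- s)`E)"
   using E m by (simp add: emeasure_distr)
  also have "...= emeasure mu E" using E by (rule emeasure_translate)
  finally show "emeasure (distr mu mu (%t. t + s)) E = emeasure mu E" .
 qed simp
 moreover have "f:borel_measurable mu" by (rule borel_measurable_continuous[OF assms])
 ultimately show ?thesis using integral_distr[OF m, of f] by simp
qed

lemma cc_parameter_integral: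
 fixes F :: "'g => 'g => complex"
 assumes F: "continuous_on UNIV (%p. F (fst p) (snd p))" and L: "compact L" and K: "compact K"
  and suppL: "!!s t. t\<notin>L ==> F s t = 0" and suppK: "!!s t. s\<notin>K ==> F s t = 0"
 shows "cc K (%s. \<integral>t. F s t \<partial>mu)"
 unfolding cc_def
proof (intro conjI K allI impI)
 have ci: "continuous_on UNIV (F s)" for s
  by (rule continuous_on_compose2[OF F, of UNIV "%t. (s, t)", simplified]) (intro continuous_intros)
 have int: "integrable mu (F s)" for s using ci L suppL by (rule integrable_supp)
 show "continuous_on UNIV (%s. \<integral>t. F s t \<partial>mu)"
  unfolding continuous_on_def
 proof (intro ballI, rule tendstoI)
  fix s0 :: 'g and e :: real assume e: "0 < e"
  define d where "d = e/(2 * (measure mu L + 1))"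
  have m: "0 < measure mu L + 1" by (simp add: add_nonneg_pos)
  have d: "0 < d" using e m by (simp add: d_def)
  obtain U where U: "open U" "s0:U" "!!s t. s:U ==> cmod (F s t - F s0 t) <= d"
   using uniform_in_parameter[OF F L d suppL, of s0] by metis
  have "dist (\<integral>t. F s t \<partial>mu) (\<integral>t. F s0 t \<partial>mu) < e" if "s:U" for s
  proof -
   have "dist (\<integral>t. F s t \<partial>mu) (\<integral>t. F s0 t \<partial>mu) = norm (\<integral>t. F s t - F s0 t \<partial>mu)"
    using int by (simp add: dist_norm Bochner_Integration.integral_diff)
   also have "...<= d * measure mu L" by (rule integral_bound[OF L]) (auto simp: U(3)[OF that] suppL)
   also have "...<= d * (measure mu L + 1)" using d by (simp add: mult_left_mono)
   also have "...= e/2" using m by (simp add: d_def divide_simps)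
   finally show ?thesis using e by simp
  qed
  thus "\<forall>\<^sub>F s in at s0 within UNIV. dist (\<integral>t. F s t \<partial>mu) (\<integral>t. F s0 t \<partial>mu) < e"
   using U by (auto simp: eventually_at_topological)
 qed
 show "(\<integral>t. F s t \<partial>mu) = 0" if "s\<notin>K" for s using suppK[OF that] by simp
qed

text \<open>Uniform approximation of \<open>F\<close> by sums of products reduces the interchange of integrals to
 linearity; the product measure, which need not live on the Borel sets of the product, is avoided.\<close>

lemma integral_swap:
 fixes F :: "'g => 'g => complex"
 assumes F: "continuous_on UNIV (%p. F (fst p) (snd p))" and K: "compact K" and L: "compact L"
  and suppK: "!!s t. s\<notin>K ==> F s t = 0" and suppL: "!!s t. t\<notin>L ==> F s t = 0"
 shows "(\<integral>s. (\<integral>t. F s t \<partial>mu) \<partial>mu) = (\<integral>t. (\<integral>s. F s t \<partial>mu) \<partial>mu)"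
proof -
 have F': "continuous_on UNIV (%p. F (snd p) (fst p))"
  by (rule continuous_on_compose2[OF F, of UNIV "%p. (snd p, fst p)", simplified]) (intro continuous_intros)
 have cs: "continuous_on UNIV (F s)" for s
  by (rule continuous_on_compose2[OF F, of UNIV "%t. (s, t)", simplified]) (intro continuous_intros)
 have ct: "continuous_on UNIV (%s. F s t)" for t
  by (rule continuous_on_compose2[OF F, of UNIV "%s. (s, t)", simplified]) (intro continuous_intros)
 \<comment> \<open>The partition is kept inside \<open>V\<close>, hence inside the compact set
   \<open>K1\<close>: the approximating sums of products vanish outside \<open>K1\<close> times
   \<open>L\<close>, and a uniform error \<open>e\<close> integrates to at most
   \<open>e * measure mu K1 * measure mu L\<close>.\<close>
 obtain V K1 where V: "open V" "K \<subseteq> V" "V \<subseteq> K1" "compact K1" using compact_neighbourhood[OF lc K] by auto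
 have suppK1: "s\<notin>K1 ==> F s t = 0" for s t using suppK V by blast
 have ccs: "cc K1 (%s. \<integral>t. F s t \<partial>mu)"
  by (rule cc_parameter_integral[OF F L V(4) suppL suppK1])
 have cct: "cc L (%t. \<integral>s. F s t \<partial>mu)"
  by (rule cc_parameter_integral[OF F' V(4) L suppK1 suppL])
 let ?I = "\<integral>s. (\<integral>t. F s t \<partial>mu) \<partial>mu" and ?J = "\<integral>t. (\<integral>s. F s t \<partial>mu) \<partial>mu"
 have bd: "cmod (?I - ?J) <= 2 * (e * measure mu K1 * measure mu L)" if e: "0 < e" for e
 proof -
  have "\<exists>U. open U \<and> s0:U \<and> (\<forall>s t. s:U --> cmod (F s t - F s0 t) <= e)" for s0
   using uniform_in_parameter[OF F L e suppL, of s0] by metis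
  then obtain U where U: "!!s0. open (U s0) \<and> s0:U s0 \<and> (\<forall>s t. s:U s0 --> cmod (F s t - F s0 t) <= e)" by metis
  obtain J and phi :: "'g => 'g => real" where J: "finite J" "J \<subseteq> K"
   and phi: "!!j. j:J ==> continuous_on UNIV (phi j)" "!!j s. j:J ==> 0 <= phi j s"
    "!!j s. j:J ==> s\<notin>U j\<inter>V ==> phi j s = 0"
    "!!s. (\<Sum>j\<in>J. phi j s) <= 1" "!!s. s:K ==> (\<Sum>j\<in>J. phi j s) = 1"
  proof (rule partition_functions[OF lc K, of "%t. U t\<inter>V"])
   show "open (U t\<inter>V) \<and> t:U t\<inter>V" if "t:K" for t using U[of t] V that by auto
  qed (rule that)
  define G where "G s t = (\<Sum>j\<in>J. complex_of_real (phi j s) * F j t)" for s t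
  have GF: "cmod (F s t - G s t) <= e" for s t
   unfolding G_def scaleR_conv_of_real[symmetric]
  proof (rule weighted_sum_close)
   show "cmod (F s t - F j t) <= e" if "j:J" "phi j s ~= 0" for j using phi(3)[OF that(1), of s] that(2) U[of j] by auto
   show "(\<Sum>j\<in>J. phi j s) = 1" if "F s t ~= 0" using phi(5)[of s] suppK[of s t] that by blast
  qed (use phi e in auto)
  have G0: "G s t = 0" if "s\<notin>K1 \<or> t\<notin>L" for s t
  proof (unfold G_def, intro sum.neutral ballI)
   fix j assume j: "j:J"
   show "complex_of_real (phi j s) * F j t = 0"
   proof (cases "t:L")
    case True
    hence "s\<notin>V" using that V(3) by blast
    thus ?thesis using phi(3)[OF j, of s] by simp
   qed (simp add: suppL)
  qed
  have iphi: "integrable mu (%s. complex_of_real (phi j s))" if "j:J" for j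
   by (rule integrable_supp[OF _ V(4)]) (use phi(1,3)[OF that] V in "auto intro!: continuous_intros")
  have iF: "integrable mu (F j)" for j by (rule integrable_supp[OF cs L suppL])
  have iFt: "integrable mu (%s. F s t)" for t by (rule integrable_supp[OF ct K suppK])
  have iGs: "integrable mu (G s)" for s unfolding G_def using iF by (intro Bochner_Integration.integrable_sum integrable_mult_right) auto
  have iGt: "integrable mu (%s. G s t)" for t unfolding G_def using iphi by (intro Bochner_Integration.integrable_sum integrable_mult_left) auto
  have Gs: "(\<integral>t. G s t \<partial>mu) = (\<Sum>j\<in>J. complex_of_real (phi j s) * (\<integral>t. F j t \<partial>mu))" for s
   unfolding G_def using iF by (subst Bochner_Integration.integral_sum) (auto intro!: integrable_mult_right)
  have Gt: "(\<integral>s. G s t \<partial>mu) = (\<Sum>j\<in>J. (\<integral>s. complex_of_real (phi j s) \<partial>mu) * F j t)" for t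
   unfolding G_def using iphi by (subst Bochner_Integration.integral_sum) (auto intro!: integrable_mult_left)
  have iIG: "integrable mu (%s. \<integral>t. G s t \<partial>mu)" "integrable mu (%t. \<integral>s. G s t \<partial>mu)"
   unfolding Gs Gt using iphi iF by (auto intro!: Bochner_Integration.integrable_sum integrable_mult_left integrable_mult_right)
  have swapG: "(\<integral>s. (\<integral>t. G s t \<partial>mu) \<partial>mu) = (\<integral>t. (\<integral>s. G s t \<partial>mu) \<partial>mu)"
   unfolding Gs Gt using iphi iF
   by (subst (1 2) Bochner_Integration.integral_sum) (auto intro!: integrable_mult_left integrable_mult_right)
  have 1: "cmod (\<integral>t. F s t - G s t \<partial>mu) <= e * measure mu L" for s
   by (rule integral_bound[OF L]) (auto simp: GF suppL G0)
  have 2: "cmod (\<integral>s. F s t - G s t \<partial>mu) <= e * measure mu K1" for t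
   by (rule integral_bound[OF V(4)]) (use V suppK in "auto simp: GF G0")
  have A: "cmod (?I - (\<integral>s. (\<integral>t. G s t \<partial>mu) \<partial>mu)) <= e * measure mu K1 * measure mu L"
  proof -
   have "?I - (\<integral>s. (\<integral>t. G s t \<partial>mu) \<partial>mu) = (\<integral>s. (\<integral>t. F s t - G s t \<partial>mu) \<partial>mu)"
    using integrable_cc[OF ccs] iIG(1) iF iGs by simp
   also have "cmod ...<= (e * measure mu L) * measure mu K1"
   proof (rule integral_bound[OF V(4) 1])
    fix s assume "s\<notin>K1"
    hence "(%t. F s t - G s t) = (%_. 0)" using suppK1 G0 by auto
    thus "(\<integral>t. F s t - G s t \<partial>mu) = 0" by (simp only: integral_zero)
   qed
   finally show ?thesis by (simp add: mult_ac)
  qed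
  have B: "cmod (?J - (\<integral>t. (\<integral>s. G s t \<partial>mu) \<partial>mu)) <= e * measure mu K1 * measure mu L"
  proof -
   have "?J - (\<integral>t. (\<integral>s. G s t \<partial>mu) \<partial>mu) = (\<integral>t. (\<integral>s. F s t - G s t \<partial>mu) \<partial>mu)"
    using integrable_cc[OF cct] iIG(2) iFt iGt by simp
   also have "cmod ...<= (e * measure mu K1) * measure mu L"
   proof (rule integral_bound[OF L 2])
    fix t assume "t\<notin>L"
    hence "(%s. F s t - G s t) = (%_. 0)" using suppL G0 by auto
    thus "(\<integral>s. F s t - G s t \<partial>mu) = 0" by (simp only: integral_zero)
   qed
   finally show ?thesis by simp
  qed
  have "?I - ?J = (?I - (\<integral>s. (\<integral>t. G s t \<partial>mu) \<partial>mu)) - (?J - (\<integral>t. (\<integral>s. G s t \<partial>mu) \<partial>mu))"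
   using swapG by simp
  hence "cmod (?I - ?J) <= cmod (?I - (\<integral>s. (\<integral>t. G s t \<partial>mu) \<partial>mu)) + cmod (?J - (\<integral>t. (\<integral>s. G s t \<partial>mu) \<partial>mu))"
   using norm_triangle_ineq4 by metis
  thus ?thesis using A B by simp
 qed
 have "cmod (?I - ?J) <= 0"
 proof (rule field_le_epsilon)
  fix d :: real assume d: "0 < d"
  \<comment> \<open>The summand 1 keeps \<open>m\<close> positive when one of the measures is
    0.\<close>
  define m where "m = 2 * measure mu K1 * measure mu L + 1"
  have m: "0 < m" by (simp add: m_def add_nonneg_pos)
  have "cmod (?I - ?J) <= 2 * (d/m * measure mu K1 * measure mu L)" by (rule bd) (use d m in simp)
  also have "...= d/m * (m - 1)" by (simp add: m_def)
  also have "...<= d/m * m" using d m by (intro mult_left_mono) auto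
  also have "...= d" using m by simp
  finally show "cmod (?I - ?J) <= 0 + d" by simp
 qed
 thus ?thesis by simp
qed

end

section \<open>Characters, convolution and the Fourier transform\<close>

lemma pairing_simps:
 "pairing t (ga + de) = pairing t ga * pairing t de" "pairing (s + t) ga = pairing s ga * pairing t ga"
 "pairing t 0 = 1" "cmod (pairing t ga) = 1" "pairing 0 ga = 1" "pairing t (- ga) = cnj (pairing t ga)"
 "pairing (- t) ga = cnj (pairing t ga)" "continuous_on UNIV (%t. pairing t ga)"
proof -
 have d: "continuous_on UNIV (dual_apply ga)" "cmod (dual_apply ga t) = 1" "dual_apply ga (s + t) = dual_apply ga s * dual_apply ga t" for ga :: "'a dual" and s t
  using dual_apply[of ga] by auto
 show "continuous_on UNIV (%t. pairing t ga)" using d(1) by (simp add: pairing_def)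
 show "pairing t (ga + de) = pairing t ga * pairing t de" unfolding pairing_def by transfer simp
 show n: "cmod (pairing t ga) = 1" for t using d(2) by (simp add: pairing_def)
 show m: "pairing (s + t) ga = pairing s ga * pairing t ga" for s t using d(3) by (simp add: pairing_def)
 show "pairing t 0 = 1" unfolding pairing_def by transfer simp
 have "pairing 0 ga * pairing 0 ga = pairing 0 ga" using m[of 0 0] by simp
 thus z: "pairing 0 ga = 1" using n[of 0] by auto
 have cnj: "inverse (pairing t ga) = cnj (pairing t ga)" 
  using complex_norm_square[of "pairing t ga"] n[of t] by (intro inverse_unique) simp
 show "pairing t (- ga) = cnj (pairing t ga)" unfolding cnj[symmetric] unfolding pairing_def by transfer simp
 have "pairing (- t) ga * pairing t ga = 1" using m[of "- t" t] z by simp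
 thus "pairing (- t) ga = cnj (pairing t ga)" using cnj by (metis inverse_unique mult.commute)
qed

lemma pairing_cnj: "pairing t ga * cnj (pairing t ga) = 1" "cnj (pairing t ga) * pairing t ga = 1"
 using complex_norm_square[of "pairing t ga"] by (simp_all add: pairing_simps mult.commute)

context haar
begin

text \<open>Inner regularity of the whole space provides a compact set of nonzero measure, and a sum
  of partition functions dominates its indicator.\<close>

lemma nonzero_integral: obtains K f where "cc K f" "(\<integral>t. f t \<partial>mu) ~= 0"
proof -
 have U: "emeasure mu UNIV ~= 0" using haar[unfolded haar_measure_def] by (elim conjE)
 have "emeasure mu UNIV = (SUP K\<in>{K. compact K \<and> K \<subseteq> UNIV}. emeasure mu K)"
  using haar[unfolded haar_measure_def, THEN conjunct2, THEN conjunct2, THEN conjunct2, THEN conjunct2, THEN conjunct2, rule_format, OF open_UNIV] .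
 then obtain K where K: "compact K" "emeasure mu K ~= 0"
  using U by (metis (mono_tags, lifting) SUP_eq_const mem_Collect_eq bot.extremum_unique bot_ennreal SUP_le_iff)
 obtain V L where V: "open V" "K \<subseteq> V" "V \<subseteq> L" "compact L" using compact_neighbourhood[OF lc K(1)] by metis
 obtain J and phi :: "'g => 'g => real" where J: "finite J" "J \<subseteq> K"
  and phi: "!!j. j:J ==> continuous_on UNIV (phi j)" "!!j s. j:J ==> 0 <= phi j s"
   "!!j s. j:J ==> s\<notin>V ==> phi j s = 0"
   "!!s. (\<Sum>j\<in>J. phi j s) <= 1" "!!s. s:K ==> (\<Sum>j\<in>J. phi j s) = 1"
 proof (rule partition_functions[OF lc K(1), of "%_. V"])
  show "open V \<and> t:V" if "t:K" for t using V that by auto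
 qed (rule that)
 define psi where "psi s = (\<Sum>j\<in>J. phi j s)" for s
 have c: "continuous_on UNIV psi" unfolding psi_def using phi(1) by (intro continuous_on_sum) auto
 have 0: "psi s = 0" if "s\<notin>L" for s unfolding psi_def using phi(3) that V by (intro sum.neutral) blast
 have p: "0 <= psi s" for s unfolding psi_def using phi(2) by (intro sum_nonneg) auto
 have i: "integrable mu psi" by (rule integrable_supp[OF c V(4) 0])
 have "measure mu K = (\<integral>s. indicator K s \<partial>mu)" by simp
 also have "...<= (\<integral>s. psi s \<partial>mu)"
  by (rule integral_mono'[OF i]) (use p phi(5) in "simp_all add: indicator_def psi_def")
 finally have "0 < (\<integral>s. psi s \<partial>mu)"
  using K compact_finite[OF K(1)] by (metis emeasure_eq_ennreal_measure ennreal_0 infinity_ennreal_def less_eq_real_def measure_nonneg not_le order.strict_trans2 order_less_irrefl)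
 moreover have "(\<integral>s. complex_of_real (psi s) \<partial>mu) = complex_of_real (\<integral>s. psi s \<partial>mu)" by simp
 ultimately have "(\<integral>s. complex_of_real (psi s) \<partial>mu) ~= 0" by simp
 moreover have "cc L (%s. complex_of_real (psi s))" using c 0 V by (auto simp: cc_def intro: continuous_on_of_real)
 ultimately show ?thesis using that by blast
qed

lemma continuous_pair:
 assumes "continuous_on UNIV (f::'g => complex)" "continuous_on UNIV h"
 shows "continuous_on UNIV (%p. f (h p))"
 using continuous_on_compose2[OF assms] by simp

lemma cc_cont: "cc K f ==> continuous_on UNIV f"
 by (simp add: cc_def)

lemma cc_zero: "cc K f ==> t\<notin>K ==> f t = 0"
 by (simp add: cc_def)

text \<open>The double integral of \<open>phi (s + t) * psi (- t)\<close> is evaluated in two ways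
  by translation invariance; the factor that comes from \<open>phi\<close> is nonzero and
  cancels.\<close>

lemma integral_reflect:
 assumes psi: "cc K psi"
 shows "(\<integral>t. psi (- t) \<partial>mu) = (\<integral>t. psi t \<partial>mu)"
proof -
 obtain L phi where phi: "cc L phi" "(\<integral>t. phi t \<partial>mu) ~= 0" using nonzero_integral by blast
 note cphi = cc_cont[OF phi(1)] and cpsi = cc_cont[OF psi]
 have K: "compact K" "compact L" using phi psi by (auto simp: cc_def)
 have "(\<integral>t. phi t \<partial>mu) * (\<integral>t. psi (- t) \<partial>mu) = (\<integral>t. (\<integral>s. phi (s + t) * psi (- t) \<partial>mu) \<partial>mu)"
  by (simp add: integral_translate[OF cphi])
 also have "...= (\<integral>s. (\<integral>t. phi (s + t) * psi (- t) \<partial>mu) \<partial>mu)"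
 proof (rule integral_swap[where K = "uminus`K" and L = "{s + t | s t. s:L \<and> t:K}"])
  show "continuous_on UNIV (%p. phi (snd p + fst p) * psi (- fst p))"
   by (intro continuous_on_mult continuous_pair[OF cphi] continuous_pair[OF cpsi] continuous_intros)
  show "compact (uminus`K)" "compact {s + t | s t. s:L \<and> t:K}" using K by (simp_all add: compact_neg compact_sum)
  show z: "phi (s + t) * psi (- t) = 0" if "t\<notin>uminus`K" for s t
   using cc_zero[OF psi, of "- t"] that by (metis add.inverse_inverse image_eqI mult_zero_right)
  show "phi (s + t) * psi (- t) = 0" if "s\<notin>{s + t | s t. s:L \<and> t:K}" for s t
  proof (rule ccontr)
   assume "phi (s + t) * psi (- t) ~= 0"
   hence "s + t:L" "- t:K" using cc_zero[OF phi(1)] cc_zero[OF psi] by auto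
   moreover have "s = (s + t) + - t" by simp
   ultimately show False using that by blast
  qed
 qed
 also have "...= (\<integral>s. (\<integral>t. phi t * psi (s - t) \<partial>mu) \<partial>mu)"
 proof (rule Bochner_Integration.integral_cong[OF refl])
  fix s
  have "continuous_on UNIV (%t. phi t * psi (s - t))"
   by (intro continuous_on_mult cphi continuous_pair[OF cpsi] continuous_intros)
  from integral_translate[OF this, of s]
  show "(\<integral>t. phi (s + t) * psi (- t) \<partial>mu) = (\<integral>t. phi t * psi (s - t) \<partial>mu)" by (simp add: add.commute)
 qed
 also have "...= (\<integral>t. (\<integral>s. phi t * psi (s - t) \<partial>mu) \<partial>mu)"
 proof (rule integral_swap[where L = L and K = "{s + t | s t. s:K \<and> t:L}"])
  show "continuous_on UNIV (%p. phi (snd p) * psi (fst p - snd p))"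
   by (intro continuous_on_mult continuous_pair[OF cphi] continuous_pair[OF cpsi] continuous_intros)
  show "phi t * psi (s - t) = 0" if "s\<notin>{s + t | s t. s:K \<and> t:L}" for s t
  proof (rule ccontr)
   assume "phi t * psi (s - t) ~= 0"
   hence "t:L" "s - t:K" using cc_zero[OF phi(1)] cc_zero[OF psi] by auto
   moreover have "s = (s - t) + t" by simp
   ultimately show False using that by blast
  qed
 qed (use K cc_zero[OF phi(1)] in "simp_all add: compact_sum")
 also have "...= (\<integral>t. phi t * (\<integral>s. psi s \<partial>mu) \<partial>mu)"
 proof (rule Bochner_Integration.integral_cong[OF refl])
  fix t
  show "(\<integral>s. phi t * psi (s - t) \<partial>mu) = phi t * (\<integral>s. psi s \<partial>mu)"
   using integral_translate[OF cpsi, of "- t"] by simp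
 qed
 also have "...= (\<integral>t. phi t \<partial>mu) * (\<integral>s. psi s \<partial>mu)" by simp
 finally show ?thesis using phi(2) by simp
qed

definition conv :: "('g => complex) => ('g => complex) => 'g => complex"
 where "conv c d t = (\<integral>s. c s * d (t - s) \<partial>mu)"

text \<open>The Fourier transform with the pairing itself in place of its conjugate:
  \<open>t\<close> will be represented by multiplication with the pairing, and \<open>hat c\<close>
  is the integral of these multipliers against \<open>c\<close>.\<close>

definition hat :: "('g => complex) => 'g dual => complex"
 where "hat c ga = (\<integral>t. c t * pairing t ga \<partial>mu)"

lemma integrable_conv:
 assumes c: "cc K c" and d: "cc L d"
 shows "integrable mu (%s. c s * d (t - s))"
proof (rule integrable_cc)
 have "continuous_on UNIV (%s. t - s)" by (intro continuous_intros)
 thus "cc K (%s. c s * d (t - s))" by (intro cc_intros(4) c continuous_pair[OF cc_cont[OF d]])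
qed

lemma cc_conv:
 assumes c: "cc K c" and d: "cc L d"
 shows "cc {s + t | s t. s:K \<and> t:L} (conv c d)"
proof -
 have K: "compact K" "compact L" using c d by (auto simp: cc_def)
 have "cc {s + t | s t. s:K \<and> t:L} (%t. \<integral>s. c s * d (t - s) \<partial>mu)"
 proof (rule cc_parameter_integral[where L = K])
  show "continuous_on UNIV (%p. c (snd p) * d (fst p - snd p))"
   by (intro continuous_on_mult continuous_pair[OF cc_cont[OF c]] continuous_pair[OF cc_cont[OF d]] continuous_intros)
  show "c s * d (t - s) = 0" if "t\<notin>{s + t | s t. s:K \<and> t:L}" for s t
  proof (rule ccontr)
   assume "c s * d (t - s) ~= 0"
   hence "s:K" "t - s:L" using cc_zero[OF c] cc_zero[OF d] by auto
   moreover have "t = s + (t - s)" by simp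
   ultimately show False using that by blast
  qed
 qed (use K cc_zero[OF c] in "simp_all add: compact_sum")
 thus ?thesis by (simp add: conv_def[abs_def])
qed

lemma conv_commute:
 assumes c: "cc K c" and d: "cc L d"
 shows "conv c d = conv d c"
proof
 fix t
 have ct: "continuous_on UNIV (%s. c (t + s) * d (- s))"
  by (intro continuous_on_mult continuous_pair[OF cc_cont[OF c]] continuous_pair[OF cc_cont[OF d]] continuous_intros)
 have cd: "continuous_on UNIV (%s. c s * d (t - s))"
  by (intro continuous_on_mult cc_cont[OF c] continuous_pair[OF cc_cont[OF d]] continuous_intros)
 have "cc (uminus`L) (%s. d (- s) * c (t + s))"
  by (intro cc_intros(4)[OF cc_reflect[OF d]] continuous_pair[OF cc_cont[OF c]] continuous_intros)
 from integral_reflect[OF this]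
 have "conv d c t = (\<integral>s. c (t + s) * d (- s) \<partial>mu)" by (simp add: conv_def mult.commute)
 also have "...= conv c d t" using integral_translate[OF cd, of t] by (simp add: conv_def add.commute)
 finally show "conv c d t = conv d c t" by simp
qed

lemma integrable_hat: "cc K c ==> integrable mu (%t. c t * pairing t ga)"
 by (rule integrable_cc[of K]) (intro cc_intros(4) pairing_simps)

lemma hat_bound: "cc K c ==> cmod (hat c ga) <= (\<integral>t. cmod (c t) \<partial>mu)"
 unfolding hat_def using integral_norm_bound[of mu "%t. c t * pairing t ga"] by (simp add: norm_mult pairing_simps)

lemma bfun_hat: "cc K c ==> bfun (hat c)"
 by (rule bfunI[OF hat_bound])

lemma hat_conv:
 assumes c: "cc K c" and d: "cc L d"
 shows "hat (conv c d) ga = hat c ga * hat d ga"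
proof -
 have K: "compact K" "compact L" using c d by (auto simp: cc_def)
 note cp = pairing_simps(8)[of ga]
 have "hat (conv c d) ga = (\<integral>t. (\<integral>s. c s * d (t - s) * pairing t ga \<partial>mu) \<partial>mu)"
  by (simp add: hat_def conv_def)
 also have "...= (\<integral>s. (\<integral>t. c s * d (t - s) * pairing t ga \<partial>mu) \<partial>mu)"
 proof (rule integral_swap[where L = K and K = "{s + t | s t. s:K \<and> t:L}"])
  show "continuous_on UNIV (%p. c (snd p) * d (fst p - snd p) * pairing (fst p) ga)"
   by (intro continuous_on_mult continuous_pair[OF cc_cont[OF c]] continuous_pair[OF cc_cont[OF d]] continuous_pair[OF cp] continuous_intros)
  show "c s * d (t - s) * pairing t ga = 0" if "t\<notin>{s + t | s t. s:K \<and> t:L}" for s t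
  proof (rule ccontr)
   assume "c s * d (t - s) * pairing t ga ~= 0"
   hence "s:K" "t - s:L" using cc_zero[OF c] cc_zero[OF d] by auto
   moreover have "t = s + (t - s)" by simp
   ultimately show False using that by blast
  qed
 qed (use K cc_zero[OF c] in "simp_all add: compact_sum")
 also have "...= (\<integral>s. (c s * pairing s ga) * hat d ga \<partial>mu)"
 proof (rule Bochner_Integration.integral_cong[OF refl])
  fix s
  have "continuous_on UNIV (%t. d (t - s) * pairing t ga)"
   by (intro continuous_on_mult continuous_pair[OF cc_cont[OF d]] cp continuous_intros)
  from integral_translate[OF this, of s]
  have "(\<integral>t. d (t - s) * pairing t ga \<partial>mu) = (\<integral>t. (d t * pairing t ga) * pairing s ga \<partial>mu)"
   by (simp add: pairing_simps mult.assoc)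
  also have "...= hat d ga * pairing s ga" unfolding hat_def by (rule integral_mult_left_zero)
  finally show "(\<integral>t. c s * d (t - s) * pairing t ga \<partial>mu) = (c s * pairing s ga) * hat d ga"
   by (simp add: mult.assoc mult.commute[of "pairing s ga"])
 qed
 also have "...= hat c ga * hat d ga" by (simp add: hat_def)
 finally show ?thesis .
qed

lemma hat_mult_pairing: "hat (%t. c t * pairing t de) ga = hat c (ga + de)"
 by (simp add: hat_def pairing_simps mult_ac)

lemma hat_star:
 assumes c: "cc K c"
 shows "hat (%t. cnj (c (- t))) ga = cnj (hat c ga)"
proof -
 have "cc K (%t. cnj (c t) * pairing (- t) ga)"
  by (intro cc_intros(4,6) c continuous_pair[OF pairing_simps(8)] continuous_intros)
 from integral_reflect[OF this]
 have "hat (%t. cnj (c (- t))) ga = (\<integral>t. cnj (c t * pairing t ga) \<partial>mu)" by (simp add: hat_def pairing_simps)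
 also have "...= cnj (hat c ga)" unfolding hat_def by (rule Bochner_Integration.integral_cnj)
 finally show ?thesis .
qed

lemma hat_add: "cc K c ==> cc L d ==> hat (%t. c t + d t) ga = hat c ga + hat d ga"
 unfolding hat_def using integrable_hat[of K c ga] integrable_hat[of L d ga] by (simp add: distrib_right)

lemma hat_scale: "hat (%t. z * c t) ga = z * hat c ga"
 unfolding hat_def by (simp add: mult.assoc)

end

section \<open>Characters of commutative C*-algebras\<close>

text \<open>The C*-identity enters as \<open>C_square\<close> alone. \<open>C\<close> may fail to be
  closed or to have a unit, so that the image of the compactly supported functions can be taken as
  it is.\<close>

locale commutative_subset = cstar_algebra A for A :: "'a normed_star_alg" (structure) +
 fixes C :: "'a set"
 assumes C_sub: "C \<subseteq> carrier A" and C_zero: "\<zero>:C"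
  and C_add: "[|x:C;y:C|] ==> x\<oplus>y:C" and C_scale: "x:C ==> k\<odot>x:C"
  and C_mult: "[|x:C;y:C|] ==> x\<otimes>y:C"
  and C_comm: "[|x:C;y:C|] ==> x\<otimes>y = y\<otimes>x"
  and C_square: "x:C ==> nrm A (x\<otimes>x) = (nrm A x)\<^sup>2"
begin

lemma C_carrier [simp]: "x:C ==> x:carrier A" using C_sub by blast

lemma C_diff: "[|x:C;y:C|] ==> x\<ominus>y:C"
 by (simp add: diff_scale C_add C_scale)

text \<open>Power-multiplicative seminorms; the value \<open>0\<close> outside \<open>C\<close> makes the pointwise order antisymmetric.\<close>

definition pms :: "('a => real) => bool"
 where "pms s \<longleftrightarrow> (\<forall>x\<in>C. 0 <= s x) \<and> (\<forall>x\<in>C. \<forall>y\<in>C. s (x\<oplus>y) <= s x + s y) \<and>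
  (\<forall>x\<in>C. \<forall>k. s (k\<odot>x) = cmod k * s x) \<and> (\<forall>x\<in>C. \<forall>y\<in>C. s (x\<otimes>y) <= s x * s y) \<and>
  (\<forall>x\<in>C. s (x\<otimes>x) = (s x)\<^sup>2) \<and> (\<forall>x. x\<notin>C --> s x = 0)"

lemma pmsD:
 assumes "pms s"
 shows "x:C ==> 0 <= s x" "x:C ==> y:C ==> s (x\<oplus>y) <= s x + s y" "x:C ==> s (k\<odot>x) = cmod k * s x"
  "x:C ==> y:C ==> s (x\<otimes>y) <= s x * s y" "x:C ==> s (x\<otimes>x) = (s x)\<^sup>2" "x\<notin>C ==> s x = 0"
 using assms unfolding pms_def by auto

text \<open>The product of \<open>x\<close> with the n-th power of \<open>a\<close>, formed one
  factor at a time because there is no unit to serve as the zeroth power.\<close>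

definition rp :: "'a => nat => 'a => 'a"
 where "rp a n x = ((%y. y\<otimes>a)^^n) x"

lemma rp_simps [simp]: "rp a 0 x = x" "rp a (Suc n) x = rp a n x\<otimes>a"
 by (simp_all add: rp_def)

lemma rp_mult_a: "rp a n (x\<otimes>a) = rp a (Suc n) x"
 by (induction n) simp_all

lemma rp_closed: "a:C ==> x:C ==> rp a n x:C"
 by (induction n) (auto intro: C_mult)

lemma rp_add: "a:C ==> x:C ==> y:C ==> rp a n (x\<oplus>y) = rp a n x\<oplus>rp a n y"
 by (induction n) (simp_all add: mult_l_distr rp_closed)

lemma rp_scale: "a:C ==> x:C ==> rp a n (k\<odot>x) = k\<odot>rp a n x"
 by (induction n) (simp_all add: smult_mult_left rp_closed)

lemma mult_rp: "a:C ==> x:C ==> y:C ==> x\<otimes>rp a n y = rp a n (x\<otimes>y)"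
proof (induction n)
 case (Suc n)
 have "x\<otimes>rp a (Suc n) y = (x\<otimes>rp a n y)\<otimes>a" using Suc.prems by (simp add: mult_assoc rp_closed)
 thus ?case using Suc by simp
qed simp

lemma rp_mult_rp: "a:C ==> x:C ==> y:C ==> rp a n x\<otimes>rp a m y = rp a (n + m) (x\<otimes>y)"
proof (induction n)
 case 0 thus ?case by (simp add: mult_rp)
next
 case (Suc n)
 have "rp a (Suc n) x\<otimes>rp a m y = rp a n x\<otimes>(a\<otimes>rp a m y)" using Suc.prems by (simp add: mult_assoc rp_closed)
 also have "a\<otimes>rp a m y = rp a m y\<otimes>a" using Suc.prems by (intro C_comm rp_closed) auto
 also have "rp a n x\<otimes>(rp a m y\<otimes>a) = (rp a n x\<otimes>rp a m y)\<otimes>a" using Suc.prems by (simp add: mult_assoc rp_closed)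
 finally show ?case using Suc by simp
qed

text \<open>If \<open>s\<close> is thought of as a supremum of |xi| over characters xi and s a = 1,
  this limit keeps only the characters with |xi a| = 1, the peak set of \<open>a\<close>.\<close>

definition peak :: "('a => real) => 'a => 'a => real"
 where "peak s a x = (if x:C then lim (%n. s (rp a n x)) else 0)"

context
 fixes s a assumes s: "pms s" and a: "a:C" and sa: "s a = 1"
begin

lemma peak_decseq: assumes x: "x:C" shows "decseq (%n. s (rp a n x))"
proof (rule decseq_SucI)
 fix n
 show "s (rp a (Suc n) x) <= s (rp a n x)"
  using pmsD(4)[OF s rp_closed[OF a x, of n] a] sa by simp
qed

lemma peak_tendsto: assumes x: "x:C" shows "(%n. s (rp a n x)) \<longlonglongrightarrow> peak s a x"
proof -
 have "\<exists>L. (%n. s (rp a n x)) \<longlonglongrightarrow> L"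
  using decseq_convergent[OF peak_decseq[OF x], of 0] pmsD(1)[OF s rp_closed[OF a x]] by metis
 thus ?thesis using x by (simp add: peak_def convergent_def convergent_LIMSEQ_iff[symmetric])
qed

lemma peak_le: "x:C ==> peak s a x <= s x"
 using decseq_ge[OF peak_decseq peak_tendsto, of x 0] by simp

text \<open>Products are compared along the subsequence of even exponents, because (x a^n)(y a^n) is
  x y a^(2n).\<close>

lemma peak_pms: "pms (peak s a)"
 unfolding pms_def
proof (intro conjI ballI allI impI)
 fix x assume x: "x:C"
 show "0 <= peak s a x"
  by (rule LIMSEQ_le_const[OF peak_tendsto[OF x]]) (use pmsD(1)[OF s rp_closed[OF a x]] in auto)
 show "peak s a (k\<odot>x) = cmod k * peak s a x" for k
 proof (rule LIMSEQ_unique)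
  show "(%n. s (rp a n (k\<odot>x))) \<longlonglongrightarrow> peak s a (k\<odot>x)" by (rule peak_tendsto[OF C_scale[OF x]])
  have "(%n. s (rp a n (k\<odot>x))) = (%n. cmod k * s (rp a n x))"
   using pmsD(3)[OF s rp_closed[OF a x]] by (simp add: rp_scale[OF a x])
  thus "(%n. s (rp a n (k\<odot>x))) \<longlonglongrightarrow> cmod k * peak s a x"
   using tendsto_mult_left[OF peak_tendsto[OF x]] by simp
 qed
 have dbl: "(%n. s (rp a (n + n) y)) \<longlonglongrightarrow> peak s a y" if "y:C" for y
 proof -
  have "strict_mono (%n::nat. n + n)" by (simp add: strict_mono_def)
  from LIMSEQ_subseq_LIMSEQ[OF peak_tendsto[OF that] this] show ?thesis by (simp add: o_def)
 qed
 show "peak s a (x\<otimes>x) = (peak s a x)\<^sup>2"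
 proof (rule LIMSEQ_unique[OF dbl[OF C_mult[OF x x]]])
  have "s (rp a (n + n) (x\<otimes>x)) = (s (rp a n x))\<^sup>2" for n
   using pmsD(5)[OF s rp_closed[OF a x, of n]] by (simp add: rp_mult_rp[OF a x x])
  thus "(%n. s (rp a (n + n) (x\<otimes>x))) \<longlonglongrightarrow> (peak s a x)\<^sup>2"
   using tendsto_power[OF peak_tendsto[OF x], of 2] by simp
 qed
 fix y assume y: "y:C"
 show "peak s a (x\<oplus>y) <= peak s a x + peak s a y"
 proof (rule LIMSEQ_le[OF peak_tendsto[OF C_add[OF x y]] tendsto_add[OF peak_tendsto[OF x] peak_tendsto[OF y]]])
  show "\<exists>N. \<forall>n\<ge>N. s (rp a n (x\<oplus>y)) <= s (rp a n x) + s (rp a n y)"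
   using pmsD(2)[OF s rp_closed[OF a x] rp_closed[OF a y]] by (simp add: rp_add[OF a x y])
 qed
 show "peak s a (x\<otimes>y) <= peak s a x * peak s a y"
 proof (rule LIMSEQ_le[OF dbl[OF C_mult[OF x y]] tendsto_mult[OF peak_tendsto[OF x] peak_tendsto[OF y]]])
  show "\<exists>N. \<forall>n\<ge>N. s (rp a (n + n) (x\<otimes>y)) <= s (rp a n x) * s (rp a n y)"
   using pmsD(4)[OF s rp_closed[OF a x] rp_closed[OF a y]] by (simp add: rp_mult_rp[OF a x y, symmetric])
 qed
next
 fix x assume "x\<notin>C" thus "peak s a x = 0" by (simp add: peak_def)
qed

lemma peak_absorb: assumes x: "x:C" shows "peak s a (x\<otimes>a) = peak s a x"
proof (rule LIMSEQ_unique[OF peak_tendsto[OF C_mult[OF x a]]])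
 show "(%n. s (rp a n (x\<otimes>a))) \<longlonglongrightarrow> peak s a x"
  unfolding rp_mult_a by (rule LIMSEQ_Suc[OF peak_tendsto[OF x]])
qed

lemma pms_power_one: "s (rp a n a) = 1"
proof -
 \<comment> \<open>\<open>f k\<close> is 2^k - 1 and \<open>rp a n a\<close> is the power of
   \<open>a\<close> with exponent n + 1, so these are the iterated squares of \<open>a\<close>;
   monotonicity in \<open>n\<close> covers the exponents in between.\<close>
 define f :: "nat => nat" where "f k = ((%m. 2 * m + 1)^^k) 0" for k
 have f: "f 0 = 0" "f (Suc k) = 2 * f k + 1" for k by (simp_all add: f_def)
 have fk: "s (rp a (f k) a) = 1" for k
 proof (induction k)
  case 0 thus ?case by (simp add: f sa)
 next
  case (Suc k)
  have "rp a (f (Suc k)) a = rp a (f k) a\<otimes>rp a (f k) a"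
   using rp_mult_rp[OF a a a, of "f k" "f k"] by (simp add: rp_mult_a f mult_2)
  thus ?case using pmsD(5)[OF s rp_closed[OF a a, of "f k"]] Suc by simp
 qed
 have ge: "k <= f k" for k by (induction k) (auto simp: f)
 have "1 <= s (rp a n a)" using decseqD[OF peak_decseq[OF a] ge[of n]] fk by simp
 moreover have "s (rp a n a) <= 1" using decseqD[OF peak_decseq[OF a], of 0 n] sa by simp
 ultimately show ?thesis by simp
qed

end

text \<open>A minimal power-multiplicative seminorm \<open>s\<close> with \<open>s c = 1\<close> is multiplicative, because it equals its own
 limit \<open>peak s a\<close> for every \<open>a\<close> with \<open>s a = 1\<close>.\<close>

lemma exists_multiplicative:
 assumes c: "c:C" "nrm A c = 1"
 shows "\<exists>s. pms s \<and> (\<forall>x\<in>C. s x <= nrm A x) \<and> s c = 1 \<and> (\<forall>x\<in>C. \<forall>y\<in>C. s (x\<otimes>y) = s x * s y)"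
proof -
 define F where "F = {s. pms s \<and> (\<forall>x\<in>C. s x <= nrm A x) \<and> s c = 1}"
 \<comment> \<open>The order is reversed, so that Zorn's lemma returns a minimal seminorm; the
   condition \<open>s c = 1\<close> in \<open>F\<close> keeps it from being 0.\<close>
 define P :: "('a => real) => ('a => real) => bool" where "P s s' \<longleftrightarrow> (\<forall>x. s' x <= s x)" for s s'
 have "\<exists>m\<in>F. \<forall>s\<in>F. P m s --> s = m"
 proof (rule predicate_Zorn)
  show "partial_order_on F (relation_of P F)"
   unfolding partial_order_on_def preorder_on_def refl_on_def trans_def antisym_def relation_of_def P_def
   by (auto intro: order_trans) (rule ext, simp add: order_antisym)
  fix Ch assume Ch: "Ch:Chains (relation_of P F)"
  hence ChF: "Ch \<subseteq> F" by (rule Chains_relation_of)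
  have total: "(\<forall>x. s x <= s' x) \<or> (\<forall>x. s' x <= s x)" if "s:Ch" "s':Ch" for s s'
   using Ch that unfolding Chains_def relation_of_def P_def by blast
  show "\<exists>u\<in>F. \<forall>s\<in>Ch. P s u"
  proof (cases "Ch = {}")
   case True
   have "(%x. if x:C then nrm A x else 0):F"
    unfolding F_def pms_def using c
    by (auto simp: C_add C_scale C_mult nrm_nonneg nrm_triangle nrm_smult nrm_mult C_square)
   thus ?thesis using True by blast
  next
   case False
   define u where "u x = (INF s\<in>Ch. s x)" for x
   have pm: "pms s" if "s:Ch" for s using that ChF by (auto simp: F_def)
   have bdd: "bdd_below ((%s. s x)`Ch)" for x
   proof (rule bdd_belowI2)
    show "0 <= s x" if "s:Ch" for s using pmsD(1,6)[OF pm[OF that], of x] by (cases "x:C") auto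
   qed
   have ule: "u x <= s x" if "s:Ch" for x s unfolding u_def by (rule cINF_lower[OF bdd that])
   \<comment> \<open>The filter of small members of the chain. The pointwise infimum is the limit
     along it, so every clause of \<open>pms\<close> passes to the infimum by a limit rule.\<close>
   define \<F> where "\<F> = (INF s\<in>Ch. principal {s'\<in>Ch. \<forall>x. s' x <= s x})"
   have ev: "eventually Q \<F> \<longleftrightarrow> (\<exists>s\<in>Ch. \<forall>s'\<in>Ch. (\<forall>x. s' x <= s x) --> Q s')" for Q
    unfolding \<F>_def
   proof (subst eventually_INF_base[OF False])
    fix s s' assume "s:Ch" "s':Ch"
    with total[OF this] show "\<exists>t\<in>Ch. principal {s''\<in>Ch. \<forall>x. s'' x <= t x} <=
      inf (principal {s''\<in>Ch. \<forall>x. s'' x <= s x}) (principal {s''\<in>Ch. \<forall>x. s'' x <= s' x})"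
     by (auto intro: order_trans)
   qed (auto simp: eventually_principal)
   have evI: "eventually Q \<F>" if "!!s. s:Ch ==> Q s" for Q using False that by (auto simp: ev)
   have nt: "\<F> ~= bot" using ev[of "%_. False"] by (metis eventually_bot order_refl)
   have lim: "((%s. s x) \<longlongrightarrow> u x) \<F>" for x
   proof (rule order_tendstoI)
    fix r assume "u x < r"
    then obtain s where "s:Ch" "s x < r" using cINF_less_iff[OF False bdd, of x r] by (auto simp: u_def)
    thus "\<forall>\<^sub>F s in \<F>. s x < r" unfolding ev by (meson le_less_trans)
   next
    show "\<forall>\<^sub>F s in \<F>. r < s x" if "r < u x" for r using ule that by (intro evI) (meson less_le_trans)
   qed
   have eq: "u x = r" if "!!s. s:Ch ==> s x = f s" "(f \<longlongrightarrow> r) \<F>" for f x r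
    using tendsto_unique[OF nt lim[of x]] tendsto_cong[OF evI[of "%s. s x = f s"]] that by blast
   have "pms u"
    unfolding pms_def
   proof (intro conjI ballI allI impI)
    fix x assume x: "x:C"
    show "0 <= u x" by (rule tendsto_lowerbound[OF lim evI nt]) (rule pmsD(1)[OF pm x])
    show "u (k\<odot>x) = cmod k * u x" for k
     by (rule eq, erule pmsD(3)[OF pm], rule x, intro tendsto_mult_left lim)
    show "u (x\<otimes>x) = (u x)\<^sup>2" by (rule eq, erule pmsD(5)[OF pm], rule x, intro tendsto_power lim)
    fix y assume y: "y:C"
    show "u (x\<oplus>y) <= u x + u y"
     by (rule tendsto_le[OF nt tendsto_add[OF lim lim] lim evI]) (rule pmsD(2)[OF pm x y])
    show "u (x\<otimes>y) <= u x * u y"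
     by (rule tendsto_le[OF nt tendsto_mult[OF lim lim] lim evI]) (rule pmsD(4)[OF pm x y])
   next
    show "u x = 0" if "x\<notin>C" for x by (rule eq, erule pmsD(6)[OF pm], rule that, rule tendsto_const)
   qed
   moreover have "\<forall>x\<in>C. u x <= nrm A x" using ule False ChF unfolding F_def by (blast intro: order_trans)
   moreover have "u c = 1" using ChF by (intro eq[OF _ tendsto_const]) (auto simp: F_def)
   ultimately have "u:F" by (simp add: F_def)
   thus ?thesis using ule unfolding P_def by blast
  qed
 qed
 then obtain s where sF: "s:F" and min: "!!s'. s':F ==> P s s' ==> s' = s" by blast
 have s: "pms s" "!!x. x:C ==> s x <= nrm A x" "s c = 1" using sF by (auto simp: F_def)
 have pk: "peak s a = s" if a: "a:C" "s a = 1" "peak s a c = 1" for a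
 proof (rule min)
  have le: "peak s a x <= s x" if "x:C" for x using peak_le[OF s(1) a(1,2) that] .
  have "\<forall>x\<in>C. peak s a x <= nrm A x" using le s(2) order_trans by blast
  thus "peak s a:F" using peak_pms[OF s(1) a(1,2)] a(3) by (simp add: F_def)
  show "P s (peak s a)" unfolding P_def
  proof
   fix x show "peak s a x <= s x" using le pmsD(6)[OF s(1), of x] by (cases "x:C") (auto simp: peak_def)
  qed
 qed
 have "(%n. s (rp c n c)) \<longlonglongrightarrow> 1" using pms_power_one[OF s(1) c(1) s(3)] by simp
 hence pcc: "peak s c c = 1" using peak_tendsto[OF s(1) c(1) s(3) c(1)] LIMSEQ_unique by blast
 have sc: "s (x\<otimes>c) = s x" if "x:C" for x
  using peak_absorb[OF s(1) c(1) s(3) that] pk[OF c(1) s(3) pcc] by simp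
 \<comment> \<open>Minimality says something about \<open>peak s a\<close> only if its value at
   \<open>c\<close> is still 1. This follows from \<open>sc\<close>, which removes the factor
   \<open>c\<close> from the product of \<open>c\<close> with a power of \<open>a\<close>.\<close>
 have one: "s (x\<otimes>a) = s x" if x: "x:C" and a: "a:C" "s a = 1" for x a
 proof -
  have "s (rp a (Suc n) c) = 1" for n
  proof -
   have "rp a (Suc n) c = c\<otimes>rp a n a" using mult_rp[OF a(1) c(1) a(1), of n] by (simp add: rp_mult_a)
   also have "...= rp a n a\<otimes>c" by (rule C_comm[OF c(1) rp_closed[OF a(1) a(1)]])
   finally show ?thesis using sc[OF rp_closed[OF a(1) a(1)]] pms_power_one[OF s(1) a] by simp
  qed
  hence "(%n. s (rp a (Suc n) c)) \<longlonglongrightarrow> 1" by simp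
  hence "peak s a c = 1" using LIMSEQ_Suc[OF peak_tendsto[OF s(1) a c(1)]] LIMSEQ_unique by blast
  thus ?thesis using peak_absorb[OF s(1) a x] pk[OF a] by simp
 qed
 have "s (x\<otimes>y) = s x * s y" if x: "x:C" and y: "y:C" for x y
 proof (cases "s y = 0")
  case True
  thus ?thesis using pmsD(4)[OF s(1) x y] pmsD(1)[OF s(1) C_mult[OF x y]] by simp
 next
  case False
  hence pos: "0 < s y" using pmsD(1)[OF s(1) y] by simp
  define a where "a = complex_of_real (1/s y)\<odot>y"
  have a: "a:C" "s a = 1" using y pos pmsD(3)[OF s(1) y] by (auto simp: a_def C_scale norm_divide)
  have "x\<otimes>a = complex_of_real (1/s y)\<odot>(x\<otimes>y)" using x y by (simp add: a_def smult_mult_right)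
  hence "s x = 1/s y * s (x\<otimes>y)"
   using one[OF x a] pmsD(3)[OF s(1) C_mult[OF x y]] pos by (simp add: norm_divide)
  thus ?thesis using pos by (simp add: field_simps)
 qed
 thus ?thesis using s by blast
qed

text \<open>The Gelfand--Mazur theorem by an elementary minimum principle: if \<open>z \<mapsto> s (x - z c)\<close> were bounded below by
 its minimum \<open>m > 0\<close>, factoring \<open>y\<^sup>2 - \<delta>\<^sup>2\<close> repeatedly would make it constant on every disc of
 radius \<open>m\<close> around a minimum point, hence everywhere.\<close>

lemma multiplicative_attains_zero:
 assumes s: "pms s" and sm: "!!x y. [|x:C;y:C|] ==> s (x\<otimes>y) = s x * s y" and c: "c:C" "s c = 1" and x: "x:C"
 shows "\<exists>z. s (x\<ominus>z\<odot>c) = 0"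
proof (rule ccontr)
 assume nz: "\<nexists>z. s (x\<ominus>z\<odot>c) = 0"
 define N where "N z = s (x\<ominus>z\<odot>c)" for z
 have inC: "x\<ominus>z\<odot>c:C" for z using x c by (intro C_diff C_scale)
 have N0: "0 < N z" for z using nz pmsD(1)[OF s inC] by (simp add: N_def) (metis less_eq_real_def)
 have sdiff: "s u <= s v + s (u\<ominus>v)" if "u:C" "v:C" for u v
 proof -
  have "u = v\<oplus>(u\<ominus>v)" using that by (metis C_carrier diff_add_cancel M.a_comm diff_closed)
  thus ?thesis using pmsD(2)[OF s that(2) C_diff[OF that]] by simp
 qed
 have sneg: "s (u\<ominus>v) = s (v\<ominus>u)" if "u:C" "v:C" for u v
 proof -
  have "u\<ominus>v = (- 1)\<odot>(v\<ominus>u)" using that by (simp add: diff_scale scale_add scale_scale M.a_comm)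
  thus ?thesis using pmsD(3)[OF s C_diff[OF that(2,1)], of "-1"] by simp
 qed
 have Nlip: "N z <= N w + cmod (z - w)" for z w
 proof -
  have "(x\<ominus>z\<odot>c)\<ominus>(x\<ominus>w\<odot>c) = (w - z)\<odot>c"
  proof -
   have cl: "x:carrier A" "c:carrier A" using x c by auto
   have "(x\<ominus>z\<odot>c)\<ominus>(x\<ominus>w\<odot>c) = (x\<oplus>(- 1)\<odot>x)\<oplus>(w\<odot>c\<oplus>(- z)\<odot>c)"
    using cl by (simp add: diff_scale scale_add scale_scale M.a_ac)
   also have "...= (w + - z)\<odot>c" using cl by (simp only: add_scale) (simp add: diff_scale[symmetric])
   finally show ?thesis by simp
  qed
  hence "s ((x\<ominus>z\<odot>c)\<ominus>(x\<ominus>w\<odot>c)) = cmod (w - z)" using pmsD(3)[OF s c(1)] c(2) by simp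
  thus ?thesis using sdiff[OF inC[of z] inC[of w]] by (simp add: N_def norm_minus_commute)
 qed
 have Nlarge: "cmod z - s x <= N z" for z
 proof -
  have "s (z\<odot>c) <= s x + s (z\<odot>c\<ominus>x)" using x c by (intro sdiff C_scale)
  thus ?thesis using pmsD(3)[OF s c(1), of z] c(2) sneg[OF C_scale[OF c(1)] x] by (simp add: N_def)
 qed
 \<comment> \<open>Outside this ball \<open>Nlarge\<close> gives N z > s x = N 0, so a minimum over
   the ball is a minimum over the plane.\<close>
 have "continuous_on (cball 0 (2 * s x)) N"
  unfolding continuous_on_iff
 proof (intro ballI allI impI)
  fix z e assume e: "(0::real) < e"
  show "\<exists>d>0. \<forall>w\<in>cball 0 (2 * s x). dist w z < d --> dist (N w) (N z) < e"
  proof (intro exI[of _ e] conjI e ballI impI)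
   fix w assume "dist w z < e"
   thus "dist (N w) (N z) < e" using Nlip[of w z] Nlip[of z w] by (simp add: dist_norm dist_real_def norm_minus_commute abs_less_iff)
  qed
 qed
 moreover have "cball 0 (2 * s x) ~= ({}::complex set)" using pmsD(1)[OF s x] by simp
 ultimately obtain z0 where "\<forall>z\<in>cball 0 (2 * s x). N z0 <= N z"
  using continuous_attains_inf[OF compact_cball] by blast
 hence z0: "!!z. z:cball 0 (2 * s x) ==> N z0 <= N z" by blast
 have min: "N z0 <= N z" for z
 proof (cases "z:cball 0 (2 * s x)")
  case False
  hence "2 * s x < cmod z" by simp
  hence "N 0 <= N z" using Nlarge[of z] x c by (simp add: N_def)
  thus ?thesis using z0[of 0] pmsD(1)[OF s x] by simp
 qed (rule z0)
 define m where "m = N z0"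
 have m: "0 < m" by (simp add: m_def N0)
 have spread: "N (w + ep) = m" if w: "N w = m" and ep: "cmod ep < m" for w ep
 proof -
  define Y where "Y k = ((%y. y\<otimes>y)^^k) (x\<ominus>w\<odot>c)" for k
  define D where "D k = ((%y. y\<otimes>y)^^k) c" for k
  have Y0: "Y 0 = x\<ominus>w\<odot>c" "Y (Suc k) = Y k\<otimes>Y k" for k by (simp_all add: Y_def)
  have D0: "D 0 = c" "D (Suc k) = D k\<otimes>D k" for k by (simp_all add: D_def)
  have YC: "Y k:C" for k by (induction k) (auto simp: Y0 inC C_mult)
  have DC: "D k:C" for k by (induction k) (auto simp: D0 c C_mult)
  have sY: "s (Y k) = m^(2^k)" for k
   by (induction k) (use w in "auto simp: Y0 N_def pmsD(5)[OF s YC] power_mult[symmetric] mult.commute")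
  have sD: "s (D k) = 1" for k by (induction k) (auto simp: D0 c pmsD(5)[OF s DC])
  \<comment> \<open>With y = x - w c, this is y^(2^k) - de c^(2^k). For de = ep^(2^k) it splits into
    2^k factors y - eta c with |eta| = |ep|; each has seminorm at least \<open>m\<close>, one of
    them has seminorm N (w + ep), and their product is at most m^(2^k) + |ep|^(2^k). Dividing by
    m^(2^k) leaves an error that vanishes for |ep| < m.\<close>
  define E where "E k de = Y k\<ominus>de\<odot>D k" for k de
  have EC: "E k de:C" for k de unfolding E_def by (intro C_diff C_scale YC DC)
  have Efac: "E (Suc k) (de\<^sup>2) = E k de\<otimes>E k (- de)" for k de
  proof -
   note cl = C_carrier[OF YC[of k]] C_carrier[OF DC[of k]]
   have "E k de\<otimes>E k (- de) = (Y k\<oplus>(- de)\<odot>D k)\<otimes>(Y k\<oplus>de\<odot>D k)"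
    using cl by (simp add: E_def diff_scale scale_scale)
   also have "...= (Y k\<otimes>Y k\<oplus>de\<odot>(Y k\<otimes>D k))\<oplus>((- de)\<odot>(Y k\<otimes>D k)\<oplus>(- de * de)\<odot>(D k\<otimes>D k))"
    using cl C_comm[OF DC[of k] YC[of k]]
    by (simp add: mult_l_distr mult_r_distr smult_mult_left smult_mult_right scale_scale scale_add M.a_ac)
   also have "...= Y k\<otimes>Y k\<oplus>(de + - de)\<odot>(Y k\<otimes>D k)\<oplus>(- de * de)\<odot>(D k\<otimes>D k)"
    using cl by (simp only: add_scale mult_closed) (simp add: M.a_ac)
   also have "...= E (Suc k) (de\<^sup>2)"
    using cl by (simp add: E_def Y0 D0 diff_scale scale_scale R.power2_eq_square power2_eq_square M.r_zero) (simp add: Power.power2_eq_square)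
   finally show ?thesis by simp
  qed
  have E0: "s (E 0 de) = N (w + de)" for de
  proof -
   have "x\<ominus>w\<odot>c\<ominus>de\<odot>c = x\<ominus>(w + de)\<odot>c"
    using x c by (simp add: diff_scale scale_scale add_scale scale_add M.a_assoc)
   thus ?thesis by (simp add: E_def Y0 D0 N_def)
  qed
  have lower: "m^(2^k) <= s (E k de)" for k de
  proof (induction k arbitrary: de)
   case 0 thus ?case using min by (simp add: E0 m_def)
  next
   case (Suc k)
   have "m^(2^Suc k) = m^(2^k) * m^(2^k)" by (simp add: mult_2 power_add)
   also have "...<= s (E k (csqrt de)) * s (E k (- csqrt de))" using Suc m pmsD(1)[OF s EC] by (intro mult_mono) auto
   also have "...= s (E (Suc k) ((csqrt de)\<^sup>2))" by (simp only: Efac sm EC)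
   finally show ?case by simp
  qed
  have up: "s (E k de) <= m^(2^k) + cmod de" for k de
   using pmsD(2)[OF s YC[of k] C_scale[OF DC[of k], of "- de"]] pmsD(3)[OF s DC[of k], of "- de"] sY[of k] sD[of k] C_carrier[OF YC[of k]] C_carrier[OF DC[of k]]
   by (simp add: E_def diff_scale scale_scale)
  have low2: "s (E 0 ep) * m^(2^k) <= m * s (E k (ep^(2^k)))" for k
  proof (induction k)
   case 0 thus ?case by simp
  next
   case (Suc k)
   have "ep^(2^Suc k) = (ep^(2^k))\<^sup>2" by (simp add: power_mult[symmetric] mult.commute)
   hence e: "s (E (Suc k) (ep^(2^Suc k))) = s (E k (ep^(2^k))) * s (E k (- (ep^(2^k))))"
    by (simp only: Efac sm EC)
   have "s (E 0 ep) * m^(2^Suc k) = (s (E 0 ep) * m^(2^k)) * m^(2^k)" by (simp add: mult_2 power_add)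
   also have "...<= (m * s (E k (ep^(2^k)))) * s (E k (- (ep^(2^k))))"
    by (rule mult_mono[OF Suc lower]) (use m pmsD(1)[OF s EC] in simp_all)
   finally show ?case unfolding e by (simp add: mult.assoc)
  qed
  have "s (E 0 ep) <= m + m * (cmod ep/m)^(2^k)" for k
  proof -
   have "s (E 0 ep) * m^(2^k) <= m * (m^(2^k) + cmod (ep^(2^k)))"
    using low2[of k] up[of k "ep^(2^k)"] m by (meson mult_le_cancel_left_pos order_trans)
   thus ?thesis using m by (simp add: norm_power power_divide field_simps)
  qed
  moreover have "(%k. m + m * (cmod ep/m)^(2^k)) \<longlonglongrightarrow> m + m * 0"
  proof (intro tendsto_intros)
   have "(%n. (cmod ep/m)^n) \<longlonglongrightarrow> 0" using ep m by (intro LIMSEQ_power_zero) simp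
   moreover have "strict_mono (%k::nat. 2^k::nat)" by (simp add: strict_mono_def)
   ultimately show "(%k. (cmod ep/m)^(2^k)) \<longlonglongrightarrow> 0"
    using LIMSEQ_subseq_LIMSEQ[of "%n. (cmod ep/m)^n" 0 "%k. 2^k"] by (simp add: o_def)
  qed
  ultimately have "s (E 0 ep) <= m" by (intro LIMSEQ_le_const) auto
  thus ?thesis using min[of "w + ep"] by (simp add: E0 m_def)
 qed
 \<comment> \<open>Steps of length m/2 stay within the discs of radius m, so \<open>N\<close> would
   equal \<open>m\<close> along an unbounded sequence, against \<open>Nlarge\<close>.\<close>
 have "N (z0 + of_nat n * complex_of_real (m/2)) = m" for n
 proof (induction n)
  case 0 thus ?case by (simp add: m_def)
 next
  case (Suc n)
  have "cmod (complex_of_real (m/2)) < m" using m by (simp only: norm_of_real)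
  from spread[OF Suc this] show ?case by (simp add: algebra_simps add_divide_distrib)
 qed
 hence "cmod (z0 + of_nat n * complex_of_real (m/2)) <= m + s x" for n using Nlarge by (metis add.commute diff_le_eq)
 moreover have "cmod (of_nat n * complex_of_real (m/2)) <= cmod (z0 + of_nat n * complex_of_real (m/2)) + cmod z0" for n
  using norm_triangle_ineq4[of "z0 + of_nat n * complex_of_real (m/2)" z0] by simp
 ultimately have bd: "real n * (m/2) <= m + s x + cmod z0" for n
 proof -
  assume a: "!!n. cmod (z0 + of_nat n * complex_of_real (m/2)) <= m + s x"
   and b: "!!n. cmod (of_nat n * complex_of_real (m/2)) <= cmod (z0 + of_nat n * complex_of_real (m/2)) + cmod z0"
  have "cmod (of_nat n * complex_of_real (m/2)) = real n * (m/2)" using m by (simp add: norm_mult norm_divide)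
  thus ?thesis using a[of n] b[of n] by linarith
 qed
 obtain n :: nat where "(m + s x + cmod z0)/(m/2) < real n" using reals_Archimedean2 by blast
 thus False using bd[of n] m by (simp add: divide_less_eq) 
qed

text \<open>\<open>e\<close> is \<open>c\<close> scaled to norm 1 and stands in for a unit:
  \<open>xi x\<close> is the number z for which x e - z e lies in the kernel of the multiplicative
  seminorm \<open>s\<close>. Uniqueness of z makes \<open>xi\<close> linear and multiplicative, and
  its modulus is \<open>s\<close>.\<close>

theorem gelfand_character:
 assumes c: "c:C" "nrm A c ~= 0"
 obtains xi where "!!x y. [|x:C;y:C|] ==> xi (x\<oplus>y) = xi x + xi y" "!!k x. x:C ==> xi (k\<odot>x) = k * xi x"
  "!!x y. [|x:C;y:C|] ==> xi (x\<otimes>y) = xi x * xi y"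
  "!!x. x:C ==> cmod (xi x) <= nrm A x" "cmod (xi c) = nrm A c"
proof -
 define e where "e = complex_of_real (1/nrm A c)\<odot>c"
 have pos: "0 < nrm A c" using c nrm_nonneg[of c] by simp
 have e: "e:C" "nrm A e = 1" using c pos by (auto simp: e_def C_scale nrm_smult norm_divide)
 obtain s where s: "pms s" "!!x. x:C ==> s x <= nrm A x" "s e = 1" "!!x y. x:C ==> y:C ==> s (x\<otimes>y) = s x * s y"
  using exists_multiplicative[OF e] by blast
 define xi where "xi x = (SOME z. s (x\<otimes>e\<ominus>z\<odot>e) = 0)" for x
 have xi0: "s (x\<otimes>e\<ominus>xi x\<odot>e) = 0" if "x:C" for x
  unfolding xi_def using multiplicative_attains_zero[OF s(1,4) e(1) s(3) C_mult[OF that e(1)]] by (rule someI_ex)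
 have sdiff: "s u <= s v + s (u\<ominus>v)" "s v <= s u + s (u\<ominus>v)" if "u:C" "v:C" for u v
 proof -
  have "u = v\<oplus>(u\<ominus>v)" using that by (metis C_carrier diff_add_cancel M.a_comm diff_closed)
  thus "s u <= s v + s (u\<ominus>v)" using pmsD(2)[OF s(1) that(2) C_diff[OF that]] by simp
  have "v = u\<oplus>(- 1)\<odot>(u\<ominus>v)"
   using that by (metis C_carrier diff_add_cancel M.a_comm diff_closed diff_scale M.minus_eq minus_scale M.minus_minus M.minus_add scale_closed M.a_inv_closed)
  thus "s v <= s u + s (u\<ominus>v)"
   using pmsD(2)[OF s(1) that(1) C_scale[OF C_diff[OF that]], of "-1"] pmsD(3)[OF s(1) C_diff[OF that], of "-1"] by simp
 qed
 have uniq: "xi x = z" if x: "x:C" and z: "s (x\<otimes>e\<ominus>z\<odot>e) = 0" for x z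
 proof -
  note cl = C_mult[OF x e(1)] C_scale[OF e(1), of z] C_scale[OF e(1), of "xi x"]
  have "(z - xi x)\<odot>e = (x\<otimes>e\<ominus>xi x\<odot>e)\<oplus>(- 1)\<odot>(x\<otimes>e\<ominus>z\<odot>e)"
  proof -
   define p where "p = x\<otimes>e"
   have p: "p:carrier A" "e:carrier A" using cl e by (auto simp: p_def)
   have "(p\<ominus>xi x\<odot>e)\<oplus>(- 1)\<odot>(p\<ominus>z\<odot>e) = (p\<oplus>(- 1)\<odot>p)\<oplus>(z\<odot>e\<oplus>(- xi x)\<odot>e)"
    using p by (simp add: diff_scale scale_add scale_scale M.a_ac)
   also have "...= (z + - xi x)\<odot>e" using p by (simp only: add_scale) (simp add: diff_scale[symmetric])
   finally show ?thesis by (simp add: p_def)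
  qed
  hence "s ((z - xi x)\<odot>e) <= s (x\<otimes>e\<ominus>xi x\<odot>e) + s ((- 1)\<odot>(x\<otimes>e\<ominus>z\<odot>e))"
   using pmsD(2)[OF s(1) C_diff[OF cl(1,3)] C_scale[OF C_diff[OF cl(1,2)]], of "-1"] by simp
  also have "...= 0" using xi0[OF x] z pmsD(3)[OF s(1) C_diff[OF cl(1,2)], of "-1"] by simp
  finally have "cmod (z - xi x) <= 0" using pmsD(3)[OF s(1) e(1)] s(3) by simp
  thus ?thesis by simp
 qed
 have abs: "cmod (xi x) = s x" if x: "x:C" for x
 proof -
  note cl = C_mult[OF x e(1)] C_scale[OF e(1), of "xi x"]
  have "s (x\<otimes>e) = s (xi x\<odot>e)" using sdiff[OF cl] xi0[OF x] by simp
  thus ?thesis using pmsD(3)[OF s(1) e(1)] s(3) s(4)[OF x e(1)] by simp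
 qed
 show ?thesis
 proof (rule that[of xi])
  fix x assume x: "x:C"
  note cx = C_mult[OF x e(1)] C_scale[OF e(1), of "xi x"]
  show "cmod (xi x) <= nrm A x" using abs[OF x] s(2)[OF x] by simp
  show "xi (k\<odot>x) = k * xi x" for k
  proof (rule uniq[OF C_scale[OF x]])
   have "(k\<odot>x)\<otimes>e\<ominus>(k * xi x)\<odot>e = k\<odot>(x\<otimes>e\<ominus>xi x\<odot>e)"
    using x e by (simp add: smult_mult_left scale_diff scale_scale)
   thus "s ((k\<odot>x)\<otimes>e\<ominus>(k * xi x)\<odot>e) = 0" using pmsD(3)[OF s(1) C_diff[OF cx]] xi0[OF x] by simp
  qed
  fix y assume y: "y:C"
  note cy = C_mult[OF y e(1)] C_scale[OF e(1), of "xi y"]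
  show "xi (x\<oplus>y) = xi x + xi y"
  proof (rule uniq[OF C_add[OF x y]])
   have "(x\<oplus>y)\<otimes>e\<ominus>(xi x + xi y)\<odot>e = (x\<otimes>e\<ominus>xi x\<odot>e)\<oplus>(y\<otimes>e\<ominus>xi y\<odot>e)"
    using x y e by (simp add: mult_l_distr add_scale add_diff_add)
   hence "s ((x\<oplus>y)\<otimes>e\<ominus>(xi x + xi y)\<odot>e) <= 0"
    using pmsD(2)[OF s(1) C_diff[OF cx] C_diff[OF cy]] xi0[OF x] xi0[OF y] by simp
   moreover have "0 <= s ((x\<oplus>y)\<otimes>e\<ominus>(xi x + xi y)\<odot>e)"
    using x y e by (intro pmsD(1)[OF s(1)] C_diff C_mult C_add C_scale)
   ultimately show "s ((x\<oplus>y)\<otimes>e\<ominus>(xi x + xi y)\<odot>e) = 0" by simp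
  qed
  show "xi (x\<otimes>y) = xi x * xi y"
  proof (rule uniq[OF C_mult[OF x y]])
   let ?w = "(x\<otimes>y)\<otimes>e\<ominus>(xi x * xi y)\<odot>e"
   have wC: "?w:C" using x y e by (intro C_diff C_mult C_scale)
   define p q where "p = x\<otimes>e" and "q = y\<otimes>e"
   have pq: "p:C" "q:C" using cx cy by (auto simp: p_def q_def)
   have "?w\<otimes>e = (p\<ominus>xi x\<odot>e)\<otimes>q\<oplus>(xi x\<odot>e)\<otimes>(q\<ominus>xi y\<odot>e)"
   proof -
    have "((x\<otimes>y)\<otimes>e)\<otimes>e = p\<otimes>q"
    proof -
     have "((x\<otimes>y)\<otimes>e)\<otimes>e = x\<otimes>((y\<otimes>e)\<otimes>e)" using x y e by (simp add: mult_assoc)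
     also have "(y\<otimes>e)\<otimes>e = e\<otimes>(y\<otimes>e)" by (rule C_comm) (use y e in "auto intro: C_mult")
     finally show ?thesis using x y e by (simp add: p_def q_def mult_assoc)
    qed
    hence "?w\<otimes>e = p\<otimes>q\<ominus>(xi x * xi y)\<odot>(e\<otimes>e)"
     using x y e by (simp add: diff_mult smult_mult_left)
    also have "...= (p\<otimes>q\<ominus>xi x\<odot>(e\<otimes>q))\<oplus>(xi x\<odot>(e\<otimes>q)\<ominus>(xi x * xi y)\<odot>(e\<otimes>e))"
     using pq e by (subst diff_add_diff) (auto simp: p_def q_def)
    also have "...= (p\<ominus>xi x\<odot>e)\<otimes>q\<oplus>(xi x\<odot>e)\<otimes>(q\<ominus>xi y\<odot>e)"
     using pq e by (simp add: diff_mult mult_diff smult_mult_left smult_mult_right scale_diff scale_scale mult.commute[of "xi y" "xi x"])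
    finally show ?thesis .
   qed
   hence "s (?w\<otimes>e) <= s ((p\<ominus>xi x\<odot>e)\<otimes>q) + s ((xi x\<odot>e)\<otimes>(q\<ominus>xi y\<odot>e))"
    using pmsD(2)[OF s(1), of "(p\<ominus>xi x\<odot>e)\<otimes>q" "(xi x\<odot>e)\<otimes>(q\<ominus>xi y\<odot>e)"] pq e by (simp add: C_mult C_diff C_scale)
   also have "...= 0"
    using s(4)[of "p\<ominus>xi x\<odot>e" q] s(4)[of "xi x\<odot>e" "q\<ominus>xi y\<odot>e"] pq e xi0[OF x] xi0[OF y]
    by (simp add: C_diff C_scale p_def q_def)
   finally have "s ?w <= 0" using s(4)[OF wC e(1)] s(3) by simp
   thus "s ?w = 0" using pmsD(1)[OF s(1) wC] by simp
  qed
 next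
  have "cmod (xi e) = 1" using abs[OF e(1)] s(3) by simp
  have "s e = s c/nrm A c" using pmsD(3)[OF s(1) c(1), of "complex_of_real (1/nrm A c)"] pos by (simp add: e_def norm_divide)
  thus "cmod (xi c) = nrm A c" using abs[OF c(1)] s(3) pos by (simp add: field_simps)
 qed
qed

end

section \<open>Characters of the convolution algebra\<close>

context haar
begin

text \<open>Nodes and weights are chosen before the integrand \<open>k\<close>. The same sum
  therefore approximates the integral against a character and, at every point simultaneously, the
  convolution with a fixed function.\<close>

lemma riemann_sum:
 assumes d: "cc K d" and N: "open N" "0:N"
 shows "\<exists>J w. finite J \<and> J \<subseteq> K \<and> (\<forall>k e. continuous_on UNIV k --> 0 <= e --> (\<forall>s t. s - t:N --> cmod (k s - k t) <= e) -->
   cmod ((\<integral>t. d t * k t \<partial>mu) - (\<Sum>j\<in>J. w j * k j)) <= e * (\<integral>t. cmod (d t) \<partial>mu))"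
proof -
 have K: "compact K" using d by (simp add: cc_def)
 have op: "open {s. s - t:N}" for t
 proof -
  have "open ((%s. s - t) -` N)" by (intro open_vimage N continuous_intros)
  moreover have "(%s. s - t) -` N = {s. s - t:N}" by auto
  ultimately show ?thesis by simp
 qed
 obtain J and phi :: "'g => 'g => real" where J: "finite J" "J \<subseteq> K"
  and phi: "!!j. j:J ==> continuous_on UNIV (phi j)" "!!j s. j:J ==> 0 <= phi j s"
   "!!j s. j:J ==> s\<notin>{s. s - j:N} ==> phi j s = 0"
   "!!s. (\<Sum>j\<in>J. phi j s) <= 1" "!!s. s:K ==> (\<Sum>j\<in>J. phi j s) = 1"
 proof (rule partition_functions[OF lc K, of "%t. {s. s - t:N}"])
  show "open {s. s - t:N} \<and> t:{s. s - t:N}" for t using op N by auto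
 qed (rule that)
 have cphi: "continuous_on UNIV (%t. complex_of_real (phi j t))" if "j:J" for j
  by (intro continuous_on_of_real phi that)
 define w where "w j = (\<integral>t. d t * complex_of_real (phi j t) \<partial>mu)" for j
 have "cmod ((\<integral>t. d t * k t \<partial>mu) - (\<Sum>j\<in>J. w j * k j)) <= e * (\<integral>t. cmod (d t) \<partial>mu)"
  if k: "continuous_on UNIV k" and e: "0 <= e" and le: "!!s t. s - t:N ==> cmod (k s - k t) <= e" for k e
 proof -
  have i1: "integrable mu (%t. d t * k t)" by (rule integrable_cc[OF cc_intros(4)[OF d k]])
  have i2: "integrable mu (%t. d t * complex_of_real (phi j t))" if "j:J" for j
   by (rule integrable_cc[OF cc_intros(4)[OF d cphi[OF that]]])
  have i3: "integrable mu (%t. \<Sum>j\<in>J. d t * complex_of_real (phi j t) * k j)"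
   using i2 by (intro Bochner_Integration.integrable_sum integrable_mult_left) auto
  have "(\<Sum>j\<in>J. w j * k j) = (\<integral>t. (\<Sum>j\<in>J. d t * complex_of_real (phi j t) * k j) \<partial>mu)"
   unfolding w_def using i2 by (subst Bochner_Integration.integral_sum) (auto intro!: integrable_mult_left)
  hence "(\<integral>t. d t * k t \<partial>mu) - (\<Sum>j\<in>J. w j * k j) = (\<integral>t. d t * k t - (\<Sum>j\<in>J. d t * complex_of_real (phi j t) * k j) \<partial>mu)"
   using i1 i3 by simp
  also have "cmod ...<= (\<integral>t. e * cmod (d t) \<partial>mu)"
  proof (rule order_trans[OF integral_norm_bound], rule integral_mono')
   show "integrable mu (%t. e * cmod (d t))" using integrable_cc[OF d] by (intro integrable_mult_right integrable_norm)
   fix t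
   show "0 <= e * cmod (d t)" using e by simp
   show "cmod (d t * k t - (\<Sum>j\<in>J. d t * complex_of_real (phi j t) * k j)) <= e * cmod (d t)"
   proof (cases "t:K")
    case True
    have "cmod (k t - (\<Sum>j\<in>J. phi j t *\<^sub>R k j)) <= e"
    proof (rule weighted_sum_close)
     show "cmod (k t - k j) <= e" if "j:J" "phi j t ~= 0" for j using phi(3)[OF that(1), of t] that(2) le[of t j] by auto
    qed (use phi e True in auto)
    hence "cmod (d t * (k t - (\<Sum>j\<in>J. phi j t *\<^sub>R k j))) <= e * cmod (d t)"
     by (simp add: norm_mult mult.commute[of e] mult_left_mono)
    thus ?thesis by (simp add: right_diff_distrib sum_distrib_left mult.assoc scaleR_conv_of_real)
   qed (simp add: cc_zero[OF d])
  qed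
  finally show ?thesis by simp
 qed
 with J show ?thesis by (intro exI[of _ J] exI[of _ w]) simp
qed

definition Cc :: "('g => complex) set"
 where "Cc = {c. \<exists>K. cc K c}"

lemma CcI: "cc K c ==> c:Cc" by (auto simp: Cc_def)

lemma cc_common: "c:Cc ==> d:Cc ==> \<exists>K. cc K c \<and> cc K d"
proof -
 assume "c:Cc" "d:Cc"
 then obtain K L where "cc K c" "cc L d" by (auto simp: Cc_def)
 moreover from this have "compact (K\<union>L)" by (auto simp: cc_def)
 ultimately show ?thesis by (intro exI[of _ "K\<union>L"]) (auto intro: cc_mono)
qed

definition cstar :: "('g => complex) => 'g => complex"
 where "cstar c t = cnj (c (- t))"

lemma Cc_intros:
 "(%_. 0):Cc" "c:Cc ==> d:Cc ==> (%t. c t + d t):Cc" "c:Cc ==> (%t. z * c t):Cc"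
 "c:Cc ==> d:Cc ==> (%t. c t - d t):Cc" "c:Cc ==> d:Cc ==> conv c d:Cc" "c:Cc ==> cstar c:Cc"
 "c:Cc ==> (%s. c (s - t)):Cc" "c:Cc ==> continuous_on UNIV h ==> (%t. c t * h t):Cc"
proof -
 show "(%_. 0):Cc" using cc_intros(1)[of "{}"] by (auto simp: Cc_def)
 assume c: "c:Cc"
 then obtain K where K: "cc K c" by (auto simp: Cc_def)
 show "(%t. z * c t):Cc" using cc_intros(3)[OF K] by (rule CcI)
 show "cstar c:Cc" unfolding cstar_def[abs_def] using cc_intros(6)[OF cc_reflect[OF K]] by (rule CcI)
 show "(%s. c (s - t)):Cc" using CcI[OF cc_translate[OF K, of "- t"]] by simp
 show "continuous_on UNIV h ==> (%t. c t * h t):Cc" using cc_intros(4)[OF K] by (blast intro: CcI)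
 assume "d:Cc"
 then obtain L where L: "cc L c" "cc L d" using cc_common[OF c] by blast
 show "(%t. c t + d t):Cc" "(%t. c t - d t):Cc" "conv c d:Cc"
  using cc_intros(2,5)[OF L] cc_conv[OF L] by (auto intro: CcI)
qed

text \<open>A character \<open>X\<close> of the convolution algebra that is bounded by the \<open>L\<^sup>1\<close>-norm is integration against
 \<open>g t = X (\<tau>\<^sub>t c) / X c\<close>, where \<open>\<tau>\<^sub>t c\<close> is the translate of \<open>c\<close>.\<close>

lemma conv_character:
 assumes add: "!!c d. [|c:Cc;d:Cc|] ==> X (%t. c t + d t) = X c + X d"
  and scale: "!!z c. c:Cc ==> X (%t. z * c t) = z * X c"
  and mult: "!!c d. [|c:Cc;d:Cc|] ==> X (conv c d) = X c * X d"
  and bound: "!!c. c:Cc ==> cmod (X c) <= (\<integral>t. cmod (c t) \<partial>mu)"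
  and c: "c:Cc" "X c ~= 0"
 shows "\<exists>ga. \<forall>d\<in>Cc. X d = hat d ga"
proof -
 obtain K where K: "cc K c" using c by (auto simp: Cc_def)
 have Kc: "compact K" using K by (simp add: cc_def)
 define tr where "tr t d = (%s. d (s - t))" for t :: 'g and d :: "'g => complex"
 have trC: "tr t d:Cc" if "d:Cc" for t d using Cc_intros(7)[OF that] by (simp add: tr_def)
 have diff: "X (%t. c t - d t) = X c - X d" if "c:Cc" "d:Cc" for c d
  using add[OF that(1) Cc_intros(3)[OF that(2), of "-1"]] scale[OF that(2), of "-1"] by simp
 have conv_tr: "conv (tr t d) e = tr t (conv d e)" if d: "d:Cc" and e: "e:Cc" for t d e
 proof
  fix u
  obtain L where L: "cc L d" "cc L e" using cc_common[OF d e] by blast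
  have "continuous_on UNIV (%s. d (s - t) * e (u - s))"
   by (intro continuous_on_mult continuous_pair[OF cc_cont[OF L(1)]] continuous_pair[OF cc_cont[OF L(2)]] continuous_intros)
  from integral_translate[OF this, of t]
  show "conv (tr t d) e u = tr t (conv d e) u"
   by (simp add: conv_def tr_def) (simp add: algebra_simps)
 qed
 have comm: "conv d e = conv e d" if "d:Cc" "e:Cc" for d e
  using cc_common[OF that] conv_commute by blast
 define g where "g t = X (tr t c)/X c" for t
 have Xtr: "X (tr t d) = g t * X d" if d: "d:Cc" for t d
 proof -
  have "X (tr t d) * X c = X (conv (tr t d) c)" using mult[OF trC[OF d] c(1)] by simp
  also have "...= X (conv (tr t c) d)" by (simp add: conv_tr d c comm[OF d c(1)])
  also have "...= X (tr t c) * X d" using mult[OF trC[OF c(1)] d] by simp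
  finally show ?thesis using c(2) by (simp add: g_def field_simps)
 qed
 have gadd: "g (s + t) = g s * g t" for s t
 proof -
  have "tr (s + t) c = tr s (tr t c)" by (auto simp: tr_def algebra_simps)
  hence "X (tr (s + t) c) = g s * (g t * X c)" by (simp add: Xtr trC c(1))
  thus ?thesis using Xtr[OF c(1), of "s + t"] c(2) by simp
 qed
 have g0: "g 0 = 1" using c(2) by (simp add: g_def tr_def)
 define B where "B = (\<integral>t. cmod (c t) \<partial>mu)/cmod (X c)"
 have gB: "cmod (g t) <= B" for t
 proof -
  have "(\<integral>s. cmod (c (s - t)) \<partial>mu) = (\<integral>s. cmod (c s) \<partial>mu)"
   using integral_translate[of "%s. cmod (c s)" "- t"] cc_cont[OF K] by (simp add: continuous_on_norm)
  hence "cmod (X (tr t c)) <= (\<integral>s. cmod (c s) \<partial>mu)" using bound[OF trC[OF c(1), of t]] by (simp add: tr_def)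
  thus ?thesis by (simp add: g_def B_def norm_divide divide_right_mono)
 qed
 have gle: "cmod (g t) <= 1" for t
 proof (rule ccontr)
  assume "\<not> cmod (g t) <= 1"
  then obtain n where n: "B < cmod (g t)^n" using real_arch_pow[of "cmod (g t)" B] by auto
  have "\<exists>s. g s = g t^n" for n
  proof (induction n)
   case 0 thus ?case using g0 by (intro exI[of _ 0]) simp
  next
   case (Suc n)
   then obtain s where "g s = g t^n" by blast
   thus ?case using gadd[of t s] by (intro exI[of _ "t + s"]) simp
  qed
  then obtain s where "g s = g t^n" by blast
  thus False using gB[of s] n by (simp add: norm_power)
 qed
 have g1: "cmod (g t) = 1" for t
 proof -
  have "cmod (g t) * cmod (g (- t)) = 1" using gadd[of t "- t"] g0 by (simp add: norm_mult[symmetric])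
  moreover have "cmod (g t) * cmod (g (- t)) <= cmod (g t) * 1" using gle[of "- t"] by (intro mult_left_mono) auto
  ultimately show ?thesis using gle[of t] by simp
 qed
 obtain L where L: "compact L" "K \<subseteq> L"
  and unif: "!!e. e > 0 ==> \<exists>U. open U \<and> 0:U \<and> (\<forall>s\<in>U. (\<forall>t. cmod (c (t - s) - c t) <= e) \<and> (\<forall>t. t\<notin>L --> c (t - s) = 0))"
  using cc_uniformly_continuous[OF lc K] by blast
 have cL: "c t = 0" if "t\<notin>L" for t using cc_zero[OF K] L(2) that by blast
 have near: "\<exists>U. open U \<and> 0:U \<and> (\<forall>s\<in>U. cmod (g s - 1) <= e)" if e: "0 < e" for e
 proof -
  define d where "d = e * cmod (X c)/(measure mu L + 1)"
  have m: "0 < measure mu L + 1" by (simp add: add_nonneg_pos)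
  have d: "0 < d" using e c(2) m by (simp add: d_def)
  obtain U where U: "open U" "0:U" "\<forall>s\<in>U. (\<forall>t. cmod (c (t - s) - c t) <= d) \<and> (\<forall>t. t\<notin>L --> c (t - s) = 0)" using unif[OF d] by blast
  have "cmod (g s - 1) <= e" if s: "s:U" for s
  proof -
   have "(g s - 1) * X c = X (%t. tr s c t - c t)" using Xtr[OF c(1)] diff[OF trC[OF c(1)] c(1)] by (simp add: left_diff_distrib)
   hence "cmod (g s - 1) * cmod (X c) <= (\<integral>t. cmod (tr s c t - c t) \<partial>mu)"
    using bound[OF Cc_intros(4)[OF trC[OF c(1), of s] c(1)]] by (metis norm_mult)
   also have "...<= d * measure mu L"
    by (rule integral_norm_le[OF L(1)]) (use U(3) s cL in "auto simp: tr_def")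
   also have "...<= d * (measure mu L + 1)" using d by (intro mult_left_mono) auto
   also have "...= e * cmod (X c)" using m by (simp add: d_def)
   finally show ?thesis using c(2) by simp
  qed
  thus ?thesis using U by blast
 qed
 have gdiff: "cmod (g s - g t) = cmod (g (s - t) - 1)" for s t
 proof -
  have "g s - g t = g t * (g (s - t) - 1)" using gadd[of t "s - t"] by (simp add: right_diff_distrib)
  thus ?thesis by (simp add: norm_mult g1)
 qed
 have gcont: "continuous_on UNIV g"
  unfolding continuous_on_def
 proof (intro ballI, rule tendstoI)
  fix t :: 'g and e :: real assume e: "0 < e"
  obtain U where U: "open U" "0:U" "\<forall>s\<in>U. cmod (g s - 1) <= e/2" using near[of "e/2"] e by auto
  have "((%s. s - t) \<longlongrightarrow> t - t) (at t within UNIV)" by (intro tendsto_intros)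
  hence "\<forall>\<^sub>F s in at t within UNIV. s - t:U" using U by (intro topological_tendstoD) auto
  thus "\<forall>\<^sub>F s in at t within UNIV. dist (g s) (g t) < e"
  proof eventually_elim
   case (elim s)
   thus ?case using U(3) e gdiff[of s t] by (auto simp: dist_norm)
  qed
 qed
 have "X d = (\<integral>t. d t * g t \<partial>mu)" if d: "d:Cc" for d
 proof -
  obtain Kd where Kd: "cc Kd d" using d by (auto simp: Cc_def)
  define M where "M = {s + t | s t. s:Kd \<and> t:K}"
  have M: "compact M" unfolding M_def using Kd Kc by (intro compact_sum) (auto simp: cc_def)
  define n where "n = (\<integral>t. cmod (d t) \<partial>mu)"
  have n0: "0 <= n" by (simp add: n_def)
  \<comment> \<open>One set of nodes and weights is used twice. The combination \<open>h\<close> of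
    translates of \<open>c\<close> is uniformly close to \<open>conv d c\<close> and vanishes with
    it outside \<open>M\<close>, so \<open>X h\<close> is close to X d * X c; and \<open>X h\<close>
    is exactly the Riemann sum of the integral of d g, times X c.\<close>
  have est: "cmod (X d * X c - (\<integral>t. d t * g t \<partial>mu) * X c) <= e * (n * (measure mu M + cmod (X c)))" if e: "0 < e" for e
  proof -
   obtain U where U: "open U" "0:U" "\<forall>s\<in>U. cmod (g s - 1) <= e" using near[OF e] by blast
   obtain U' where U': "open U'" "0:U'" "\<forall>s\<in>U'. (\<forall>t. cmod (c (t - s) - c t) <= e) \<and> (\<forall>t. t\<notin>L --> c (t - s) = 0)" using unif[OF e] by blast
   have "open (U\<inter>U')" "0:U\<inter>U'" using U U' by auto
   from riemann_sum[OF Kd this] obtain J w where J: "finite J" "J \<subseteq> Kd"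
    and app': "\<forall>k e. continuous_on UNIV k --> 0 <= e --> (\<forall>s t. s - t:U\<inter>U' --> cmod (k s - k t) <= e) -->
     cmod ((\<integral>t. d t * k t \<partial>mu) - (\<Sum>j\<in>J. w j * k j)) <= e * (\<integral>t. cmod (d t) \<partial>mu)"
    by (elim exE conjE)
   note app = app'[rule_format]
   have 1: "cmod ((\<integral>t. d t * g t \<partial>mu) - (\<Sum>j\<in>J. w j * g j)) <= e * n"
    unfolding n_def by (rule app[OF gcont]) (use e U(3) gdiff in auto)
   define h where "h = (%s. \<Sum>j\<in>J. w j * tr j c s)"
   have hC: "h:Cc \<and> X h = (\<Sum>j\<in>J. w j * (g j * X c))"
    using J(1) unfolding h_def
   proof (induction J rule: finite_induct)
    case empty thus ?case using Cc_intros(1) scale[OF Cc_intros(1), of 0] by simp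
   next
    case (insert j J)
    have a: "(%s. w j * tr j c s):Cc" by (intro Cc_intros(3) trC c(1))
    have "X (%s. w j * tr j c s) = w j * (g j * X c)" using scale[OF trC[OF c(1)]] Xtr[OF c(1)] by simp
    thus ?case using insert Cc_intros(2)[OF a conjunct1[OF insert.IH]] add[OF a conjunct1[OF insert.IH]] by simp
   qed
   have 2: "cmod (conv d c s - h s) <= e * n" for s
   proof -
    have "cmod ((\<integral>t. d t * c (s - t) \<partial>mu) - (\<Sum>j\<in>J. w j * c (s - j))) <= e * n"
     unfolding n_def
    proof (rule app)
     show "continuous_on UNIV (%t. c (s - t))" by (intro continuous_pair[OF cc_cont[OF K]] continuous_intros)
     show "0 <= e" using e by simp
     fix u t assume ut: "u - t:U\<inter>U'"
     have "cmod (c ((s - t) - (u - t)) - c (s - t)) <= e" using U'(3) ut by blast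
     thus "cmod (c (s - u) - c (s - t)) <= e" by simp
    qed
    thus ?thesis by (simp add: conv_def h_def tr_def)
   qed
   have 3: "conv d c s - h s = 0" if s: "s\<notin>M" for s
   proof -
    have "conv d c s = 0" using cc_zero[OF cc_conv[OF Kd K]] s by (simp add: M_def)
    moreover have "tr j c s = 0" if j: "j:J" for j
    proof (rule ccontr)
     assume "tr j c s ~= 0"
     hence "s - j:K" using cc_zero[OF K] by (auto simp: tr_def)
     moreover have "s = j + (s - j)" by simp
     ultimately show False using s j J(2) unfolding M_def by blast
    qed
    ultimately show ?thesis by (simp add: h_def)
   qed
   have cdC: "conv d c:Cc" by (rule Cc_intros(5)[OF d c(1)])
   have "cmod (X (conv d c) - X h) <= (\<integral>s. cmod (conv d c s - h s) \<partial>mu)"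
    using bound[OF Cc_intros(4)[OF cdC conjunct1[OF hC]]] diff[OF cdC conjunct1[OF hC]] by simp
   also have "...<= (e * n) * measure mu M" by (rule integral_norm_le[OF M 2 3])
   finally have 4: "cmod (X d * X c - (\<Sum>j\<in>J. w j * g j) * X c) <= (e * n) * measure mu M"
    using mult[OF d c(1)] hC by (simp add: sum_distrib_right mult.assoc)
   have 5: "cmod ((\<Sum>j\<in>J. w j * g j) * X c - (\<integral>t. d t * g t \<partial>mu) * X c) <= (e * n) * cmod (X c)"
    using 1 by (simp add: left_diff_distrib[symmetric] norm_mult norm_minus_commute mult_right_mono)
   have "cmod (X d * X c - (\<integral>t. d t * g t \<partial>mu) * X c) <= (e * n) * measure mu M + (e * n) * cmod (X c)"
    by (rule norm_diff_triangle_le[OF 4 5])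
   thus ?thesis by (simp add: algebra_simps)
  qed
  have "cmod (X d * X c - (\<integral>t. d t * g t \<partial>mu) * X c) <= 0"
  proof (rule field_le_epsilon)
   fix r :: real assume r: "0 < r"
   define q where "q = n * (measure mu M + cmod (X c)) + 1"
   have q: "0 < q" using n0 by (simp add: q_def add_nonneg_pos)
   have "cmod (X d * X c - (\<integral>t. d t * g t \<partial>mu) * X c) <= r/q * (q - 1)"
    using est[of "r/q"] r q by (simp add: q_def)
   also have "...<= r/q * q" using r q by (intro mult_left_mono) auto
   finally show "cmod (X d * X c - (\<integral>t. d t * g t \<partial>mu) * X c) <= 0 + r" using q by simp
  qed
  thus ?thesis using c(2) by (simp add: left_diff_distrib[symmetric])
 qed
 moreover have "pairing t (Abs_dual g) = g t" for t
  using gcont g1 gadd by (simp add: pairing_def Abs_dual_inverse)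
 ultimately show ?thesis by (intro exI[of _ "Abs_dual g"]) (simp add: hat_def)
qed

text \<open>A character of the commutative image attains the norm of \<open>j c\<close>. Composed
  with \<open>j\<close> it is bounded by the L^1-norm, so \<open>conv_character\<close> turns it
  into evaluation of \<open>hat\<close> at a point of the dual group.\<close>

theorem conv_norm_le_hat:
 fixes A :: "'a normed_star_alg" (structure)
 assumes A: "cstar_algebra A"
  and closed: "!!c. c:Cc ==> j c:carrier A"
  and add: "!!c d. [|c:Cc;d:Cc|] ==> j (%t. c t + d t) = j c\<oplus>j d"
  and scale: "!!z c. c:Cc ==> j (%t. z * c t) = z\<odot>j c"
  and mult: "!!c d. [|c:Cc;d:Cc|] ==> j (conv c d) = j c\<otimes>j d"
  and star: "!!c. c:Cc ==> j (cstar c) = star A (j c)"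
  and bound: "!!c. c:Cc ==> nrm A (j c) <= (\<integral>t. cmod (c t) \<partial>mu)"
  and c: "c:Cc" and b: "0 <= b" "!!ga. cmod (hat c ga) <= b"
 shows "nrm A (j c) <= b"
proof (cases "nrm A (j c) = 0")
 case True thus ?thesis using b by simp
next
 case False
 interpret A: cstar_algebra A by fact
 have comm: "j c\<otimes>j d = j d\<otimes>j c" if "c:Cc" "d:Cc" for c d
  using mult that cc_common[OF that] conv_commute by metis
 interpret commutative_subset A "j`Cc"
 proof
  show "j`Cc \<subseteq> carrier A" using closed by blast
  have "j (%t. 0 * 0) = 0\<odot>j (%_. 0)" by (rule scale[OF Cc_intros(1)])
  hence "j (%_. 0) = \<zero>" using closed[OF Cc_intros(1)] by simp
  thus "\<zero>:j`Cc" using Cc_intros(1) by (metis imageI)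
  fix x assume "x:j`Cc"
  then obtain c where c: "c:Cc" "x = j c" by blast
  show "k\<odot>x:j`Cc" for k using scale[OF c(1), of k] c Cc_intros(3) by (metis imageI)
  \<comment> \<open>The image is commutative and contains adjoints, so its elements are normal, and
    the C*-identity is applied to x x and to x* x.\<close>
  show "nrm A (x\<otimes>x) = (nrm A x)\<^sup>2"
  proof -
   have xC: "x:carrier A" using closed c by simp
   define y where "y = star A x"
   have y: "y:carrier A" "y\<otimes>x = x\<otimes>y"
    using comm[OF Cc_intros(6)[OF c(1)] c(1)] star[OF c(1)] c xC by (auto simp: y_def)
   have "(nrm A (x\<otimes>x))\<^sup>2 = nrm A ((y\<otimes>y)\<otimes>(x\<otimes>x))"
    using A.nrm_cstar[of "x\<otimes>x"] xC by (simp add: A.star_mult y_def)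
   also have "(y\<otimes>y)\<otimes>(x\<otimes>x) = (y\<otimes>x)\<otimes>(y\<otimes>x)"
    using xC y A.mult_assoc A.mult_closed by metis
   also have "...= star A (y\<otimes>x)\<otimes>(y\<otimes>x)"
    using xC y by (simp add: A.star_mult A.star_star y_def)
   also have "nrm A ...= (nrm A (y\<otimes>x))\<^sup>2" using A.nrm_cstar[of "y\<otimes>x"] xC y by simp
   also have "nrm A (y\<otimes>x) = (nrm A x)\<^sup>2" using A.nrm_cstar[OF xC] by (simp add: y_def)
   finally have "(nrm A (x\<otimes>x))\<^sup>2 = ((nrm A x)\<^sup>2)\<^sup>2" .
   thus ?thesis by (rule power2_eq_imp_eq) (simp_all add: A.nrm_nonneg[OF A.mult_closed[OF xC xC]])
  qed
  fix y assume "y:j`Cc"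
  then obtain d where d: "d:Cc" "y = j d" by blast
  show "x\<oplus>y:j`Cc" using add[OF c(1) d(1)] c d Cc_intros(2) by (metis imageI)
  show "x\<otimes>y:j`Cc" using mult[OF c(1) d(1)] c d Cc_intros(5) by (metis imageI)
  show "x\<otimes>y = y\<otimes>x" using comm[OF c(1) d(1)] c d by simp
 qed
 obtain xi where xi: "!!x y. [|x:j`Cc;y:j`Cc|] ==> xi (x\<oplus>y) = xi x + xi y" "!!k x. x:j`Cc ==> xi (k\<odot>x) = k * xi x"
  "!!x y. [|x:j`Cc;y:j`Cc|] ==> xi (x\<otimes>y) = xi x * xi y"
  "!!x. x:j`Cc ==> cmod (xi x) <= nrm A x" "cmod (xi (j c)) = nrm A (j c)"
  by (rule gelfand_character[OF imageI[OF c] False]) (rule that)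
 have "\<exists>ga. \<forall>d\<in>Cc. xi (j d) = hat d ga"
 proof (rule conv_character)
  fix c assume c: "c:Cc"
  show "cmod (xi (j c)) <= (\<integral>t. cmod (c t) \<partial>mu)" using xi(4)[OF imageI[OF c]] bound[OF c] by simp
  show "xi (j (%t. z * c t)) = z * xi (j c)" for z using scale[OF c] xi(2)[OF imageI[OF c]] by simp
  fix d assume d: "d:Cc"
  show "xi (j (%t. c t + d t)) = xi (j c) + xi (j d)" using add[OF c d] xi(1)[OF imageI[OF c] imageI[OF d]] by simp
  show "xi (j (conv c d)) = xi (j c) * xi (j d)" using mult[OF c d] xi(3)[OF imageI[OF c] imageI[OF d]] by simp
 next
  show "c:Cc" by fact
  show "xi (j c) ~= 0" using xi(5) False by auto
 qed
 then obtain ga where "xi (j c) = hat c ga" using c by blast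
 thus ?thesis using xi(5) b(2)[of ga] by simp
qed

end

section \<open>The Fock representation of the Cuntz algebra\<close>

lemma inner_cscale_ii [simp]: "inner (cscale \<i> z) z = 0"
proof -
 have "inner (cscale \<i> z) z = inner z (cscale (- \<i>) z)" unfolding inner_cscale by simp
 also have "cscale (- \<i>) z = - cscale \<i> z" by (rule coord_ext) simp
 finally show ?thesis by (simp add: inner_commute)
qed

lemma inner_cscale_ket: "inner (cscale \<i> (ket p)) x = Im (coord x p)"
proof -
 have "inner (cscale \<i> (ket p)) x = inner (ket p) (cscale (- \<i>) x)" by (simp add: inner_cscale)
 thus ?thesis by (simp add: inner_ket)
qed

text \<open>Real and imaginary part of a coordinate are inner products with \<open>ket p\<close> and
  with \<open>cscale \<i> (ket p)\<close>; the imaginary part vanishes because a vector is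
  orthogonal to its multiple by i for the real inner product.\<close>

lemma coord_adj_self:
 assumes "adj T S" "clin T"
 shows "coord (S (T (ket p))) p = complex_of_real ((norm (T (ket p)))\<^sup>2)"
proof (rule complex_eqI)
 have a: "inner u (S v) = inner (T u) v" for u v using assms(1) by (simp add: adj_def)
 have "Re (coord (S (T (ket p))) p) = inner (T (ket p)) (T (ket p))" by (simp add: inner_ket[symmetric] a)
 thus "Re (coord (S (T (ket p))) p) = Re (complex_of_real ((norm (T (ket p)))\<^sup>2))" by (simp add: power2_norm_eq_inner)
 have "Im (coord (S (T (ket p))) p) = inner (cscale \<i> (T (ket p))) (T (ket p))"
  using assms(2) by (simp add: inner_cscale_ket[symmetric] a clin_def)
 thus "Im (coord (S (T (ket p))) p) = Im (complex_of_real ((norm (T (ket p)))\<^sup>2))" by simp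
qed

locale cuntz = unital_cstar_algebra A for A :: "'a normed_star_alg" (structure) +
 fixes S :: "nat => 'a" and om :: "nat => 'd::ab_group_add"
 assumes S_closed: "S i:carrier A"
  and S_rel: "star A (S i)\<otimes>S j = (if i = j then \<one> else \<zero>)"
  and one_zero: "\<one> ~= \<zero>"
  and generated: "!!C. cstar_subalgebra C A ==> range S \<subseteq> C ==> C = carrier A"
begin

fun Sw :: "nat list => 'a" where
 "Sw [] = \<one>"
| "Sw (i#w) = S i\<otimes>Sw w"

lemma Sw_closed [simp]: "Sw w:carrier A"
 by (induction w) (auto simp: one_closed S_closed)

lemma Sw_append: "Sw (v@w) = Sw v\<otimes>Sw w"
 by (induction v) (simp_all add: one_mult mult_assoc S_closed)

lemma star_Sw_Cons: "star A (Sw (i#w)) = star A (Sw w)\<otimes>star A (S i)"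
 by (simp add: star_mult S_closed)

lemma S_cancel: "x:carrier A ==> star A (S i)\<otimes>(S j\<otimes>x) = (if i = j then x else \<zero>)"
 by (simp add: mult_assoc[symmetric] S_closed S_rel one_mult)

lemma Sw_cancel: "x:carrier A ==> star A (Sw w)\<otimes>(Sw w\<otimes>x) = x"
proof (induction w arbitrary: x)
 case Nil thus ?case by (simp add: star_one one_mult)
next
 case (Cons i w)
 have "star A (Sw (i#w))\<otimes>(Sw (i#w)\<otimes>x) = star A (Sw w)\<otimes>(star A (S i)\<otimes>(S i\<otimes>(Sw w\<otimes>x)))"
  using Cons.prems by (simp only: star_Sw_Cons) (simp add: mult_assoc S_closed)
 thus ?case using Cons by (simp add: S_cancel)
qed

lemma Sw_orth: "\<nexists>ka. w = v@ka ==> \<nexists>ka. v = w@ka ==> x:carrier A ==> star A (Sw v)\<otimes>(Sw w\<otimes>x) = \<zero>"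
proof (induction v arbitrary: w)
 case Nil thus ?case by simp
next
 case (Cons i v)
 then obtain j w' where w: "w = j#w'" by (cases w) auto
 have "star A (Sw (i#v))\<otimes>(Sw w\<otimes>x) = star A (Sw v)\<otimes>(star A (S i)\<otimes>(S j\<otimes>(Sw w'\<otimes>x)))"
  using Cons.prems w by (simp only: star_Sw_Cons) (simp add: mult_assoc S_closed)
 also have "...= \<zero>"
 proof (cases "i = j")
  case True
  have "star A (Sw v)\<otimes>(Sw w'\<otimes>x) = \<zero>" using Cons.prems w True by (intro Cons.IH) auto
  thus ?thesis using True Cons.prems by (simp add: S_cancel)
 next
  case False thus ?thesis using Cons.prems by (simp add: S_cancel)
 qed
 finally show ?case .
qed

definition mo :: "nat list => nat list => 'a"
 where "mo mu nu = Sw mu\<otimes>star A (Sw nu)"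

lemma mo_closed [simp]: "mo mu nu:carrier A" by (simp add: mo_def)

lemma star_mo: "star A (mo mu nu) = mo nu mu"
 by (simp add: mo_def star_mult star_star)

lemma mo_mult1: "mo mu nu\<otimes>mo (nu@ka) nu' = mo (mu@ka) nu'"
proof -
 have "mo mu nu\<otimes>mo (nu@ka) nu' = Sw mu\<otimes>(star A (Sw nu)\<otimes>(Sw nu\<otimes>(Sw ka\<otimes>star A (Sw nu'))))"
  by (simp add: mo_def Sw_append mult_assoc)
 thus ?thesis by (simp add: Sw_cancel) (simp add: mo_def Sw_append mult_assoc)
qed

lemma mo_mult2: "mo mu (nu@ka)\<otimes>mo nu nu' = mo mu (nu'@ka)"
proof -
 have "star A (mo mu (nu@ka)\<otimes>mo nu nu') = star A (mo mu (nu'@ka))"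
  by (simp add: star_mult star_mo mo_mult1)
 thus ?thesis by (metis mo_closed mult_closed star_star)
qed

lemma mo_mult0:
 assumes "\<nexists>ka. mu' = nu@ka" "\<nexists>ka. nu = mu'@ka"
 shows "mo mu nu\<otimes>mo mu' nu' = \<zero>"
proof -
 have "mo mu nu\<otimes>mo mu' nu' = Sw mu\<otimes>(star A (Sw nu)\<otimes>(Sw mu'\<otimes>star A (Sw nu')))"
  by (simp add: mo_def mult_assoc)
 thus ?thesis using Sw_orth[OF assms] by simp
qed

lemma nrm_one: "nrm A \<one> = 1"
proof -
 have "(nrm A \<one>)\<^sup>2 = nrm A \<one>" using nrm_cstar[OF one_closed] by (simp add: star_one one_mult one_closed)
 moreover have "nrm A \<one> ~= 0" using nrm_eq_0[OF one_closed] one_zero by simp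
 ultimately show ?thesis by (simp add: Power.power2_eq_square)
qed

lemma nrm_Sw: "nrm A (Sw w) = 1"
proof -
 have "star A (Sw w)\<otimes>Sw w = \<one>" using Sw_cancel[OF one_closed, of w] by (simp add: mult_one)
 hence "(nrm A (Sw w))\<^sup>2 = 1" using nrm_cstar[OF Sw_closed, of w] by (simp add: nrm_one)
 thus ?thesis using nrm_nonneg[OF Sw_closed, of w] by (simp add: power2_eq_1_iff)
qed

lemma nrm_mo: "nrm A (mo mu nu) <= 1"
 using nrm_mult[of "Sw mu" "star A (Sw nu)"] by (simp add: mo_def nrm_star nrm_Sw)

text \<open>Constant coefficients: the instance of the abstract system in which the group does not
  appear yet.\<close>

definition Mon :: "nat list => nat list => ('a\<times>('d => complex)) set"
 where "Mon mu nu = {(z\<odot>mo mu nu, %_. z) | z. True}"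

sublocale mon: monomials A om Mon
proof
 fix mu nu a C assume "(a, C):Mon mu nu"
 then obtain z where z: "a = z\<odot>mo mu nu" "C = (%_. z)" by (auto simp: Mon_def)
 show "a:carrier A \<and> bfun C" using z by (simp add: bfun_intros)
 show "nrm A a <= c" if "0 <= c" "!!ga. cmod (C ga) <= c" for c
 proof -
  have "nrm A a <= cmod z * 1" using z nrm_mo[of mu nu] unfolding z(1) nrm_smult[OF mo_closed] by (intro mult_left_mono) auto
  thus ?thesis using that(2)[of undefined] z by simp
 qed
 show "(star A a, %ga. cnj (C ga)):Mon nu mu" using z by (auto simp: Mon_def star_smult star_mo)
next
 fix mu nu
 show "(\<zero>, %_. 0):Mon mu nu" unfolding Mon_def by (intro CollectI exI[of _ 0]) simp
 fix a C b D assume "(a, C):Mon mu nu" "(b, D):Mon mu nu"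
 thus "(a\<oplus>b, %ga. C ga + D ga):Mon mu nu" by (auto simp: Mon_def add_scale[symmetric])
next
 fix mu nu nu' ka a C b D assume "(a, C):Mon mu nu" "(b, D):Mon (nu@ka) nu'"
 thus "(a\<otimes>b, %ga. C (ga + wt om ka) * D ga):Mon (mu@ka) nu'"
  by (auto simp: Mon_def smult_mult_left smult_mult_right scale_scale mo_mult1 ab_semigroup_mult_class.mult.commute)
next
 fix mu nu nu' ka a C b D assume "(a, C):Mon mu (nu@ka)" "(b, D):Mon nu nu'"
 thus "(a\<otimes>b, %ga. C ga * D (ga + wt om ka)):Mon mu (nu'@ka)"
  by (auto simp: Mon_def smult_mult_left smult_mult_right scale_scale mo_mult2 ab_semigroup_mult_class.mult.commute)
next
 fix mu nu mu' nu' a C b D assume "(a, C):Mon mu nu" "(b, D):Mon mu' nu'" "\<nexists>ka. mu' = nu@ka" "\<nexists>ka. nu = mu'@ka"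
 thus "a\<otimes>b = \<zero>"
  using mo_mult0[of mu' nu mu nu'] by (auto simp: Mon_def smult_mult_left smult_mult_right)
qed

abbreviation "Rep \<equiv> mon.Lin UNIV"

lemma Rep_mo: "(z\<odot>mo mu nu, Top om mu nu (%_. z)):Rep"
 by (rule mon.Lin_mon) (auto simp: Mon_def)

lemma Rep_scale: "(x, T):Rep ==> (c\<odot>x, cscaleL c o\<^sub>L T):Rep"
proof (induction rule: mon.Lin.induct)
 case zero
 have "cscaleL c o\<^sub>L 0 = 0" by (intro blinfun_eqI coord_ext) simp
 thus ?case using mon.Lin.zero by simp
next
 case (step x T mu nu a C)
 from step(3) obtain z where z: "a = z\<odot>mo mu nu" "C = (%_. z)" by (auto simp: Mon_def)
 have "c\<odot>(a\<oplus>x) = (c * z)\<odot>mo mu nu\<oplus>c\<odot>x" using z mon.Lin_closed[OF step(1)] by (simp add: scale_add scale_scale)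
 moreover have "cscaleL c o\<^sub>L (Top om mu nu C + T) = Top om mu nu (%_. c * z) + (cscaleL c o\<^sub>L T)"
  unfolding z Top_scale[OF bfun_intros(1)] by (intro blinfun_eqI coord_ext) (simp add: blinfun.add_left algebra_simps)
 ultimately show ?case using mon.Lin.step[OF step(4) UNIV_I, of "(c * z)\<odot>mo mu nu" "%_. c * z" mu nu]
   unfolding Mon_def by auto
qed

lemma Rep_star: "(x, T):Rep ==> (star A x, star bop T):Rep"
 using mon.Lin_star[of x T UNIV] by simp

lemma Rep_mult: "(x, T):Rep ==> (y, U):Rep ==> (x\<otimes>y, T o\<^sub>L U):Rep"
 by (rule mon.Lin_mult) (auto simp: mon.comp_closed_def)

lemma Rep_dense: "nclosure A (fst`Rep) = carrier A"
proof (rule generated)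
 show "cstar_subalgebra (nclosure A (fst`Rep)) A"
 proof (rule nclosure_subalgebra)
  show "fst`Rep \<subseteq> carrier A" using mon.Lin_closed by auto
  show "\<zero>:fst`Rep" using mon.Lin.zero by (metis fst_conv imageI)
  fix x assume "x:fst`Rep"
  then obtain T where xT: "(x, T):Rep" by auto
  show "c\<odot>x:fst`Rep" for c using Rep_scale[OF xT] by (metis fst_conv imageI)
  show "star A x:fst`Rep" using Rep_star[OF xT] by (metis fst_conv imageI)
  fix y assume "y:fst`Rep"
  then obtain U where yU: "(y, U):Rep" by auto
  show "x\<oplus>y:fst`Rep" using mon.Lin_add[OF xT yU] by (metis fst_conv imageI)
  show "x\<otimes>y:fst`Rep" using Rep_mult[OF xT yU] by (metis fst_conv imageI)
 qed
 show "range S \<subseteq> nclosure A (fst`Rep)"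
 proof
  fix y assume "y:range S"
  then obtain i where y: "y = S i" by blast
  have "S i = 1\<odot>mo [i] []" by (simp add: mo_def star_one mult_one S_closed one_closed)
  hence "S i:fst`Rep" using Rep_mo[of 1 "[i]" "[]"] by (metis fst_conv imageI)
  moreover have "fst`Rep \<subseteq> carrier A" using mon.Lin_closed by auto
  ultimately show "y:nclosure A (fst`Rep)" using nclosure_subset y by blast
 qed
qed

text \<open>Compression by a generator that does not occur in \<open>x\<close> extracts the vacuum expectation.\<close>

lemma compression:
 "(x, T):Rep ==> \<exists>N. \<forall>k\<ge>N. star A (S k)\<otimes>(x\<otimes>S k) = coord (T (ket (ga, []))) (ga, [])\<odot>\<one>"
proof (induction rule: mon.Lin.induct)
 case zero thus ?case by (simp add: S_closed one_closed)
next
 case (step x T mu nu a C)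
 from step(4) obtain N where N: "!!k. k >= N ==> star A (S k)\<otimes>(x\<otimes>S k) = coord (T (ket (ga, []))) (ga, [])\<odot>\<one>" by blast
 from step(3) obtain z where z: "a = z\<odot>mo mu nu" "C = (%_. z)" by (auto simp: Mon_def)
 note c = mon.Lin_closed[OF step(1)]
 \<comment> \<open>From here on \<open>k\<close> is larger than every letter of the monomial, so the
   adjoint of \<open>S k\<close> annihilates \<open>Sw mu\<close> from the left unless
   \<open>mu\<close> is empty, and similarly for \<open>nu\<close>.\<close>
 define M where "M = Suc (Max (insert 0 (set mu\<union>set nu)))"
 have M: "k\<notin>set mu\<union>set nu" if k: "k >= M" for k
 proof
  assume "k:set mu\<union>set nu"
  hence "k <= Max (insert 0 (set mu\<union>set nu))" by (intro Max_ge) auto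
  thus False using k by (simp add: M_def)
 qed
 have entry: "coord (Top om mu nu C (ket (ga, []))) (ga, []) = (if mu = [] \<and> nu = [] then z else 0)"
  by (simp add: z Top_entry bfun_intros)
 have mo_k: "star A (S k)\<otimes>(mo mu nu\<otimes>S k) = (if mu = [] \<and> nu = [] then \<one> else \<zero>)" if k: "k >= M" for k
 proof -
  have e: "star A (S k)\<otimes>(mo mu nu\<otimes>S k) = (star A (S k)\<otimes>Sw mu)\<otimes>(star A (Sw nu)\<otimes>S k)"
   by (simp add: mo_def mult_assoc S_closed)
  have l: "star A (S k)\<otimes>Sw mu = \<zero>" if ne: "mu ~= []"
  proof -
   obtain i w where i: "mu = i#w" using ne by (cases mu) auto
   hence "k ~= i" using M[OF k] by auto
   thus ?thesis by (simp add: i S_cancel)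
  qed
  have r: "star A (Sw nu)\<otimes>S k = \<zero>" if ne: "nu ~= []"
  proof -
   obtain i w where i: "nu = i#w" using ne by (cases nu) auto
   hence "k ~= i" using M[OF k] by auto
   hence "star A (S i)\<otimes>S k = \<zero>" by (simp add: S_rel)
   thus ?thesis by (simp only: i star_Sw_Cons) (simp add: mult_assoc S_closed)
  qed
  show ?thesis
  proof (cases "mu = [] \<and> nu = []")
   case True
   thus ?thesis by (simp add: mo_def star_one one_mult one_closed S_closed S_rel)
  next
   case False
   thus ?thesis unfolding e using l r by (cases "mu = []") (auto simp: S_closed one_closed)
  qed
 qed
 have "star A (S k)\<otimes>((a\<oplus>x)\<otimes>S k) = coord ((Top om mu nu C + T) (ket (ga, []))) (ga, [])\<odot>\<one>" if k: "k >= max N M" for k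
 proof -
  have "star A (S k)\<otimes>((a\<oplus>x)\<otimes>S k) = z\<odot>(star A (S k)\<otimes>(mo mu nu\<otimes>S k))\<oplus>star A (S k)\<otimes>(x\<otimes>S k)"
   using c by (simp add: z mult_l_distr mult_r_distr smult_mult_left smult_mult_right S_closed)
  also have "z\<odot>(star A (S k)\<otimes>(mo mu nu\<otimes>S k)) = (if mu = [] \<and> nu = [] then z else 0)\<odot>\<one>"
   using mo_k[of k] k by (simp add: one_closed)
  finally show ?thesis using N[of k] k entry by (simp add: blinfun.add_left add_scale one_closed)
 qed
 thus ?case by blast
qed

text \<open>Applied to x* x, the compression turns a vacuum expectation into the square of a norm of
  \<open>A\<close>; the expectation of the corresponding operator is the squared norm of the image
  of the vacuum.\<close>

lemma compression_norm:
 assumes "(x, T):Rep"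
 shows "\<exists>N. \<forall>k\<ge>N. nrm A (x\<otimes>S k) = norm (T (ket (ga, [])))"
proof -
 obtain T' where T': "adj T T'" "clin T" using mon.Lin_closed[OF assms] by (auto simp: bop_carrier)
 have sq: "(star A x\<otimes>x, T' o\<^sub>L T):Rep"
  using Rep_mult[OF Rep_star[OF assms] assms] by (simp add: star_bop[OF T'(1)])
 obtain N where N: "!!k. k >= N ==> star A (S k)\<otimes>((star A x\<otimes>x)\<otimes>S k) = coord ((T' o\<^sub>L T) (ket (ga, []))) (ga, [])\<odot>\<one>"
  using compression[OF sq] by blast
 have xC: "x:carrier A" using mon.Lin_closed[OF assms] by blast
 have "nrm A (x\<otimes>S k) = norm (T (ket (ga, [])))" if k: "k >= N" for k
 proof -
  have "(nrm A (x\<otimes>S k))\<^sup>2 = nrm A (star A (S k)\<otimes>((star A x\<otimes>x)\<otimes>S k))"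
   using nrm_cstar[of "x\<otimes>S k"] xC by (simp add: star_mult S_closed mult_assoc)
  also have "...= (norm (T (ket (ga, []))))\<^sup>2"
   using N[OF k] coord_adj_self[OF T'] by (simp add: nrm_smult one_closed nrm_one norm_power del: of_real_power)
  finally show ?thesis using xC by (simp add: power2_eq_iff_nonneg nrm_nonneg S_closed)
 qed
 thus ?thesis by blast
qed

text \<open>The vacuum of each block is cyclic: prepending \<open>w\<close> carries it to the basis
  vector at \<open>w\<close>.\<close>

lemma vacuum_vector:
 assumes "finite F"
 shows "\<exists>a U. (a, U):Rep \<and> U (ket (ga, [])) = (\<Sum>w\<in>F. cscale (xi w) (ket (ga, w)))"
 using assms
proof (induction F rule: finite_induct)
 case empty thus ?case by (intro exI[of _ \<zero>] exI[of _ 0]) (simp add: mon.Lin.zero)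
next
 case (insert w F)
 then obtain a U where aU: "(a, U):Rep" "U (ket (ga, [])) = (\<Sum>w\<in>F. cscale (xi w) (ket (ga, w)))" by blast
 have "Top om w [] (%_. xi w) (ket (ga, [])) = cscale (xi w) (ket (ga, w))"
 proof (rule coord_ext)
  fix p :: "'d\<times>nat list"
  show "coord (Top om w [] (%_. xi w) (ket (ga, []))) p = coord (cscale (xi w) (ket (ga, w))) p"
   by (cases p) (auto simp: Top_entry bfun_intros coord_ket)
 qed
 thus ?case using mon.Lin_add[OF Rep_mo[of "xi w" w "[]"] aU(1)] aU(2) insert.hyps
  by (intro exI[of _ "xi w\<odot>mo w []\<oplus>a"] exI[of _ "Top om w [] (%_. xi w) + U"]) (simp add: blinfun.add_left)
qed

lemma Rep_block: "(x, T):Rep ==> (!!v. coord y (ga, v) = 0) ==> coord (T y) (ga, v) = 0"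
proof (induction arbitrary: v rule: mon.Lin.induct)
 case (step x T mu nu a C)
 thus ?case using mon.Mon_closed[OF step(3)] by (simp add: blinfun.add_left coord_Top)
qed simp

text \<open>A finitely supported vector of one block is the image of its vacuum under some operator
  \<open>U\<close> with counterpart \<open>a\<close>. For large k, \<open>compression_norm\<close>
  identifies |T U vacuum| with |x a S_k| and |U vacuum| with |a S_k|, and submultiplicativity in
  \<open>A\<close> compares the two. The blocks are orthogonal and invariant, so the estimate
  extends to all finitely supported vectors by Pythagoras.\<close>

lemma Rep_norm_ge:
 assumes xT: "(x, T):Rep"
 shows "norm T <= nrm A x"
proof (rule blinfun_norm_le_restr)
 have xC: "x:carrier A" using mon.Lin_closed[OF xT] by blast
 show n0: "0 <= nrm A x" by (rule nrm_nonneg[OF xC])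
 fix F :: "('d\<times>nat list) set" and y z assume F: "finite F"
 define G where "G = fst`F"
 have G: "finite G" using F by (simp add: G_def)
 define f where "f ga = restr {p\<in>F. fst p = ga} y" for ga
 have Ff: "finite {p\<in>F. fst p = ga}" for ga using F by simp
 have cf: "coord (f ga) (de, v) = (if (de, v):F \<and> de = ga then coord y (de, v) else 0)" for ga de v
  by (simp add: f_def coord_restr[OF Ff])
 have sumf: "restr F y = (\<Sum>ga\<in>G. f ga)"
 proof (rule coord_ext)
  fix p :: "'d\<times>nat list"
  obtain de v where p: "p = (de, v)" by (cases p)
  have "(\<Sum>ga\<in>G. coord (f ga) (de, v)) = (\<Sum>ga\<in>G. if ga = de then (if (de, v):F then coord y (de, v) else 0) else 0)"
   by (rule sum.cong) (auto simp: cf)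
  also have "...= (if (de, v):F then coord y (de, v) else 0)" using G by (auto simp: G_def image_iff)
  finally show "coord (restr F y) p = coord (\<Sum>ga\<in>G. f ga) p" by (simp add: p coord_restr[OF F])
 qed
 have single: "norm (T (f ga)) <= nrm A x * norm (f ga)" for ga
 proof -
  have "finite (snd`{p\<in>F. fst p = ga})" using F by simp
  from vacuum_vector[OF this, of ga "%w. coord y (ga, w)"]
  obtain a U where aU: "(a, U):Rep" "U (ket (ga, [])) = (\<Sum>w\<in>snd`{p\<in>F. fst p = ga}. cscale (coord y (ga, w)) (ket (ga, w)))" by blast
  have inj: "inj_on snd {p\<in>F. fst p = ga}" by (auto simp: inj_on_def prod_eq_iff)
  have Uf: "U (ket (ga, [])) = f ga"
   unfolding aU(2) f_def restr_def sum.reindex[OF inj] by (rule sum.cong) auto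
  have aC: "a:carrier A" using mon.Lin_closed[OF aU(1)] by blast
  obtain N where N: "!!k. k >= N ==> nrm A (a\<otimes>S k) = norm (U (ket (ga, [])))" using compression_norm[OF aU(1)] by blast
  obtain N' where N': "!!k. k >= N' ==> nrm A ((x\<otimes>a)\<otimes>S k) = norm ((T o\<^sub>L U) (ket (ga, [])))" using compression_norm[OF Rep_mult[OF xT aU(1)]] by blast
  define k where "k = max N N'"
  have "norm (T (f ga)) = nrm A (x\<otimes>(a\<otimes>S k))" using N'[of k] xC aC by (simp add: k_def Uf mult_assoc S_closed)
  also have "...<= nrm A x * nrm A (a\<otimes>S k)" using xC aC by (intro nrm_mult) (auto simp: S_closed)
  also have "nrm A (a\<otimes>S k) = norm (f ga)" using N[of k] by (simp add: k_def Uf)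
  finally show ?thesis .
 qed
 have orth: "inner u w = 0" if "!!de v. de ~= ga ==> coord u (de, v) = 0" "!!v. coord w (ga, v) = 0" for u w :: "('d\<times>nat list) ell2" and ga
 proof -
  have "inner (coord u p) (coord w p) = 0" for p using that by (cases p, cases "fst p = ga") auto
  thus ?thesis unfolding inner_ell2_coord by simp
 qed
 have pyth: "(norm (\<Sum>ga\<in>G. h ga))\<^sup>2 = (\<Sum>ga\<in>G. (norm (h ga))\<^sup>2)"
  if h: "!!ga de v. de ~= ga ==> coord (h ga) (de, v) = 0" for h :: "'d => ('d\<times>nat list) ell2"
 proof (rule norm_sum_Pythagorean[OF G])
  show "pairwise (%ga de. orthogonal (h ga) (h de)) G"
   unfolding pairwise_def orthogonal_def using orth h by metis
 qed
 have "(norm (T (restr F y)))\<^sup>2 = (norm (\<Sum>ga\<in>G. T (f ga)))\<^sup>2" by (simp add: sumf blinfun.sum_right)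
 also have "...= (\<Sum>ga\<in>G. (norm (T (f ga)))\<^sup>2)" by (rule pyth) (rule Rep_block[OF xT], simp add: cf)
 also have "...<= (\<Sum>ga\<in>G. (nrm A x * norm (f ga))\<^sup>2)" by (intro sum_mono power_mono single) simp
 also have "...= (nrm A x)\<^sup>2 * (norm (\<Sum>ga\<in>G. f ga))\<^sup>2" 
  by (subst pyth) (auto simp: cf power_mult_distrib sum_distrib_left)
 finally have "(norm (T (restr F y)))\<^sup>2 <= (nrm A x * norm (restr F y))\<^sup>2" by (simp add: sumf power_mult_distrib)
 hence Tle: "norm (T (restr F y)) <= nrm A x * norm (restr F y)" by (rule power2_le_imp_le) (simp add: n0)
 have "\<bar>inner (T (restr F y)) (restr F z)\<bar> <= norm (T (restr F y)) * norm (restr F z)" by (rule Cauchy_Schwarz_ineq2)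
 also have "...<= nrm A x * norm (restr F y) * norm (restr F z)" using Tle by (intro mult_right_mono) auto
 finally show "\<bar>inner (T (restr F y)) (restr F z)\<bar> <= nrm A x * norm (restr F y) * norm (restr F z)" .
qed

lemma Rep_norm: "(x, T):Rep ==> nrm A x = norm T"
 using Rep_norm_ge mon.Lin_norm by (intro antisym) auto

lemma fock_representation:
 obtains Phi where "star_hom A bop Phi" "!!x. x:carrier A ==> norm (Phi x) = nrm A x"
  "!!mu nu. Phi (mo mu nu) = Top om mu nu (%_. 1)"
proof (rule isometric_extension[OF cstar_algebra_axioms cstar_algebra_bop, of Rep])
 fix a T b U assume aT: "(a, T):Rep"
 show "a:carrier A \<and> T:carrier bop \<and> nrm A a = nrm bop T" using mon.Lin_closed[OF aT] Rep_norm[OF aT] by simp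
 show "(c\<odot>a, c\<odot>\<^bsub>bop\<^esub>T):Rep" for c using Rep_scale[OF aT] by simp
 show "(star A a, star bop T):Rep" by (rule Rep_star[OF aT])
 assume bU: "(b, U):Rep"
 show "(a\<oplus>b, T\<oplus>\<^bsub>bop\<^esub>U):Rep" using mon.Lin_add[OF aT bU] by simp
 show "(a\<otimes>b, T\<otimes>\<^bsub>bop\<^esub>U):Rep" using Rep_mult[OF aT bU] by simp
next
 fix x e assume x: "x:carrier A" "(0::real) < e"
 have sub: "fst`Rep \<subseteq> carrier A" using mon.Lin_closed by auto
 have "x:nclosure A (fst`Rep)" using x Rep_dense by simp
 then obtain y where "y:fst`Rep" "nrm A (y\<ominus>x) < e" using x(2) unfolding nclosure_iff[OF sub] by blast
 thus "\<exists>(a, T)\<in>Rep. nrm A (a\<ominus>x) < e" by force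
next
 fix Phi assume h: "star_hom A bop Phi" "!!x. x:carrier A ==> nrm bop (Phi x) = nrm A x" "!!a T. (a, T):Rep ==> Phi a = T"
 show thesis
 proof (rule that[OF h(1)])
  show "norm (Phi x) = nrm A x" if "x:carrier A" for x using h(2)[OF that] by simp
  show "Phi (mo mu nu) = Top om mu nu (%_. 1)" for mu nu using h(3)[OF Rep_mo[of 1 mu nu]] by simp
 qed
qed

end

section \<open>Continuous functions with values in the Cuntz algebra\<close>

locale crossed = haar mu + cuntz A S om
 for mu :: "'g::{topological_ab_group_add, t2_space} measure" and A :: "'a normed_star_alg" (structure)
  and S :: "nat => 'a" and om :: "nat => 'g dual" +
 fixes al :: "'g => 'a => 'a" and Phi :: "'a => ('g dual\<times>nat list) bop"
 assumes action: "cstar_action A al"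
  and al_S: "al t (S i) = pairing t (om i)\<odot>S i"
  and Phi_hom: "star_hom A bop Phi" and Phi_norm: "x:carrier A ==> norm (Phi x) = nrm A x"
  and Phi_mo: "Phi (mo mu' nu') = Top om mu' nu' (%_. 1)"
begin

lemma al_hom: "star_hom A A (al t)"
 using action by (simp add: cstar_action_def star_iso_def)

lemmas alD = star_homD[OF al_hom]

lemma al_closed [simp]: "x:carrier A ==> al t x:carrier A" by (rule alD(1))

lemma al_diff: "x:carrier A ==> y:carrier A ==> al t (x\<ominus>y) = al t x\<ominus>al t y"
 by (simp add: diff_scale alD)

lemma al_zero [simp]: "al t \<zero> = \<zero>"
 using alD(3)[of \<zero> t 0] by simp

lemma al_one: "al t \<one> = \<one>"
proof -
 have "\<one>:al t`carrier A"
  using action one_closed by (simp add: cstar_action_def star_iso_def bij_betw_def)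
 then obtain y where y: "y:carrier A" "al t y = \<one>" by (metis imageE)
 have "al t \<one> = al t \<one>\<otimes>al t y" unfolding y(2) by (rule mult_one[symmetric]) (simp add: one_closed)
 also have "...= al t (\<one>\<otimes>y)" by (rule alD(4)[OF one_closed y(1), symmetric])
 finally show ?thesis using y by (simp add: one_mult)
qed

lemmas PhiD' = star_homD[OF Phi_hom]

lemma PhiD: "x:carrier A ==> Phi x:carrier bop" "x:carrier A ==> y:carrier A ==> Phi (x\<oplus>y) = Phi x + Phi y"
 "x:carrier A ==> Phi (c\<odot>x) = cscaleL c o\<^sub>L Phi x" "x:carrier A ==> y:carrier A ==> Phi (x\<otimes>y) = Phi x o\<^sub>L Phi y"
 "x:carrier A ==> y:carrier A ==> Phi (x\<ominus>y) = Phi x - Phi y" "Phi \<zero> = 0"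
proof -
 show "x:carrier A ==> Phi x:carrier bop" by (rule PhiD'(1))
 show add: "x:carrier A ==> y:carrier A ==> Phi (x\<oplus>y) = Phi x + Phi y" for x y using PhiD'(2) by simp
 show sc: "x:carrier A ==> Phi (c\<odot>x) = cscaleL c o\<^sub>L Phi x" for c x using PhiD'(3) by simp
 show "x:carrier A ==> y:carrier A ==> Phi (x\<otimes>y) = Phi x o\<^sub>L Phi y" using PhiD'(4) by simp
 have m: "cscaleL (- 1) o\<^sub>L T = - T" for T :: "('g dual\<times>nat list) bop"
  by (intro blinfun_eqI coord_ext) (simp add: blinfun.minus_left)
 show "x:carrier A ==> y:carrier A ==> Phi (x\<ominus>y) = Phi x - Phi y" by (simp add: diff_scale add sc m)
 show "Phi \<zero> = 0" using Phi_norm[of \<zero>] by simp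
qed

text \<open>If \<open>x\<^sup>* x\<close> had smaller norm than its image, \<open>1\<close> minus the normalised image of \<open>x\<^sup>* x\<close> would be
 bounded below, and the image of \<open>x\<close> could not attain its norm.\<close>

lemma al_nrm:
 assumes x: "x:carrier A"
 shows "nrm A (al t x) <= nrm A x"
proof (rule ccontr)
 assume less: "\<not> ?thesis"
 define T where "T = Phi (al t x)"
 define N where "N = (norm T)\<^sup>2"
 define h where "h = complex_of_real (1/N)\<odot>(star A x\<otimes>x)"
 define P where "P = Phi (al t h)"
 have nT: "norm T > nrm A x" "nrm A x >= 0" using less x by (simp_all add: T_def Phi_norm nrm_nonneg)
 hence N0: "N > 0" unfolding N_def by (intro zero_less_power) linarith
 have "(nrm A x)\<^sup>2 < N" using nT unfolding N_def by (intro power_strict_mono) auto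
 hence h: "h:carrier A" "nrm A h < 1"
  using x N0 by (simp_all add: h_def nrm_smult nrm_cstar norm_divide divide_less_eq)
 obtain g where g: "g:carrier A" "g\<otimes>(\<one>\<ominus>h) = \<one>" using neumann_inverse[OF h] .
 define G where "G = max 1 (norm (Phi (al t g)))"
 have Tc: "T:carrier bop" using PhiD(1) x by (simp add: T_def)
 then obtain T' where adj: "adj T T'" by (auto simp: bop_carrier)
 have P_eq: "P u = (1/N) *\<^sub>R T' (T u)" for u
  using x star_bop[OF adj] by (auto simp: P_def h_def alD PhiD PhiD'(5) T_def intro!: coord_ext)
 have nP: "norm (P u) <= norm u" for u
  using norm_blinfun[of "T' o\<^sub>L T" u] N0 by (simp add: P_eq adj_norm_cstar[OF adj] N_def[symmetric] field_simps)
 have one: "Phi \<one> u = u" for u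
  using Phi_mo[of "[]" "[]"] by (auto simp: mo_def star_one mult_one one_closed coord_Top bfun_intros intro!: coord_ext)
 have "Phi (al t g) o\<^sub>L (Phi \<one> - P) = Phi (al t (g\<otimes>(\<one>\<ominus>h)))"
  using g(1) h one_closed by (simp add: P_def alD(4) al_diff al_one PhiD)
 hence inv: "Phi (al t g) (u - P u) = u" for u
  unfolding g(2) al_one by (metis blinfun_apply_blinfun_compose blinfun.diff_left one)
 \<comment> \<open>Expanding |u - P u|^2 with <u, P u> = |T u|^2 / N and |P u| <= |u| turns the
   lower bound |u| <= G |u - P u| into an upper bound for |T u|^2 that is smaller than N |u|^2 by
   the fraction 1/(2 G^2). As G >= 1, this fraction lies between 0 and 1.\<close>
 have bound: "(norm (T u))\<^sup>2 <= N * (1 - 1/(2 * G\<^sup>2)) * (norm u)\<^sup>2" for u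
 proof -
  have "norm u <= norm (Phi (al t g)) * norm (u - P u)" using norm_blinfun[of "Phi (al t g)" "u - P u"] by (simp add: inv)
  also have "...<= G * norm (u - P u)" by (simp add: G_def mult_right_mono)
  finally have "(norm u)\<^sup>2 <= (G * norm (u - P u))\<^sup>2" by (simp add: power_mono)
  also have "...= G\<^sup>2 * (norm (u - P u))\<^sup>2" by (simp add: power_mult_distrib)
  also have "(norm (u - P u))\<^sup>2 = (norm u)\<^sup>2 + (norm (P u))\<^sup>2 - 2 * inner u (P u)"
   by (simp add: power2_norm_eq_inner inner_diff_left inner_diff_right inner_commute)
  also have "inner u (P u) = (norm (T u))\<^sup>2/N"
   using adj by (simp add: P_eq adj_def power2_norm_eq_inner)
  also have "G\<^sup>2 * ((norm u)\<^sup>2 + (norm (P u))\<^sup>2 - 2 * ((norm (T u))\<^sup>2/N)) <= G\<^sup>2 * (2 * (norm u)\<^sup>2 - 2 * ((norm (T u))\<^sup>2/N))"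
   using power_mono[OF nP[of u], of 2] by (simp add: mult_left_mono)
  finally show ?thesis using N0 by (simp add: G_def field_simps)
 qed
 have "1 <= G\<^sup>2" using one_le_power[of G 2] by (simp add: G_def)
 hence G1: "1/(2 * G\<^sup>2) <= 1" "0 < 1/(2 * G\<^sup>2)" by (auto simp: divide_simps)
 define q where "q = N * (1 - 1/(2 * G\<^sup>2))"
 have q: "0 <= q" "q < N" using N0 G1 by (simp_all add: q_def)
 have "norm T <= sqrt q"
 proof (rule norm_blinfun_bound)
  show "norm (T u) <= sqrt q * norm u" for u
   using real_sqrt_le_mono[OF bound[of u, folded q_def]] by (simp add: real_sqrt_mult)
 qed (use q in simp)
 also have "...< sqrt N" using q by simp
 finally show False by (simp add: N_def)
qed

lemma al_Sw: "al t (Sw w) = pairing t (wt om w)\<odot>Sw w"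
 by (induction w)
  (simp_all add: al_one pairing_simps one_closed alD(4) S_closed al_S smult_mult_left smult_mult_right scale_scale mult.commute)

text \<open>The character by which the action scales the monomial with words \<open>v\<close> and
  \<open>w\<close>; see \<open>al_mo\<close>.\<close>

definition pw :: "nat list => nat list => 'g => complex"
 where "pw v w t = pairing t (wt om v - wt om w)"

lemma al_mo: "al t (mo mu' nu') = pw mu' nu' t\<odot>mo mu' nu'"
proof -
 have "wt om mu' - wt om nu' = wt om mu' + - wt om nu'" by simp
 hence "pw mu' nu' t = pairing t (wt om mu') * cnj (pairing t (wt om nu'))"
  unfolding pw_def by (simp only: pairing_simps)
 thus ?thesis
  by (simp add: mo_def alD(4,5) al_Sw star_smult smult_mult_left smult_mult_right scale_scale mult.commute)
qed

lemma pw_cont: "continuous_on UNIV (pw mu' nu')"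
 unfolding pw_def by (rule pairing_simps)

lemma Phi_inj: "x:carrier A ==> y:carrier A ==> Phi x = Phi y ==> x = y"
 using Phi_norm[of "x\<ominus>y"] PhiD(5)[of x y] nrm_eq_0[of "x\<ominus>y"] by (simp add: diff_eq_zero)

lemma nrm_diff_Phi: "x:carrier A ==> y:carrier A ==> nrm A (x\<ominus>y) = norm (Phi x - Phi y)"
 using Phi_norm[of "x\<ominus>y"] PhiD(5)[of x y] by simp

text \<open>\<open>Phi\<close> is isometric with values in a normed space type, so continuity of
  functions into \<open>A\<close> is treated from here on by the ordinary continuity rules for
  operators.\<close>

lemma nrm_continuous_Phi: "(!!t. f t:carrier A) ==> nrm_continuous A f \<longleftrightarrow> continuous_on UNIV (%t. Phi (f t))"
 by (simp add: nrm_continuous_def continuous_on_def nrm_diff_Phi LIM_zero_iff tendsto_norm_zero_iff)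

section \<open>Compactly supported functions into the Cuntz algebra\<close>

definition CL :: "'g set => ('g => 'a) => bool"
 where "CL K f \<longleftrightarrow> compact K \<and> (\<forall>t. f t:carrier A) \<and> nrm_continuous A f \<and> (\<forall>t. t\<notin>K --> f t = \<zero>)"

lemma CLD:
 assumes "CL K f"
 shows "compact K" "f t:carrier A" "continuous_on UNIV (%t. Phi (f t))" "t\<notin>K ==> f t = \<zero>"
 using assms nrm_continuous_Phi[of f] by (auto simp: CL_def)

lemma CLI:
 assumes "compact K" "!!t. f t:carrier A" "continuous_on UNIV (%t. Phi (f t))" "!!t. t\<notin>K ==> f t = \<zero>"
 shows "CL K f"
 using assms nrm_continuous_Phi[of f] by (auto simp: CL_def)

lemma CL_mono: "CL K f ==> K \<subseteq> L ==> compact L ==> CL L f"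
 by (auto simp: CL_def)

lemma CL_nrm_cont: assumes "CL K f" shows "continuous_on UNIV (%t. nrm A (f t))"
proof -
 have "(%t. nrm A (f t)) = (%t. norm (Phi (f t)))" using Phi_norm CLD(2)[OF assms] by simp
 thus ?thesis using continuous_on_norm[OF CLD(3)[OF assms]] by (simp only:)
qed

lemma CL_nrm_int: assumes "CL K f" shows "integrable mu (%t. nrm A (f t))"
 by (rule integrable_supp[OF CL_nrm_cont[OF assms] CLD(1)[OF assms]]) (simp add: CLD(4)[OF assms])

lemma CL_add: assumes "CL K f" "CL K g" shows "CL K (%t. f t\<oplus>g t)"
 by (rule CLI) (use CLD[OF assms(1)] CLD[OF assms(2)] in "simp_all add: PhiD continuous_on_add")

lemma CL_zero: "compact K ==> CL K (%_. \<zero>)"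
 by (rule CLI) (simp_all add: PhiD)

lemma continuous_cscaleL:
 assumes "continuous_on UNIV c" "continuous_on UNIV (F::'g => 'i bop)"
 shows "continuous_on UNIV (%t. cscaleL (c t) o\<^sub>L F t)"
proof -
 have e: "cscaleL z o\<^sub>L T = Re z *\<^sub>R T + Im z *\<^sub>R (cscaleL \<i> o\<^sub>L T)" for z and T :: "'i bop"
 proof (intro blinfun_eqI coord_ext)
  fix x i
  have "z * coord (T x) i = (complex_of_real (Re z) + \<i> * complex_of_real (Im z)) * coord (T x) i"
   using complex_eq[of z] by simp
  thus "coord ((cscaleL z o\<^sub>L T) x) i = coord ((Re z *\<^sub>R T + Im z *\<^sub>R (cscaleL \<i> o\<^sub>L T)) x) i"
   by (simp add: blinfun.add_left blinfun.scaleR_left algebra_simps)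
 qed
 have "continuous_on UNIV (%t. Re (c t) *\<^sub>R F t + Im (c t) *\<^sub>R (cscaleL \<i> o\<^sub>L F t))"
  by (intro continuous_on_add continuous_on_scaleR continuous_on_Re continuous_on_Im assms
    bounded_bilinear.continuous_on[OF bounded_bilinear_blinfun_compose] continuous_on_const)
 thus ?thesis by (simp only: e[symmetric])
qed

lemma CL_scale: assumes "cc K c" "x:carrier A" shows "CL K (%t. c t\<odot>x)"
 by (rule CLI) (use assms in "simp_all add: PhiD continuous_cscaleL cc_def")

lemma CL_scale': assumes "CL K f" shows "CL K (%t. z\<odot>f t)"
 by (rule CLI) (use CLD[OF assms] in "simp_all add: PhiD continuous_cscaleL")

lemma CL_diff: assumes "CL K f" "CL K g" shows "CL K (%t. f t\<ominus>g t)"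
 by (rule CLI) (use CLD[OF assms(1)] CLD[OF assms(2)] in "simp_all add: PhiD continuous_on_diff")

text \<open>Pointwise continuity of the action alone does not allow both arguments to vary; the
  contractivity from \<open>al_nrm\<close> does.\<close>

lemma al_continuous:
 assumes g: "!!s. g s:carrier A" "continuous_on UNIV (%s. Phi (g s))"
 shows "continuous_on UNIV (%s. Phi (al s (g s)))"
 unfolding continuous_on_def
proof (intro ballI)
 fix t :: 'g
 have "nrm_continuous A (%s. al s (g t))" using action g(1) by (simp add: cstar_action_def)
 hence "((%s. Phi (al s (g t))) \<longlongrightarrow> Phi (al t (g t))) (at t)"
  using g(1) by (simp add: nrm_continuous_Phi continuous_on_def)
 hence 1: "((%s. norm (Phi (al s (g t)) - Phi (al t (g t)))) \<longlongrightarrow> 0) (at t)"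
  by (simp add: LIM_zero tendsto_norm_zero)
 have "((%s. Phi (g s)) \<longlongrightarrow> Phi (g t)) (at t)" using g(2) by (simp add: continuous_on_def)
 hence 2: "((%s. norm (Phi (g s) - Phi (g t))) \<longlongrightarrow> 0) (at t)"
  by (simp add: LIM_zero tendsto_norm_zero)
 have "((%s. Phi (al s (g s)) - Phi (al t (g t))) \<longlongrightarrow> 0) (at t)"
 proof (rule Lim_null_comparison)
  show "\<forall>\<^sub>F s in at t. norm (Phi (al s (g s)) - Phi (al t (g t))) <= norm (Phi (g s) - Phi (g t)) + norm (Phi (al s (g t)) - Phi (al t (g t)))"
  proof (intro always_eventually allI)
   fix s
   have "norm (Phi (al s (g s)) - Phi (al s (g t))) <= norm (Phi (g s) - Phi (g t))"
    using al_nrm[of "g s\<ominus>g t" s] g(1) by (simp add: al_diff nrm_diff_Phi)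
   thus "norm (Phi (al s (g s)) - Phi (al t (g t))) <= norm (Phi (g s) - Phi (g t)) + norm (Phi (al s (g t)) - Phi (al t (g t)))"
    by (rule norm_diff_triangle_le) simp
  qed
  show "((%s. norm (Phi (g s) - Phi (g t)) + norm (Phi (al s (g t)) - Phi (al t (g t)))) \<longlongrightarrow> 0) (at t)"
   using tendsto_add[OF 2 1] by simp
 qed
 thus "((%s. Phi (al s (g s))) \<longlongrightarrow> Phi (al t (g t))) (at t within UNIV)" by (simp add: LIM_zero_iff)
qed

lemma CL_compose:
 assumes f: "CL K f" and h: "continuous_on UNIV h" "continuous_on UNIV k" and inv: "!!t. k (h t) = t"
 shows "CL (k`K) (%t. f (h t))"
proof (rule CLI)
 show "compact (k`K)" using CLD(1)[OF f] continuous_on_subset[OF h(2) subset_UNIV] by (intro compact_continuous_image)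
 show "f (h t):carrier A" for t by (rule CLD[OF f])
 show "continuous_on UNIV (%t. Phi (f (h t)))" using continuous_on_compose2[OF CLD(3)[OF f] h(1)] by simp
 fix t assume "t\<notin>k`K"
 hence "h t\<notin>K" using inv[of t] by (metis image_eqI)
 thus "f (h t) = \<zero>" by (rule CLD[OF f])
qed

lemma CL_integrand:
 assumes f: "CL K f" and g: "CL L g"
 shows "CL K (%s. f s\<otimes>al s (g (t - s)))"
proof (rule CLI)
 show "compact K" by (rule CLD[OF f])
 show "f s\<otimes>al s (g (t - s)):carrier A" for s using CLD(2)[OF f] CLD(2)[OF g] by simp
 have "continuous_on UNIV (%s. t - s)" by (intro continuous_intros)
 hence "continuous_on UNIV (%s. Phi (g (t - s)))" using continuous_on_compose2[OF CLD(3)[OF g], of UNIV "%s. t - s"] by simp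
 hence "continuous_on UNIV (%s. Phi (al s (g (t - s))))" by (intro al_continuous CLD(2)[OF g])
 thus "continuous_on UNIV (%s. Phi (f s\<otimes>al s (g (t - s))))"
  using CLD(2)[OF f] CLD(2)[OF g] CLD(3)[OF f]
  by (simp add: PhiD bounded_bilinear.continuous_on[OF bounded_bilinear_blinfun_compose])
 show "f s\<otimes>al s (g (t - s)) = \<zero>" if "s\<notin>K" for s using CLD(4)[OF f that] CLD(2)[OF g] by simp
qed

section \<open>The weak integral\<close>

text \<open>The property by which \<open>alg_integral\<close> selects its value. Existence and
  uniqueness are proved for it first, so that the description can be evaluated.\<close>

definition wint :: "('g => 'a) => 'a => bool"
 where "wint h x \<longleftrightarrow> x:carrier A \<and> (\<forall>phi. bounded_functional A phi -->
  integrable mu (%s. phi (h s)) \<and> (\<integral>s. phi (h s) \<partial>mu) = phi x)"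

text \<open>The complex inner product, linear in its first argument, recovered from its real
  part.\<close>

definition cinner :: "('g dual\<times>nat list) ell2 => ('g dual\<times>nat list) ell2 => complex"
 where "cinner x y = Complex (inner x y) (inner x (cscale \<i> y))"

lemma bounded_functional_matrix: "bounded_functional A (%x. cinner (Phi x u) v)"
 unfolding bounded_functional_def
proof (intro conjI ballI allI)
 fix x assume x: "x:carrier A"
 show "cinner (Phi (c\<odot>x) u) v = c * cinner (Phi x u) v" for c
 proof -
  have "cscale c z = Re c *\<^sub>R z + Im c *\<^sub>R cscale \<i> z" for z :: "('g dual\<times>nat list) ell2"
  proof (rule coord_ext)
   fix i
   have "c * coord z i = (complex_of_real (Re c) + \<i> * complex_of_real (Im c)) * coord z i" using complex_eq[of c] by simp
   thus "coord (cscale c z) i = coord (Re c *\<^sub>R z + Im c *\<^sub>R cscale \<i> z) i" by (simp add: algebra_simps)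
  qed
  moreover have "inner (cscale \<i> z) w = - inner z (cscale \<i> w)" for z w :: "('g dual\<times>nat list) ell2"
  proof -
   have "cscale (- \<i>) w = - cscale \<i> w" by (rule coord_ext) simp
   thus ?thesis by (simp add: inner_cscale)
  qed
  moreover have "inner (cscale \<i> z) (cscale \<i> w) = inner z w" for z w :: "('g dual\<times>nat list) ell2"
  proof -
   have "cscale (- \<i>) (cscale \<i> w) = w" by (rule coord_ext) simp
   thus ?thesis by (simp add: inner_cscale)
  qed
  ultimately show ?thesis using x by (simp add: PhiD cinner_def complex_eq_iff inner_add_left)
 qed
 fix y assume y: "y:carrier A"
 show "cinner (Phi (x\<oplus>y) u) v = cinner (Phi x u) v + cinner (Phi y u) v"
  using x y by (simp add: PhiD cinner_def complex_eq_iff blinfun.add_left inner_add_left)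
next
 show "\<exists>M. \<forall>x\<in>carrier A. cmod (cinner (Phi x u) v) <= M * nrm A x"
 proof (intro exI ballI)
  fix x assume x: "x:carrier A"
  have n: "norm (Phi x u) <= nrm A x * norm u" using norm_blinfun[of "Phi x" u] Phi_norm[OF x] by simp
  have "cmod (cinner (Phi x u) v) <= \<bar>inner (Phi x u) v\<bar> + \<bar>inner (Phi x u) (cscale \<i> v)\<bar>"
   using cmod_le[of "cinner (Phi x u) v"] by (simp add: cinner_def)
  also have "...<= norm (Phi x u) * norm v + norm (Phi x u) * norm (cscale \<i> v)"
   by (intro add_mono Cauchy_Schwarz_ineq2)
  also have "...= 2 * norm (Phi x u) * norm v" by (simp add: norm_cscale)
  also have "...<= 2 * (nrm A x * norm u) * norm v" by (intro mult_right_mono mult_left_mono n) auto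
  finally show "cmod (cinner (Phi x u) v) <= (2 * norm u * norm v) * nrm A x" by (simp add: mult_ac)
 qed
qed

lemma wint_norm:
 assumes h: "CL K h" and x: "wint h x"
 shows "nrm A x <= (\<integral>s. nrm A (h s) \<partial>mu)"
proof -
 have xC: "x:carrier A" using x by (simp add: wint_def)
 define b where "b = (\<integral>s. nrm A (h s) \<partial>mu)"
 have b0: "0 <= b" unfolding b_def using CLD(2)[OF h] by (simp add: nrm_nonneg)
 have le: "\<bar>inner (Phi x u) v\<bar> <= b * norm u * norm v" for u v
 proof -
  have i: "integrable mu (%s. cinner (Phi (h s) u) v)" "(\<integral>s. cinner (Phi (h s) u) v \<partial>mu) = cinner (Phi x u) v"
   using x bounded_functional_matrix by (auto simp: wint_def)
  have "inner (Phi x u) v = Re (\<integral>s. cinner (Phi (h s) u) v \<partial>mu)" using i(2) by (simp add: cinner_def)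
  also have "...= (\<integral>s. inner (Phi (h s) u) v \<partial>mu)" using i(1) by (subst integral_Re[symmetric]) (auto simp: cinner_def)
  finally have "\<bar>inner (Phi x u) v\<bar> <= (\<integral>s. \<bar>inner (Phi (h s) u) v\<bar> \<partial>mu)" by (simp add: integral_abs_bound)
  also have "...<= (\<integral>s. nrm A (h s) * (norm u * norm v) \<partial>mu)"
  proof (rule integral_mono')
   show "integrable mu (%s. nrm A (h s) * (norm u * norm v))" using CL_nrm_int[OF h] by (rule integrable_mult_left)
   fix s
   show "0 <= nrm A (h s) * (norm u * norm v)" using CLD(2)[OF h] by (simp add: nrm_nonneg)
   have "\<bar>inner (Phi (h s) u) v\<bar> <= norm (Phi (h s) u) * norm v" by (rule Cauchy_Schwarz_ineq2)
   also have "...<= (nrm A (h s) * norm u) * norm v"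
    using norm_blinfun[of "Phi (h s)" u] Phi_norm[OF CLD(2)[OF h]] by (intro mult_right_mono) auto
   finally show "\<bar>inner (Phi (h s) u) v\<bar> <= nrm A (h s) * (norm u * norm v)" by (simp add: mult.assoc)
  qed
  finally show ?thesis by (simp add: b_def mult.assoc)
 qed
 have "norm (Phi x) <= b" by (rule blinfun_norm_le_restr[OF b0]) (rule le)
 thus ?thesis using Phi_norm[OF xC] by (simp add: b_def)
qed

text \<open>The matrix coefficients of \<open>Phi\<close> are bounded functionals that separate the
  points of \<open>A\<close>.\<close>

lemma wint_unique: assumes "wint h x" "wint h y" shows "x = y"
proof -
 have c: "x:carrier A" "y:carrier A" using assms by (auto simp: wint_def)
 have "inner (Phi x u - Phi y u) v = 0" for u v
 proof -
  have "cinner (Phi x u) v = cinner (Phi y u) v" using assms bounded_functional_matrix[of u v] unfolding wint_def by metis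
  thus ?thesis by (simp add: cinner_def inner_diff_left)
 qed
 hence "Phi x u = Phi y u" for u using inner_eq_zero_iff[of "Phi x u - Phi y u"] by (metis eq_iff_diff_eq_0)
 thus ?thesis using Phi_inj[OF c] blinfun_eqI by blast
qed

lemma alg_integral_eq: "wint h x ==> alg_integral mu A h = x"
 unfolding alg_integral_def wint_def[symmetric] using wint_unique by (intro the_equality)

lemma bounded_functionalD:
 assumes "bounded_functional A phi"
 shows "x:carrier A ==> y:carrier A ==> phi (x\<oplus>y) = phi x + phi y" "x:carrier A ==> phi (c\<odot>x) = c * phi x" "phi \<zero> = 0"
  "\<exists>M\<ge>0. \<forall>x\<in>carrier A. cmod (phi x) <= M * nrm A x" "x:carrier A ==> y:carrier A ==> phi (x\<ominus>y) = phi x - phi y"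
proof -
 note d = assms[unfolded bounded_functional_def]
 show add: "x:carrier A ==> y:carrier A ==> phi (x\<oplus>y) = phi x + phi y" for x y using d by simp
 show sc: "x:carrier A ==> phi (c\<odot>x) = c * phi x" for x c using d by simp
 show "phi \<zero> = 0" using sc[of \<zero> 0] by simp
 show "x:carrier A ==> y:carrier A ==> phi (x\<ominus>y) = phi x - phi y" by (simp add: diff_scale add sc)
 obtain M where M: "\<forall>x\<in>carrier A. cmod (phi x) <= M * nrm A x" using d by blast
 have "cmod (phi x) <= max M 0 * nrm A x" if x: "x:carrier A" for x
  using M x mult_right_mono[OF max.cobounded1[of M 0] nrm_nonneg[OF x]] by force
 thus "\<exists>M\<ge>0. \<forall>x\<in>carrier A. cmod (phi x) <= M * nrm A x" by (intro exI[of _ "max M 0"]) auto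
qed

lemma wint_scale: assumes "cc K c" "a:carrier A" shows "wint (%s. c s\<odot>a) ((\<integral>s. c s \<partial>mu)\<odot>a)"
 unfolding wint_def using assms integrable_cc[OF assms(1)] by (auto simp: bounded_functionalD(2))

lemma wint_add: assumes "!!s. h s:carrier A" "!!s. k s:carrier A" "wint h x" "wint k y" shows "wint (%s. h s\<oplus>k s) (x\<oplus>y)"
 using assms unfolding wint_def by (auto simp: bounded_functionalD(1))

lemma wint_zero: "wint (%_. \<zero>) \<zero>"
 unfolding wint_def by (auto simp: bounded_functionalD(3))

inductive_set Step :: "'g set => ('g => 'a) set" for K where
 zero: "(%_. \<zero>):Step K"
| step: "[|f:Step K;cc K c;a:carrier A|] ==> (%t. c t\<odot>a\<oplus>f t):Step K"

lemma Step_CL: "f:Step K ==> compact K ==> CL K f"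
 by (induction rule: Step.induct) (simp_all add: CL_zero CL_add CL_scale)

lemma Step_wint: "f:Step K ==> compact K ==> \<exists>x. wint f x"
proof (induction rule: Step.induct)
 case zero thus ?case using wint_zero by blast
next
 case (step f c a)
 then obtain x where "wint f x" by blast
 thus ?case using wint_add[OF _ _ wint_scale[OF step(2,3)]] step CLD(2)[OF Step_CL[OF step(1,5)]] by blast
qed

lemma Step_dense:
 assumes f: "CL K f"
 obtains K1 where "compact K1" "K \<subseteq> K1" "!!e. 0 < e ==> \<exists>h\<in>Step K1. \<forall>t. nrm A (f t\<ominus>h t) <= e"
proof -
 have K: "compact K" by (rule CLD[OF f])
 obtain V L where V: "open V" "K \<subseteq> V" "V \<subseteq> L" "compact L" using compact_neighbourhood[OF lc K] by metis
 have "\<exists>h\<in>Step L. \<forall>t. nrm A (f t\<ominus>h t) <= e" if e: "0 < e" for e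
 proof -
  have "\<exists>U. open U \<and> t:U \<and> (\<forall>s\<in>U. nrm A (f s\<ominus>f t) <= e)" for t
  proof -
   have "((%s. Phi (f s)) \<longlongrightarrow> Phi (f t)) (at t within UNIV)" using CLD(3)[OF f] by (simp add: continuous_on_def)
   hence "\<forall>\<^sub>F s in at t. dist (Phi (f s)) (Phi (f t)) < e" using e by (intro tendstoD) simp_all
   then obtain U where U: "open U" "t:U" "\<forall>s\<in>U. s ~= t --> dist (Phi (f s)) (Phi (f t)) < e"
    by (auto simp: eventually_at_topological)
   have "nrm A (f s\<ominus>f t) <= e" if "s:U" for s
    using U(3) that e CLD(2)[OF f] by (cases "s = t") (auto simp: nrm_diff_Phi dist_norm less_imp_le)
   thus ?thesis using U by blast
  qed
  then obtain U where U: "!!t. open (U t) \<and> t:U t \<and> (\<forall>s\<in>U t. nrm A (f s\<ominus>f t) <= e)" by metis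
  obtain J and phi :: "'g => 'g => real" where J: "finite J" "J \<subseteq> K"
   and phi: "!!j. j:J ==> continuous_on UNIV (phi j)" "!!j s. j:J ==> 0 <= phi j s"
    "!!j s. j:J ==> s\<notin>U j\<inter>V ==> phi j s = 0"
    "!!s. (\<Sum>j\<in>J. phi j s) <= 1" "!!s. s:K ==> (\<Sum>j\<in>J. phi j s) = 1"
  proof (rule partition_functions[OF lc K, of "%t. U t\<inter>V"])
   show "open (U t\<inter>V) \<and> t:U t\<inter>V" if "t:K" for t using U[of t] V that by auto
  qed (rule that)
  have ccphi: "cc L (%t. complex_of_real (phi j t))" if j: "j:J" for j
   unfolding cc_def using phi(1)[OF j] phi(3)[OF j] V by (auto intro!: continuous_on_of_real)
  have "\<exists>h\<in>Step L. \<forall>t. Phi (h t) = (\<Sum>j\<in>I. phi j t *\<^sub>R Phi (f j))" if "I \<subseteq> J" for I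
   using finite_subset[OF that J(1)] that
  proof (induction I rule: finite_induct)
   case empty thus ?case using Step.zero by (intro bexI[of _ "%_. \<zero>"]) (simp_all add: PhiD)
  next
   case (insert j I)
   then obtain h where h: "h:Step L" "\<forall>t. Phi (h t) = (\<Sum>j\<in>I. phi j t *\<^sub>R Phi (f j))" by blast
   have r: "cscaleL (complex_of_real r) o\<^sub>L T = r *\<^sub>R T" for r and T :: "('g dual\<times>nat list) bop"
    by (intro blinfun_eqI coord_ext) (simp add: blinfun.scaleR_left)
   have hC: "h t:carrier A" for t using CLD(2)[OF Step_CL[OF h(1) V(4)]] .
   have "(%t. complex_of_real (phi j t)\<odot>f j\<oplus>h t):Step L"
    using insert.prems by (intro Step.step h(1) ccphi CLD(2)[OF f]) simp
   moreover have "Phi (complex_of_real (phi j t)\<odot>f j\<oplus>h t) = (\<Sum>j\<in>insert j I. phi j t *\<^sub>R Phi (f j))" for t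
    using h(2) hC CLD(2)[OF f] insert.hyps by (simp add: PhiD r)
   ultimately show ?case by (intro bexI[of _ "%t. complex_of_real (phi j t)\<odot>f j\<oplus>h t"]) simp_all
  qed
  then obtain h where h: "h:Step L" "!!t. Phi (h t) = (\<Sum>j\<in>J. phi j t *\<^sub>R Phi (f j))" by blast
  have "nrm A (f t\<ominus>h t) <= e" for t
  proof -
   have "norm (Phi (f t) - Phi (h t)) <= e"
    unfolding h(2)
   proof (rule weighted_sum_close)
    show "norm (Phi (f t) - Phi (f j)) <= e" if "j:J" "phi j t ~= 0" for j
     using phi(3)[OF that(1), of t] that(2) U[of j] CLD(2)[OF f] by (auto simp: nrm_diff_Phi)
    show "(\<Sum>j\<in>J. phi j t) = 1" if "Phi (f t) ~= 0" using phi(5)[of t] CLD(4)[OF f, of t] that PhiD(6) by metis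
   qed (use phi e in auto)
   thus ?thesis using CLD(2)[OF f] CLD(2)[OF Step_CL[OF h(1) V(4)]] by (simp add: nrm_diff_Phi)
  qed
  thus ?thesis using h(1) by blast
 qed
 thus ?thesis using that[of L] V by blast
qed

lemma nrm_integral_le:
 assumes f: "CL K f" and B: "!!t. nrm A (f t) <= B"
 shows "(\<integral>t. nrm A (f t) \<partial>mu) <= B * measure mu K"
proof -
 have "(\<integral>t. norm (nrm A (f t)) \<partial>mu) <= B * measure mu K"
  by (rule integral_norm_le[OF CLD(1)[OF f]]) (use B CLD(2,4)[OF f] in "simp_all add: nrm_nonneg")
 thus ?thesis using CLD(2)[OF f] by (simp add: nrm_nonneg)
qed

text \<open>By \<open>wint_norm\<close> the integrals of uniformly approximating step functions form
  a Cauchy sequence. Its limit is the integral, because a bounded functional commutes with both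
  limits.\<close>

lemma wint_exists:
 assumes h: "CL K h"
 shows "\<exists>x. wint h x"
proof -
 obtain L where L: "compact L" "K \<subseteq> L" and app: "!!e. 0 < e ==> \<exists>k\<in>Step L. \<forall>t. nrm A (h t\<ominus>k t) <= e"
  using Step_dense[OF h] by metis
 have hL: "CL L h" by (rule CL_mono[OF h L(2,1)])
 have "\<forall>n::nat. \<exists>k\<in>Step L. \<forall>t. nrm A (h t\<ominus>k t) <= 1/Suc n" using app by simp
 then obtain k where k: "!!n::nat. k n:Step L" "!!n t. nrm A (h t\<ominus>k n t) <= 1/Suc n" by metis
 have kC: "CL L (k n)" for n by (rule Step_CL[OF k(1) L(1)])
 have "\<forall>n. \<exists>x. wint (k n) x" using Step_wint[OF k(1) L(1)] by blast
 then obtain X where X: "!!n. wint (k n) (X n)" by metis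
 have XC: "X n:carrier A" for n using X by (simp add: wint_def)
 define m where "m = measure mu L"
 have Xdiff: "nrm A (X n\<ominus>X l) <= (1/Suc n + 1/Suc l) * m" for n l
 proof -
  have d: "CL L (%t. k n t\<ominus>k l t)" by (rule CL_diff[OF kC kC])
  have "wint (%t. k n t\<oplus>(- 1)\<odot>k l t) (X n\<oplus>(- 1)\<odot>X l)"
  proof (rule wint_add[OF _ _ X])
   show "wint (%t. (- 1)\<odot>k l t) ((- 1)\<odot>X l)"
    using X[of l] CLD(2)[OF kC, of l] by (auto simp: wint_def bounded_functionalD(2))
  qed (use CLD(2)[OF kC] in auto)
  hence "wint (%t. k n t\<ominus>k l t) (X n\<ominus>X l)" using XC CLD(2)[OF kC] by (simp add: diff_scale)
  hence "nrm A (X n\<ominus>X l) <= (\<integral>t. nrm A (k n t\<ominus>k l t) \<partial>mu)" by (rule wint_norm[OF d])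
  also have "...<= (1/Suc n + 1/Suc l) * measure mu L"
  proof (rule nrm_integral_le[OF d])
   fix t
   show "nrm A (k n t\<ominus>k l t) <= 1/Suc n + 1/Suc l"
    using nrm_diff_triangle[of "k n t" "h t" "k l t"] nrm_diff_commute[of "k n t" "h t"] k(2)[of t n] k(2)[of t l]
     CLD(2)[OF kC] CLD(2)[OF h] by (smt (verit))
  qed
  finally show ?thesis by (simp add: m_def)
 qed
 have inv0: "(%n. 1/real (Suc n)) \<longlonglongrightarrow> 0" using LIMSEQ_inverse_real_of_nat by (simp add: inverse_eq_divide)
 have "\<exists>x\<in>carrier A. (%n::nat. nrm A (X n\<ominus>x)) \<longlonglongrightarrow> 0"
 proof (rule nrm_complete[OF XC])
  fix e :: real assume e: "0 < e"
  have m0: "0 <= m" by (simp add: m_def)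
  have "(%n. 1/real (Suc n) * m) \<longlonglongrightarrow> 0 * m" by (intro tendsto_intros inv0)
  hence "\<forall>\<^sub>F n in sequentially. 1/real (Suc n) * m < e/2" using e by (intro order_tendstoD(2)[of _ "0 * m"]) auto
  then obtain N where N: "!!n. n >= N ==> 1/real (Suc n) * m < e/2" unfolding eventually_sequentially by blast
  have "nrm A (X n\<ominus>X l) < e" if "n >= N" "l >= N" for n l
   using Xdiff[of n l] N[OF that(1)] N[OF that(2)] unfolding distrib_right by linarith
  thus "\<exists>N. \<forall>m\<ge>N. \<forall>n\<ge>N. nrm A (X m\<ominus>X n) < e" by blast
 qed
 then obtain x where x: "x:carrier A" "(%n::nat. nrm A (X n\<ominus>x)) \<longlonglongrightarrow> 0" by blast
 have "wint h x"
  unfolding wint_def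
 proof (intro conjI x(1) allI impI)
  fix phi assume phi: "bounded_functional A phi"
  note pd = bounded_functionalD[OF phi]
  obtain M where M: "0 <= M" "!!x. x:carrier A ==> cmod (phi x) <= M * nrm A x" using pd(4) by blast
  have "continuous_on UNIV (%s. phi (h s))"
   unfolding continuous_on_def
  proof (intro ballI)
   fix t :: 'g
   have "((%s. norm (Phi (h s) - Phi (h t))) \<longlongrightarrow> 0) (at t within UNIV)"
    using CLD(3)[OF h] by (simp add: continuous_on_def LIM_zero tendsto_norm_zero)
   hence "((%s. M * nrm A (h s\<ominus>h t)) \<longlongrightarrow> 0) (at t within UNIV)"
    using CLD(2)[OF h] by (simp add: nrm_diff_Phi tendsto_mult_right_zero)
   hence "((%s. phi (h s) - phi (h t)) \<longlongrightarrow> 0) (at t within UNIV)"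
    by (rule Lim_null_comparison[rotated])
     (use M(2) CLD(2)[OF h] pd(5) in "metis (no_types, lifting) always_eventually diff_closed")
   thus "((%s. phi (h s)) \<longlongrightarrow> phi (h t)) (at t within UNIV)" by (simp add: LIM_zero_iff)
  qed
  thus int: "integrable mu (%s. phi (h s))"
   by (rule integrable_supp[OF _ CLD(1)[OF h]]) (simp add: CLD(4)[OF h] pd(3))
  have 1: "(%n. phi (X n)) \<longlonglongrightarrow> phi x"
  proof (rule LIM_zero_cancel, rule Lim_null_comparison)
   show "\<forall>\<^sub>F n in sequentially. norm (phi (X n) - phi x) <= M * nrm A (X n\<ominus>x)"
    using M(2) x XC pd(5) by (metis (no_types, lifting) always_eventually diff_closed)
   show "(%n. M * nrm A (X n\<ominus>x)) \<longlonglongrightarrow> 0" using x(2) by (rule tendsto_mult_right_zero)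
  qed
  have 2: "(%n. phi (X n)) \<longlonglongrightarrow> (\<integral>s. phi (h s) \<partial>mu)"
  proof (rule LIM_zero_cancel, rule Lim_null_comparison)
   show "\<forall>\<^sub>F n in sequentially. norm (phi (X n) - (\<integral>s. phi (h s) \<partial>mu)) <= (M * (1/real (Suc n))) * m"
   proof (intro always_eventually allI)
    fix n
    have e: "phi (X n) = (\<integral>s. phi (k n s) \<partial>mu)" "integrable mu (%s. phi (k n s))" using X[of n] phi by (auto simp: wint_def)
    have "phi (X n) - (\<integral>s. phi (h s) \<partial>mu) = (\<integral>s. phi (k n s) - phi (h s) \<partial>mu)" using e int by simp
    also have "norm ...<= (M * (1/real (Suc n))) * measure mu L"
    proof (rule integral_bound[OF L(1)])
     fix s
     have "phi (k n s) - phi (h s) = phi (k n s\<ominus>h s)" using pd(5) CLD(2)[OF kC] CLD(2)[OF h] by simp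
     hence "norm (phi (k n s) - phi (h s)) <= M * nrm A (k n s\<ominus>h s)" using M(2) CLD(2)[OF kC] CLD(2)[OF h] by simp
     also have "...<= M * (1/real (Suc n))"
      using k(2)[of s n] M(1) nrm_diff_commute[OF CLD(2)[OF kC] CLD(2)[OF h], of n s s] by (intro mult_left_mono) auto
     finally show "norm (phi (k n s) - phi (h s)) <= M * (1/real (Suc n))" .
     show "s\<notin>L ==> phi (k n s) - phi (h s) = 0" using CLD(4)[OF kC] CLD(4)[OF hL] by simp
    qed
    finally show "norm (phi (X n) - (\<integral>s. phi (h s) \<partial>mu)) <= (M * (1/real (Suc n))) * m" by (simp add: m_def)
   qed
   have "(%n. (M * (1/real (Suc n))) * m) \<longlonglongrightarrow> (M * 0) * m" by (intro tendsto_intros inv0)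
   thus "(%n. (M * (1/real (Suc n))) * m) \<longlonglongrightarrow> 0" by simp
  qed
  show "(\<integral>s. phi (h s) \<partial>mu) = phi x" by (rule LIMSEQ_unique[OF 2 1])
 qed
 thus ?thesis by blast
qed

lemma wint_alg_integral: "CL K h ==> wint h (alg_integral mu A h)"
 using wint_exists alg_integral_eq by metis

end

section \<open>The integrated form of the covariant representation\<close>

text \<open>Reduces weak identities between operators to basis vectors. The vectors tested carry a
  complex factor \<open>z\<close> because \<open>D\<close> is only real linear.\<close>

lemma ell2_functional_zero:
 fixes D :: "'i ell2 => real"
 assumes D: "bounded_linear D" and ket: "!!z p. D (cscale z (ket p)) = 0"
 shows "D v = 0"
proof (rule ccontr)
 assume nz: "D v ~= 0"
 obtain M where M: "!!x. norm (D x) <= norm x * M" "0 < M" using bounded_linear.pos_bounded[OF D] by blast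
 obtain F where F: "finite F" "norm (v - restr F v) <= \<bar>D v\<bar>/(2 * M)"
  using restr_approx[of "\<bar>D v\<bar>/(2 * M)" v] nz M(2) by auto
 have "D (restr F v) = 0" unfolding restr_def linear_sum[OF bounded_linear.linear[OF D]] by (simp add: ket)
 hence "\<bar>D v\<bar> = norm (D (v - restr F v))" using linear_diff[OF bounded_linear.linear[OF D]] by simp
 also have "...<= (\<bar>D v\<bar>/(2 * M)) * M" using M(1) mult_right_mono[OF F(2), of M] M(2) by (meson less_imp_le order_trans)
 finally show False using nz M(2) by simp
qed

lemma inner_cscale_right_ket: "inner x (cscale z (ket p)) = Re (cnj z * coord x p)"
proof -
 have "inner x (cscale z (ket p)) = inner (cscale (cnj z) x) (ket p)" by (simp add: inner_cscale)
 thus ?thesis by (simp add: inner_commute[of _ "ket p"] inner_ket)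
qed

context haar
begin

lemma weak_integral:
 fixes W :: "'g => 'i ell2"
 assumes W: "continuous_on UNIV W" "compact K" "!!t. t\<notin>K ==> W t = 0"
 shows "integrable mu (%t. inner (W t) v)" "bounded_linear (%v. \<integral>t. inner (W t) v \<partial>mu)"
  "\<bar>\<integral>t. inner (W t) v \<partial>mu\<bar> <= (\<integral>t. norm (W t) \<partial>mu) * norm v"
proof -
 show i: "integrable mu (%t. inner (W t) v)" for v
  by (rule integrable_supp[OF _ W(2)]) (use W in "auto intro: continuous_intros")
 have n: "integrable mu (%t. norm (W t))"
  by (rule integrable_supp[OF _ W(2)]) (use W in "auto intro: continuous_intros")
 show b: "\<bar>\<integral>t. inner (W t) v \<partial>mu\<bar> <= (\<integral>t. norm (W t) \<partial>mu) * norm v" for v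
 proof -
  have "\<bar>\<integral>t. inner (W t) v \<partial>mu\<bar> <= (\<integral>t. \<bar>inner (W t) v\<bar> \<partial>mu)" by (rule integral_abs_bound)
  also have "...<= (\<integral>t. norm (W t) * norm v \<partial>mu)"
   using n by (intro Bochner_Integration.integral_mono) (auto simp: Cauchy_Schwarz_ineq2 i)
  finally show ?thesis using n by simp
 qed
 show "bounded_linear (%v. \<integral>t. inner (W t) v \<partial>mu)"
  by (rule bounded_linear_intro[of _ "\<integral>t. norm (W t) \<partial>mu"])
   (use i b in "auto simp: inner_add_right mult.commute")
qed

end

context crossed
begin

text \<open>The unitaries that implement the action \<open>al\<close> in the Fock representation.\<close>

definition Ug :: "'g => ('g dual\<times>nat list) bop"
 where "Ug t = wop Some (%p. pairing t (fst p + wt om (snd p)))"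

lemma coord_Ug: "coord (Ug t x) p = pairing t (fst p + wt om (snd p)) * coord x p"
 unfolding Ug_def by (subst coord_wop[where c = 1]) (auto simp: pinj_def pairing_simps(4))

lemma norm_Ug: "norm (Ug t x) <= norm x"
proof -
 have "norm (Ug t) <= 1" unfolding Ug_def by (rule norm_wop) (auto simp: pinj_def pairing_simps(4))
 thus ?thesis using norm_blinfun[of "Ug t" x] mult_right_mono[of "norm (Ug t)" 1 "norm x"] by simp
qed

lemma Ug_add: "Ug (s + t) x = Ug s (Ug t x)"
 by (rule coord_ext) (simp add: coord_Ug pairing_simps mult.assoc)

lemma inner_Ug: "inner (Ug t x) y = inner x (Ug (- t) y)"
 unfolding inner_ell2_coord by (rule infsum_cong) (simp add: coord_Ug pairing_simps inner_complex_def algebra_simps)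

lemma clin_Ug: "clin (Ug t)"
 unfolding clin_def by (intro allI coord_ext) (simp add: coord_Ug)

text \<open>Replacing the prefix \<open>nu'\<close> by \<open>mu'\<close> changes the weight of a
  basis vector by \<open>wt om mu' - wt om nu'\<close>, which is the character by which the action
  scales the monomial.\<close>

lemma intertwine_mo: "Ug s (Phi (mo mu' nu') y) = Phi (al s (mo mu' nu')) (Ug s y)"
proof (rule coord_ext)
 fix p :: "'g dual\<times>nat list"
 obtain ga v where p: "p = (ga, v)" by (cases p)
 show "coord (Ug s (Phi (mo mu' nu') y)) p = coord (Phi (al s (mo mu' nu')) (Ug s y)) p"
 proof (cases "\<exists>ka. v = mu'@ka")
  case True
  then obtain ka where v: "v = mu'@ka" by blast
  have "ga + (wt om mu' + wt om ka) = (wt om mu' - wt om nu') + (ga + (wt om nu' + wt om ka))" by simp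
  hence "pairing s (ga + (wt om mu' + wt om ka)) = pw mu' nu' s * pairing s (ga + (wt om nu' + wt om ka))"
   unfolding pw_def by (metis pairing_simps(1))
  thus ?thesis by (simp add: p v al_mo PhiD Phi_mo coord_Ug coord_Top_append bfun_intros)
 next
  case False
  thus ?thesis by (simp add: p al_mo PhiD Phi_mo coord_Ug coord_Top_out bfun_intros)
 qed
qed

lemma intertwine:
 assumes x: "x:carrier A"
 shows "Ug s (Phi x y) = Phi (al s x) (Ug s y)"
proof -
 have cl: "Ug s (cscale z w) = cscale z (Ug s w)" for z w using clin_Ug by (simp add: clin_def)
 have Rep: "Ug s (Phi a y) = Phi (al s a) (Ug s y)" if "(a, T):Rep" for a T
  using that
 proof (induction rule: mon.Lin.induct)
  case zero thus ?case by (simp add: PhiD blinfun.zero_right)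
 next
  case (step x T mu' nu' a C)
  from step(3) obtain z where z: "a = z\<odot>mo mu' nu'" by (auto simp: Mon_def)
  thus ?case using step(4) mon.Lin_closed[OF step(1)] intertwine_mo[of s mu' nu' y]
   by (simp add: PhiD alD(2,3) blinfun.add_left blinfun.add_right cl)
 qed
 have sub: "fst`Rep \<subseteq> carrier A" using mon.Lin_closed by auto
 have "norm (Ug s (Phi x y) - Phi (al s x) (Ug s y)) <= e" if e: "0 < e" for e
 proof -
  have "x:nclosure A (fst`Rep)" using x Rep_dense by simp
  then obtain a where a: "a:fst`Rep" "nrm A (a\<ominus>x) < e/(2 * norm y + 1)"
   unfolding nclosure_iff[OF sub] using e by (metis divide_pos_pos add_nonneg_pos mult_nonneg_nonneg norm_ge_zero zero_le_numeral zero_less_one)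
  obtain T where T: "(a, T):Rep" using a by auto
  have aC: "a:carrier A" using a(1) sub by blast
  have n: "norm (Phi (al s x) - Phi (al s a)) <= nrm A (a\<ominus>x)"
   using al_nrm[of "a\<ominus>x" s] x aC by (simp add: nrm_diff_Phi[symmetric] al_diff nrm_diff_commute[of "al s x"])
  have "Ug s (Phi x y) - Phi (al s x) (Ug s y) = - Ug s ((Phi a - Phi x) y) - (Phi (al s x) - Phi (al s a)) (Ug s y)"
   using Rep[OF T] by (simp add: blinfun.diff_left blinfun.diff_right)
  also have "norm ...<= norm (Ug s ((Phi a - Phi x) y)) + norm ((Phi (al s x) - Phi (al s a)) (Ug s y))"
   by (metis norm_minus_cancel norm_triangle_ineq4)
  also have "...<= nrm A (a\<ominus>x) * norm y + nrm A (a\<ominus>x) * norm y"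
  proof (rule add_mono)
   show "norm (Ug s ((Phi a - Phi x) y)) <= nrm A (a\<ominus>x) * norm y"
    using norm_Ug[of s "(Phi a - Phi x) y"] norm_blinfun[of "Phi a - Phi x" y] x aC by (simp add: nrm_diff_Phi)
   have "norm ((Phi (al s x) - Phi (al s a)) (Ug s y)) <= norm (Phi (al s x) - Phi (al s a)) * norm (Ug s y)" by (rule norm_blinfun)
   also have "...<= nrm A (a\<ominus>x) * norm y" using x aC by (intro mult_mono n norm_Ug) (auto simp: nrm_nonneg)
   finally show "norm ((Phi (al s x) - Phi (al s a)) (Ug s y)) <= nrm A (a\<ominus>x) * norm y" .
  qed
  also have "...= (2 * norm y) * nrm A (a\<ominus>x)" by simp
  also have "...<= (2 * norm y + 1) * (e/(2 * norm y + 1))" using a(2) x aC by (intro mult_mono) (auto simp: nrm_nonneg)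
  also have "...= e" by (simp add: add_nonneg_eq_0_iff)
  finally show ?thesis .
 qed
 thus ?thesis by (metis dense_le norm_ge_zero norm_le_zero_iff not_le right_minus_eq)
qed

text \<open>On a finitely supported vector only finitely many characters are involved. Truncation of
  \<open>u\<close> is uniform in \<open>t\<close> because every \<open>Ug t\<close> is a
  contraction.\<close>

lemma continuous_Ug: "continuous_on UNIV (%t. Ug t u)"
proof -
 have "\<forall>n::nat. \<exists>F. finite F \<and> norm (u - restr F u) <= 1/Suc n" by (intro allI restr_approx) simp
 then obtain F where F: "!!n::nat. finite (F n)" "!!n. norm (u - restr (F n) u) <= 1/Suc n" by metis
 have c: "continuous_on UNIV (%t. Ug t (restr (F n) u))" for n
 proof -
  have "continuous_on UNIV (%t. \<Sum>p\<in>F n. (cscaleL (coord u p * pairing t (fst p + wt om (snd p))) o\<^sub>L id_blinfun) (ket p))"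
   by (intro continuous_on_sum bounded_bilinear.continuous_on[OF bounded_bilinear_blinfun_apply] continuous_cscaleL
     continuous_on_const continuous_on_mult pairing_simps)
  also have "(%t. \<Sum>p\<in>F n. (cscaleL (coord u p * pairing t (fst p + wt om (snd p))) o\<^sub>L id_blinfun) (ket p)) = (%t. Ug t (restr (F n) u))"
  proof
   fix t
   have "(cscaleL (coord u p * pairing t (fst p + wt om (snd p))) o\<^sub>L id_blinfun) (ket p) = Ug t (cscale (coord u p) (ket p))" for p
    by (rule coord_ext) (simp add: coord_Ug coord_ket)
   thus "(\<Sum>p\<in>F n. (cscaleL (coord u p * pairing t (fst p + wt om (snd p))) o\<^sub>L id_blinfun) (ket p)) = Ug t (restr (F n) u)"
    by (simp add: restr_def blinfun.sum_right)
  qed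
  finally show ?thesis .
 qed
 show ?thesis
 proof (rule uniform_limit_theorem[of _ "%n t. Ug t (restr (F n) u)" sequentially])
  show "uniform_limit UNIV (%n t. Ug t (restr (F n) u)) (%t. Ug t u) sequentially"
  proof (rule uniform_limitI)
   fix e :: real assume e: "0 < e"
   obtain N :: nat where N: "1/Suc N < e" using e by (rule nat_approx_posE)
   have "dist (Ug t (restr (F n) u)) (Ug t u) < e" if n: "n >= N" for n t
   proof -
    have "dist (Ug t (restr (F n) u)) (Ug t u) <= norm (u - restr (F n) u)"
     using norm_Ug[of t "u - restr (F n) u"] by (simp add: dist_norm norm_minus_commute blinfun.diff_right)
    also have "...<= 1/Suc N" using F(2)[of n] n by (smt (verit) frac_le of_nat_0_less_iff of_nat_mono Suc_le_mono zero_less_Suc)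
    finally show ?thesis using N by simp
   qed
   thus "\<forall>\<^sub>F n in sequentially. \<forall>t\<in>UNIV. dist (Ug t (restr (F n) u)) (Ug t u) < e"
    unfolding eventually_sequentially by blast
  qed
 qed (use c in simp_all)
qed

lemma continuous_Ug':
 assumes h: "continuous_on UNIV (h::'p::topological_space => 'g)" and W: "continuous_on UNIV W"
 shows "continuous_on UNIV (%p. Ug (h p) (W p))"
 unfolding continuous_on_def
proof (intro ballI)
 fix p0 :: 'p
 have "continuous_on UNIV (%p. Ug (h p) (W p0))" using continuous_on_compose2[OF continuous_Ug h] by simp
 hence "((%p. norm (Ug (h p) (W p0) - Ug (h p0) (W p0))) \<longlongrightarrow> 0) (at p0)"
  by (simp add: continuous_on_def LIM_zero tendsto_norm_zero)
 moreover have "((%p. norm (W p - W p0)) \<longlongrightarrow> 0) (at p0)"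
  using W by (simp add: continuous_on_def LIM_zero tendsto_norm_zero)
 ultimately have "((%p. norm (W p - W p0) + norm (Ug (h p) (W p0) - Ug (h p0) (W p0))) \<longlongrightarrow> 0) (at p0)"
  using tendsto_add by fastforce
 moreover have "norm (Ug (h p) (W p) - Ug (h p0) (W p0)) <= norm (W p - W p0) + norm (Ug (h p) (W p0) - Ug (h p0) (W p0))" for p
 proof -
  have "norm (Ug (h p) (W p) - Ug (h p) (W p0)) <= norm (W p - W p0)"
   using norm_Ug[of "h p" "W p - W p0"] by (simp add: blinfun.diff_right)
  thus ?thesis by (rule norm_diff_triangle_le) simp
 qed
 ultimately have "((%p. Ug (h p) (W p) - Ug (h p0) (W p0)) \<longlongrightarrow> 0) (at p0)"
  by (rule_tac Lim_null_comparison[OF always_eventually]) auto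
 thus "((%p. Ug (h p) (W p)) \<longlongrightarrow> Ug (h p0) (W p0)) (at p0 within UNIV)" by (simp add: LIM_zero_iff)
qed

text \<open>The integrated form of the covariant representation \<open>(Phi, Ug)\<close>.\<close>

definition IF :: "('g => 'a) => ('g dual\<times>nat list) bop => bool"
 where "IF f T \<longleftrightarrow> (\<forall>u v. inner (T u) v = (\<integral>t. inner (Phi (f t) (Ug t u)) v \<partial>mu))"

lemma CL_weak:
 assumes f: "CL K f"
 shows "continuous_on UNIV (%t. Phi (f t) (Ug t u))" "t\<notin>K ==> Phi (f t) (Ug t u) = 0"
  "norm (Phi (f t) (Ug t u)) <= nrm A (f t) * norm u" "integrable mu (%t. inner (Phi (f t) (Ug t u)) v)"
proof -
 show c: "continuous_on UNIV (%t. Phi (f t) (Ug t u))"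
  by (intro bounded_bilinear.continuous_on[OF bounded_bilinear_blinfun_apply] CLD(3)[OF f] continuous_Ug)
 show z: "t\<notin>K ==> Phi (f t) (Ug t u) = 0" for t by (simp add: CLD(4)[OF f] PhiD)
 show "integrable mu (%t. inner (Phi (f t) (Ug t u)) v)" by (rule weak_integral(1)[OF c CLD(1)[OF f] z])
 have "norm (Phi (f t) (Ug t u)) <= norm (Phi (f t)) * norm (Ug t u)" by (rule norm_blinfun)
 also have "...<= nrm A (f t) * norm u" using Phi_norm[OF CLD(2)[OF f]] CLD(2)[OF f] by (intro mult_mono norm_Ug) (auto simp: nrm_nonneg)
 finally show "norm (Phi (f t) (Ug t u)) <= nrm A (f t) * norm u" .
qed

lemma IF_le:
 assumes f: "CL K f"
 shows "\<bar>\<integral>t. inner (Phi (f t) (Ug t u)) v \<partial>mu\<bar> <= (\<integral>t. nrm A (f t) \<partial>mu) * norm u * norm v"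
proof -
 note w = CL_weak[OF f]
 have "\<bar>\<integral>t. inner (Phi (f t) (Ug t u)) v \<partial>mu\<bar> <= (\<integral>t. norm (Phi (f t) (Ug t u)) \<partial>mu) * norm v"
  by (rule weak_integral(3)[OF w(1) CLD(1)[OF f] w(2)])
 also have "(\<integral>t. norm (Phi (f t) (Ug t u)) \<partial>mu) <= (\<integral>t. nrm A (f t) * norm u \<partial>mu)"
  using w(3) CLD(2)[OF f] by (intro integral_mono' integrable_mult_left CL_nrm_int[OF f]) (auto simp: nrm_nonneg)
 finally show ?thesis by (simp add: mult_right_mono)
qed

lemma IF_norm: "CL K f ==> IF f T ==> norm T <= (\<integral>t. nrm A (f t) \<partial>mu)"
 by (rule blinfun_norm_le_restr) (auto simp: IF_def IF_le nrm_nonneg CLD(2) intro!: Bochner_Integration.integral_nonneg)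

lemma IF_unique: assumes "IF f T" "IF f R" shows "T = R"
proof (rule blinfun_eqI)
 fix u
 have "inner (T u - R u) v = 0" for v using assms by (simp add: IF_def inner_diff_left)
 from this[of "T u - R u"] show "T u = R u" by simp
qed

lemma IF_zero: "IF (%_. \<zero>) 0"
 by (simp add: IF_def PhiD)

lemma IF_add: "CL K f ==> CL L g ==> IF f T ==> IF g R ==> IF (%t. f t\<oplus>g t) (T + R)"
 using CL_weak(4)[of K f] CL_weak(4)[of L g] by (simp add: IF_def PhiD CLD(2) blinfun.add_left inner_add_left)

lemma clin_Phi: "x:carrier A ==> clin (Phi x)"
 using PhiD(1)[of x] by (simp add: bop_carrier)

lemma IF_clin: assumes f: "CL K f" and T: "IF f T" shows "clin T"
 unfolding clin_def
proof (intro allI)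
 fix c u
 have "inner (T (cscale c u) - cscale c (T u)) v = 0" for v
  using T clin_Ug clin_Phi[OF CLD(2)[OF f]] by (simp add: IF_def clin_def inner_diff_left inner_cscale)
 from this[of "T (cscale c u) - cscale c (T u)"] show "T (cscale c u) = cscale c (T u)" by simp
qed

lemma IF_scale: "CL K f ==> IF f T ==> IF (%t. z\<odot>f t) (cscaleL z o\<^sub>L T)"
 by (simp add: IF_def PhiD CLD(2) inner_cscale)

text \<open>On the basis vector at (ga, nu' @ ka) the unitary multiplies by the character ga + wt
  nu' + wt ka. \<open>Top\<close> already feeds ga + wt ka into its coefficient, which leaves the
  shift by the weight of \<open>nu'\<close>.\<close>

lemma IF_mo:
 assumes c: "cc K c"
 shows "IF (%t. c t\<odot>mo mu' nu') (Top om mu' nu' (%ga. hat c (ga + wt om nu')))"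
 unfolding IF_def
proof (intro allI)
 fix u v
 let ?T = "Top om mu' nu' (%ga. hat c (ga + wt om nu'))"
 have f: "CL K (%t. c t\<odot>mo mu' nu')" by (rule CL_scale[OF c]) simp
 note w = CL_weak[OF f]
 note bh = bfun_intros(5)[OF bfun_hat[OF c], of "%ga. ga + wt om nu'"]
 have "inner (?T u) v - (\<integral>t. inner (Phi (c t\<odot>mo mu' nu') (Ug t u)) v \<partial>mu) = 0"
 proof (rule ell2_functional_zero)
  show "bounded_linear (%v. inner (?T u) v - (\<integral>t. inner (Phi (c t\<odot>mo mu' nu') (Ug t u)) v \<partial>mu))"
   by (intro bounded_linear_sub bounded_linear_inner_right weak_integral(2)[OF w(1) CLD(1)[OF f] w(2)])
  fix z and p :: "'g dual\<times>nat list"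
  obtain ga x where p: "p = (ga, x)" by (cases p)
  show "inner (?T u) (cscale z (ket p)) - (\<integral>t. inner (Phi (c t\<odot>mo mu' nu') (Ug t u)) (cscale z (ket p)) \<partial>mu) = 0"
  proof (cases "\<exists>ka. x = mu'@ka")
   case True
   then obtain ka where x: "x = mu'@ka" by blast
   define de where "de = ga + wt om ka + wt om nu'"
   define k where "k = cnj z * coord u (ga, nu'@ka)"
   have de: "ga + (wt om nu' + wt om ka) = de" by (simp add: de_def algebra_simps)
   have "(\<integral>t. inner (Phi (c t\<odot>mo mu' nu') (Ug t u)) (cscale z (ket p)) \<partial>mu) = (\<integral>t. Re (k * (c t * pairing t de)) \<partial>mu)"
    by (simp add: inner_cscale_right_ket p x PhiD Phi_mo coord_Top_append bfun_intros coord_Ug de k_def mult_ac)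
   also have "...= Re (k * hat c de)"
    unfolding hat_def using integrable_hat[OF c, of de] by (subst integral_Re) auto
   finally show ?thesis by (simp add: inner_cscale_right_ket p x coord_Top_append[OF bh] de_def k_def mult_ac)
  next
   case False
   thus ?thesis by (simp add: inner_cscale_right_ket p PhiD Phi_mo coord_Top_out bfun_intros bh)
  qed
 qed
 thus "inner (?T u) v = (\<integral>t. inner (Phi (c t\<odot>mo mu' nu') (Ug t u)) v \<partial>mu)" by simp
qed

text \<open>Step functions with monomials for values: the functions whose integrated form is
  explicit by \<open>IF_mo\<close>.\<close>

inductive_set Elem :: "'g set => ('g => 'a) set" for K where
 zero: "(%_. \<zero>):Elem K"
| step: "[|f:Elem K;cc K c|] ==> (%t. c t\<odot>mo mu' nu'\<oplus>f t):Elem K"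

lemma Elem_CL: "f:Elem K ==> compact K ==> CL K f"
 by (induction rule: Elem.induct) (simp_all add: CL_zero CL_add CL_scale)

lemma Elem_add: "f:Elem K ==> compact K ==> g:Elem K ==> (%t. f t\<oplus>g t):Elem K"
proof (induction rule: Elem.induct)
 case zero thus ?case using CLD(2)[OF Elem_CL[OF zero(2,1)]] by simp
next
 case (step f c mu' nu')
 have "(%t. c t\<odot>mo mu' nu'\<oplus>f t\<oplus>g t) = (%t. c t\<odot>mo mu' nu'\<oplus>(f t\<oplus>g t))"
  using CLD(2)[OF Elem_CL[OF step(1,4)]] CLD(2)[OF Elem_CL[OF step(5,4)]] by (simp add: M.a_assoc)
 thus ?case using Elem.step[OF step(3)[OF step(4,5)] step(2)] by simp
qed

lemma Elem_scale: "(x, T):Rep ==> cc K c ==> (%t. c t\<odot>x):Elem K"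
proof (induction rule: mon.Lin.induct)
 case zero thus ?case using Elem.zero by simp
next
 case (step x T mu' nu' a C)
 from step(3) obtain z where z: "a = z\<odot>mo mu' nu'" by (auto simp: Mon_def)
 have "(%t. c t\<odot>(a\<oplus>x)) = (%t. (z * c t)\<odot>mo mu' nu'\<oplus>c t\<odot>x)"
  using mon.Lin_closed[OF step(1)] by (simp add: z scale_add scale_scale mult.commute)
 thus ?case using Elem.step[OF step(4)[OF step(5)] cc_intros(3)[OF step(5), of z]] by simp
qed

lemma Step_Elem: "f:Step K ==> compact K ==> 0 < e ==> \<exists>h\<in>Elem K. \<forall>t. nrm A (f t\<ominus>h t) <= e"
proof (induction arbitrary: e rule: Step.induct)
 case zero thus ?case using Elem.zero by (intro bexI[of _ "%_. \<zero>"]) auto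
next
 case (step f c a)
 obtain h where h: "h:Elem K" "\<forall>t. nrm A (f t\<ominus>h t) <= e/2" using step(4)[OF step(5), of "e/2"] step(6) by auto
 obtain M where M: "0 <= M" "!!t. cmod (c t) <= M" by (rule cc_bounded[OF step(2)]) (rule that)
 have sub: "fst`Rep \<subseteq> carrier A" using mon.Lin_closed by auto
 have "a:nclosure A (fst`Rep)" using step(3) Rep_dense by simp
 moreover have "0 < e/(2 * (M + 1))" using M(1) step(6) by simp
 ultimately obtain x where x: "x:fst`Rep" "nrm A (x\<ominus>a) < e/(2 * (M + 1))"
  unfolding nclosure_iff[OF sub] by blast
 have xC: "x:carrier A" using x(1) sub by blast
 have "(%t. c t\<odot>x\<oplus>h t):Elem K" using Elem_add[OF Elem_scale[OF _ step(2)] step(5) h(1)] x(1) by auto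
 moreover have "nrm A ((c t\<odot>a\<oplus>f t)\<ominus>(c t\<odot>x\<oplus>h t)) <= e" for t
 proof -
  have C: "f t:carrier A" "h t:carrier A" using CLD(2)[OF Step_CL[OF step(1,5)]] CLD(2)[OF Elem_CL[OF h(1) step(5)]] by auto
  have "nrm A ((c t\<odot>a\<oplus>f t)\<ominus>(c t\<odot>x\<oplus>h t)) = nrm A (c t\<odot>(a\<ominus>x)\<oplus>(f t\<ominus>h t))"
   using C xC step(3) by (simp add: add_diff_add scale_diff)
  also have "...<= nrm A (c t\<odot>(a\<ominus>x)) + nrm A (f t\<ominus>h t)" using C xC step(3) by (intro nrm_triangle) auto
  also have "...= cmod (c t) * nrm A (x\<ominus>a) + nrm A (f t\<ominus>h t)"
   using xC step(3) by (simp add: nrm_smult nrm_diff_commute[of a x])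
  also have "cmod (c t) * nrm A (x\<ominus>a) <= (M + 1) * (e/(2 * (M + 1)))"
   using M(2)[of t] x(2) M(1) xC step(3) by (intro mult_mono) (auto simp: nrm_nonneg)
  also have "...= e/2" using M(1) by (simp add: field_simps)
  finally show ?thesis using h(2)[rule_format, of t] by linarith
 qed
 ultimately show ?case by (intro bexI[of _ "%t. c t\<odot>x\<oplus>h t"]) auto
qed

lemma Elem_dense:
 assumes f: "CL K f"
 shows "\<exists>L. compact L \<and> K \<subseteq> L \<and> (\<forall>e>0. \<exists>h\<in>Elem L. \<forall>t. nrm A (f t\<ominus>h t) <= e)"
proof -
 obtain L where L: "compact L" "K \<subseteq> L" "!!e. 0 < e ==> \<exists>k\<in>Step L. \<forall>t. nrm A (f t\<ominus>k t) <= e"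
  using Step_dense[OF f] by metis
 have "\<exists>h\<in>Elem L. \<forall>t. nrm A (f t\<ominus>h t) <= e" if e: "0 < e" for e
 proof -
  obtain k where k: "k:Step L" "\<forall>t. nrm A (f t\<ominus>k t) <= e/2" using L(3)[of "e/2"] e by auto
  obtain h where h: "h:Elem L" "\<forall>t. nrm A (k t\<ominus>h t) <= e/2" using Step_Elem[OF k(1) L(1), of "e/2"] e by auto
  have "nrm A (f t\<ominus>h t) <= e" for t
   using nrm_diff_triangle[of "f t" "k t" "h t"] k(2)[rule_format, of t] h(2)[rule_format, of t]
    CLD(2)[OF f, of t] CLD(2)[OF Step_CL[OF k(1) L(1)], of t] CLD(2)[OF Elem_CL[OF h(1) L(1)], of t] by linarith
  thus ?thesis using h(1) by blast
 qed
 thus ?thesis using L by blast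
qed

lemma Elem_IF: "f:Elem K ==> compact K ==> \<exists>T. IF f T"
proof (induction rule: Elem.induct)
 case zero thus ?case using IF_zero by blast
next
 case (step f c mu' nu')
 then obtain T where "IF f T" by blast
 thus ?case using IF_add[OF CL_scale[OF step(2) mo_closed] Elem_CL[OF step(1,4)] IF_mo[OF step(2)]] by blast
qed

lemma IF_diff: assumes f: "CL K f" and g: "CL L g" and T: "IF f T" and R: "IF g R" shows "IF (%t. f t\<ominus>g t) (T - R)"
proof -
 have "cscaleL (- 1) o\<^sub>L R = - R" by (intro blinfun_eqI coord_ext) (simp add: blinfun.minus_left)
 thus ?thesis using IF_add[OF f CL_scale'[OF g, of "- 1"] T IF_scale[OF g R, of "- 1"]] CLD(2)[OF f] CLD(2)[OF g]
  by (simp add: diff_scale)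
qed

text \<open>The integrated form is contractive for the L^1-norm and known on \<open>Elem\<close>,
  whose functions approximate uniformly on one compact set of finite measure.\<close>

lemma IF_exists:
 assumes f: "CL K f"
 shows "\<exists>T. IF f T"
proof -
 obtain L where L: "compact L" "K \<subseteq> L" "!!e. 0 < e ==> \<exists>h\<in>Elem L. \<forall>t. nrm A (f t\<ominus>h t) <= e"
  using Elem_dense[OF f] by blast
 have fL: "CL L f" by (rule CL_mono[OF f L(2,1)])
 have "\<forall>n::nat. \<exists>h\<in>Elem L. \<forall>t. nrm A (f t\<ominus>h t) <= 1/Suc n" using L(3) by simp
 then obtain h where h: "!!n::nat. h n:Elem L" "!!n t. nrm A (f t\<ominus>h n t) <= 1/Suc n" by metis
 have hC: "CL L (h n)" for n by (rule Elem_CL[OF h(1) L(1)])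
 have "\<forall>n. \<exists>T. IF (h n) T" using Elem_IF[OF h(1) L(1)] by blast
 then obtain X where X: "!!n. IF (h n) (X n)" by metis
 define m where "m = measure mu L"
 have inv0: "(%n. 1/real (Suc n)) \<longlonglongrightarrow> 0" using LIMSEQ_inverse_real_of_nat by (simp add: inverse_eq_divide)
 have dist: "dist (X n) (X l) <= (1/Suc n + 1/Suc l) * m" for n l
 proof -
  have d: "CL L (%t. h n t\<ominus>h l t)" by (rule CL_diff[OF hC hC])
  have "nrm A (h n t\<ominus>h l t) <= 1/Suc n + 1/Suc l" for t
   using nrm_diff_triangle[of "h n t" "f t" "h l t"] nrm_diff_commute[of "h n t" "f t"] h(2)[of t n] h(2)[of t l]
    CLD(2)[OF hC] CLD(2)[OF f] by (smt (verit))
  from nrm_integral_le[OF d this] IF_norm[OF d IF_diff[OF hC hC X X]] show ?thesis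
   by (simp add: dist_norm m_def)
 qed
 have "Cauchy X"
 proof (rule metric_CauchyI)
  fix e :: real assume e: "0 < e"
  have "(%n. 1/real (Suc n) * m) \<longlonglongrightarrow> 0 * m" by (intro tendsto_intros inv0)
  hence "\<forall>\<^sub>F n in sequentially. 1/real (Suc n) * m < e/2" using e by (intro order_tendstoD(2)[of _ "0 * m"]) auto
  then obtain N where N: "!!n. n >= N ==> 1/real (Suc n) * m < e/2" unfolding eventually_sequentially by blast
  have "dist (X n) (X l) < e" if "n >= N" "l >= N" for n l
   using dist[of n l] N[OF that(1)] N[OF that(2)] unfolding distrib_right by linarith
  thus "\<exists>N. \<forall>n\<ge>N. \<forall>l\<ge>N. dist (X n) (X l) < e" by blast
 qed
 then obtain T where T: "X \<longlonglongrightarrow> T" using Cauchy_convergent convergentD by blast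
 have "inner (T u) v = (\<integral>t. inner (Phi (f t) (Ug t u)) v \<partial>mu)" for u v
 proof (rule LIMSEQ_unique)
  show "(%n. inner (X n u) v) \<longlonglongrightarrow> inner (T u) v" by (intro tendsto_intros T)
  show "(%n. inner (X n u) v) \<longlonglongrightarrow> (\<integral>t. inner (Phi (f t) (Ug t u)) v \<partial>mu)"
  proof (rule LIM_zero_cancel, rule Lim_null_comparison)
   show "\<forall>\<^sub>F n in sequentially. norm (inner (X n u) v - (\<integral>t. inner (Phi (f t) (Ug t u)) v \<partial>mu)) <= 1/real (Suc n) * m * norm u * norm v"
   proof (intro always_eventually allI)
    fix n
    have d: "CL L (%t. f t\<ominus>h n t)" by (rule CL_diff[OF fL hC])
    have "(\<integral>t. inner (Phi (f t\<ominus>h n t) (Ug t u)) v \<partial>mu) = (\<integral>t. inner (Phi (f t) (Ug t u)) v \<partial>mu) - inner (X n u) v"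
     using X[of n] CL_weak(4)[OF f, of u v] CL_weak(4)[OF hC, of n u v] CLD(2)[OF f] CLD(2)[OF hC]
     by (simp add: IF_def PhiD blinfun.diff_left inner_diff_left)
    hence "norm (inner (X n u) v - (\<integral>t. inner (Phi (f t) (Ug t u)) v \<partial>mu)) <= (\<integral>t. nrm A (f t\<ominus>h n t) \<partial>mu) * norm u * norm v"
     using IF_le[OF d, of u v] by (simp add: abs_minus_commute)
    also have "...<= 1/real (Suc n) * m * norm u * norm v"
     unfolding m_def by (intro mult_right_mono nrm_integral_le[OF d h(2)]) auto
    finally show "norm (inner (X n u) v - (\<integral>t. inner (Phi (f t) (Ug t u)) v \<partial>mu)) <= 1/real (Suc n) * m * norm u * norm v" .
   qed
   have "(%n. 1/real (Suc n) * m * norm u * norm v) \<longlonglongrightarrow> 0 * m * norm u * norm v" by (intro tendsto_intros inv0)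
   thus "(%n. 1/real (Suc n) * m * norm u * norm v) \<longlonglongrightarrow> 0" by simp
  qed
 qed
 thus ?thesis unfolding IF_def by blast
qed

end

section \<open>The convolution algebra and its Fock seminorm\<close>

context crossed
begin

abbreviation L :: "('g => 'a) normed_star_alg"
 where "L \<equiv> convolution_algebra mu A al"

lemma L_simps:
 "(f\<oplus>\<^bsub>L\<^esub>g) = (%t. f t\<oplus>g t)" "(z\<odot>\<^bsub>L\<^esub>f) = (%t. z\<odot>f t)" "\<zero>\<^bsub>L\<^esub> = (%_. \<zero>)"
 "(f\<otimes>\<^bsub>L\<^esub>g) = (%t. alg_integral mu A (%s. f s\<otimes>al s (g (t - s))))"
 "star L f = (%t. al t (star A (f (- t))))" "nrm L f = (\<integral>t. nrm A (f t) \<partial>mu)"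
 by (simp_all add: convolution_algebra_def)

lemma L_carrier: "f:carrier L \<longleftrightarrow> (\<exists>K. CL K f)"
proof
 assume "f:carrier L"
 hence f: "range f \<subseteq> carrier A" "nrm_continuous A f" "compact (closure {t. f t ~= \<zero>})"
  by (auto simp: convolution_algebra_def)
 hence "CL (closure {t. f t ~= \<zero>}) f" using closure_subset[of "{t. f t ~= \<zero>}"] by (auto simp: CL_def)
 thus "\<exists>K. CL K f" by blast
next
 assume "\<exists>K. CL K f"
 then obtain K where K: "CL K f" by blast
 have "closure {t. f t ~= \<zero>} \<subseteq> K"
  using CLD(4)[OF K] compact_imp_closed[OF CLD(1)[OF K]] by (intro closure_minimal) auto
 hence "compact (closure {t. f t ~= \<zero>})" using compact_Int_closed[OF CLD(1)[OF K], of "closure {t. f t ~= \<zero>}"]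
  by (simp add: Int_absorb1)
 thus "f:carrier L" using K by (auto simp: convolution_algebra_def CL_def)
qed

lemma CL_star: assumes f: "CL K f" shows "CL (uminus`K) (star L f)"
proof -
 have c: "CL (uminus`K) (%t. f (- t))" by (rule CL_compose[OF f]) (simp_all add: continuous_intros)
 note C = CLD(2)[OF c]
 have "nrm_continuous A (%t. star A (f (- t)))"
  using c C unfolding CL_def nrm_continuous_def by (simp add: star_diff[symmetric] nrm_star)
 hence "continuous_on UNIV (%t. Phi (star A (f (- t))))" using nrm_continuous_Phi[of "%t. star A (f (- t))"] C by simp
 hence "continuous_on UNIV (%t. Phi (al t (star A (f (- t)))))" using C by (intro al_continuous) simp_all
 thus ?thesis unfolding L_simps using CLD(1)[OF c] CLD(4)[OF c] C by (intro CLI) simp_all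
qed

lemma adj_Phi: "x:carrier A ==> inner (Phi (star A x) u) v = inner u (Phi x v)"
proof -
 assume x: "x:carrier A"
 obtain R where R: "adj (Phi x) R" using PhiD(1)[OF x] by (auto simp: bop_carrier)
 have "Phi (star A x) = R" using PhiD'(5)[OF x] star_bop[OF R] by simp
 thus ?thesis using R by (simp add: adj_def inner_commute)
qed

text \<open>By covariance the integrand belonging to \<open>star L f\<close> at t is that of
  \<open>f\<close> at -t with the roles of the vectors exchanged, and the integral is invariant
  under reflection.\<close>

lemma IF_star: assumes f: "CL K f" and T: "IF f T" and R: "IF (star L f) R" shows "adj T R"
 unfolding adj_def
proof (intro allI)
 fix u v
 have i: "Phi (star L f t) (Ug t v) = Ug t (Phi (star A (f (- t))) v)" for t
  using intertwine[of "star A (f (- t))" t v] CLD(2)[OF f] by (simp add: L_simps)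
 have c: "cc K (%t. complex_of_real (inner (Phi (f t) (Ug t u)) v))"
  unfolding cc_def using CL_weak(1,2)[OF f, where u = u] CLD(1)[OF f] by (auto intro!: continuous_intros)
 have "inner (R v) u = (\<integral>t. inner (Phi (f (- t)) (Ug (- t) u)) v \<partial>mu)"
 proof -
  have "inner (Phi (star L f t) (Ug t v)) u = inner (Phi (f (- t)) (Ug (- t) u)) v" for t
   unfolding i inner_Ug adj_Phi[OF CLD(2)[OF f]] by (rule inner_commute)
  thus ?thesis using R by (simp add: IF_def)
 qed
 also have "...= inner (T u) v" using integral_reflect[OF c] T by (simp add: IF_def)
 finally show "inner (T u) v = inner u (R v)" by (simp add: inner_commute)
qed

text \<open>Covariance merges \<open>Ug s\<close> and \<open>Ug (t - s)\<close> into
  \<open>Ug t\<close>. Both sides are then double integrals of the same kernel \<open>F\<close>,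
  taken in the two orders.\<close>

lemma IF_mult:
 assumes f: "CL K f" and g: "CL K' g" and T: "IF f T" and R: "IF g R"
 shows "IF (f\<otimes>\<^bsub>L\<^esub>g) (T o\<^sub>L R)"
 unfolding IF_def
proof (intro allI)
 fix u v
 define W where "W t = Phi (g t) (Ug t u)" for t
 have Wc: "continuous_on UNIV W" unfolding W_def by (rule CL_weak[OF g])
 define F where "F s t = complex_of_real (inner (Phi (f s) (Ug s (W (t - s)))) v)" for s t
 have C: "f s:carrier A" "g t:carrier A" for s t using CLD(2)[OF f] CLD(2)[OF g] by auto
 have Feq: "F s t = complex_of_real (inner (Phi (f s\<otimes>al s (g (t - s))) (Ug t u)) v)" for s t
  using Ug_add[of s "t - s" u] intertwine[of "g (t - s)" s "Ug (t - s) u"] C by (simp add: F_def W_def PhiD)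
 have Fcont: "continuous_on UNIV (%p. F (fst p) (snd p))"
  unfolding F_def
  by (intro continuous_intros bounded_bilinear.continuous_on[OF bounded_bilinear_blinfun_apply]
    continuous_on_compose2[OF CLD(3)[OF f]] continuous_Ug' continuous_on_compose2[OF Wc]) auto
 have swap: "(\<integral>s. (\<integral>t. F s t \<partial>mu) \<partial>mu) = (\<integral>t. (\<integral>s. F s t \<partial>mu) \<partial>mu)"
 proof (rule integral_swap[OF Fcont CLD(1)[OF f]])
  show "compact {s + t | s t. s:K \<and> t:K'}" by (rule compact_sum[OF CLD(1)[OF f] CLD(1)[OF g]])
  show z: "F s t = 0" if "s\<notin>K" for s t using that by (simp add: F_def CLD(4)[OF f] PhiD)
  show "F s t = 0" if t: "t\<notin>{s + t | s t. s:K \<and> t:K'}" for s t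
  proof (cases "s:K")
   case True
   have "t = s + (t - s)" by simp
   hence "t - s\<notin>K'" using t True by blast
   thus ?thesis by (simp add: F_def W_def CLD(4)[OF g] PhiD)
  qed (rule z)
 qed
 have "complex_of_real (inner ((T o\<^sub>L R) u) v) = (\<integral>s. (\<integral>t. F s t \<partial>mu) \<partial>mu)"
 proof -
  have "inner (Phi (f s) (Ug s (R u))) v = (\<integral>t. inner (Phi (f s) (Ug s (W (t - s)))) v \<partial>mu)" for s
  proof -
   define k where "k = Ug (- s) (Phi (star A (f s)) v)"
   have k: "inner (Phi (f s) (Ug s x)) v = inner x k" for x
    unfolding k_def inner_Ug[of s x, symmetric] using adj_Phi[OF C(1), of s v] by (simp add: inner_commute)
   have "(\<integral>t. inner (W (t - s)) k \<partial>mu) = (\<integral>t. inner (W t) k \<partial>mu)"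
    using integral_translate[of "%t. inner (W t) k" "- s"] Wc by (simp add: continuous_intros)
   thus ?thesis using R by (simp add: k IF_def W_def)
  qed
  hence "inner ((T o\<^sub>L R) u) v = (\<integral>s. \<integral>t. inner (Phi (f s) (Ug s (W (t - s)))) v \<partial>mu \<partial>mu)"
   using T by (simp add: IF_def)
  thus ?thesis by (simp add: F_def)
 qed
 also have "...= (\<integral>t. (\<integral>s. F s t \<partial>mu) \<partial>mu)" by (rule swap)
 also have "...= complex_of_real (\<integral>t. inner (Phi ((f\<otimes>\<^bsub>L\<^esub>g) t) (Ug t u)) v \<partial>mu)"
 proof -
  have "(\<integral>s. F s t \<partial>mu) = complex_of_real (inner (Phi ((f\<otimes>\<^bsub>L\<^esub>g) t) (Ug t u)) v)" for t
  proof -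
   have w: "integrable mu (%s. cinner (Phi (f s\<otimes>al s (g (t - s))) (Ug t u)) v)"
    "(\<integral>s. cinner (Phi (f s\<otimes>al s (g (t - s))) (Ug t u)) v \<partial>mu) = cinner (Phi ((f\<otimes>\<^bsub>L\<^esub>g) t) (Ug t u)) v"
    using wint_alg_integral[OF CL_integrand[OF f g, of t]] bounded_functional_matrix[of "Ug t u" v]
    unfolding wint_def L_simps by blast+
   have "(\<integral>s. inner (Phi (f s\<otimes>al s (g (t - s))) (Ug t u)) v \<partial>mu) = (\<integral>s. Re (cinner (Phi (f s\<otimes>al s (g (t - s))) (Ug t u)) v) \<partial>mu)"
    by (simp add: cinner_def)
   also have "...= Re (cinner (Phi ((f\<otimes>\<^bsub>L\<^esub>g) t) (Ug t u)) v)" using w by (subst integral_Re) auto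
   finally show ?thesis by (simp add: Feq cinner_def)
  qed
  thus ?thesis by simp
 qed
 finally show "inner ((T o\<^sub>L R) u) v = (\<integral>t. inner (Phi ((f\<otimes>\<^bsub>L\<^esub>g) t) (Ug t u)) v \<partial>mu)" by simp
qed

text \<open>Places the operator norm of the integrated form among the seminorms whose supremum is
  the norm of the crossed product.\<close>

lemma IF_seminorm:
 obtains p where "cstar_seminorm L p" "!!f. f:carrier L ==> p f <= nrm L f"
  "!!f T. f:carrier L ==> IF f T ==> p f = norm T"
proof -
 define R where "R f = (THE T. IF f T)" for f
 have ex: "\<exists>T. IF f T" if "f:carrier L" for f using IF_exists that L_carrier by blast
 have Req: "IF f T ==> R f = T" for f T unfolding R_def using IF_unique by blast
 have RI: "IF f (R f)" if "f:carrier L" for f using ex[OF that] Req by metis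
 have seminorm: "cstar_seminorm L (%f. norm (R f))"
  unfolding cstar_seminorm_def
 proof (intro conjI ballI allI)
  fix f assume f: "f:carrier L"
  then obtain K where K: "CL K f" using L_carrier by blast
  note Rf = RI[OF f]
  show "0 <= norm (R f)" by simp
  show "norm (R (z\<odot>\<^bsub>L\<^esub>f)) = cmod z * norm (R f)" for z
   using Req[OF IF_scale[OF K Rf, of z]] by (simp add: L_simps norm_cscaleL)
  note sK = CL_star[OF K]
  have "star L f:carrier L" using sK L_carrier by blast
  note Rs = RI[OF this]
  show "norm (R (star L f\<otimes>\<^bsub>L\<^esub>f)) = (norm (R f))\<^sup>2"
   using Req[OF IF_mult[OF sK K Rs Rf]] adj_norm_cstar[OF IF_star[OF K Rf Rs]] by simp
  fix g assume g: "g:carrier L"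
  then obtain K' where K': "CL K' g" using L_carrier by blast
  note Rg = RI[OF g]
  show "norm (R (f\<oplus>\<^bsub>L\<^esub>g)) <= norm (R f) + norm (R g)"
   using Req[OF IF_add[OF K K' Rf Rg]] norm_triangle_ineq[of "R f" "R g"] by (simp add: L_simps)
  show "norm (R (f\<otimes>\<^bsub>L\<^esub>g)) <= norm (R f) * norm (R g)"
   using Req[OF IF_mult[OF K K' Rf Rg]] norm_blinfun_compose[of "R f" "R g"] by simp
 qed
 show ?thesis
 proof (rule that[OF seminorm])
  show "norm (R f) <= nrm L f" if f: "f:carrier L" for f
   using IF_norm RI[OF f] f L_carrier L_simps(6) by metis
 qed (simp add: Req)
qed

end

section \<open>The Fock representation of the crossed product\<close>

locale crossed_product_algebra = crossed mu A S om al Phi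
 for mu :: "'g::{topological_ab_group_add, t2_space} measure" and A :: "'a normed_star_alg" (structure)
  and S om al Phi +
 fixes B :: "'b normed_star_alg" and io :: "('g => 'a) => 'b"
 assumes crossed_product: "crossed_product B io mu A al"
begin

sublocale B: cstar_algebra B
 using crossed_product by (simp add: crossed_product_def enveloping_cstar_algebra_def)

lemma io_hom: "star_hom L B io"
 using crossed_product by (simp add: crossed_product_def enveloping_cstar_algebra_def)

lemmas ioD = star_homD[OF io_hom]

lemma io_dense: "b:carrier B ==> 0 < e ==> \<exists>f\<in>carrier L. nrm B (b\<ominus>\<^bsub>B\<^esub>io f) < e"
 using crossed_product by (simp add: crossed_product_def enveloping_cstar_algebra_def)

lemma io_zero: "io (%_. \<zero>) = \<zero>\<^bsub>B\<^esub>"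
proof -
 have "(%_. \<zero>):carrier L" using CL_zero[OF compact_empty] L_carrier by blast
 from ioD(3)[OF this, of 0] ioD(1)[OF this] show ?thesis by (simp add: L_simps)
qed

lemma io_norm:
 assumes f: "f:carrier L"
 shows "nrm B (io f) <= nrm L f" "IF f T ==> norm T <= nrm B (io f)"
proof -
 let ?P = "{p. cstar_seminorm L p \<and> (\<forall>y\<in>carrier L. p y <= nrm L y)}"
 have eq: "nrm B (io f) = (SUP p\<in>?P. p f)"
  using crossed_product f by (simp add: crossed_product_def enveloping_cstar_algebra_def)
 obtain p where q: "cstar_seminorm L p" "!!f. f:carrier L ==> p f <= nrm L f"
  "!!f T. f:carrier L ==> IF f T ==> p f = norm T"
  by (rule IF_seminorm) (rule that)
 have p: "p:?P" "!!T. IF f T ==> p f = norm T" using q f by auto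
 have bdd: "bdd_above ((%p. p f)`?P)" by (rule bdd_aboveI[of _ "nrm L f"]) (use f in auto)
 show "nrm B (io f) <= nrm L f" unfolding eq using p(1) f by (intro cSUP_least) auto
 show "norm T <= nrm B (io f)" if "IF f T" unfolding eq using cSUP_upper[OF p(1) bdd] p(2)[OF that] by simp
qed

definition el :: "nat list => nat list => ('g => complex) => 'g => 'a"
 where "el mu' nu' c = (%t. c t\<odot>mo mu' nu')"

lemma el_CL: "cc K c ==> CL K (el mu' nu' c)"
 unfolding el_def by (rule CL_scale) simp_all

lemma el_closed [simp]: "c:Cc ==> el mu' nu' c:carrier L"
 unfolding L_carrier Cc_def using el_CL by blast

lemma el_add: "el mu' nu' (%t. c t + d t) = el mu' nu' c\<oplus>\<^bsub>L\<^esub>el mu' nu' d"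
 by (simp add: el_def L_simps add_scale)

lemma el_scale: "el mu' nu' (%t. z * c t) = z\<odot>\<^bsub>L\<^esub>el mu' nu' c"
 by (simp add: el_def L_simps scale_scale)

lemma el_star: "star L (el mu' nu' c) = el nu' mu' (%t. cstar c t * pw nu' mu' t)"
 by (simp add: el_def L_simps star_smult star_mo alD al_mo scale_scale cstar_def mult.commute)

lemma el_mult:
 assumes c: "c:Cc" and d: "d:Cc"
 shows "el mu1 nu1 c\<otimes>\<^bsub>L\<^esub>el mu2 nu2 d = (%t. conv (%s. c s * pw mu2 nu2 s) d t\<odot>(mo mu1 nu1\<otimes>mo mu2 nu2))"
proof
 fix t
 let ?k = "%s. (c s * pw mu2 nu2 s) * d (t - s)"
 obtain K where K: "cc K c" "cc K d" using cc_common[OF c d] by blast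
 have "cc K ?k"
  by (intro cc_intros(4) K(1) pw_cont continuous_pair[OF cc_cont[OF K(2)]] continuous_intros)
 from alg_integral_eq[OF wint_scale[OF this mult_closed[OF mo_closed mo_closed]]]
 show "(el mu1 nu1 c\<otimes>\<^bsub>L\<^esub>el mu2 nu2 d) t = conv (%s. c s * pw mu2 nu2 s) d t\<odot>(mo mu1 nu1\<otimes>mo mu2 nu2)"
  by (simp add: L_simps el_def conv_def alD al_mo smult_mult_left smult_mult_right scale_scale mult_ac)
qed

lemma pw_Cc: "c:Cc ==> (%t. c t * pw mu' nu' t):Cc"
 by (intro Cc_intros(8) pw_cont)

lemma hat_pw: "hat (%t. c t * pw mu' nu' t) ga = hat c (ga + (wt om mu' - wt om nu'))"
 unfolding pw_def by (rule hat_mult_pairing)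

lemma hat_conv': "c:Cc ==> d:Cc ==> hat (conv c d) ga = hat c ga * hat d ga"
 unfolding Cc_def using hat_conv by blast

lemma hat_cstar: "c:Cc ==> hat (cstar c) ga = cnj (hat c ga)"
 using hat_star by (auto simp: Cc_def cstar_def[abs_def])

lemma pw_self: "pw nu' nu' t = 1"
 by (simp add: pw_def pairing_simps)

lemma nrm_el: assumes c: "c:Cc" shows "nrm B (io (el mu' nu' c)) <= (\<integral>t. cmod (c t) \<partial>mu)"
proof -
 obtain K where K: "cc K c" using c by (auto simp: Cc_def)
 have "nrm B (io (el mu' nu' c)) <= (\<integral>t. nrm A (c t\<odot>mo mu' nu') \<partial>mu)"
  using io_norm(1)[OF el_closed[OF c], of mu' nu'] by (simp add: L_simps el_def)
 also have "...<= (\<integral>t. cmod (c t) \<partial>mu)"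
 proof (rule integral_mono')
  show "integrable mu (%t. cmod (c t))" using integrable_cc[OF K] by simp
  show "nrm A (c t\<odot>mo mu' nu') <= cmod (c t)" for t
   using mult_left_mono[OF nrm_mo, of "cmod (c t)" mu' nu'] by (simp add: nrm_smult)
 qed simp
 finally show ?thesis .
qed

text \<open>The projection \<open>mo nu' nu'\<close> is fixed by the action, so multiplying it by
  scalar functions represents the untwisted convolution algebra of the group, to which
  \<open>conv_norm_le_hat\<close> applies.\<close>

lemma nrm_el_diagonal:
 assumes c: "c:Cc" and b: "0 <= b" "!!ga. cmod (hat c ga) <= b"
 shows "nrm B (io (el nu' nu' c)) <= b"
proof (rule conv_norm_le_hat[OF B.cstar_algebra_axioms, of "%c. io (el nu' nu' c)"])
 fix c d assume c: "c:Cc" and d: "d:Cc"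
 show "io (el nu' nu' (%t. c t + d t)) = io (el nu' nu' c)\<oplus>\<^bsub>B\<^esub>io (el nu' nu' d)"
  using c d by (simp add: el_add ioD(2))
 have "mo nu' nu'\<otimes>mo nu' nu' = mo nu' nu'" using mo_mult1[of nu' nu' "[]"] by simp
 hence "el nu' nu' (conv c d) = el nu' nu' c\<otimes>\<^bsub>L\<^esub>el nu' nu' d"
  unfolding el_mult[OF c d] by (simp add: pw_self) (simp add: el_def)
 thus "io (el nu' nu' (conv c d)) = io (el nu' nu' c)\<otimes>\<^bsub>B\<^esub>io (el nu' nu' d)"
  using c d by (simp add: ioD(4))
next
 fix c assume c: "c:Cc"
 show "io (el nu' nu' c):carrier B" by (simp add: c ioD(1))
 show "io (el nu' nu' (%t. z * c t)) = z\<odot>\<^bsub>B\<^esub>io (el nu' nu' c)" for z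
  using c by (simp add: el_scale ioD(3))
 show "io (el nu' nu' (cstar c)) = star B (io (el nu' nu' c))"
  using c ioD(5)[OF el_closed[OF c], of nu' nu'] by (simp add: el_star pw_self)
 show "nrm B (io (el nu' nu' c)) <= (\<integral>t. cmod (c t) \<partial>mu)" by (rule nrm_el[OF c])
qed (use c b in auto)

text \<open>The shift by \<open>wt om nu'\<close> is that of \<open>IF_mo\<close>, so that the
  operator attached to this monomial is the integrated form of the function.\<close>

definition MonB :: "nat list => nat list => ('b\<times>('g dual => complex)) set"
 where "MonB mu' nu' = {(io (el mu' nu' c), %ga. hat c (ga + wt om nu')) | c. c:Cc}"

lemma MonBI: "c:Cc ==> a = io (el mu' nu' c) ==> (!!ga. C ga = hat c (ga + wt om nu')) ==> (a, C):MonB mu' nu'"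
 unfolding MonB_def by blast

lemma MonBE:
 assumes "(a, C):MonB mu' nu'"
 obtains c where "c:Cc" "a = io (el mu' nu' c)" "C = (%ga. hat c (ga + wt om nu'))"
 using assms unfolding MonB_def by blast

lemma MonB_star: assumes "(a, C):MonB mu' nu'" shows "(star B a, %ga. cnj (C ga)):MonB nu' mu'"
proof -
 obtain c where c: "c:Cc" "a = io (el mu' nu' c)" "C = (%ga. hat c (ga + wt om nu'))" using assms by (rule MonBE)
 show ?thesis
 proof (rule MonBI[OF pw_Cc[OF Cc_intros(6)[OF c(1)]]])
  show "star B a = io (el nu' mu' (%t. cstar c t * pw nu' mu' t))"
   using ioD(5)[OF el_closed[OF c(1)], of mu' nu'] by (simp add: c(2) el_star)
  fix ga
  have "ga + wt om mu' + (wt om nu' - wt om mu') = ga + wt om nu'" by simp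
  thus "cnj (C ga) = hat (%t. cstar c t * pw nu' mu' t) (ga + wt om mu')" by (simp only: hat_pw hat_cstar[OF c(1)] c(3))
 qed
qed

text \<open>Covers both comparable cases of the product: in each of them one of \<open>eta\<close>
  and \<open>ka\<close> is empty. The two word equations are what makes the shifts from the twisted
  convolution agree with those in the rules for monomials.\<close>

lemma io_el_mult:
 assumes c: "c:Cc" and d: "d:Cc" and m: "mo mu1 nu1\<otimes>mo mu2 nu2 = mo mu' nu'"
  and w: "nu2@eta = nu'" "mu2@eta = nu1@ka"
 shows "(io (el mu1 nu1 c)\<otimes>\<^bsub>B\<^esub>io (el mu2 nu2 d), %ga. hat c (ga + wt om ka + wt om nu1) * hat d (ga + wt om eta + wt om nu2)):MonB mu' nu'"
proof (rule MonBI[of "conv (%s. c s * pw mu2 nu2 s) d"])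
 show "conv (%s. c s * pw mu2 nu2 s) d:Cc" by (intro Cc_intros(5) pw_Cc c d)
 have "el mu1 nu1 c\<otimes>\<^bsub>L\<^esub>el mu2 nu2 d = el mu' nu' (conv (%s. c s * pw mu2 nu2 s) d)"
  unfolding el_mult[OF c d] m by (simp add: el_def)
 thus "io (el mu1 nu1 c)\<otimes>\<^bsub>B\<^esub>io (el mu2 nu2 d) = io (el mu' nu' (conv (%s. c s * pw mu2 nu2 s) d))"
  using ioD(4)[OF el_closed[OF c] el_closed[OF d]] by metis
 fix ga
 have a: "wt om nu' = wt om nu2 + wt om eta" "wt om mu2 + wt om eta = wt om nu1 + wt om ka"
  using arg_cong[OF w(1), of "wt om"] arg_cong[OF w(2), of "wt om"] by simp_all
 have "ga + wt om nu' + (wt om mu2 - wt om nu2) = ga + (wt om mu2 + wt om eta)" by (simp add: a(1) algebra_simps)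
 hence 1: "ga + wt om nu' + (wt om mu2 - wt om nu2) = ga + wt om ka + wt om nu1" by (simp only: a(2)) (simp add: algebra_simps)
 have 2: "ga + wt om nu' = ga + wt om eta + wt om nu2" by (simp add: a(1) algebra_simps)
 show "hat c (ga + wt om ka + wt om nu1) * hat d (ga + wt om eta + wt om nu2) = hat (conv (%s. c s * pw mu2 nu2 s) d) (ga + wt om nu')"
  unfolding hat_conv'[OF pw_Cc[OF c] d] hat_pw 1 unfolding 2 ..
qed

lemma MonB_mult:
 assumes a: "(a, C):MonB mu1 nu1" and b: "(b, D):MonB mu2 nu2" and m: "mo mu1 nu1\<otimes>mo mu2 nu2 = mo mu' nu'"
  and w: "nu2@eta = nu'" "mu2@eta = nu1@ka"
 shows "(a\<otimes>\<^bsub>B\<^esub>b, %ga. C (ga + wt om ka) * D (ga + wt om eta)):MonB mu' nu'"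
 using a b by (auto elim!: MonBE intro!: io_el_mult[OF _ _ m w])

sublocale monB: monomials B om MonB
proof
 fix mu' nu' a C assume aC: "(a, C):MonB mu' nu'"
 then obtain c where c: "c:Cc" "a = io (el mu' nu' c)" "C = (%ga. hat c (ga + wt om nu'))" by (rule MonBE)
 obtain K where K: "cc K c" using c(1) by (auto simp: Cc_def)
 show cl: "a:carrier B \<and> bfun C" using c bfun_hat[OF K] bfun_intros(5)[of "hat c"] by (simp add: ioD(1))
 \<comment> \<open>a* a is a diagonal monomial whose coefficient is the squared modulus of
   \<open>C\<close>, so the diagonal bound carries over through the C*-identity.\<close>
 show "nrm B a <= r" if r: "0 <= r" "!!ga. cmod (C ga) <= r" for r
 proof -
  have "(star B a\<otimes>\<^bsub>B\<^esub>a, %ga. cnj (C (ga + wt om [])) * C (ga + wt om [])):MonB nu' nu'"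
   using mo_mult1[of nu' mu' "[]" nu'] by (intro MonB_mult[OF MonB_star[OF aC] aC]) auto
  then obtain d where d: "d:Cc" "star B a\<otimes>\<^bsub>B\<^esub>a = io (el nu' nu' d)" "!!ga. cnj (C ga) * C ga = hat d (ga + wt om nu')"
   by (elim MonBE) (simp add: fun_eq_iff)
  have "cmod (hat d ga) <= r\<^sup>2" for ga
  proof -
   have "hat d ga = cnj (C (ga - wt om nu')) * C (ga - wt om nu')" unfolding d(3) by simp
   hence "cmod (hat d ga) = (cmod (C (ga - wt om nu')))\<^sup>2" by (simp add: norm_mult Power.power2_eq_square)
   thus ?thesis using r by (simp add: power_mono)
  qed
  hence "(nrm B a)\<^sup>2 <= r\<^sup>2" using nrm_el_diagonal[OF d(1), of "r\<^sup>2"] B.nrm_cstar[of a] cl d(2) by (metis zero_le_power2)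
  thus ?thesis using r(1) by (rule power2_le_imp_le)
 qed
 show "(star B a, %ga. cnj (C ga)):MonB nu' mu'" by (rule MonB_star[OF aC])
next
 fix mu' nu'
 have "el mu' nu' (%_. 0) = (%_. \<zero>)" by (simp add: el_def)
 thus "(\<zero>\<^bsub>B\<^esub>, %_. 0):MonB mu' nu'" using io_zero Cc_intros(1) by (intro MonBI[of "%_. 0"]) (auto simp: hat_def)
 fix a C b D assume a: "(a, C):MonB mu' nu'" and b: "(b, D):MonB mu' nu'"
 obtain c where c: "c:Cc" "a = io (el mu' nu' c)" "C = (%ga. hat c (ga + wt om nu'))" using a by (rule MonBE)
 obtain d where d: "d:Cc" "b = io (el mu' nu' d)" "D = (%ga. hat d (ga + wt om nu'))" using b by (rule MonBE)
 obtain K where K: "cc K c" "cc K d" using cc_common[OF c(1) d(1)] by blast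
 show "(a\<oplus>\<^bsub>B\<^esub>b, %ga. C ga + D ga):MonB mu' nu'"
  by (rule MonBI[OF Cc_intros(2)[OF c(1) d(1)]]) (simp_all add: c d el_add ioD(2) hat_add[OF K])
next
 fix mu' nu' nu2 ka a C b D assume "(a, C):MonB mu' nu'" "(b, D):MonB (nu'@ka) nu2"
 from MonB_mult[OF this mo_mult1, of "[]"] show "(a\<otimes>\<^bsub>B\<^esub>b, %ga. C (ga + wt om ka) * D ga):MonB (mu'@ka) nu2" by simp
next
 fix mu' nu' nu2 ka a C b D assume "(a, C):MonB mu' (nu'@ka)" "(b, D):MonB nu' nu2"
 from MonB_mult[OF this mo_mult2, of ka "[]"] show "(a\<otimes>\<^bsub>B\<^esub>b, %ga. C ga * D (ga + wt om ka)):MonB mu' (nu2@ka)" by simp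
next
 fix mu1 nu1 mu2 nu2 a C b D assume a: "(a, C):MonB mu1 nu1" and b: "(b, D):MonB mu2 nu2"
  and n: "\<nexists>ka. mu2 = nu1@ka" "\<nexists>ka. nu1 = mu2@ka"
 obtain c where c: "c:Cc" "a = io (el mu1 nu1 c)" using a by (rule MonBE)
 obtain d where d: "d:Cc" "b = io (el mu2 nu2 d)" using b by (rule MonBE)
 have "el mu1 nu1 c\<otimes>\<^bsub>L\<^esub>el mu2 nu2 d = (%_. \<zero>)" by (simp add: el_mult[OF c(1) d(1)] mo_mult0[OF n])
 thus "a\<otimes>\<^bsub>B\<^esub>b = \<zero>\<^bsub>B\<^esub>" using ioD(4)[OF el_closed[OF c(1)] el_closed[OF d(1)]] io_zero unfolding c(2) d(2) by metis
qed

text \<open>Ties the operator half of a pair to an actual function, so that \<open>io_norm\<close>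
  can bound it by the norm of \<open>B\<close>.\<close>

lemma Lin_IF: "(b, T):monB.Lin UNIV ==> \<exists>K f. CL K f \<and> b = io f \<and> IF f T"
proof (induction rule: monB.Lin.induct)
 case zero
 show ?case by (intro exI[of _ "{}"] exI[of _ "%_. \<zero>"]) (simp add: CL_zero IF_zero io_zero)
next
 case (step x T mu' nu' a C)
 from step(3) obtain c where c: "c:Cc" "a = io (el mu' nu' c)" "C = (%ga. hat c (ga + wt om nu'))" by (rule MonBE)
 obtain K f where f: "CL K f" "x = io f" "IF f T" using step(4) by blast
 obtain K' where K': "cc K' c" using c(1) by (auto simp: Cc_def)
 have U: "compact (K'\<union>K)" using CLD(1)[OF f(1)] K' by (intro compact_Un) (simp_all add: cc_def)
 have C: "CL (K'\<union>K) (el mu' nu' c)" "CL (K'\<union>K) f"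
  using CL_mono[OF el_CL[OF K'] _ U] CL_mono[OF f(1) _ U] by auto
 have "CL (K'\<union>K) (%t. el mu' nu' c t\<oplus>f t)" by (rule CL_add[OF C])
 moreover have "IF (%t. el mu' nu' c t\<oplus>f t) (Top om mu' nu' C + T)"
  using IF_add[OF el_CL[OF K'] f(1) IF_mo[OF K', folded el_def] f(3)] by (simp add: c(3))
 moreover have "a\<oplus>\<^bsub>B\<^esub>x = io (%t. el mu' nu' c t\<oplus>f t)"
 proof -
  have "el mu' nu' c:carrier L" "f:carrier L" using C unfolding L_carrier by blast+
  from ioD(2)[OF this] show ?thesis by (simp add: c(2) f(2) L_simps)
 qed
 ultimately show ?case by blast
qed

text \<open>The upper bound is the abstract estimate for sums of monomials; the lower one holds
  because the Fock seminorm takes part in the supremum.\<close>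

lemma Lin_norm_eq: assumes "(b, T):monB.Lin UNIV" shows "nrm B b = norm T"
proof (rule antisym)
 show "nrm B b <= norm T" by (rule monB.Lin_norm[OF assms])
 show "norm T <= nrm B b" using Lin_IF[OF assms] io_norm(2) L_carrier by blast
qed

lemma Elem_Lin: "f:Elem K ==> compact K ==> \<exists>T. (io f, T):monB.Lin UNIV"
proof (induction rule: Elem.induct)
 case zero thus ?case using monB.Lin.zero io_zero by metis
next
 case (step f c mu' nu')
 then obtain T where T: "(io f, T):monB.Lin UNIV" by blast
 have c: "c:Cc" by (rule CcI[OF step(2)])
 have "f:carrier L" using Elem_CL[OF step(1,4)] L_carrier by blast
 hence e: "io (%t. c t\<odot>mo mu' nu'\<oplus>f t) = io (el mu' nu' c)\<oplus>\<^bsub>B\<^esub>io f"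
  using ioD(2)[OF el_closed[OF c]] by (simp add: L_simps el_def)
 show ?case unfolding e using monB.Lin.step[OF T UNIV_I MonBI[OF c refl refl]] by blast
qed

text \<open>An element of \<open>Elem\<close> that is uniformly close on a fixed compact set is
  close in the L^1-norm, which dominates the norm of \<open>B\<close>.\<close>

lemma Lin_dense:
 assumes b: "b:carrier B" and e: "0 < e"
 shows "\<exists>(a, T)\<in>monB.Lin UNIV. nrm B (a\<ominus>\<^bsub>B\<^esub>b) < e"
proof -
 obtain f where f: "f:carrier L" "nrm B (b\<ominus>\<^bsub>B\<^esub>io f) < e/2" using io_dense[OF b, of "e/2"] e by auto
 obtain K where K: "CL K f" using f(1) L_carrier by blast
 obtain M where M: "compact M" "K \<subseteq> M" "!!r. 0 < r ==> \<exists>h\<in>Elem M. \<forall>t. nrm A (f t\<ominus>h t) <= r"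
  using Elem_dense[OF K] by blast
 have fM: "CL M f" by (rule CL_mono[OF K M(2,1)])
 define r where "r = e/(2 * (measure mu M + 1))"
 have r: "0 < r" using e by (simp add: r_def add_nonneg_pos)
 obtain h where h: "h:Elem M" "\<forall>t. nrm A (f t\<ominus>h t) <= r" using M(3)[OF r] by blast
 have hM: "CL M h" by (rule Elem_CL[OF h(1) M(1)])
 have hL: "h:carrier L" using hM L_carrier by blast
 obtain T where T: "(io h, T):monB.Lin UNIV" using Elem_Lin[OF h(1) M(1)] by blast
 have d: "CL M (%t. f t\<ominus>h t)" by (rule CL_diff[OF fM hM])
 have s: "(%t. (- 1)\<odot>h t):carrier L" using CL_scale'[OF hM] L_carrier by blast
 have "(%t. f t\<ominus>h t) = f\<oplus>\<^bsub>L\<^esub>((- 1)\<odot>\<^bsub>L\<^esub>h)" using CLD(2)[OF fM] CLD(2)[OF hM] by (simp add: L_simps diff_scale)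
 hence "io (%t. f t\<ominus>h t) = io f\<ominus>\<^bsub>B\<^esub>io h"
  using ioD(2)[OF f(1) s] ioD(3)[OF hL, of "- 1"] ioD(1)[OF f(1)] ioD(1)[OF hL] by (simp add: L_simps B.diff_scale)
 hence "nrm B (io f\<ominus>\<^bsub>B\<^esub>io h) <= (\<integral>t. nrm A (f t\<ominus>h t) \<partial>mu)"
  using io_norm(1)[of "%t. f t\<ominus>h t"] d L_carrier by (auto simp: L_simps)
 also have "...<= r * measure mu M" using h(2) by (intro nrm_integral_le[OF d]) blast
 also have "...<= e/2"
 proof -
  have "r * measure mu M <= r * (measure mu M + 1)" using r by simp
  also have "...= e/2"
   using add_nonneg_pos[OF measure_nonneg zero_less_one, of mu M] by (simp add: r_def field_simps)
  finally show ?thesis .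
 qed
 finally have "nrm B (b\<ominus>\<^bsub>B\<^esub>io h) < e"
  using B.nrm_diff_triangle[OF b ioD(1)[OF f(1)] ioD(1)[OF hL]] f(2) by linarith
 thus ?thesis using T B.nrm_diff_commute[OF b ioD(1)[OF hL]] by (intro bexI[of _ "(io h, T)"]) auto
qed

lemma Lin_scale: "(b, T):monB.Lin UNIV ==> (z\<odot>\<^bsub>B\<^esub>b, cscaleL z o\<^sub>L T):monB.Lin UNIV"
proof (induction rule: monB.Lin.induct)
 case zero
 have "cscaleL z o\<^sub>L 0 = 0" by (intro blinfun_eqI coord_ext) simp
 thus ?case using monB.Lin.zero by simp
next
 case (step x T mu' nu' a C)
 from step(3) obtain c where c: "c:Cc" "a = io (el mu' nu' c)" "C = (%ga. hat c (ga + wt om nu'))" by (rule MonBE)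
 note cl = monB.Mon_closed[OF step(3)] monB.Lin_closed[OF step(1)]
 have m: "(z\<odot>\<^bsub>B\<^esub>a, %ga. z * C ga):MonB mu' nu'"
  by (rule MonBI[OF Cc_intros(3)[OF c(1), of z]]) (simp_all add: c el_scale ioD(3) hat_scale)
 have "z\<odot>\<^bsub>B\<^esub>(a\<oplus>\<^bsub>B\<^esub>x) = z\<odot>\<^bsub>B\<^esub>a\<oplus>\<^bsub>B\<^esub>z\<odot>\<^bsub>B\<^esub>x" using cl by (simp add: B.scale_add)
 moreover have "cscaleL z o\<^sub>L (Top om mu' nu' C + T) = Top om mu' nu' (%ga. z * C ga) + (cscaleL z o\<^sub>L T)"
  using cl by (subst Top_scale) (auto intro!: blinfun_eqI coord_ext simp: blinfun.add_left algebra_simps)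
 ultimately show ?case using monB.Lin.step[OF step(4) UNIV_I m] by simp
qed

theorem fock_embedding:
 obtains Psi where "star_hom B bop Psi" "!!x. x:carrier B ==> norm (Psi x) = nrm B x"
  "!!x. x:carrier B ==> Psi x:nclosure bop (snd`monB.Lin UNIV)"
proof (rule isometric_extension[OF B.cstar_algebra_axioms cstar_algebra_bop, of "monB.Lin UNIV"])
 fix a T b R assume aT: "(a, T):monB.Lin UNIV"
 show "a:carrier B \<and> T:carrier bop \<and> nrm B a = nrm bop T" using monB.Lin_closed[OF aT] Lin_norm_eq[OF aT] by simp
 show "(c\<odot>\<^bsub>B\<^esub>a, c\<odot>\<^bsub>bop\<^esub>T):monB.Lin UNIV" for c using Lin_scale[OF aT] by simp
 show "(star B a, star bop T):monB.Lin UNIV" using monB.Lin_star[OF aT] by simp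
 assume bR: "(b, R):monB.Lin UNIV"
 show "(a\<oplus>\<^bsub>B\<^esub>b, T\<oplus>\<^bsub>bop\<^esub>R):monB.Lin UNIV" using monB.Lin_add[OF aT bR] by simp
 show "(a\<otimes>\<^bsub>B\<^esub>b, T\<otimes>\<^bsub>bop\<^esub>R):monB.Lin UNIV"
  using monB.Lin_mult[OF aT bR, of UNIV] by (simp add: monB.comp_closed_def)
next
 fix x e assume "x:carrier B" "(0::real) < e"
 thus "\<exists>(a, T)\<in>monB.Lin UNIV. nrm B (a\<ominus>\<^bsub>B\<^esub>x) < e" by (rule Lin_dense)
next
 fix Psi assume h: "star_hom B bop Psi" "!!x. x:carrier B ==> nrm bop (Psi x) = nrm B x"
  "!!x. x:carrier B ==> Psi x:nclosure bop (snd`monB.Lin UNIV)"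
 show thesis using h by (intro that[of Psi]) auto
qed

end

section \<open>Finite-dimensional subalgebras\<close>

text \<open>An inductive span works for infinite \<open>X\<close> as well;
  \<open>lspan_finsum\<close> returns to the finite sums that \<open>finite_dim_subalgebra\<close>
  asks for.\<close>

inductive_set lspan :: "'a normed_star_alg => 'a set => 'a set" for A X where
 zero: "\<zero>\<^bsub>A\<^esub>:lspan A X"
| step: "[|x:lspan A X;b:X|] ==> c\<odot>\<^bsub>A\<^esub>b\<oplus>\<^bsub>A\<^esub>x:lspan A X"

context cstar_algebra
begin

lemma lspan_closed: "x:lspan A X ==> X \<subseteq> carrier A ==> x:carrier A"
 by (induction rule: lspan.induct) auto

lemma lspan_base: "b:X ==> X \<subseteq> carrier A ==> c\<odot>b:lspan A X"
 using lspan.step[OF lspan.zero, of b X A c] by (metis M.r_zero scale_closed subsetD)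

lemma lspan_add: "x:lspan A X ==> X \<subseteq> carrier A ==> y:lspan A X ==> x\<oplus>y:lspan A X"
proof (induction rule: lspan.induct)
 case (step x b c)
 have "c\<odot>b\<oplus>x\<oplus>y = c\<odot>b\<oplus>(x\<oplus>y)"
  using step lspan_closed by (meson M.a_assoc scale_closed subsetD)
 thus ?case using step by (simp add: lspan.step)
qed (simp add: lspan_closed)

lemma lspan_scale: "x:lspan A X ==> X \<subseteq> carrier A ==> k\<odot>x:lspan A X"
proof (induction rule: lspan.induct)
 case zero thus ?case by (simp add: lspan.zero)
next
 case (step x b c)
 have "k\<odot>(c\<odot>b\<oplus>x) = (k * c)\<odot>b\<oplus>k\<odot>x"
  using step lspan_closed[OF step(1)] by (simp add: scale_add scale_scale subsetD)
 thus ?case using step by (simp add: lspan.step)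
qed

lemma lspan_trans: "x:lspan A X ==> X \<subseteq> lspan A Y ==> Y \<subseteq> carrier A ==> x:lspan A Y"
 by (induction rule: lspan.induct) (auto intro: lspan.zero lspan_add lspan_scale)

lemma lspan_mono: "x:lspan A X ==> X \<subseteq> Y ==> x:lspan A Y"
 by (induction rule: lspan.induct) (auto intro: lspan.intros)

lemma lspan_finite: "x:lspan A X ==> \<exists>Y. finite Y \<and> Y \<subseteq> X \<and> x:lspan A Y"
proof (induction rule: lspan.induct)
 case zero thus ?case using lspan.zero by blast
next
 case (step x b c)
 then obtain Y where "finite Y" "Y \<subseteq> X" "x:lspan A Y" by blast
 thus ?case using step lspan.step[OF lspan_mono, of x Y "insert b Y" b c] by (intro exI[of _ "insert b Y"]) auto
qed

lemma lspan_star: "x:lspan A X ==> X \<subseteq> carrier A ==> (!!b. b:X ==> star A b:lspan A X) ==> star A x:lspan A X"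
proof (induction rule: lspan.induct)
 case (step x b c)
 have "star A (c\<odot>b\<oplus>x) = cnj c\<odot>star A b\<oplus>star A x"
  using step lspan_closed[OF step(1)] by (simp add: star_add star_smult subsetD)
 thus ?case using step by (simp add: lspan_add lspan_scale)
qed (simp add: lspan.zero)

lemma lspan_mult:
 assumes X: "X \<subseteq> carrier A" and m: "!!b d. b:X ==> d:X ==> b\<otimes>d:lspan A X"
  and x: "x:lspan A X" and y: "y:lspan A X"
 shows "x\<otimes>y:lspan A X"
 using x
proof (induction rule: lspan.induct)
 case zero thus ?case using lspan_closed[OF y X] by (simp add: lspan.zero)
next
 case (step x b c)
 have bC: "b:carrier A" using step(2) X by blast
 have "b\<otimes>y:lspan A X" using y
 proof (induction rule: lspan.induct)
  case zero thus ?case using bC by (simp add: lspan.zero)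
 next
  case (step y d k)
  hence "b\<otimes>(k\<odot>d\<oplus>y) = k\<odot>(b\<otimes>d)\<oplus>b\<otimes>y"
   using bC X lspan_closed[OF step(1) X] by (simp add: mult_r_distr smult_mult_right subsetD)
  thus ?case using step m[OF \<open>b \<in> X\<close>] by (simp add: lspan_add lspan_scale X)
 qed
 moreover have "(c\<odot>b\<oplus>x)\<otimes>y = c\<odot>(b\<otimes>y)\<oplus>x\<otimes>y"
  using bC lspan_closed[OF step(1) X] lspan_closed[OF y X] by (simp add: mult_l_distr smult_mult_left)
 ultimately show ?case using step(3) by (simp add: lspan_add lspan_scale X)
qed

lemma lspan_insert:
 assumes "x:lspan A (insert a X)" "insert a X \<subseteq> carrier A"
 shows "\<exists>k s. s:lspan A X \<and> x = k\<odot>a\<oplus>s"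
 using assms
proof (induction rule: lspan.induct)
 case zero thus ?case by (intro exI[of _ 0] exI[of _ \<zero>]) (simp add: lspan.zero)
next
 case (step x b c)
 then obtain k s where ks: "s:lspan A X" "x = k\<odot>a\<oplus>s" by blast
 have C: "a:carrier A" "b:carrier A" "s:carrier A" using step(2,4) lspan_closed[OF ks(1)] by auto
 show ?case
 proof (cases "b = a")
  case True
  thus ?thesis using ks C by (intro exI[of _ "c + k"] exI[of _ s]) (simp add: add_scale M.a_assoc)
 next
  case False
  thus ?thesis using ks C step(2) by (intro exI[of _ k] exI[of _ "c\<odot>b\<oplus>s"]) (simp add: lspan.step M.a_lcomm)
 qed
qed

text \<open>Finite-dimensional subspaces are closed. By induction a new vector \<open>a\<close>
  outside the span of \<open>X\<close> has a positive distance \<open>d\<close> from it, so the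
  coefficients of \<open>a\<close> in a convergent sequence are Cauchy, and subtracting their limit
  leads back to \<open>X\<close>.\<close>

lemma lspan_limit:
 assumes "finite X" "X \<subseteq> carrier A" "!!n::nat. Z n:lspan A X" "x:carrier A" "nlim A Z x"
 shows "x:lspan A X"
 using assms
proof (induction X arbitrary: Z x rule: finite_induct)
 case empty
 have "Z n = \<zero>" for n using empty.prems(2)[of n] by (cases rule: lspan.cases) auto
 hence "nlim A (%_. \<zero>) x" using empty.prems(4) by (simp add: nlim_def)
 hence "x = \<zero>" using nlim_unique[OF _ nlim_const] empty.prems(3) by auto
 thus ?case by (simp add: lspan.zero)
next
 case (insert a X)
 have X: "X \<subseteq> carrier A" and a: "a:carrier A" using insert.prems(1) by auto
 show ?case
 proof (cases "a:lspan A X")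
  case True
  have "insert a X \<subseteq> lspan A X" using True lspan_base[OF _ X, of _ 1] X by force
  hence "Z n:lspan A X" for n using lspan_trans[OF insert.prems(2) _ X] by blast
  from insert.IH[OF X this insert.prems(3,4)] show ?thesis by (rule lspan_mono) auto
 next
  case False
  have "\<exists>d>0. \<forall>s\<in>lspan A X. d <= nrm A (a\<ominus>s)"
  proof (rule ccontr)
   assume n: "\<not> ?thesis"
   have "\<exists>s\<in>lspan A X. nrm A (a\<ominus>s) < 1/Suc n" for n :: nat
   proof (rule ccontr)
    assume "\<not> ?thesis"
    hence "\<forall>s\<in>lspan A X. 1/Suc n <= nrm A (a\<ominus>s)" by force
    moreover have "(0::real) < 1/Suc n" by simp
    ultimately show False using n by blast
   qed
   then obtain s where s: "!!n::nat. s n:lspan A X" "!!n. nrm A (a\<ominus>s n) < 1/Suc n" by metis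
   have "nlim A s a"
   proof (rule nlimI_le)
    show "nrm A (s n\<ominus>a) <= 1/Suc n" for n
     using s(2)[of n] nrm_diff_commute[OF a lspan_closed[OF s(1) X], of n] by simp
    show "(%n. 1/real (Suc n)) \<longlonglongrightarrow> 0" using LIMSEQ_inverse_real_of_nat by (simp add: inverse_eq_divide)
   qed (use a lspan_closed[OF s(1) X] in auto)
   thus False using insert.IH[OF X, of s a] s(1) a False by blast
  qed
  then obtain d where d: "0 < d" "!!s. s:lspan A X ==> d <= nrm A (a\<ominus>s)" by blast
  have "\<forall>n. \<exists>k s. s:lspan A X \<and> Z n = k\<odot>a\<oplus>s" using lspan_insert insert.prems(1,2) by blast
  then obtain k s where ks: "!!n. s n:lspan A X" "!!n. Z n = k n\<odot>a\<oplus>s n" by metis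
  have sC: "s n:carrier A" for n by (rule lspan_closed[OF ks(1) X])
  have ZC: "range Z \<subseteq> carrier A" using ks(2) sC a by auto
  have le: "cmod (k n - k m) * d <= nrm A (Z n\<ominus>Z m)" for n m
  proof (cases "k n = k m")
   case False
   define z where "z = k n - k m"
   have z: "z ~= 0" using False by (simp add: z_def)
   define r where "r = (- 1/z)\<odot>(s n\<oplus>(- 1)\<odot>s m)"
   have r: "r:lspan A X" unfolding r_def using ks(1) X by (intro lspan_scale lspan_add)
   have rC: "r:carrier A" by (rule lspan_closed[OF r X])
   have "(- z)\<odot>r = s n\<oplus>(- 1)\<odot>s m" using z sC by (simp add: r_def scale_scale)
   hence "z\<odot>(a\<ominus>r) = z\<odot>a\<oplus>(s n\<oplus>(- 1)\<odot>s m)"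
    using a rC by (simp add: diff_scale scale_add scale_scale)
   also have "...= Z n\<ominus>Z m"
   proof -
    have "Z n\<ominus>Z m = (k n\<odot>a\<ominus>k m\<odot>a)\<oplus>(s n\<ominus>s m)" using a sC by (simp add: ks(2) add_diff_add)
    moreover have "k n\<odot>a\<ominus>k m\<odot>a = z\<odot>a"
     using add_scale[OF a, of "k n" "- k m"] a by (simp add: z_def diff_scale scale_scale)
    ultimately show ?thesis using sC by (simp add: diff_scale)
   qed
   finally have "nrm A (Z n\<ominus>Z m) = cmod z * nrm A (a\<ominus>r)" using a rC nrm_smult[of "a\<ominus>r" z] by simp
   thus ?thesis using d(2)[OF r] by (simp add: z_def mult_left_mono)
  qed (use ZC in "simp add: nrm_nonneg image_subset_iff")
  have "Cauchy k"
  proof (rule metric_CauchyI)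
   fix e :: real assume e: "0 < e"
   obtain N where N: "\<forall>m\<ge>N. \<forall>n\<ge>N. nrm A (Z m\<ominus>Z n) < e * d"
    using nlim_cauchy[OF insert.prems(4) ZC insert.prems(3), of "e * d"] e d(1) by auto
   have "dist (k m) (k n) < e" if "m >= N" "n >= N" for m n
    using le[of m n] N that d(1) by (smt (verit) dist_norm mult_less_cancel_right_pos)
   thus "\<exists>N. \<forall>m\<ge>N. \<forall>n\<ge>N. dist (k m) (k n) < e" by blast
  qed
  then obtain k0 where k0: "k \<longlonglongrightarrow> k0" using Cauchy_convergent convergentD by blast
  have ka: "nlim A (%n. (- k n)\<odot>a) ((- k0)\<odot>a)"
  proof (rule nlimI_le)
   show "nrm A ((- k n)\<odot>a\<ominus>(- k0)\<odot>a) <= cmod (k n - k0) * nrm A a" for n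
   proof -
    have "(- k n)\<odot>a\<ominus>(- k0)\<odot>a = (- (k n - k0))\<odot>a"
     using add_scale[OF a, of "- k n" "k0"] a by (simp add: diff_scale scale_scale)
    thus ?thesis using a by (simp add: nrm_smult norm_minus_commute)
   qed
   have "(%n. cmod (k n - k0)) \<longlonglongrightarrow> 0" using k0 by (simp add: LIM_zero tendsto_norm_zero)
   thus "(%n. cmod (k n - k0) * nrm A a) \<longlonglongrightarrow> 0" by (rule tendsto_mult_left_zero)
  qed (use a in auto)
  have "nlim A (%n. Z n\<oplus>(- k n)\<odot>a) (x\<oplus>(- k0)\<odot>a)"
   by (rule nlim_add[OF insert.prems(4) ka ZC]) (use a insert.prems(3) in auto)
  moreover have "Z n\<oplus>(- k n)\<odot>a = s n" for n
  proof -
   have "Z n\<oplus>(- k n)\<odot>a = (k n\<odot>a\<oplus>s n)\<oplus>(- k n)\<odot>a" by (simp only: ks(2)[of n])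
   also have "...= s n\<oplus>(k n\<odot>a\<oplus>(- k n)\<odot>a)" using a sC[of n] by (simp add: M.a_ac)
   also have "k n\<odot>a\<oplus>(- k n)\<odot>a = \<zero>" using add_scale[OF a, of "k n" "- k n"] a by simp
   finally show ?thesis using sC by simp
  qed
  ultimately have lim: "nlim A s (x\<oplus>(- k0)\<odot>a)" by simp
  have y: "x\<oplus>(- k0)\<odot>a:lspan A X"
   by (rule insert.IH[OF X, of s]) (use ks(1) a insert.prems(3) lim in auto)
  have "k0\<odot>a\<oplus>(x\<oplus>(- k0)\<odot>a) = x\<oplus>(k0\<odot>a\<oplus>(- k0)\<odot>a)" using a insert.prems(3) by (simp add: M.a_ac)
  also have "k0\<odot>a\<oplus>(- k0)\<odot>a = \<zero>" using add_scale[OF a, of k0 "- k0"] a by simp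
  finally have "x = k0\<odot>a\<oplus>(x\<oplus>(- k0)\<odot>a)" using insert.prems(3) by simp
  thus ?thesis using lspan.step[OF lspan_mono[OF y, of "insert a X"], of a k0] by auto
 qed
qed

lemma lspan_subalgebra:
 assumes X: "finite X" "X \<subseteq> carrier A" and star: "!!b. b:X ==> star A b:lspan A X"
  and m: "!!b d. b:X ==> d:X ==> b\<otimes>d:lspan A X"
 shows "cstar_subalgebra (lspan A X) A"
proof (rule subalgebraI)
 show "x:lspan A X" if "!!n::nat. Z n:lspan A X" "x:carrier A" "nlim A Z x" for Z x
  by (rule lspan_limit[OF X that])
 show "lspan A X \<subseteq> carrier A" using lspan_closed[OF _ X(2)] by blast
qed (use X star m in "auto intro: lspan.zero lspan_add lspan_scale lspan_star lspan_mult")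

lemma lspan_finsum:
 assumes "x:lspan A X" "finite X" "X \<subseteq> carrier A"
 shows "\<exists>c. x = (\<Oplus>b\<in>X. c b\<odot>b)"
 using assms
proof (induction rule: lspan.induct)
 case zero
 have "(\<Oplus>b\<in>X. (0::complex)\<odot>b) = (\<Oplus>b\<in>X. \<zero>)" using zero by (intro M.finsum_cong') auto
 thus ?case by (intro exI[of _ "%_. 0"]) simp
next
 case (step x b k)
 then obtain c where c: "x = (\<Oplus>b\<in>X. c b\<odot>b)" by blast
 define c' where "c' = c(b := c b + k)"
 have split: "(\<Oplus>d\<in>X. f d\<odot>d) = f b\<odot>b\<oplus>(\<Oplus>d\<in>X - {b}. f d\<odot>d)" for f
  using M.finsum_insert[of "X - {b}" b "%d. f d\<odot>d"] step by (auto simp: insert_absorb)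
 have "(\<Oplus>d\<in>X - {b}. c' d\<odot>d) = (\<Oplus>d\<in>X - {b}. c d\<odot>d)"
  using step by (intro M.finsum_cong') (auto simp: c'_def)
 moreover have "(\<Oplus>d\<in>X - {b}. c d\<odot>d):carrier A" using step by (intro M.finsum_closed) auto
 moreover have "b:carrier A" using step by blast
 ultimately have "k\<odot>b\<oplus>x = (\<Oplus>d\<in>X. c' d\<odot>d)"
  unfolding c split[of c] split[of c'] by (simp add: c'_def add_scale M.a_ac)
 thus ?case by blast
qed

end

section \<open>Totally bounded sets of characters\<close>

lemma finite_net:
 assumes "0 < e"
 obtains r :: "complex => complex" and Z where "finite Z" "!!z. cmod z <= M ==> r z:Z \<and> cmod (z - r z) < e"
proof -
 have "cball 0 M \<subseteq> (\<Union>x\<in>UNIV::complex set. ball x e)" using assms by (metis UN_I UNIV_I centre_in_ball subsetI)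
 then obtain Z :: "complex set" where Z: "Z \<subseteq> UNIV" "finite Z" "cball 0 M \<subseteq> (\<Union>x\<in>Z. ball x e)"
  by (rule compactE_image[OF compact_cball open_ball]) (rule that)
 have "\<forall>z. \<exists>x. cmod z <= M --> x:Z \<and> cmod (z - x) < e"
  using Z(3) by (force simp: subset_iff dist_norm norm_minus_commute)
 then obtain r where "!!z. cmod z <= M --> r z:Z \<and> cmod (z - r z) < e" by metis
 thus ?thesis using that Z(2) by blast
qed

abbreviation small :: "'g::topological_ab_group_add set => real => 'g dual set => bool"
 where "small Q d p \<equiv> \<forall>ga\<in>p. \<forall>de\<in>p. \<forall>t\<in>Q. cmod (pairing t ga - pairing t de) < d"

text \<open>\<open>TB V\<close>: total boundedness with respect to the uniformity of the dual group.\<close>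

definition TB :: "'g::topological_ab_group_add dual set => bool"
 where "TB V \<longleftrightarrow> (\<forall>Q d. compact Q --> 0 < d --> (\<exists>P. finite P \<and> V \<subseteq> \<Union>P \<and> (\<forall>p\<in>P. small Q d p)))"

lemma TBE:
 assumes "TB V" "compact Q" "0 < d"
 obtains P where "finite P" "V \<subseteq> \<Union>P" "\<forall>p\<in>P. small Q d p"
proof -
 obtain P where P: "finite P \<and> V \<subseteq> \<Union>P \<and> (\<forall>p\<in>P. small Q d p)"
  using assms(1)[unfolded TB_def, rule_format, OF assms(2,3)] by (rule exE)
 show ?thesis by (rule that[of P]) (use P in simp_all)
qed

lemma TBI:
 assumes "!!Q d. compact Q ==> 0 < d ==> \<exists>P. finite P \<and> V \<subseteq> \<Union>P \<and> (\<forall>p\<in>P. small Q d p)"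
 shows "TB V"
 unfolding TB_def using assms by simp

lemma TB_subset:
 assumes V: "TB V" and W: "W \<subseteq> V" shows "TB W"
proof (rule TBI)
 fix Q :: "'a set" and d :: real assume Q: "compact Q" "0 < d"
 obtain P where P: "finite P" "V \<subseteq> \<Union>P" "\<forall>p\<in>P. small Q d p"
  by (rule TBE[OF V Q]) (rule that)
 show "\<exists>P. finite P \<and> W \<subseteq> \<Union>P \<and> (\<forall>p\<in>P. small Q d p)"
  using P(1,3) order_trans[OF W P(2)] by (intro exI[of _ P]) simp
qed

lemma TB_Union: "finite F ==> (!!V. V:F ==> TB V) ==> TB (\<Union>F)"
proof (induction F rule: finite_induct)
 case empty show ?case by (rule TBI) auto
next
 case (insert V F)
 have 1: "TB V" and 2: "TB (\<Union>F)" using insert by simp_all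
 show ?case
 proof (rule TBI)
  fix Q :: "'a set" and d :: real assume Q: "compact Q" "0 < d"
  obtain P where P: "finite P" "V \<subseteq> \<Union>P" "\<forall>p\<in>P. small Q d p"
   by (rule TBE[OF 1 Q]) (rule that)
  obtain P' where P': "finite P'" "\<Union>F \<subseteq> \<Union>P'" "\<forall>p\<in>P'. small Q d p"
   by (rule TBE[OF 2 Q]) (rule that)
  have "\<Union>(insert V F) \<subseteq> \<Union>(P\<union>P')" using P(2) P'(2) by auto
  thus "\<exists>P. finite P \<and> \<Union>(insert V F) \<subseteq> \<Union>P \<and> (\<forall>p\<in>P. small Q d p)"
   using P(1,3) P'(1,3) by (intro exI[of _ "P\<union>P'"]) auto
 qed
qed

lemma TB_translate:
 assumes V: "TB V" shows "TB ((%ga. ga + a)`V)"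
proof (rule TBI)
 fix Q :: "'a set" and d :: real assume Q: "compact Q" "0 < d"
 obtain P where P: "finite P" "V \<subseteq> \<Union>P" "\<forall>p\<in>P. small Q d p"
  by (rule TBE[OF V Q]) (rule that)
 have "cmod (pairing t (ga + a) - pairing t (de + a)) = cmod (pairing t ga - pairing t de)" for t ga de
  by (simp add: pairing_simps left_diff_distrib[symmetric] norm_mult)
 moreover have "(%ga. ga + a)`V \<subseteq> \<Union>((`) (%ga. ga + a)`P)" using P(2) by fastforce
 ultimately show "\<exists>P. finite P \<and> (%ga. ga + a)`V \<subseteq> \<Union>P \<and> (\<forall>p\<in>P. small Q d p)"
  using P(1,3) by (intro exI[of _ "(`) (%ga. ga + a)`P"]) auto
qed

text \<open>A strong form of the Riemann--Lebesgue lemma: where a transform is bounded away from 0, the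
 characters are equicontinuous.\<close>

lemma (in haar) TB_hat:
 assumes c: "cc K c" and e: "0 < e"
 shows "TB {ga. e <= cmod (hat c ga)}"
proof (rule TBI)
 fix Q :: "'g set" and d :: real assume Q: "compact Q" "0 < d"
 define V where "V = {ga. e <= cmod (hat c ga)}"
 obtain M where M: "compact M" "K \<subseteq> M"
  "\<forall>e>0. \<exists>U. open U \<and> 0:U \<and> (\<forall>s\<in>U. (\<forall>t. cmod (c (t - s) - c t) <= e) \<and> (\<forall>t. t\<notin>M --> c (t - s) = 0))"
  using cc_uniformly_continuous[OF lc c] by blast
 define m where "m = measure mu M"
 have m: "0 <= m" by (simp add: m_def)
 \<comment> \<open>Integrated over \<open>M\<close> this bound gives at most e d/8; dividing by the
   modulus of the transform, which is at least \<open>e\<close> on \<open>V\<close>, leaves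
   d/8.\<close>
 obtain U where U: "open U" "0:U" "\<forall>s\<in>U. (\<forall>t. cmod (c (t - s) - c t) <= e * d/(8 * (m + 1))) \<and> (\<forall>t. t\<notin>M --> c (t - s) = 0)"
  using M(3)[rule_format, of "e * d/(8 * (m + 1))"] e Q(2) m by auto
 have eq: "cmod (pairing s ga - 1) <= d/8" if s: "s:U" and ga: "ga:V" for s ga
 proof -
  have cont: "continuous_on UNIV (%t. c t * pairing (t + s) ga)"
   by (intro continuous_on_mult cc_cont[OF c] continuous_pair[OF pairing_simps(8)] continuous_intros)
  have cs: "cc M (%t. c (t - s))" unfolding cc_def
   using U(3) s M(1) by (auto intro!: continuous_pair[OF cc_cont[OF c]] continuous_intros)
  have "(\<integral>t. c (t - s) * pairing t ga \<partial>mu) = (\<integral>t. c t * pairing (t + s) ga \<partial>mu)"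
   using integral_translate[OF cont, of "- s"] by simp
  also have "(%t. c t * pairing (t + s) ga) = (%t. pairing s ga * (c t * pairing t ga))"
   by (simp add: pairing_simps fun_eq_iff)
  also have "(\<integral>t. pairing s ga * (c t * pairing t ga) \<partial>mu) = pairing s ga * hat c ga" by (simp add: hat_def)
  finally have "(pairing s ga - 1) * hat c ga = (\<integral>t. (c (t - s) - c t) * pairing t ga \<partial>mu)"
   using integrable_hat[OF cs, of ga] integrable_hat[OF c, of ga] by (simp add: left_diff_distrib hat_def)
  also have "norm ...<= e * d/(8 * (m + 1)) * measure mu M"
   using U(3) s c M(2) by (intro integral_bound[OF M(1)]) (auto simp: norm_mult pairing_simps(4) cc_def)
  also have "...<= e * d/(8 * (m + 1)) * (m + 1)" using e Q(2) m by (intro mult_left_mono) (auto simp: m_def)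
  also have "...= e * d/8" using m by (simp add: field_simps)
  finally have "cmod (pairing s ga - 1) * cmod (hat c ga) <= e * d/8" by (simp add: norm_mult)
  moreover have "cmod (pairing s ga - 1) * e <= cmod (pairing s ga - 1) * cmod (hat c ga)"
   using ga by (intro mult_left_mono) (auto simp: V_def)
  ultimately have "cmod (pairing s ga - 1) * e <= (d/8) * e" by (simp add: mult.commute)
  thus ?thesis using e by (simp add: mult_le_cancel_right)
 qed
 have "open {t. t - q:U}" for q using open_vimage[OF U(1), of "%t. t - q"] by (simp add: vimage_def continuous_intros)
 moreover have "Q \<subseteq> (\<Union>q\<in>Q. {t. t - q:U})" using U(2) by auto
 ultimately obtain J where J: "J \<subseteq> Q" "finite J" "Q \<subseteq> (\<Union>q\<in>J. {t. t - q:U})"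
  by (rule compactE_image[OF Q(1)])
 obtain r Z where r: "finite Z" "!!z. cmod z <= 1 ==> r z:Z \<and> cmod (z - r z) < d/8"
  by (rule finite_net[of "d/8" 1]) (use Q(2) that in auto)
 \<comment> \<open>A piece consists of the characters whose values at the nodes \<open>J\<close>
   round to the same numbers. Two of them differ at a point of \<open>Q\<close> by at most four
   errors of d/8: from the point to its node and from the value to its rounding, for each of the
   two.\<close>
 let ?p = "%phi. {ga\<in>V. \<forall>q\<in>J. r (pairing q ga) = phi q}"
 have "V \<subseteq> \<Union>(?p`PiE J (%_. Z))"
 proof
  fix ga assume "ga:V"
  hence "ga:?p (restrict (%q. r (pairing q ga)) J)" by simp
  moreover have "restrict (%q. r (pairing q ga)) J:PiE J (%_. Z)" using r(2) by (simp add: pairing_simps(4))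
  ultimately show "ga:\<Union>(?p`PiE J (%_. Z))" by blast
 qed
 moreover have "cmod (pairing t ga - pairing t de) < d" if p: "ga:?p phi" "de:?p phi" and t: "t:Q" for phi ga de t
 proof -
  obtain q where q: "q:J" "t - q:U" using J(3) t by blast
  have near: "cmod (pairing t eta - pairing q eta) <= d/8" if "eta:V" for eta
  proof -
   have "pairing t eta = pairing q eta * pairing (t - q) eta" using pairing_simps(2)[of q "t - q" eta] by simp
   hence "pairing t eta - pairing q eta = pairing q eta * (pairing (t - q) eta - 1)" by (simp add: right_diff_distrib)
   thus ?thesis using eq[OF q(2) that] by (simp add: norm_mult pairing_simps(4))
  qed
  have "cmod (pairing q ga - phi q) < d/8" "cmod (pairing q de - phi q) < d/8"
   using p q(1) r(2)[of "pairing q ga"] r(2)[of "pairing q de"] by (auto simp: pairing_simps(4))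
  moreover have "cmod (pairing t ga - pairing q ga) <= d/8" "cmod (pairing t de - pairing q de) <= d/8"
   using near p by auto
  moreover have "cmod (pairing t ga - pairing t de) = cmod ((pairing t ga - pairing q ga) + (pairing q ga - phi q) - (pairing q de - phi q) - (pairing t de - pairing q de))"
   by simp
  ultimately show ?thesis
   using norm_triangle_ineq[of "pairing t ga - pairing q ga" "pairing q ga - phi q"]
    norm_triangle_ineq4[of "(pairing t ga - pairing q ga) + (pairing q ga - phi q)" "pairing q de - phi q"]
    norm_triangle_ineq4[of "(pairing t ga - pairing q ga) + (pairing q ga - phi q) - (pairing q de - phi q)" "pairing t de - pairing q de"] Q(2)
   by linarith
 qed
 moreover have "finite (?p`PiE J (%_. Z))" using J(2) r(1) by (simp add: finite_PiE)
 ultimately show "\<exists>P. finite P \<and> {ga. e <= cmod (hat c ga)} \<subseteq> \<Union>P \<and> (\<forall>p\<in>P. small Q d p)"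
  unfolding V_def[symmetric] by (intro exI[of _ "?p`PiE J (%_. Z)"]) blast
qed

text \<open>For a subbasic set, the compact image of \<open>Q\<close> under the character
  \<open>be\<close> has positive distance from the complement of the open set, and this distance can
  serve as \<open>d\<close>.\<close>

lemma dual_neighbourhood:
 fixes U :: "'g::topological_ab_group_add dual set"
 assumes "open U" "be:U"
 shows "\<exists>Q d. compact Q \<and> 0 < d \<and> (\<forall>ga. (\<forall>t\<in>Q. cmod (pairing t ga - pairing t be) < d) --> ga:U)"
 using assms unfolding open_dual_def
proof (induction rule: generate_topology.induct)
 case UNIV show ?case by (intro exI[of _ "{}"] exI[of _ 1]) simp
next
 case (Int U W)
 have "be:U" "be:W" using Int.prems by auto
 from Int(3)[OF this(1)] Int(4)[OF this(2)] obtain Q d Q' d' where "compact Q" "0 < d"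
  "\<forall>ga. (\<forall>t\<in>Q. cmod (pairing t ga - pairing t be) < d) --> ga:U"
  "compact Q'" "0 < d'" "\<forall>ga. (\<forall>t\<in>Q'. cmod (pairing t ga - pairing t be) < d') --> ga:W" by blast
 thus ?case by (intro exI[of _ "Q\<union>Q'"] exI[of _ "min d d'"]) (auto simp: compact_Un)
next
 case (UN KK)
 then obtain W where W: "W:KK" "be:W" by blast
 thus ?case using UN(2)[OF W] by blast
next
 case (Basis U)
 then obtain Q O' where U: "U = {ga. \<forall>t\<in>Q. pairing t ga:O'}" "compact Q" "open O'" by blast
 have "continuous_on Q (%t. pairing t be)" using continuous_on_subset[OF pairing_simps(8)] by blast
 hence "compact ((%t. pairing t be)`Q)" using U(2) by (rule compact_continuous_image)
 moreover have "(%t. pairing t be)`Q\<inter>(- O') = {}" using Basis U(1) by blast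
 ultimately obtain d where d: "0 < d" "\<forall>x\<in>(%t. pairing t be)`Q. \<forall>y\<in>- O'. d <= dist x y"
  using separate_compact_closed[of "(%t. pairing t be)`Q" "- O'"] U(3) by auto
 show ?case
 proof (intro exI conjI allI impI)
  fix ga assume ga: "\<forall>t\<in>Q. cmod (pairing t ga - pairing t be) < d"
  have "pairing t ga:O'" if "t:Q" for t
   using d(2) ga that by (metis ComplI dist_commute dist_norm imageI not_le)
  thus "ga:U" using U(1) by blast
 qed (use U d in auto)
qed

section \<open>Words whose weights stay in a totally bounded set\<close>

locale noncontracting =
 fixes om :: "nat => 'g::topological_ab_group_add dual"
 assumes not_in_closure: "!!i n. - om i\<notin>closure {wt om w | w. w:lists {..<n}}"
begin

text \<open>For a word i # v, multiplication by the unimodular value at om i turns the distance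
  between wt v and - om i into the distance between the weight of the whole word and 0. The
  hypothesis bounds the former from below for each i, and only finitely many i are first
  letters.\<close>

lemma separation:
 obtains Q d where "compact Q" "0 < d" "!!w. w:lists {..<n} ==> w ~= [] ==> \<exists>t\<in>Q. d <= cmod (pairing t (wt om w) - 1)"
proof -
 have "\<exists>Q d. compact Q \<and> 0 < d \<and> (\<forall>v\<in>lists {..<n}. \<exists>t\<in>Q. d <= cmod (pairing t (wt om (i#v)) - 1))" for i
 proof -
  have op: "open (- closure {wt om w | w. w:lists {..<n}})" by (rule open_Compl[OF closed_closure])
  have mem: "- om i:- closure {wt om w | w. w:lists {..<n}}" using not_in_closure by simp
  obtain Q d where Q: "compact Q" "0 < d"
   "\<forall>ga. (\<forall>t\<in>Q. cmod (pairing t ga - pairing t (- om i)) < d) --> ga:- closure {wt om w | w. w:lists {..<n}}"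
   using dual_neighbourhood[OF op mem] by (elim exE conjE) (rule that)
  have "\<exists>t\<in>Q. d <= cmod (pairing t (wt om (i#v)) - 1)" if v: "v:lists {..<n}" for v
  proof -
   have "wt om v:{wt om w | w. w:lists {..<n}}" using v by (intro CollectI exI[of _ v] conjI refl)
   from subsetD[OF closure_subset this] have "wt om v:closure {wt om w | w. w:lists {..<n}}" .
   hence "\<not> (\<forall>t\<in>Q. cmod (pairing t (wt om v) - pairing t (- om i)) < d)" using Q(3)[THEN spec, of "wt om v"] by (simp only: Compl_iff) simp
   then obtain t where t: "t:Q" "d <= cmod (pairing t (wt om v) - pairing t (- om i))" by (auto simp: not_less)
   have "pairing t (wt om (i#v)) - 1 = pairing t (om i) * (pairing t (wt om v) - pairing t (- om i))"
    by (simp add: pairing_simps right_diff_distrib pairing_cnj)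
   hence "cmod (pairing t (wt om (i#v)) - 1) = cmod (pairing t (wt om v) - pairing t (- om i))"
    by (simp only: norm_mult pairing_simps(4) mult_1)
   thus ?thesis using t by (intro bexI[of _ t]) simp_all
  qed
  thus ?thesis using Q(1,2) by (intro exI[of _ Q] exI[of _ d]) simp
 qed
 then obtain Q d where Q: "!!i. compact (Q i)" "!!i. 0 < d i"
  "!!i v. v:lists {..<n} ==> \<exists>t\<in>Q i. d i <= cmod (pairing t (wt om (i#v)) - 1)" by metis
 show ?thesis
 \<comment> \<open>The inserted 1 gives the minimum a value when n = 0.\<close>
 proof (rule that[of "\<Union>i<n. Q i" "Min (insert 1 (d`{..<n}))"])
  show "compact (\<Union>i<n. Q i)" using Q(1) by (intro compact_UN) auto
  show "0 < Min (insert 1 (d`{..<n}))" using Q(2) by (subst Min_gr_iff) auto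
  fix w assume w: "w:lists {..<n}" "w ~= []"
  then obtain i v where iv: "w = i#v" "i < n" "v:lists {..<n}" by (cases w) auto
  obtain t where t: "t:Q i" "d i <= cmod (pairing t (wt om w) - 1)" using Q(3)[OF iv(3)] iv(1) by blast
  have "Min (insert 1 (d`{..<n})) <= d i" using iv(2) by (intro Min_le) auto
  thus "\<exists>t\<in>\<Union>i<n. Q i. Min (insert 1 (d`{..<n})) <= cmod (pairing t (wt om w) - 1)" using t iv(2) by (meson UN_I lessThan_iff order_trans)
 qed
qed

text \<open>By pigeonhole, two suffix sums of a long word with all suffix sums in \<open>K\<close> would be close.\<close>

lemma bounded_paths:
 assumes K: "TB K"
 shows "\<exists>N. \<forall>ga. \<forall>w\<in>lists {..<n}. (\<forall>a b. w = a@b --> ga + wt om b:K) --> length w <= N"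
proof -
 obtain Q d where Q: "compact Q" "0 < d" "!!w. w:lists {..<n} ==> w ~= [] ==> \<exists>t\<in>Q. d <= cmod (pairing t (wt om w) - 1)"
  by (rule separation) (rule that)
 obtain P where P: "finite P" "K \<subseteq> \<Union>P" "\<forall>p\<in>P. small Q d p"
  by (rule TBE[OF K Q(1,2)]) (rule that)
 have "length w <= card P" if w: "w:lists {..<n}" and path: "\<forall>a b. w = a@b --> ga + wt om b:K" for ga w
 proof (rule ccontr)
  assume long: "\<not> length w <= card P"
  have "ga + wt om (drop j w):K" for j by (rule path[rule_format, OF append_take_drop_id[symmetric]])
  hence "\<forall>j. \<exists>p. p:P \<and> ga + wt om (drop j w):p" using P(2) by blast
  then obtain p where p: "!!j. p j:P" "!!j. ga + wt om (drop j w):p j" by metis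
  have "\<not> inj_on p {..<length w}"
   using card_inj_on_le[of p "{..<length w}" P] p(1) P(1) long by auto
  then obtain j l where jl: "j < l" "l < length w" "p j = p l"
   unfolding inj_on_def by (metis lessThan_iff linorder_neqE_nat)
  define u where "u = take (l - j) (drop j w)"
  have u: "drop j w = u@drop l w" using jl by (simp add: u_def) (metis append_take_drop_id drop_drop le_add_diff_inverse2 less_imp_le)
  have "set u \<subseteq> set w" unfolding u_def by (meson order_trans set_drop_subset set_take_subset)
  hence "u:lists {..<n}" "u ~= []" using w jl by (auto simp: u_def)
  then obtain t where t: "t:Q" "d <= cmod (pairing t (wt om u) - 1)" using Q(3) by blast
  have "ga + wt om (drop j w) = (ga + wt om (drop l w)) + wt om u" unfolding u by (simp add: algebra_simps)
  hence "pairing t (ga + wt om (drop j w)) - pairing t (ga + wt om (drop l w)) = pairing t (ga + wt om (drop l w)) * (pairing t (wt om u) - 1)"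
   by (simp only: pairing_simps(1)) (simp add: algebra_simps)
  hence "d <= cmod (pairing t (ga + wt om (drop j w)) - pairing t (ga + wt om (drop l w)))"
   using t(2) by (simp add: norm_mult pairing_simps(4))
  thus False using P(3) p jl(3) t(1) by (metis not_le)
 qed
 thus ?thesis by blast
qed

text \<open>Letters are prepended starting from the right end of a word, so its suffixes are the
  intermediate stages, and their weights, translated by a point of \<open>V\<close>, have to remain
  in \<open>K\<close>.\<close>

definition path :: "'g dual set => nat list => 'g dual set => bool"
 where "path K ka V \<longleftrightarrow> (\<forall>eta\<in>V. \<forall>a b. ka = a@b --> eta + wt om b:K)"

text \<open>The triples \<open>(mu, nu, V)\<close> for which \<open>S\<^sub>\<mu> 1\<^sub>V S\<^sub>\<nu>\<^sup>*\<close> can occur in products of operators of this kind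
 with \<open>V \<in> UU\<close> that never leave \<open>K\<close>.\<close>

definition adm :: "'g dual set => nat => 'g dual set set => nat list => nat list => 'g dual set => bool"
 where "adm K n UU mu nu V \<longleftrightarrow> mu:lists {..<n} \<and> nu:lists {..<n} \<and> path K mu V \<and> path K nu V \<and>
  (\<exists>F\<subseteq>UU\<times>lists {..<n}. V = {eta. \<forall>(U, ka)\<in>F. eta + wt om ka:U} \<and> (\<forall>(U, ka)\<in>F. path K ka V))"

lemma path_append:
 assumes "path K ka' V" "path K ka W" "!!eta. eta:W ==> eta + wt om ka:V"
 shows "path K (ka'@ka) W"
 unfolding path_def
proof (intro ballI allI impI)
 fix eta a b assume eta: "eta:W" and ab: "ka'@ka = a@b"
 consider b' where "ka' = a@b'" "b = b'@ka" | a' where "ka = a'@b" using ab by (auto simp: append_eq_append_conv2)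
 thus "eta + wt om b:K"
 proof cases
  case 1
  hence "(eta + wt om ka) + wt om b':K" using assms(1,3) eta unfolding path_def by blast
  thus ?thesis using 1 by (simp add: algebra_simps)
 next
  case 2 thus ?thesis using assms(2) eta unfolding path_def by blast
 qed
qed

lemma path_mono: "path K ka V ==> W \<subseteq> V ==> path K ka W"
 unfolding path_def by blast

lemma path_suffix: "path K (nu@ka) V ==> path K ka V"
 unfolding path_def by (metis append.assoc)

text \<open>The product rule intersects \<open>W\<close> with a translate of \<open>V\<close>. Its
  constraints are those of \<open>W\<close> together with those of \<open>V\<close> with
  \<open>ka\<close> appended to the words, and paths can be joined because eta + wt ka lies in
  \<open>V\<close>.\<close>

lemma adm_mult:
 assumes a: "adm K n UU mu nu V" and b: "adm K n UU (nu@ka) nu' W"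
 shows "adm K n UU (mu@ka) nu' {eta. eta + wt om ka:V \<and> eta:W}" (is "adm _ _ _ _ _ ?X")
proof -
 obtain F where F: "F \<subseteq> UU\<times>lists {..<n}" "V = {eta. \<forall>(U, ka)\<in>F. eta + wt om ka:U}" "\<forall>(U, ka)\<in>F. path K ka V"
  using a unfolding adm_def by blast
 obtain F' where F': "F' \<subseteq> UU\<times>lists {..<n}" "W = {eta. \<forall>(U, ka)\<in>F'. eta + wt om ka:U}" "\<forall>(U, ka)\<in>F'. path K ka W"
  using b unfolding adm_def by blast
 have X: "?X \<subseteq> W" by blast
 have ka: "path K ka ?X" using b path_mono[OF path_suffix X] unfolding adm_def by blast
 have app: "path K (ka'@ka) ?X" if "path K ka' V" for ka' by (rule path_append[OF that ka]) blast
 have kan: "ka:lists {..<n}" using b unfolding adm_def by auto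
 have "\<exists>G\<subseteq>UU\<times>lists {..<n}. ?X = {eta. \<forall>(U, ka)\<in>G. eta + wt om ka:U} \<and> (\<forall>(U, ka)\<in>G. path K ka ?X)"
 proof (intro exI[of _ "(%(U, ka'). (U, ka'@ka))`F\<union>F'"] conjI)
  show "(%(U, ka'). (U, ka'@ka))`F\<union>F' \<subseteq> UU\<times>lists {..<n}"
  proof (intro Un_least image_subsetI F'(1))
   fix x assume "x:F"
   thus "(case x of (U, ka') => (U, ka'@ka)):UU\<times>lists {..<n}" using subsetD[OF F(1)] kan by fastforce
  qed
  show "?X = {eta. \<forall>(U, ka)\<in>(%(U, ka'). (U, ka'@ka))`F\<union>F'. eta + wt om ka:U}"
   by (auto simp: F(2) F'(2) ball_Un algebra_simps split_beta)
  show "\<forall>(U, ka)\<in>(%(U, ka'). (U, ka'@ka))`F\<union>F'. path K ka ?X"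
   using F(3) F'(3) app path_mono[OF _ X] by auto
 qed
 moreover have "path K nu' ?X" using b path_mono[OF _ X] unfolding adm_def by blast
 ultimately show ?thesis using a b kan app unfolding adm_def by auto
qed

lemma adm_sym: "adm K n UU mu nu V ==> adm K n UU nu mu V"
 unfolding adm_def by blast

definition PT :: "nat list\<times>nat list\<times>'g dual set => ('g dual\<times>nat list) bop"
 where "PT = (%(mu, nu, V). Top om mu nu (indicator V))"

definition gens :: "('g dual\<times>nat list) bop set"
 where "gens = PT`{(mu, nu, V). TB V}"

text \<open>A point of a nonempty \<open>V\<close> makes all words involved paths in
  \<open>K\<close>, and \<open>bounded_paths\<close> leaves finitely many of them, hence finitely
  many sets of constraints. For empty \<open>V\<close> the words are unrestricted, but the operator
  is 0.\<close>

lemma finite_adm: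
 assumes K: "TB K" and UU: "finite UU"
 shows "finite (PT`{(mu, nu, V). adm K n UU mu nu V})"
proof -
 obtain N where N: "\<forall>ga. \<forall>w\<in>lists {..<n}. (\<forall>a b. w = a@b --> ga + wt om b:K) --> length w <= N"
  using bounded_paths[OF K, of n] by (rule exE)
 define Wd where "Wd = {w. set w \<subseteq> {..<n} \<and> length w <= N}"
 have Wd: "finite Wd" unfolding Wd_def by (rule finite_lists_length_le) simp
 let ?f = "%(mu, nu, F). PT (mu, nu, {eta. \<forall>(U, ka)\<in>F. eta + wt om ka:U})"
 have "PT (mu, nu, V):insert 0 (?f`(Wd\<times>Wd\<times>Pow (UU\<times>Wd)))" if a: "adm K n UU mu nu V" for mu nu V
 proof (cases "V = {}")
  case True
  have "indicator {} = (%_::'g dual. 0::complex)" by (simp add: fun_eq_iff)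
  thus ?thesis using True by (simp add: PT_def Top_zero)
 next
  case False
  then obtain eta where eta: "eta:V" by blast
  have W: "w:Wd" if "w:lists {..<n}" "path K w V" for w
   using that eta N[rule_format, OF that(1), of eta] unfolding path_def Wd_def by auto
  obtain F where F: "F \<subseteq> UU\<times>lists {..<n}" "V = {eta. \<forall>(U, ka)\<in>F. eta + wt om ka:U}" "\<forall>(U, ka)\<in>F. path K ka V"
   using a unfolding adm_def by blast
  have "F \<subseteq> UU\<times>Wd" using F(1,3) W by fastforce
  hence "(mu, nu, F):Wd\<times>Wd\<times>Pow (UU\<times>Wd)" using a W unfolding adm_def by blast
  hence "?f (mu, nu, F):?f`(Wd\<times>Wd\<times>Pow (UU\<times>Wd))" by (rule imageI)
  hence "PT (mu, nu, V):?f`(Wd\<times>Wd\<times>Pow (UU\<times>Wd))" by (simp only: prod.case F(2)[symmetric])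
  thus ?thesis by (rule insertI2)
 qed
 hence "PT`{(mu, nu, V). adm K n UU mu nu V} \<subseteq> insert 0 (?f`(Wd\<times>Wd\<times>Pow (UU\<times>Wd)))" by auto
 moreover have "finite (insert 0 (?f`(Wd\<times>Wd\<times>Pow (UU\<times>Wd))))" using Wd UU by simp
 ultimately show ?thesis by (rule finite_subset)
qed

interpretation bop: cstar_algebra "bop::('g dual\<times>nat list) bop normed_star_alg"
 by (rule cstar_algebra_bop)

lemma bfun_indicator: "bfun (indicator V::'g dual => complex)"
 by (rule bfun_intros)

lemma PT_carrier: "PT x:carrier bop"
 by (cases x) (simp add: PT_def Top_carrier bfun_indicator)

lemma adm_subalgebra:
 assumes K: "TB K" and UU: "finite UU"
 shows "cstar_subalgebra (lspan bop (PT`{(mu, nu, V). adm K n UU mu nu V})) bop"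
proof (rule bop.lspan_subalgebra[OF finite_adm[OF K UU]])
 let ?E = "PT`{(mu, nu, V). adm K n UU mu nu V}"
 show E: "?E \<subseteq> carrier bop" using PT_carrier by blast
 have base: "PT (mu, nu, V):lspan bop ?E" if "adm K n UU mu nu V" for mu nu V
  using bop.lspan_base[OF _ E, of "PT (mu, nu, V)" 1] bop.scale_one[OF PT_carrier, of "(mu, nu, V)"] that by auto
 show "star bop b:lspan bop ?E" if bE: "b:?E" for b
 proof -
  obtain mu nu V where b: "b = PT (mu, nu, V)" "adm K n UU mu nu V" using bE by auto
  have "(%ga. cnj (indicator V ga)) = (indicator V::'g dual => complex)" by (auto simp: indicator_def)
  hence "star bop b = PT (nu, mu, V)" by (simp add: b PT_def star_Top bfun_indicator)
  thus ?thesis using base[OF adm_sym[OF b(2)]] by simp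
 qed
 fix b d assume "b:?E" "d:?E"
 then obtain mu nu V mu' nu' W where b: "b = PT (mu, nu, V)" "adm K n UU mu nu V" and d: "d = PT (mu', nu', W)" "adm K n UU mu' nu' W" by auto
 have ind: "(%ga. indicator V (ga + a) * indicator W ga) = (indicator {eta. eta + a:V \<and> eta:W}::'g dual => complex)" for V W a
  by (auto simp: indicator_def)
 have ind': "(%ga. indicator V ga * indicator W (ga + a)) = (indicator {eta. eta + a:W \<and> eta:V}::'g dual => complex)" for V W a
  by (auto simp: indicator_def)
 consider ka where "mu' = nu@ka" | ka where "nu = mu'@ka" | "\<nexists>ka. mu' = nu@ka" "\<nexists>ka. nu = mu'@ka" by blast
 thus "b\<otimes>\<^bsub>bop\<^esub>d:lspan bop ?E"
 proof cases
  case 1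
  hence "b\<otimes>\<^bsub>bop\<^esub>d = PT (mu@ka, nu', {eta. eta + wt om ka:V \<and> eta:W})"
   by (simp add: b d PT_def Top_mult1 bfun_indicator ind)
  thus ?thesis using base[OF adm_mult[OF b(2) d(2)[unfolded 1]]] by simp
 next
  case 2
  have "b\<otimes>\<^bsub>bop\<^esub>d = PT (mu, nu'@ka, {eta. eta + wt om ka:W \<and> eta:V})"
   using 2 by (simp add: b d PT_def Top_mult2 bfun_indicator ind')
  thus ?thesis using base[OF adm_sym[OF adm_mult[OF adm_sym[OF d(2)] adm_sym[OF b(2), unfolded 2]]]] by simp
 next
  case 3
  hence "b\<otimes>\<^bsub>bop\<^esub>d = \<zero>\<^bsub>bop\<^esub>" by (simp add: b d PT_def Top_mult0 bfun_indicator)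
  thus ?thesis by (simp only: lspan.zero)
 qed
qed

text \<open>\<open>K\<close> collects the translates of each given \<open>V\<close> by the weights
  of all suffixes of its two words, from the whole word to the empty one. This makes each given
  generator admissible with the single constraint that its argument lies in
  \<open>V\<close>.\<close>

lemma gens_subalgebra:
 assumes "finite G" "G \<subseteq> gens"
 shows "\<exists>E. finite E \<and> G \<subseteq> E \<and> E \<subseteq> gens \<and> cstar_subalgebra (lspan bop E) bop"
proof -
 obtain X where X: "X \<subseteq> {(mu, nu, V). TB V}" "finite X" "G = PT`X"
  using finite_subset_image[OF assms(1)] assms(2) unfolding gens_def by metis
 define L where "L = (\<Union>(mu, nu, V)\<in>X. set mu\<union>set nu)"
 have "finite L" using X(2) by (auto simp: L_def)
 then obtain n where n: "L \<subseteq> {..<n}" using finite_nat_set_iff_bounded by (metis lessThan_iff subsetI)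
 define KK where "KK = (\<Union>(mu, nu, V)\<in>X. (%b. (%ga. ga + wt om b)`V)`((%i. drop i mu)`{..length mu}\<union>(%i. drop i nu)`{..length nu}))"
 have KK: "finite KK" "!!W. W:KK ==> TB W" using X(1,2) by (auto simp: KK_def TB_translate)
 define K where "K = \<Union>KK"
 have K: "TB K" unfolding K_def by (rule TB_Union[OF KK])
 define UU where "UU = (snd \<circ> snd)`X"
 have UU: "finite UU" using X(2) by (simp add: UU_def)
 let ?E = "PT`{(mu, nu, V). adm K n UU mu nu V}"
 have "PT x:?E" if x: "x:X" for x
 proof -
  obtain mu nu V where xe: "x = (mu, nu, V)" by (cases x)
  have drop: "(%ga. ga + wt om (drop i w))`V \<subseteq> K" if "w = mu \<or> w = nu" "i <= length w" for w i
   using that x unfolding K_def KK_def xe by (intro Union_upper) (auto intro!: bexI[OF _ x[unfolded xe]])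
  have p: "path K w V" if "w = mu \<or> w = nu" for w
   unfolding path_def
  proof (intro ballI allI impI)
   fix eta a b assume "eta:V" and ab: "w = a@b"
   thus "eta + wt om b:K" using drop[OF that, of "length a"] by auto
  qed
  have "path K [] V" using p[of mu] unfolding path_def by (metis append_Nil2 Nil_is_append_conv)
  moreover have "V = {eta. \<forall>(U, ka)\<in>{(V, [])}. eta + wt om ka:U}" by simp
  moreover have "{(V, [])} \<subseteq> UU\<times>lists {..<n}" using x xe by (force simp: UU_def)
  moreover have "mu:lists {..<n}" "nu:lists {..<n}" using n x xe by (force simp: L_def)+
  ultimately have "adm K n UU mu nu V" using p unfolding adm_def by (intro conjI exI[of _ "{(V, [])}"]) auto
  thus ?thesis unfolding xe by blast
 qed
 hence "G \<subseteq> ?E" using X(3) by blast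
 moreover have "?E \<subseteq> gens"
 proof -
  have "TB V" if "adm K n UU mu nu V" for mu nu V
  proof -
   have "eta:K" if "eta:V" for eta
    using \<open>adm K n UU mu nu V\<close> that unfolding adm_def path_def by (metis add.right_neutral append_Nil2 wt_simps(1))
   thus ?thesis using TB_subset[OF K] by blast
  qed
  thus ?thesis unfolding gens_def by blast
 qed
 ultimately show ?thesis using finite_adm[OF K UU, of n] adm_subalgebra[OF K UU, of n] by blast
qed

section \<open>The ambient AF-algebra of operators\<close>

definition DD :: "('g dual\<times>nat list) bop set"
 where "DD = nclosure bop (lspan bop gens)"

lemma gens_carrier: "gens \<subseteq> carrier bop"
 using PT_carrier by (auto simp: gens_def)

lemma lspan_gens: "lspan bop gens \<subseteq> carrier bop"
 using bop.lspan_closed[OF _ gens_carrier] by blast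

text \<open>Each approximant is a combination of finitely many generators, and
  \<open>gens_subalgebra\<close> places all of these in one finite-dimensional algebra.\<close>

lemma DD_AF:
 assumes F: "finite F" "F \<subseteq> DD" and e: "0 < e"
 shows "\<exists>E. finite E \<and> E \<subseteq> gens \<and> cstar_subalgebra (lspan bop E) bop \<and>
  (\<forall>x\<in>F. \<exists>y\<in>lspan bop E. nrm bop (x\<ominus>\<^bsub>bop\<^esub>y) < e)"
proof -
 have "\<forall>x\<in>F. \<exists>y Y. finite Y \<and> Y \<subseteq> gens \<and> y:lspan bop Y \<and> nrm bop (y\<ominus>\<^bsub>bop\<^esub>x) < e"
 proof
  fix x assume "x:F"
  hence "x:nclosure bop (lspan bop gens)" using F(2) by (auto simp: DD_def)
  hence "\<exists>y\<in>lspan bop gens. nrm bop (y\<ominus>\<^bsub>bop\<^esub>x) < e"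
   using e by (simp only: bop.nclosure_iff[OF lspan_gens])
  then obtain y where y: "y:lspan bop gens" "nrm bop (y\<ominus>\<^bsub>bop\<^esub>x) < e" by (elim bexE)
  obtain Y where "finite Y \<and> Y \<subseteq> gens \<and> y:lspan bop Y" using bop.lspan_finite[OF y(1)] by (rule exE)
  thus "\<exists>y Y. finite Y \<and> Y \<subseteq> gens \<and> y:lspan bop Y \<and> nrm bop (y\<ominus>\<^bsub>bop\<^esub>x) < e"
   using y(2) by (intro exI[of _ y] exI[of _ Y]) simp
 qed
 then obtain y Y where y: "!!x. x:F ==> finite (Y x)" "!!x. x:F ==> Y x \<subseteq> gens"
  "!!x. x:F ==> y x:lspan bop (Y x)" "!!x. x:F ==> nrm bop (y x\<ominus>\<^bsub>bop\<^esub>x) < e" by metis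
 have "finite (\<Union>(Y`F))" "\<Union>(Y`F) \<subseteq> gens" using F(1) y(1,2) by blast+
 then obtain E where E: "finite E" "\<Union>(Y`F) \<subseteq> E" "E \<subseteq> gens" "cstar_subalgebra (lspan bop E) bop"
  using gens_subalgebra by metis
 have "\<exists>z\<in>lspan bop E. nrm bop (x\<ominus>\<^bsub>bop\<^esub>z) < e" if x: "x:F" for x
 proof
  have "Y x \<subseteq> E" using E(2) x by blast
  thus "y x:lspan bop E" by (rule bop.lspan_mono[OF y(3)[OF x]])
  hence "y x:carrier bop" using bop.lspan_closed order_trans[OF E(3) gens_carrier] by metis
  moreover have "x:carrier bop" using F(2) x by (auto simp: DD_def nclosure_def)
  ultimately show "nrm bop (x\<ominus>\<^bsub>bop\<^esub>y x) < e" using y(4)[OF x] bop.nrm_diff_commute by metis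
 qed
 thus ?thesis using E by (intro exI[of _ E]) simp
qed

lemma Top_step:
 assumes "finite Z" "!!z. z:Z ==> TB (V z)"
 shows "Top om mu nu (%ga. \<Sum>z\<in>Z. z * indicator (V z) ga):lspan bop gens \<and> bfun (%ga. \<Sum>z\<in>Z. z * indicator (V z) ga)"
 using assms
proof (induction Z rule: finite_induct)
 case empty thus ?case using lspan.zero[of bop gens] by (simp add: Top_zero bfun_intros)
next
 case (insert z Z)
 have b: "bfun (%ga. z * indicator (V z) ga)" by (rule bfun_intros(3)[OF bfun_intros(1) bfun_indicator])
 have "Top om mu nu (%ga. z * indicator (V z) ga) = z\<odot>\<^bsub>bop\<^esub>PT (mu, nu, V z)"
  using Top_scale[OF bfun_indicator] by (simp add: PT_def)
 moreover have "PT (mu, nu, V z):gens" using insert.prems[of z] by (auto simp: gens_def)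
 ultimately have m: "Top om mu nu (%ga. z * indicator (V z) ga):lspan bop gens" using bop.lspan_base[OF _ gens_carrier] by metis
 have IH: "Top om mu nu (%ga. \<Sum>z\<in>Z. z * indicator (V z) ga):lspan bop gens" "bfun (%ga. \<Sum>z\<in>Z. z * indicator (V z) ga)"
  using insert.IH insert.prems by simp_all
 have eq: "(%ga. \<Sum>z\<in>insert z Z. z * indicator (V z) ga) = (%ga. z * indicator (V z) ga + (\<Sum>z\<in>Z. z * indicator (V z) ga))"
  by (simp only: sum.insert[OF insert.hyps])
 show ?case unfolding eq Top_add[OF b IH(2)]
  by (rule conjI[OF bop.lspan_add[OF m gens_carrier IH(1), unfolded bop_simps] bfun_intros(2)[OF b IH(2)]])
qed

text \<open>The coefficient is replaced by 0 where it is smaller than e/2 and rounded to a finite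
  net elsewhere. The level sets are subsets of a totally bounded set, so the result is a finite
  combination of generators.\<close>

lemma Top_TB:
 assumes C: "bfun C" and TB: "!!e. 0 < e ==> TB {ga. e <= cmod (C ga)}"
 shows "Top om mu nu C:DD"
 unfolding DD_def bop.nclosure_iff[OF lspan_gens]
proof (intro conjI allI impI)
 show T: "Top om mu nu C:carrier bop" by (rule Top_carrier[OF C])
 fix e :: real assume e: "0 < e"
 obtain M where M: "0 <= M" "!!ga. cmod (C ga) <= M" using C by (elim bfunE) blast
 obtain r Z where r: "finite Z" "!!z. cmod z <= M ==> r z:Z \<and> cmod (z - r z) < e/2"
  by (rule finite_net[of "e/2" M]) (use e that in auto)
 define V where "V z = {ga. e/2 <= cmod (C ga) \<and> r (C ga) = z}" for z
 define D where "D ga = (\<Sum>z\<in>Z. z * indicator (V z) ga)" for ga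
 have "TB (V z)" for z using TB_subset[OF TB[of "e/2"], of "V z"] e by (auto simp: V_def)
 from Top_step[OF r(1), of V mu nu, OF this] have D: "Top om mu nu D:lspan bop gens" "bfun D" by (auto simp: D_def[abs_def])
 have Deq: "D ga = (if e/2 <= cmod (C ga) then r (C ga) else 0)" for ga
 proof -
  have "D ga = (\<Sum>z\<in>Z. if z = r (C ga) then (if e/2 <= cmod (C ga) then z else 0) else 0)"
   unfolding D_def by (rule sum.cong) (auto simp: V_def indicator_def)
  thus ?thesis using r(2)[OF M(2), of ga] by (simp add: sum.delta[OF r(1)])
 qed
 have le: "cmod (D ga - C ga) <= e/2" for ga
  using r(2)[OF M(2), of ga] by (auto simp: Deq norm_minus_commute)
 have "bfun (%ga. D ga - C ga)" by (rule bfunI[OF le])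
 from Top_add[OF this C, of om mu nu] have "Top om mu nu D - Top om mu nu C = Top om mu nu (%ga. D ga - C ga)" by simp
 also have "norm ...<= e/2" using e le by (intro norm_Top) auto
 finally have "nrm bop (Top om mu nu D\<ominus>\<^bsub>bop\<^esub>Top om mu nu C) < e" using e by (simp add: a_minus_bop[OF T])
 thus "\<exists>y\<in>lspan bop gens. nrm bop (y\<ominus>\<^bsub>bop\<^esub>Top om mu nu C) < e" using D(1) by blast
qed

end

section \<open>Cardinality and density\<close>

text \<open>\<open>rep Y X\<close>: the cardinality of \<open>X\<close> is at most that of the set of sequences in \<open>Y\<close>.\<close>

definition seqs :: "'b set => (nat => 'b) set"
 where "seqs Y = {s. \<forall>n. s n:Y}"

definition rep :: "'b set => 'm set => bool"
 where "rep Y X \<longleftrightarrow> (\<exists>r. X \<subseteq> r`seqs Y)"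

text \<open>Splits one sequence into countably many along the pairing of natural numbers, so that
  sequences of sequences in \<open>Y\<close> need no more room than sequences in
  \<open>Y\<close>.\<close>

definition sub :: "nat => (nat => 'b) => nat => 'b"
 where "sub k s n = s (prod_encode (k, n))"

lemma sub_surj: assumes "!!k. t k:seqs Y" obtains s where "s:seqs Y" "!!k. sub k s = t k"
 using assms by (intro that[of "%m. case prod_decode m of (k, n) => t k n"])
  (auto simp: seqs_def sub_def split: prod.split)

lemma sub_surj2: assumes "t:seqs Y" "u:seqs Y" obtains s where "s:seqs Y" "sub 0 s = t" "sub 1 s = u"
 by (rule sub_surj[of "%k. if k = 0 then t else u" Y]) (use assms that in auto)

text \<open>A natural number encoded as the first place at which the sequence leaves
  \<open>z\<close>; realising every number takes a second element of \<open>Y\<close>.\<close>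

definition num :: "'b => (nat => 'b) => nat"
 where "num z s = (LEAST n. s n ~= z)"

lemma num_surj: assumes "z:Y" "y:Y" "y ~= z" obtains s where "s:seqs Y" "num z s = n"
proof (rule that[of "%m. if m = n then y else z"])
 show "num z (%m. if m = n then y else z) = n"
  unfolding num_def using assms by (intro Least_equality) (auto split: if_splits)
qed (use assms in "auto simp: seqs_def")

lemma rep_seqs: assumes "rep Y X" shows "rep Y (seqs X)"
proof -
 obtain r where r: "X \<subseteq> r`seqs Y" using assms by (auto simp: rep_def)
 have "h:(%s k. r (sub k s))`seqs Y" if h: "h:seqs X" for h
 proof -
  have "\<forall>k. \<exists>t. t:seqs Y \<and> h k = r t" using h r by (fastforce simp: seqs_def)
  then obtain t where t: "!!k. t k:seqs Y" "!!k. h k = r (t k)" by metis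
  obtain s where s: "s:seqs Y" "!!k. sub k s = t k" by (rule sub_surj[OF t(1)]) (rule that)
  have "h = (%k. r (sub k s))" using s(2) t(2) by auto
  thus ?thesis using s(1) by blast
 qed
 thus ?thesis unfolding rep_def by blast
qed

lemma rep_image: assumes "rep Y X" shows "rep Y (f`X)"
proof -
 obtain r where "X \<subseteq> r`seqs Y" using assms by (auto simp: rep_def)
 hence "f`X \<subseteq> (f \<circ> r)`seqs Y" by auto
 thus ?thesis unfolding rep_def by blast
qed

lemma rep_UN:
 assumes zy: "z:Y" "y:Y" "y ~= z" and I: "rep Y I" and N: "!!i. i:I ==> countable (N i)"
 shows "rep Y (\<Union>i\<in>I. N i)"
proof -
 obtain r where r: "I \<subseteq> r`seqs Y" using I by (auto simp: rep_def)
 have "x:(%s. from_nat_into (N (r (sub 0 s))) (num z (sub 1 s)))`seqs Y" if i: "i:I" and x: "x:N i" for i x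
 proof -
  obtain t where t: "t:seqs Y" "i = r t" using r i by auto
  obtain n where n: "from_nat_into (N i) n = x" using from_nat_into_surj[OF N[OF i] x] by blast
  obtain u where u: "u:seqs Y" "num z u = n" by (rule num_surj[OF zy]) (rule that)
  obtain s where s: "s:seqs Y" "sub 0 s = t" "sub 1 s = u" by (rule sub_surj2[OF t(1) u(1)]) (rule that)
  show ?thesis using s t(2) u(2) n by (intro image_eqI[of _ _ s]) auto
 qed
 thus ?thesis unfolding rep_def by blast
qed

lemma rep_UN_nat:
 assumes zy: "z:Y" "y:Y" "y ~= z" and X: "!!n::nat. rep Y (X n)"
 shows "rep Y (\<Union>n. X n)"
proof -
 obtain r where r: "!!n. X n \<subseteq> r n`seqs Y" using X unfolding rep_def by metis
 have "x:(%s. r (num z (sub 0 s)) (sub 1 s))`seqs Y" if x: "x:X n" for n x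
 proof -
  obtain t where t: "t:seqs Y" "x = r n t" using r x by blast
  obtain u where u: "u:seqs Y" "num z u = n" by (rule num_surj[OF zy]) (rule that)
  obtain s where s: "s:seqs Y" "sub 0 s = u" "sub 1 s = t" by (rule sub_surj2[OF u(1) t(1)]) (rule that)
  show ?thesis using s t(2) u(2) by (intro image_eqI[of _ _ s]) auto
 qed
 thus ?thesis unfolding rep_def by blast
qed

text \<open>\<open>G\<close> is the union of the iterates of \<open>f\<close>. Finite nonempty
  subsets are presented as ranges of sequences, so that \<open>rep_seqs\<close> controls the index
  set of each step; every finite subset of the union already lies in one iterate.\<close>

lemma closing_off:
 fixes X :: "'m set"
 assumes zy: "z:Y" "y:Y" "y ~= z" and X: "rep Y X" "X \<subseteq> D"
  and N: "!!F. finite F ==> countable (N F) \<and> F \<subseteq> N F" "!!F. finite F ==> F \<subseteq> D ==> N F \<subseteq> D"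
 obtains G where "X \<subseteq> G" "G \<subseteq> D" "rep Y G" "!!F. finite F ==> F ~= {} ==> F \<subseteq> G ==> N F \<subseteq> G"
proof -
 define f where "f A = (\<Union>h\<in>seqs A. if finite (range h) then N (range h) else {})" for A :: "'m set"
 define G where "G n = (f^^n) X" for n
 have G: "G 0 = X" "G (Suc n) = f (G n)" for n by (simp_all add: G_def)
 have fN: "N F \<subseteq> f A" if F: "finite F" "F ~= {}" "F \<subseteq> A" for F A
 proof -
  have "range (from_nat_into F) = F" using F by (intro range_from_nat_into) (auto simp: countable_finite)
  hence "from_nat_into F:seqs A" "N F = (if finite (range (from_nat_into F)) then N (range (from_nat_into F)) else {})"
   using F by (auto simp: seqs_def)
  thus ?thesis unfolding f_def by blast
 qed
 have inc: "A \<subseteq> f A" for A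
 proof
  fix x assume "x:A"
  thus "x:f A" using fN[of "{x}" A] N(1)[of "{x}"] by auto
 qed
 have mono: "G m \<subseteq> G n" if "m <= n" for m n
  using that by (induction n rule: dec_induct) (use inc G in auto)
 have GD: "G n \<subseteq> D" for n
 proof (induction n)
  case (Suc n)
  have "range h \<subseteq> D" if "h:seqs (G n)" for h using that Suc by (auto simp: seqs_def)
  thus ?case unfolding G(2) f_def using N(2) by (intro UN_least) simp
 qed (simp add: G X)
 have rp: "rep Y (G n)" for n
 proof (induction n)
  case (Suc n)
  show ?case unfolding G(2) f_def by (rule rep_UN[OF zy rep_seqs[OF Suc]]) (use N(1) in auto)
 qed (simp add: G X)
 show ?thesis
 proof (rule that[of "\<Union>n. G n"])
  show "X \<subseteq> (\<Union>n. G n)" using G(1) by blast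
  show "(\<Union>n. G n) \<subseteq> D" using GD by blast
  show "rep Y (\<Union>n. G n)" by (rule rep_UN_nat[OF zy rp])
  fix F assume F: "finite F" "F ~= {}" "F \<subseteq> (\<Union>n. G n)"
  have "\<exists>n. F \<subseteq> G n" using F(1,3)
  proof (induction F rule: finite_induct)
   case (insert x F)
   then obtain n m where "F \<subseteq> G n" "x:G m" by auto
   thus ?case using mono[of n "max n m"] mono[of m "max n m"] by (intro exI[of _ "max n m"]) auto
  qed simp
  then obtain n where "F \<subseteq> G n" by blast
  thus "N F \<subseteq> (\<Union>n. G n)" using fN[OF F(1,2)] G(2)[of n] by blast
 qed
qed

section \<open>Separated subsets of the unit ball\<close>

context cstar_algebra
begin

text \<open>A maximal 1/2-separated subset of the unit ball. It stands in for the density character: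
  its rational combinations are dense, and its sequences inject into the algebra.\<close>

lemma separated_set:
 obtains Y where "Y \<subseteq> carrier A" "\<zero>:Y" "!!x. x:Y ==> nrm A x <= 1"
  "!!x y. [|x:Y;y:Y;x ~= y|] ==> 1/2 <= nrm A (x\<ominus>y)"
  "!!x. x:carrier A ==> nrm A x <= 1 ==> \<exists>y\<in>Y. nrm A (x\<ominus>y) < 1/2"
proof -
 define YY where "YY = {Y. Y \<subseteq> {x\<in>carrier A. nrm A x <= 1} \<and> \<zero>:Y \<and> (\<forall>x\<in>Y. \<forall>y\<in>Y. x ~= y --> 1/2 <= nrm A (x\<ominus>y))}"
 have "\<exists>M\<in>YY. \<forall>X\<in>YY. M \<subseteq> X --> X = M"
 proof (rule subset_Zorn_nonempty)
  have "{\<zero>}:YY" by (simp add: YY_def)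
  thus "YY ~= {}" by blast
  fix CC assume C: "CC ~= {}" "subset.chain YY CC"
  have sub: "CC \<subseteq> YY" using C(2) by (simp add: subset_chain_def)
  have two: "\<exists>Y\<in>CC. x:Y \<and> y:Y" if "x:\<Union>CC" "y:\<Union>CC" for x y
   using that C(2) unfolding subset_chain_def by blast
  have "1/2 <= nrm A (x\<ominus>y)" if xy: "x:\<Union>CC" "y:\<Union>CC" "x ~= y" for x y
  proof -
   obtain Y where "Y:CC" "x:Y" "y:Y" using two[OF xy(1,2)] by (elim bexE conjE)
   thus ?thesis using sub xy(3) by (auto simp: YY_def)
  qed
  moreover obtain Y where "Y:CC" using C(1) by (metis ex_in_conv)
  ultimately show "\<Union>CC\<in>YY" using sub by (auto simp: YY_def)
 qed
 then obtain Y where Y: "Y:YY" "!!X. X:YY ==> Y \<subseteq> X ==> X = Y" by blast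
 have Yc: "y:carrier A" "nrm A y <= 1" if "y:Y" for y using that Y(1) by (auto simp: YY_def)
 show ?thesis
 proof (rule that[of Y])
  fix x assume x: "x:carrier A" "nrm A x <= 1"
  show "\<exists>y\<in>Y. nrm A (x\<ominus>y) < 1/2"
  proof (rule ccontr)
   assume "\<not> ?thesis"
   hence far: "1/2 <= nrm A (x\<ominus>y)" "1/2 <= nrm A (y\<ominus>x)" if "y:Y" for y
    using that nrm_diff_commute[OF x(1) Yc(1)] by (auto simp: not_less)
   hence "insert x Y:YY" using Y(1) x by (auto simp: YY_def)
   hence "x:Y" using Y(2)[of "insert x Y"] by blast
   thus False using far(1)[of x] x by simp
  qed
 qed (use Y(1) in "auto simp: YY_def")
qed

text \<open>The injection is \<open>s \<mapsto> \<Sum>\<^sub>n 8\<^sup>-\<^sup>n s n\<close>.\<close>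

lemma separated_sequences:
 assumes Y: "Y \<subseteq> carrier A" "!!x. x:Y ==> nrm A x <= 1" "!!x y. [|x:Y;y:Y;x ~= y|] ==> 1/2 <= nrm A (x\<ominus>y)"
 shows "\<exists>J. inj_on J (seqs Y) \<and> J`seqs Y \<subseteq> carrier A"
proof -
 define c where "c n = complex_of_real ((1/8)^n)" for n
 define p where "p s = rec_nat \<zero> (%n x. x\<oplus>c n\<odot>s n)" for s
 have p: "p s 0 = \<zero>" "p s (Suc n) = p s n\<oplus>c n\<odot>s n" for s n by (simp_all add: p_def)
 have sC: "s n:carrier A" if "s:seqs Y" for s n using that Y(1) by (auto simp: seqs_def)
 have pC: "p s n:carrier A" if "s:seqs Y" for s n by (induction n) (use sC[OF that] in "simp_all add: p")
 have cn: "cmod (c n) = (1/8)^n" for n by (simp only: c_def norm_of_real) simp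
 have tail: "nrm A (p s (n + k)\<ominus>p s n) <= 8/7 * ((1/8)^n - (1/8)^(n + k))" if s: "s:seqs Y" for s n k
 proof (induction k)
  case 0 thus ?case using pC[OF s] by simp
 next
  case (Suc k)
  have "p s (n + Suc k)\<ominus>p s (n + k) = c (n + k)\<odot>s (n + k)"
   using pC[OF s] sC[OF s] M.a_comm[of "p s (n + k)" "c (n + k)\<odot>s (n + k)"] by (simp add: p add_diff_cancel)
  hence "nrm A (p s (n + Suc k)\<ominus>p s (n + k)) <= (1/8)^(n + k) * 1"
   using sC[OF s] s Y(2) by (simp add: nrm_smult cn seqs_def mult_left_mono)
  thus ?case using nrm_diff_triangle[OF pC[OF s] pC[OF s] pC[OF s], of "n + Suc k" n "n + k"] Suc by simp
 qed
 have tail': "nrm A (p s m\<ominus>p s n) <= 8/7 * (1/8)^n" if "s:seqs Y" "n <= m" for s n m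
 proof -
  have "nrm A (p s m\<ominus>p s n) <= 8/7 * ((1/8)^n - (1/8)^m)" using tail[OF that(1), of n "m - n"] that(2) by simp
  moreover have "0 <= (1/8::real)^m" by simp
  ultimately show ?thesis by argo
 qed
 have "\<exists>x\<in>carrier A. (%n. nrm A (p s n\<ominus>x)) \<longlonglongrightarrow> 0" if s: "s:seqs Y" for s
 proof (rule nrm_complete[OF pC[OF s]])
  fix e :: real assume e: "0 < e"
  obtain N where N: "(1/8::real)^N < e * 7/16" using real_arch_pow_inv[of "e * 7/16" "1/8"] e by auto
  have "nrm A (p s m\<ominus>p s n) < e" if "m >= N" "n >= N" for m n
   using nrm_diff_triangle[OF pC[OF s] pC[OF s] pC[OF s], of m n N] nrm_diff_commute[OF pC[OF s] pC[OF s], of N n]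
    tail'[OF s that(1)] tail'[OF s that(2)] N by simp
  thus "\<exists>N. \<forall>m\<ge>N. \<forall>n\<ge>N. nrm A (p s m\<ominus>p s n) < e" by blast
 qed
 then obtain J where J: "!!s. s:seqs Y ==> J s:carrier A" "!!s. s:seqs Y ==> (%n. nrm A (p s n\<ominus>J s)) \<longlonglongrightarrow> 0" by metis
 have near: "nrm A (J s\<ominus>p s n) <= 8/7 * (1/8)^n" if s: "s:seqs Y" for s n
 proof (rule LIMSEQ_le_const)
  show "(%m. nrm A (p s m\<ominus>J s) + 8/7 * (1/8)^n) \<longlonglongrightarrow> 8/7 * (1/8)^n"
   using tendsto_add[OF J(2)[OF s] tendsto_const] by simp
  have "nrm A (J s\<ominus>p s n) <= nrm A (p s m\<ominus>J s) + 8/7 * (1/8)^n" if "m >= n" for m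
   using nrm_diff_triangle[OF J(1)[OF s] pC[OF s] pC[OF s], of n m] tail'[OF s that] nrm_diff_commute[OF J(1)[OF s] pC[OF s], of m] by simp
  thus "\<exists>N. \<forall>m\<ge>N. nrm A (J s\<ominus>p s n) <= nrm A (p s m\<ominus>J s) + 8/7 * (1/8)^n" by blast
 qed
 have "inj_on J (seqs Y)"
 proof (rule inj_onI, rule ccontr)
  fix s t assume s: "s:seqs Y" and t: "t:seqs Y" and eq: "J s = J t" and ne: "s ~= t"
  have "\<exists>n. s n ~= t n" using ne by blast
  then obtain n where n: "s n ~= t n" "!!k. k < n ==> s k = t k" using exists_least_iff[of "%n. s n ~= t n"] by metis
  have "p s k = p t k" if "k <= n" for k using that by (induction k) (use n(2) in "auto simp: p")
  hence "p s (Suc n)\<ominus>p t (Suc n) = c n\<odot>(s n\<ominus>t n)"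
   using pC[OF t] sC[OF s] sC[OF t] by (simp add: p add_diff_add scale_diff)
  hence "(1/8)^n * nrm A (s n\<ominus>t n) = nrm A (p s (Suc n)\<ominus>p t (Suc n))"
   using sC[OF s] sC[OF t] by (simp add: nrm_smult cn)
  \<comment> \<open>All terms after the first difference amount to at most 2/7 of 8^-n in total,
    whereas the first difference itself contributes at least 1/2 of 8^-n.\<close>
  also have "...<= 2 * (8/7 * (1/8)^Suc n)"
   using nrm_diff_triangle[OF pC[OF s] J(1)[OF s] pC[OF t], of "Suc n" "Suc n"] near[OF s, of "Suc n"] near[OF t, of "Suc n"]
    nrm_diff_commute[OF pC[OF s] J(1)[OF s], of "Suc n"] eq by simp
  finally have "(1/8)^n * nrm A (s n\<ominus>t n) <= (1/8)^n * (2/7)" by simp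
  hence "nrm A (s n\<ominus>t n) <= 2/7" by (simp only: mult_le_cancel_left_pos[of "(1/8::real)^n"] zero_less_power zero_less_divide_iff zero_less_one zero_less_numeral simp_thms)
  moreover have "1/2 <= nrm A (s n\<ominus>t n)" using Y(3) s t n(1) by (auto simp: seqs_def)
  ultimately show False by linarith
 qed
 thus ?thesis using J(1) by blast
qed

text \<open>Scaling to the unit ball and subtracting the nearest point of \<open>Y\<close> halves
  the error bound. The bound \<open>q\<close> is rational from the start, and remains so, to keep
  the combination in \<open>H\<close>.\<close>

lemma dense_combinations:
 assumes Y: "!!x. x:carrier A ==> nrm A x <= 1 ==> \<exists>y\<in>Y. nrm A (x\<ominus>y) < 1/2"
  and H: "H \<subseteq> carrier A" "Y \<subseteq> H" "\<zero>:H" "!!x y. x:H ==> y:H ==> x\<oplus>y:H"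
   "!!x q. x:H ==> q:\<rat> ==> complex_of_real q\<odot>x:H"
  and b: "b:carrier A" and e: "0 < e"
 shows "\<exists>h\<in>H. nrm A (b\<ominus>h) < e"
proof -
 have step: "\<exists>h\<in>H. nrm A (b\<ominus>h) <= q/2^n" if "b:carrier A" "nrm A b <= q" "q:\<rat>" "0 < q" for b n q
  using that
 proof (induction n arbitrary: b q)
  case 0 thus ?case using H(3) by (intro bexI[of _ \<zero>]) simp_all
 next
  case (Suc n)
  define x where "x = complex_of_real (1/q)\<odot>b"
  have x: "x:carrier A" "nrm A x <= 1" using Suc.prems by (simp_all add: x_def nrm_smult norm_divide)
  obtain y where y: "y:Y" "nrm A (x\<ominus>y) < 1/2" using Y[OF x] by blast
  have yC: "y:carrier A" using y(1) H(1,2) by blast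
  define k where "k = complex_of_real q\<odot>y"
  have k: "k:H" using y(1) H(2,5) Suc.prems(3) by (auto simp: k_def)
  have kC: "k:carrier A" using k H(1) by blast
  have "b = complex_of_real q\<odot>x" using Suc.prems by (simp add: x_def scale_scale of_real_mult[symmetric] del: of_real_mult of_real_divide)
  hence "b\<ominus>k = complex_of_real q\<odot>(x\<ominus>y)" using x yC by (simp add: k_def scale_diff)
  hence "nrm A (b\<ominus>k) <= q/2" using y(2) x yC Suc.prems(4) by (simp add: nrm_smult)
  then obtain h where h: "h:H" "nrm A (b\<ominus>k\<ominus>h) <= q/2/2^n"
   using Suc.IH[of "b\<ominus>k" "q/2"] Suc.prems kC by auto
  have hC: "h:carrier A" using h(1) H(1) by blast
  have "b\<ominus>(k\<oplus>h) = b\<ominus>k\<ominus>h" using Suc.prems(1) kC hC by (simp add: diff_scale scale_add M.a_assoc)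
  thus ?case using h H(4)[OF k h(1)] by (intro bexI[of _ "k\<oplus>h"]) simp_all
 qed
 obtain q where q: "q:\<rat>" "nrm A b < q" using Rats_dense_in_real[of "nrm A b" "nrm A b + 1"] by auto
 have q0: "0 < q" using q(2) nrm_nonneg[OF b] by linarith
 obtain n where n: "(1/2::real)^n < e/q" using real_arch_pow_inv[of "e/q" "1/2"] e q0 by auto
 have "q/2^n < e" using n q0 by (simp add: power_divide field_simps)
 thus ?thesis using step[OF b, of q n] q q0 by (meson le_less_trans less_imp_le)
qed

end

section \<open>Transport of structure and reduction of the ambient algebra\<close>

text \<open>Carries the axioms along an isometric *-homomorphism onto the carrier of
  \<open>R\<close>. It serves the copy of the AF-algebra, its finite-dimensional subalgebras and the
  image of \<open>B\<close>.\<close>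

lemma transport:
 assumes M: "cstar_algebra M" and g: "star_hom M R g" and car: "carrier R = g`carrier M"
  and zero: "\<zero>\<^bsub>R\<^esub> = g \<zero>\<^bsub>M\<^esub>" and nrm: "!!x. x:carrier M ==> nrm R (g x) = nrm M x"
 shows "cstar_algebra R" "!!x y. x:carrier M ==> y:carrier M ==> g (x\<ominus>\<^bsub>M\<^esub>y) = g x\<ominus>\<^bsub>R\<^esub>g y"
proof -
 interpret M: cstar_algebra M by fact
 note D = star_homD(2-5)[OF g, symmetric]
 have grp: "abelian_group R"
 proof (rule abelian_groupI)
  fix x assume "x:carrier R"
  then obtain a where a: "a:carrier M" "x = g a" by (auto simp: car)
  show "\<exists>y\<in>carrier R. y\<oplus>\<^bsub>R\<^esub>x = \<zero>\<^bsub>R\<^esub>"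
   using a by (intro bexI[of _ "g (\<ominus>\<^bsub>M\<^esub>a)"]) (auto simp: D car zero M.M.l_neg)
 qed (auto simp: car D zero M.M.a_ac)
 have minus: "g (x\<ominus>\<^bsub>M\<^esub>y) = g x\<ominus>\<^bsub>R\<^esub>g y" if xy: "x:carrier M" "y:carrier M" for x y
 proof -
  have "\<ominus>\<^bsub>R\<^esub>g y = g (\<ominus>\<^bsub>M\<^esub>y)"
   using xy by (intro abelian_group.minus_equality[OF grp]) (auto simp: D car zero M.M.l_neg)
  thus ?thesis using xy by (simp add: a_minus_def D)
 qed
 thus "!!x y. x:carrier M ==> y:carrier M ==> g (x\<ominus>\<^bsub>M\<^esub>y) = g x\<ominus>\<^bsub>R\<^esub>g y" .
 show "cstar_algebra R"
 proof (rule cstar_algebraI'[OF grp])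
  show "cstar_algebra_axioms R"
  proof
   show "nrm R x = 0 \<longleftrightarrow> x = \<zero>\<^bsub>R\<^esub>" if "x:carrier R" for x
    using that nrm[of "\<zero>\<^bsub>M\<^esub>"] by (auto simp: car zero nrm M.nrm_eq_0)
   fix X :: "nat => 'b" assume X: "!!n. X n:carrier R" "!!e. 0 < e ==> \<exists>N. \<forall>m\<ge>N. \<forall>n\<ge>N. nrm R (X m\<ominus>\<^bsub>R\<^esub>X n) < e"
   have "\<forall>n. \<exists>y. y:carrier M \<and> X n = g y" using X(1) by (auto simp: car)
   then obtain Z where Z: "!!n. Z n:carrier M" "!!n. X n = g (Z n)" by metis
   have "\<exists>x\<in>carrier M. (%n::nat. nrm M (Z n\<ominus>\<^bsub>M\<^esub>x)) \<longlonglongrightarrow> 0"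
    by (rule M.nrm_complete[OF Z(1)]) (use X(2) Z in "simp add: minus[symmetric] nrm")
   thus "\<exists>x\<in>carrier R. (%n::nat. nrm R (X n\<ominus>\<^bsub>R\<^esub>x)) \<longlonglongrightarrow> 0"
    using Z by (auto simp: car minus[symmetric] nrm)
  qed (auto simp: car D nrm M.mult_assoc M.mult_l_distr M.mult_r_distr M.smult_mult_left M.smult_mult_right
    M.star_star M.star_add M.star_smult M.star_mult M.nrm_nonneg M.nrm_triangle M.nrm_smult M.nrm_mult M.nrm_cstar)
 qed (auto simp: car D M.add_scale M.scale_add M.scale_scale)
qed

text \<open>The zero algebra is treated apart because the coding by sequences requires two distinct
  elements of \<open>Y\<close>.\<close>

lemma (in cstar_algebra) AF_embeddable_trivial:
 assumes "carrier A = {\<zero>}"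
 shows "AF_embeddable A"
proof -
 have sub: "cstar_subalgebra (carrier A) A"
  unfolding cstar_subalgebra_def using cstar_algebra_axioms by simp
 have "finite_dim_subalgebra (carrier A) A"
  unfolding finite_dim_subalgebra_def using sub assms by (intro conjI exI[of _ "{}"]) auto
 moreover have "\<forall>x\<in>F. \<exists>y\<in>carrier A. nrm A (x\<ominus>y) < e" if "F \<subseteq> carrier A" "0 < e" for F e
  using that assms by (auto simp: nrm_zero)
 ultimately have "AF_algebra A" unfolding AF_algebra_def using cstar_algebra_axioms by blast
 moreover have "star_iso A (A\<lparr>carrier := carrier A\<rparr>) id"
  by (simp add: star_iso_def star_hom_def)
 ultimately show ?thesis unfolding AF_embeddable_def using sub by blast
qed

lemma complex_rational_approx:
 assumes "0 < e"
 shows "\<exists>q\<in>(%(a, b). Complex a b)`(\<rat>\<times>\<rat>). cmod (q - c) < e"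
proof -
 obtain a where a: "a:\<rat>" "Re c - e/2 < a" "a < Re c + e/2" using Rats_dense_in_real[of "Re c - e/2" "Re c + e/2"] assms by auto
 obtain b where b: "b:\<rat>" "Im c - e/2 < b" "b < Im c + e/2" using Rats_dense_in_real[of "Im c - e/2" "Im c + e/2"] assms by auto
 have "cmod (Complex a b - c) < e" using cmod_le[of "Complex a b - c"] a b by (simp add: abs_if split: if_splits)
 thus ?thesis using a(1) b(1) by (intro bexI[of _ "Complex a b"]) auto
qed

text \<open>The Loewenheim--Skolem argument that makes the ambient AF-algebra as small as \<open>B\<close>.\<close>

theorem AF_embeddableI:
 fixes M :: "'m normed_star_alg" (structure) and B :: "'b normed_star_alg"
 assumes B: "cstar_algebra B" and M: "cstar_algebra M" and hom: "star_hom B M Psi"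
  and iso: "!!x. x:carrier B ==> nrm M (Psi x) = nrm B x" and D: "D \<subseteq> carrier M" "Psi`carrier B \<subseteq> D"
  and Dadd: "!!x y. x:D ==> y:D ==> x\<oplus>y:D" and Dscale: "!!c x. x:D ==> c\<odot>x:D"
  and AF: "!!F e. finite F ==> F \<subseteq> D ==> 0 < e ==> \<exists>E. finite E \<and> E \<subseteq> D \<and> cstar_subalgebra (lspan M E) M \<and>
   (\<forall>x\<in>F. \<exists>y\<in>lspan M E. nrm M (x\<ominus>y) < e)"
 shows "AF_embeddable B"
proof (cases "carrier B = {\<zero>\<^bsub>B\<^esub>}")
 case True thus ?thesis by (rule cstar_algebra.AF_embeddable_trivial[OF B])
next
 case False
 interpret B: cstar_algebra B by fact
 interpret M: cstar_algebra M by fact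
 note Psi = star_homD[OF hom]
 have Psi0: "Psi \<zero>\<^bsub>B\<^esub> = \<zero>" using Psi(3)[of "\<zero>\<^bsub>B\<^esub>" 0] Psi(1)[of "\<zero>\<^bsub>B\<^esub>"] by simp
 obtain Y where Y: "Y \<subseteq> carrier B" "\<zero>\<^bsub>B\<^esub>:Y" "!!x. x:Y ==> nrm B x <= 1"
  "!!x y. [|x:Y;y:Y;x ~= y|] ==> 1/2 <= nrm B (x\<ominus>\<^bsub>B\<^esub>y)"
  "!!x. x:carrier B ==> nrm B x <= 1 ==> \<exists>y\<in>Y. nrm B (x\<ominus>\<^bsub>B\<^esub>y) < 1/2"
  by (rule B.separated_set) (rule that)
 \<comment> \<open>A unit vector has distance 1 from zero but less than 1/2 from some point of
   \<open>Y\<close>, which is therefore nonzero.\<close>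
 obtain y where y: "y:Y" "y ~= \<zero>\<^bsub>B\<^esub>"
 proof -
  obtain b where b: "b:carrier B" "b ~= \<zero>\<^bsub>B\<^esub>" using False B.M.zero_closed by blast
  have n: "0 < nrm B b" using B.nrm_nonneg[OF b(1)] B.nrm_eq_0[OF b(1)] b(2) by linarith
  define x where "x = complex_of_real (1/nrm B b)\<odot>\<^bsub>B\<^esub>b"
  have x: "x:carrier B" "nrm B x = 1" using b n by (simp_all add: x_def B.nrm_smult norm_divide)
  obtain y where "y:Y" "nrm B (x\<ominus>\<^bsub>B\<^esub>y) < 1/2" using Y(5)[OF x(1)] x(2) by auto
  thus thesis using that x by (cases "y = \<zero>\<^bsub>B\<^esub>") auto
 qed
 obtain J where J: "inj_on J (seqs Y)" "J`seqs Y \<subseteq> carrier B" using B.separated_sequences[OF Y(1,3,4)] by blast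
 define Q where "Q = (%(a, b). Complex a b)`(\<rat>\<times>\<rat>)"
 have Qc: "countable Q" unfolding Q_def by (intro countable_image countable_SIGMA countable_rat)
 have "\<forall>F k. \<exists>E. finite F \<and> F \<subseteq> D --> finite E \<and> E \<subseteq> D \<and> cstar_subalgebra (lspan M E) M \<and>
   (\<forall>x\<in>F. \<exists>y\<in>lspan M E. nrm M (x\<ominus>y) < 1/Suc k)"
  using AF by (metis of_nat_0_less_iff zero_less_Suc zero_less_divide_1_iff)
 then obtain E where E: "!!F k. finite F ==> F \<subseteq> D ==> finite (E F k) \<and> E F k \<subseteq> D \<and> cstar_subalgebra (lspan M (E F k)) M \<and>
   (\<forall>x\<in>F. \<exists>y\<in>lspan M (E F k). nrm M (x\<ominus>y) < 1/Suc k)" by metis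
 \<comment> \<open>One round of closing off adds sums, multiples by the countable dense set
   \<open>Q\<close> of scalars and, for every accuracy 1/Suc k, a finite set whose span is a
   C*-algebra approximating \<open>F\<close>.\<close>
 define N where "N F = F\<union>(%(x, y). x\<oplus>y)`(F\<times>F)\<union>(%(q, x). q\<odot>x)`(Q\<times>F)\<union>
  (if F \<subseteq> D then \<Union>k::nat. E F k else {})" for F
 have N: "countable (N F) \<and> F \<subseteq> N F" if F: "finite F" for F
 proof
  have "countable (\<Union>k. E F k)" if "F \<subseteq> D" using E[OF F that] by (intro countable_UN) (auto intro: countable_finite)
  thus "countable (N F)" unfolding N_def using F Qc
   by (auto intro!: countable_Un countable_image countable_SIGMA intro: countable_finite)
 qed (auto simp: N_def)
 have ND: "N F \<subseteq> D" if "finite F" "F \<subseteq> D" for F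
  using that E[OF that] Dadd Dscale by (auto simp: N_def intro!: Dadd Dscale dest: subsetD)
 have "rep Y Y" unfolding rep_def
 proof (intro exI subsetI)
  fix x assume "x:Y" thus "x:(%s. s 0)`seqs Y" by (intro image_eqI[of _ _ "%_. x"]) (auto simp: seqs_def)
 qed
 hence "rep Y (Psi`Y)" by (rule rep_image)
 moreover have "Psi`Y \<subseteq> D" using Y(1) D(2) by blast
 ultimately obtain G where G: "Psi`Y \<subseteq> G" "G \<subseteq> D" "rep Y G" "!!F. finite F ==> F ~= {} ==> F \<subseteq> G ==> N F \<subseteq> G"
  by (rule closing_off[OF Y(2) y, where N = N and D = D]) (use N ND that in blast)+
 have GM: "G \<subseteq> carrier M" using G(2) D(1) by blast
 have Gadd: "x\<oplus>y:G" if "x:G" "y:G" for x y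
  using G(4)[of "{x, y}"] that by (auto simp: N_def)
 have Gscale: "q\<odot>x:G" if "x:G" "q:Q" for x q
  using G(4)[of "{x}"] that by (auto simp: N_def)
 have G0: "\<zero>:G" using G(1) Y(2) Psi0 by force
 define K where "K = nclosure M G"
 have K: "x:K \<longleftrightarrow> x:carrier M \<and> (\<forall>e>0. \<exists>y\<in>G. nrm M (y\<ominus>x) < e)" for x
  unfolding K_def by (rule M.nclosure_iff[OF GM])
 have KM: "K \<subseteq> carrier M" using K by blast
 have GK: "G \<subseteq> K" unfolding K_def by (rule M.nclosure_subset[OF GM])
 have Klim: "x:K" if "!!n::nat. X n:K" "x:carrier M" "nlim M X x" for X x
  using M.nclosure_limit[OF GM, folded K_def] that by blast
 have Kseq: "\<exists>X. (\<forall>n::nat. X n:G) \<and> nlim M X x" if "x:K" for x using that by (auto simp: K_def nclosure_def)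
 have Kadd: "x\<oplus>y:K" if "x:K" "y:K" for x y
  by (rule M.nclosure_add[OF GM Gadd, folded K_def, OF _ _ that])
 have Kscale: "c\<odot>x:K" if x: "x:K" for c x
 proof -
  have xM: "x:carrier M" using x KM by blast
  have q: "q\<odot>x:K" if "q:Q" for q
   by (rule M.nclosure_scale[OF GM Gscale[OF _ that], folded K_def, OF _ x])
  have "\<forall>n::nat. \<exists>q. q:Q \<and> cmod (q - c) < 1/Suc n" using complex_rational_approx[of "1/Suc _" c] unfolding Q_def by (metis of_nat_0_less_iff zero_less_Suc zero_less_divide_1_iff)
  then obtain p where p: "!!n::nat. p n:Q" "!!n. cmod (p n - c) < 1/Suc n" by metis
  show ?thesis
  proof (rule Klim[OF q[OF p(1)]])
   show "nlim M (%n. p n\<odot>x) (c\<odot>x)"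
   proof (rule M.nlimI_le)
    show "nrm M (p n\<odot>x\<ominus>c\<odot>x) <= 1/Suc n * nrm M x" for n
    proof -
     have "p n\<odot>x\<ominus>c\<odot>x = (p n - c)\<odot>x"
      using M.add_scale[OF xM, of "p n" "- c"] xM by (simp add: M.diff_scale M.scale_scale)
     thus ?thesis
      using mult_right_mono[OF less_imp_le[OF p(2)[of n]] M.nrm_nonneg[OF xM]] M.nrm_smult[OF xM] by simp
    qed
    have "(%n. 1/real (Suc n)) \<longlonglongrightarrow> 0" using LIMSEQ_inverse_real_of_nat by (simp add: inverse_eq_divide)
    thus "(%n. 1/real (Suc n) * nrm M x) \<longlonglongrightarrow> 0" by (rule tendsto_mult_left_zero)
   qed (use xM in auto)
  qed (use xM in simp)
 qed
 have span: "lspan M E' \<subseteq> K" if "E' \<subseteq> G" for E'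
 proof
  fix x assume "x:lspan M E'"
  thus "x:K" by (induction rule: lspan.induct) (use that G0 GK Kadd Kscale in auto)
 qed
 have KAF: "\<exists>E'. finite E' \<and> E' \<subseteq> G \<and> cstar_subalgebra (lspan M E') M \<and> (\<forall>x\<in>F. \<exists>y\<in>lspan M E'. nrm M (x\<ominus>y) < e)"
  if F: "finite F" "F \<subseteq> K" and e: "0 < e" for F e
 proof -
  obtain k :: nat where k: "1/Suc k < e/2" using e by (metis half_gt_zero nat_approx_posE)
  have "\<forall>x\<in>F. \<exists>g. g:G \<and> nrm M (g\<ominus>x) < e/2" using F(2) e K by (meson half_gt_zero subsetD)
  then obtain g where g: "!!x. x:F ==> g x:G" "!!x. x:F ==> nrm M (g x\<ominus>x) < e/2" by metis
  define F' where "F' = insert \<zero> (g`F)"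
  have F': "finite F'" "F' ~= {}" "F' \<subseteq> G" using F(1) g(1) G0 by (auto simp: F'_def)
  have F'D: "F' \<subseteq> D" using F'(3) G(2) by blast
  note E' = E[OF F'(1) F'D, of k]
  have EG: "E F' k \<subseteq> G" using G(4)[OF F'] F'D unfolding N_def by (simp add: UN_subset_iff)
  have "\<exists>y\<in>lspan M (E F' k). nrm M (x\<ominus>y) < e" if x: "x:F" for x
  proof -
   have "g x:F'" using x by (simp add: F'_def)
   then obtain y where y: "y:lspan M (E F' k)" "nrm M (g x\<ominus>y) < 1/Suc k" using E' by blast
   have C: "x:carrier M" "g x:carrier M" "y:carrier M" using x F(2) KM g(1)[OF x] GM span[OF EG] y(1) by auto
   have "nrm M (x\<ominus>y) < e"
    using M.nrm_diff_triangle[OF C] M.nrm_diff_commute[OF C(1,2)] g(2)[OF x] y(2) k by linarith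
   thus ?thesis using y(1) by blast
  qed
  thus ?thesis using E' EG by blast
 qed
 \<comment> \<open>Products and adjoints are not part of the closing off. They come from the
   approximating finite-dimensional algebras, which lie in \<open>K\<close> and are closed under
   both, and pass to the limit.\<close>
 have Ksub: "cstar_subalgebra K M"
 proof (rule M.subalgebraI[OF KM _ Kadd Kscale])
  show "\<zero>:K" using G0 GK by blast
  fix x assume x: "x:K"
  have xM: "x:carrier M" using x KM by blast
  have star: "star M a:lspan M E'" if "cstar_subalgebra (lspan M E') M" "a:lspan M E'" for E' a
   using cstar_algebra.star_closed[of "M\<lparr>carrier := lspan M E'\<rparr>" a] that by (simp add: cstar_subalgebra_def)
  have mult: "a\<otimes>b:lspan M E'" if "cstar_subalgebra (lspan M E') M" "a:lspan M E'" "b:lspan M E'" for E' a b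
   using cstar_algebra.mult_closed[of "M\<lparr>carrier := lspan M E'\<rparr>" a b] that by (simp add: cstar_subalgebra_def)
  have lim: "nlim M X z" if "!!n::nat. X n:K" "z:K" "!!n. nrm M (z\<ominus>X n) < 1/Suc n" for X z
  proof (rule M.nlimI_le)
   have c: "z:carrier M" "X n:carrier M" for n using that(1)[of n] that(2) KM by auto
   show "nrm M (X n\<ominus>z) <= 1/Suc n" for n using that(3)[of n] M.nrm_diff_commute[OF c] by simp
   show "(%n. 1/real (Suc n)) \<longlonglongrightarrow> 0" using LIMSEQ_inverse_real_of_nat by (simp add: inverse_eq_divide)
  qed (use that KM in auto)
  have approx: "\<exists>X Z. (\<forall>n::nat. X n:K \<and> Z n:K \<and> star M (X n):K \<and> X n\<otimes>Z n:K) \<and> nlim M X x \<and> nlim M Z z" if z: "z:K" for z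
  proof -
   have "\<exists>a b. a:K \<and> b:K \<and> star M a:K \<and> a\<otimes>b:K \<and> nrm M (x\<ominus>a) < 1/Suc n \<and> nrm M (z\<ominus>b) < 1/Suc n" for n :: nat
   proof -
    have "finite {x, z}" "{x, z} \<subseteq> K" "0 < 1/real (Suc n)" using x z by auto
    from KAF[OF this] obtain E' where E': "E' \<subseteq> G" "cstar_subalgebra (lspan M E') M" "\<forall>w\<in>{x, z}. \<exists>y\<in>lspan M E'. nrm M (w\<ominus>y) < 1/Suc n" by (elim exE conjE)
    obtain a b where "a:lspan M E'" "b:lspan M E'" "nrm M (x\<ominus>a) < 1/Suc n" "nrm M (z\<ominus>b) < 1/Suc n" using E'(3) by auto
    thus ?thesis using span[OF E'(1)] star[OF E'(2)] mult[OF E'(2)] by (intro exI[of _ a] exI[of _ b]) auto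
   qed
   then obtain X Z where XZ: "!!n::nat. X n:K \<and> Z n:K \<and> star M (X n):K \<and> X n\<otimes>Z n:K \<and> nrm M (x\<ominus>X n) < 1/Suc n \<and> nrm M (z\<ominus>Z n) < 1/Suc n" by metis
   thus ?thesis using lim[of X x] lim[of Z z] x z by (intro exI[of _ X] exI[of _ Z]) auto
  qed
  obtain X where X: "!!n::nat. X n:K" "!!n. star M (X n):K" "nlim M X x" using approx[OF x] by metis
  show "star M x:K" by (rule Klim[OF X(2) _ M.nlim_star[OF X(3)]]) (use X(1) KM xM in auto)
  fix z assume z: "z:K"
  obtain X Z where X: "!!n::nat. X n:K" "!!n. Z n:K" "!!n. X n\<otimes>Z n:K" "nlim M X x" "nlim M Z z" using approx[OF z] by metis
  show "x\<otimes>z:K" by (rule Klim[OF X(3) _ M.nlim_mult[OF X(4,5)]]) (use X(1,2) KM xM z in auto)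
 next
  fix X x assume "!!n::nat. X n:K" "x:carrier M" "nlim M X x"
  thus "x:K" by (rule Klim)
 qed
 have PsiK: "Psi`carrier B \<subseteq> K"
 proof
  fix w assume "w:Psi`carrier B"
  then obtain b where b: "b:carrier B" "w = Psi b" by blast
  \<comment> \<open>The preimage of \<open>G\<close> contains \<open>Y\<close> and is closed under
    addition and rational multiples, so \<open>dense_combinations\<close> makes it dense in
    \<open>B\<close>; isometry carries this over to the image.\<close>
  define H where "H = {b\<in>carrier B. Psi b:G}"
  have q: "complex_of_real q:Q" if "q:\<rat>" for q using that unfolding Q_def by (intro image_eqI[of _ _ "(q, 0)"]) (auto simp: complex_eq_iff)
  have "\<exists>h\<in>H. nrm B (b\<ominus>\<^bsub>B\<^esub>h) < e" if "0 < e" for e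
   by (rule B.dense_combinations[OF Y(5) _ _ _ _ _ b(1) that])
    (use Y(1,2) G(1) G0 Psi0 Psi(2,3) Gadd Gscale q in "auto simp: H_def")
  moreover have "nrm M (Psi h\<ominus>w) = nrm B (b\<ominus>\<^bsub>B\<^esub>h)" if "h:carrier B" for h
  proof -
   have "Psi (h\<ominus>\<^bsub>B\<^esub>b) = Psi h\<ominus>w" using b that Psi by (simp add: B.diff_scale M.diff_scale)
   thus ?thesis using iso[of "h\<ominus>\<^bsub>B\<^esub>b"] b that B.nrm_diff_commute[of b h] by simp
  qed
  ultimately show "w:K" unfolding K using b Psi(1) by (auto simp: H_def) metis
 qed
 have "rep Y K"
 proof -
  have "K \<subseteq> (%X. THE x. x:carrier M \<and> nlim M X x)`seqs G"
  proof
   fix x assume x: "x:K"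
   then obtain X where X: "!!n::nat. X n:G" "nlim M X x" using Kseq by metis
   have c: "x:carrier M" "range X \<subseteq> carrier M" using x KM X(1) GM by auto
   have "x = (THE x. x:carrier M \<and> nlim M X x)"
   proof (rule sym, rule the_equality)
    fix w assume "w:carrier M \<and> nlim M X w"
    thus "w = x" using M.nlim_unique[OF _ X(2) c(2) _ c(1)] by (elim conjE)
   qed (intro conjI c(1) X(2))
   thus "x:(%X. THE x. x:carrier M \<and> nlim M X x)`seqs G" using X(1) by (auto simp: seqs_def)
  qed
  thus ?thesis using rep_image[OF rep_seqs[OF G(3)]] unfolding rep_def by (meson order_trans)
 qed
 then obtain r where r: "K \<subseteq> r`seqs Y" by (auto simp: rep_def)
 \<comment> \<open>An element of \<open>K\<close> is coded by a sequence in \<open>Y\<close>, and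
   \<open>J\<close> sends such sequences injectively into the carrier of \<open>B\<close>. This
   places \<open>K\<close> inside the type of \<open>B\<close>.\<close>
 define g where "g x = J (inv_into (seqs Y) r x)" for x
 have g: "inj_on g K"
  unfolding g_def using r J(1) by (intro comp_inj_on[of "inv_into (seqs Y) r" K J, unfolded comp_def] inj_on_inv_into inj_on_subset[OF J(1)])
   (auto intro: inv_into_into)
 define h where "h = inv_into K g"
 have h: "h (g x) = x" if "x:K" for x unfolding h_def by (rule inv_into_f_f[OF g that])
 define R :: "'b normed_star_alg" where "R = \<lparr>carrier = g`K, monoid.mult = (%x y. g (h x\<otimes>h y)), one = undefined,
  zero = g \<zero>, add = (%x y. g (h x\<oplus>h y)), smult = (%c x. g (c\<odot>h x)), star = (%x. g (star M (h x))), nrm = (%x. nrm M (h x))\<rparr>"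
 have ghom: "star_hom (M\<lparr>carrier := C\<rparr>) (R\<lparr>carrier := g`C\<rparr>) g" if "C \<subseteq> K" for C
  unfolding star_hom_def R_def using that by (auto simp: h subset_iff)
 have sub: "cstar_algebra (R\<lparr>carrier := g`C\<rparr>)" if "C \<subseteq> K" "cstar_subalgebra C M" for C
  using transport(1)[OF _ ghom[OF that(1)]] that by (auto simp: cstar_subalgebra_def R_def h subset_iff)
 have RR: "R\<lparr>carrier := g`K\<rparr> = R" by (simp add: R_def)
 interpret R: cstar_algebra R using sub[OF subset_refl Ksub] by (simp only: RR)
 have ops: "g (x\<oplus>y) = g x\<oplus>\<^bsub>R\<^esub>g y" "g (c\<odot>x) = c\<odot>\<^bsub>R\<^esub>g x" "nrm R (g x) = nrm M x" if "x:K" "y:K" for x y c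
  using that by (auto simp: R_def h)
 have dist: "nrm R (g x\<ominus>\<^bsub>R\<^esub>g y) = nrm M (x\<ominus>y)" if xy: "x:K" "y:K" for x y
 proof -
  have c: "g x:carrier R" "g y:carrier R" "x:carrier M" "y:carrier M" using xy KM by (auto simp: R_def)
  have "g x\<ominus>\<^bsub>R\<^esub>g y = g (x\<oplus>(- 1)\<odot>y)" using xy Kscale[OF xy(2)] by (simp only: R.diff_scale[OF c(1,2)] ops)
  thus ?thesis using ops(3)[OF Kadd[OF xy(1) Kscale[OF xy(2)]] xy(1), of "- 1"] by (simp only: M.diff_scale[OF c(3,4)])
 qed
 have "AF_algebra R"
  unfolding AF_algebra_def
 proof (intro conjI allI impI R.cstar_algebra_axioms)
  fix F and e :: real assume F: "finite F \<and> F \<subseteq> carrier R \<and> 0 < e"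
  hence "F \<subseteq> g`K" by (simp add: R_def)
  then obtain F' where F': "F' \<subseteq> K" "finite F'" "F = g`F'" using F finite_subset_image by metis
  obtain E' where E': "finite E'" "E' \<subseteq> G" "cstar_subalgebra (lspan M E') M" "\<forall>x\<in>F'. \<exists>y\<in>lspan M E'. nrm M (x\<ominus>y) < e"
   using KAF[OF F'(2,1)] F by (elim exE conjE) metis
  have EK: "E' \<subseteq> K" using E'(2) GK by blast
  have gE: "g`E' \<subseteq> carrier R" using EK by (auto simp: R_def)
  have img: "g x:lspan R (g`E')" if "x:lspan M E'" for x
   using that
  proof (induction rule: lspan.induct)
   case zero
   have "g \<zero> = \<zero>\<^bsub>R\<^esub>" by (simp add: R_def)
   thus ?case by (simp add: lspan.zero)
  next
   case (step x b c)
   have "x:K" "b:K" using step span[OF E'(2)] EK by auto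
   hence "g (c\<odot>b\<oplus>x) = c\<odot>\<^bsub>R\<^esub>g b\<oplus>\<^bsub>R\<^esub>g x" using Kscale by (simp add: ops)
   thus ?case using step by (simp add: lspan.step)
  qed
  have "cstar_subalgebra (g`lspan M E') R"
   unfolding cstar_subalgebra_def using sub[OF span[OF E'(2)] E'(3)] span[OF E'(2)] by (auto simp: R_def)
  moreover have "\<exists>X. finite X \<and> X \<subseteq> g`lspan M E' \<and> (\<forall>x\<in>g`lspan M E'. \<exists>c. x = (\<Oplus>\<^bsub>R\<^esub>b\<in>X. c b\<odot>\<^bsub>R\<^esub>b))"
  proof (intro exI[of _ "g`E'"] conjI ballI)
   have "E' \<subseteq> lspan M E'" using M.lspan_base[of _ E' 1] EK KM by (metis M.scale_one subset_iff)
   thus "g`E' \<subseteq> g`lspan M E'" by (rule image_mono)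
   show "\<exists>c. x = (\<Oplus>\<^bsub>R\<^esub>b\<in>g`E'. c b\<odot>\<^bsub>R\<^esub>b)" if "x:g`lspan M E'" for x
    using that img R.lspan_finsum[OF _ _ gE] E'(1) by blast
  qed (use E' in simp)
  moreover have "\<forall>x\<in>F. \<exists>y\<in>g`lspan M E'. nrm R (x\<ominus>\<^bsub>R\<^esub>y) < e"
   using E'(4) F'(1,3) dist span[OF E'(2)] by (auto simp: subset_iff)
  ultimately show "\<exists>C. finite_dim_subalgebra C R \<and> (\<forall>x\<in>F. \<exists>y\<in>C. nrm R (x\<ominus>\<^bsub>R\<^esub>y) < e)"
   unfolding finite_dim_subalgebra_def by blast
 qed
 moreover define C where "C = g`Psi`carrier B"
 have phi: "star_hom B (R\<lparr>carrier := C\<rparr>) (%x. g (Psi x))"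
  unfolding star_hom_def C_def R_def using PsiK Psi by (auto simp: h image_subset_iff)
 have "cstar_algebra (R\<lparr>carrier := C\<rparr>)"
  by (rule transport(1)[OF B phi]) (use PsiK iso in "auto simp: C_def R_def image_image h Psi0 image_subset_iff")
 hence "cstar_subalgebra C R" unfolding cstar_subalgebra_def using PsiK by (auto simp: C_def R_def)
 moreover have "star_iso B (R\<lparr>carrier := C\<rparr>) (%x. g (Psi x))"
 proof -
  have "inj_on Psi (carrier B)"
  proof (rule inj_onI)
   fix a b assume ab: "a:carrier B" "b:carrier B" "Psi a = Psi b"
   have "Psi (a\<ominus>\<^bsub>B\<^esub>b) = Psi a\<ominus>Psi b" using ab(1,2) Psi by (simp add: B.diff_scale M.diff_scale)
   hence "Psi (a\<ominus>\<^bsub>B\<^esub>b) = \<zero>" using ab Psi(1) M.diff_self by simp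
   hence "nrm B (a\<ominus>\<^bsub>B\<^esub>b) = 0" using iso[of "a\<ominus>\<^bsub>B\<^esub>b"] ab by simp
   thus "a = b" using B.nrm_eq_0[of "a\<ominus>\<^bsub>B\<^esub>b"] B.diff_eq_zero ab by simp
  qed
  hence "inj_on (g \<circ> Psi) (carrier B)" using PsiK g by (intro comp_inj_on) (auto intro: inj_on_subset)
  thus ?thesis unfolding star_iso_def using phi by (simp add: bij_betw_def C_def image_image comp_def)
 qed
 ultimately show ?thesis unfolding AF_embeddable_def by blast
qed

theorem proposition5p1:
  fixes \<omega> :: "nat \<Rightarrow> ('g::{topological_ab_group_add, t2_space}) dual"
    and \<mu> :: "'g measure"
    and \<O> :: "'o normed_star_alg" and S :: "nat \<Rightarrow> 'o"
    and \<alpha> :: "'g \<Rightarrow> 'o \<Rightarrow> 'o"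
    and B :: "'b normed_star_alg" and \<iota> :: "('g \<Rightarrow> 'o) \<Rightarrow> 'b"
  assumes "locally compact (UNIV :: 'g set)"
    and "haar_measure \<mu>"
    and "cuntz_algebra_infinity \<O> S"
    and "cstar_action \<O> \<alpha>"
    and "\<And>t i. \<alpha> t (S i) = pairing t (\<omega> i) \<odot>\<^bsub>\<O>\<^esub> S i"
    and "crossed_product B \<iota> \<mu> \<O> \<alpha>"
    and "\<And>i n. - \<omega> i \<notin> closure {sum_list (map \<omega> w) | w. w \<in> lists {..<n}}"
  shows "AF_embeddable B"
proof -
 note cuntz = assms(3)[unfolded cuntz_algebra_infinity_def cuntz_isometries_def]
 interpret unital_cstar_algebra \<O> using cuntz by blast
 interpret cuntz \<O> S \<omega>
  by unfold_locales (use cuntz in "auto simp: image_subset_iff")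
 obtain \<Phi> where \<Phi>: "star_hom \<O> bop \<Phi>" "!!x. x:carrier \<O> ==> norm (\<Phi> x) = nrm \<O> x"
  "!!v w. \<Phi> (mo v w) = Top \<omega> v w (%_. 1)"
  by (rule fock_representation) (rule that)
 interpret crossed_product_algebra \<mu> \<O> S \<omega> \<alpha> \<Phi> B \<iota>
  by unfold_locales (use assms \<Phi> in auto)
 interpret noncontracting \<omega>
  by unfold_locales (use assms(7) in "simp add: wt_def")
 interpret bop: cstar_algebra "bop::('g dual\<times>nat list) bop normed_star_alg"
  by (rule cstar_algebra_bop)
 obtain \<Psi> where \<Psi>: "star_hom B bop \<Psi>" "!!x. x:carrier B ==> norm (\<Psi> x) = nrm B x"
  "!!x. x:carrier B ==> \<Psi> x:nclosure bop (snd`monB.Lin UNIV)"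
  by (rule fock_embedding) (rule that)
 have add: "x + y:DD" if "x:DD" "y:DD" for x y
  using bop.nclosure_add[OF lspan_gens bop.lspan_add[OF _ gens_carrier]] that by (simp add: DD_def)
 have scale: "c\<odot>\<^bsub>bop\<^esub>x:DD" if "x:DD" for c x
  using bop.nclosure_scale[OF lspan_gens bop.lspan_scale[OF _ gens_carrier]] that by (simp only: DD_def)
 have "T:DD" if "(b, T):monB.Lin UNIV" for b T
  using that
 proof (induction rule: monB.Lin.induct)
  case zero
  have "0:lspan bop gens" using lspan.zero[of bop gens] by simp
  thus ?case unfolding DD_def by (rule subsetD[OF bop.nclosure_subset[OF lspan_gens]])
 next
  case (step x T v w a C)
  obtain c where c: "c:Cc" "C = (%\<gamma>. hat c (\<gamma> + wt \<omega> w))" using step(3) by (rule MonBE)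
  obtain K where K: "cc K c" using c(1) by (auto simp: Cc_def)
  \<comment> \<open>The shift of the argument is absorbed into the function as a character, so the
    coefficient is itself a Fourier transform and \<open>TB_hat\<close> applies.\<close>
  have C: "C = hat (%t. c t * pairing t (wt \<omega> w))" unfolding c(2) by (intro ext) (simp add: hat_mult_pairing)
  have "Top \<omega> v w C:DD"
  proof (rule Top_TB)
   show "bfun C" using monB.Mon_closed[OF step(3)] by simp
   show "TB {\<gamma>. e <= cmod (C \<gamma>)}" if "0 < e" for e
    unfolding C by (rule TB_hat[OF cc_intros(4)[OF K pairing_simps(8)] that])
  qed
  thus ?case by (rule add[OF _ step(4)])
 qed
 hence LD: "snd`monB.Lin UNIV \<subseteq> DD" by auto
 have \<Psi>D: "\<Psi>`carrier B \<subseteq> DD"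
  unfolding DD_def by (rule image_subsetI) (rule bop.nclosure_nclosure[OF lspan_gens LD[unfolded DD_def] \<Psi>(3)])
 show ?thesis
 proof (rule AF_embeddableI[OF B.cstar_algebra_axioms bop.cstar_algebra_axioms \<Psi>(1) _ _ \<Psi>D])
  show "DD \<subseteq> carrier bop" by (auto simp: DD_def nclosure_def)
  have gD: "gens \<subseteq> DD"
  proof
   fix x assume x: "x:gens"
   hence "x:lspan bop gens"
    using bop.lspan_base[OF x gens_carrier, of 1] by (simp only: bop.scale_one[OF subsetD[OF gens_carrier x]])
   thus "x:DD" unfolding DD_def by (rule subsetD[OF bop.nclosure_subset[OF lspan_gens]])
  qed
  show "\<exists>E. finite E \<and> E \<subseteq> DD \<and> cstar_subalgebra (lspan bop E) bop \<and> (\<forall>x\<in>F. \<exists>y\<in>lspan bop E. nrm bop (x\<ominus>\<^bsub>bop\<^esub>y) < e)"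
   if F: "finite F" "F \<subseteq> DD" "0 < e" for F e
  proof -
   obtain E where "finite E \<and> E \<subseteq> gens \<and> cstar_subalgebra (lspan bop E) bop \<and> (\<forall>x\<in>F. \<exists>y\<in>lspan bop E. nrm bop (x\<ominus>\<^bsub>bop\<^esub>y) < e)"
    using DD_AF[OF F] by (rule exE)
   thus ?thesis using gD by (intro exI[of _ E]) auto
  qed
 qed (use \<Psi>(2) add scale in simp_all)
qed

end
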